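(* Let $\gamma>-1$ and $0<\lambda\le\Lambda$. Let $F:\mathcal S^n\to\mathbb R$ be uniformly elliptic with constants $\lambda,\Lambda$, with $F(O)=0$, and either concave or convex. Let $p\in\mathbb R^n$ with $|p|\le 1$ and $p_n=0$, and let $u$ be a viscosity solution to $$u_t=|Du+p|^\gamma F(D^2u)\ \text{ in } Q_1^+,\qquad u=0\ \text{ on } S_1 .$$ Then $u\in C^{1,\bar\alpha}_\gamma(0,0)$ for some $\bar\alpha\in(0,1)$ with $\bar\alpha<\frac1{1+\gamma}$, that is, there exists a constant $a\in\mathbb R$ such that $$|u(x,t)-ax_n|\le C_\star\big(|x|^{1+\bar\alpha}+|t|^{\frac{1+\bar\alpha}{2-\bar\alpha\gamma}}\big)\quad\text{for all }(x,t)\in Q_{1/2}^+,$$ and $|a|\le C_\star$, where $C_\star>0$ is a constant depending only on $n,\lambda,\Lambda,\gamma$, and $\|u\|_{L^\infty(Q_1^+)}$.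
   Context: Notation. $\mathcal S^n$ is the space of real symmetric $n\times n$ matrices; $Q_r=B_r\times(-r^2,0]$ with $B_r=B_r(0)\subset\mathbb R^n$; $Q_r^+=Q_r\cap\{x_n>0\}$; $S_r=Q_r\cap\{x_n=0\}$. Uniform ellipticity. $F$ is uniformly elliptic with constants $0<\lambda\le\Lambda$ if $\mathcal M^-_{\lambda,\Lambda}(M-N)\le F(M)-F(N)\le\mathcal M^+_{\lambda,\Lambda}(M-N)$ for all $M,N\in\mathcal S^n$, where $\mathcal M^+_{\lambda,\Lambda}(M)=\sup_{\lambda I\le A\le\Lambda I}\mathrm{tr}(AM)$ and $\mathcal M^-_{\lambda,\Lambda}(M)=\inf_{\lambda I\le A\le\Lambda I}\mathrm{tr}(AM)$. Viscosity solutions. A continuous function $u$ is a viscosity subsolution (resp. supersolution) of $u_t=(|\nu Du+p|^2+\varepsilon^2)^{\gamma/2}F(D^2u)+f$ in $\Omega$ ($f$ continuous) if for every $(x_0,t_0)\in\Omega$: (i) for every test function $\varphi$ ($C^2$ in $x$, $C^1$ in $t$) touching $u$ from above (resp. below) at $(x_0,t_0)$ in a neighborhood of $(x_0,t_0)$, if $\nu D\varphi(x_0,t_0)+p\ne0$ then $\varphi_t\le$ (resp. $\ge$) $(|\nu D\varphi+p|^2+\varepsilon^2)^{\gamma/2}F(D^2\varphi)+f$ at $(x_0,t_0)$; (ii) with $v=\nu u+p\cdot x$, for every $\psi\in C^1(t_0-\delta,t_0+\delta)$, $\delta>0$, such that $v(x_0,t_0)-\psi(t_0)\ge$ (resp.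 $\le$) $v(x_0,t)-\psi(t)$ for all $t\in(t_0-\delta,t_0+\delta)$ and $\sup_{t}$ (resp. $\inf_t$) over $(t_0-\delta,t_0+\delta)$ of $v(x,t)-\psi(t)$ equals $v(x_0,t_0)-\psi(t_0)$ for all $x\in B_\delta(x_0)$, one has $\psi'(t_0)\le$ (resp. $\ge$) $\nu f(x_0,t_0)$. A viscosity solution is both a sub- and a supersolution. Here the equation is the case $\nu=1$, $\varepsilon=0$, $f=0$. The boundary condition means $u$ is continuous up to $S_1$ and vanishes there. *)

theory Defs
  imports "HOL-Analysis.Analysis" "HOL-Probability.Essential_Supremum"
begin

definition sym_matrices :: "(real^'n^'n) set" where
  "sym_matrices = {M. transpose M = M}"

definition loewner_le :: "real^'n^'n \<Rightarrow> real^'n^'n \<Rightarrow> bool" where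
  "loewner_le A B \<longleftrightarrow> (\<forall>x. x \<bullet> (A *v x) \<le> x \<bullet> (B *v x))"

definition elliptic_matrices :: "real \<Rightarrow> real \<Rightarrow> (real^'n^'n) set" where
  "elliptic_matrices lam Lam =
     {A \<in> sym_matrices. loewner_le (mat lam) A \<and> loewner_le A (mat Lam)}"

definition pucci_plus :: "real \<Rightarrow> real \<Rightarrow> real^'n^'n \<Rightarrow> real" where
  "pucci_plus lam Lam M = (SUP A\<in>elliptic_matrices lam Lam. trace (A ** M))"

definition pucci_minus :: "real \<Rightarrow> real \<Rightarrow> real^'n^'n \<Rightarrow> real" where
  "pucci_minus lam Lam M = (INF A\<in>elliptic_matrices lam Lam. trace (A ** M))"

text \<open>An operator on symmetric matrices is represented by a function on all matrices, of which
  only the values on \<^const>\<open>sym_matrices\<close> are ever constrained or used.\<close>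

definition uniformly_elliptic :: "real \<Rightarrow> real \<Rightarrow> (real^'n^'n \<Rightarrow> real) \<Rightarrow> bool" where
  "uniformly_elliptic lam Lam F \<longleftrightarrow>
     (\<forall>M\<in>sym_matrices. \<forall>N\<in>sym_matrices.
        pucci_minus lam Lam (M - N) \<le> F M - F N \<and> F M - F N \<le> pucci_plus lam Lam (M - N))"

text \<open>Points of space-time are pairs \<open>(x, t)\<close>. The index \<open>k\<close> marks the distinguished
  coordinate, written \<open>x\<^sub>n\<close> on paper.\<close>

definition Qcyl :: "real \<Rightarrow> ((real^'n) \<times> real) set" where
  "Qcyl r = ball 0 r \<times> {- (r^2)<..0}"

definition Qplus :: "'n \<Rightarrow> real \<Rightarrow> ((real^'n) \<times> real) set" where
  "Qplus k r = Qcyl r \<inter> {(x, t). x $ k > 0}"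

definition Sflat :: "'n \<Rightarrow> real \<Rightarrow> ((real^'n) \<times> real) set" where
  "Sflat k r = Qcyl r \<inter> {(x, t). x $ k = 0}"

definition Linfty_norm :: "((real^'n) \<times> real) set \<Rightarrow> ((real^'n) \<times> real \<Rightarrow> real) \<Rightarrow> ereal" where
  "Linfty_norm \<Omega> u = esssup (restrict_space lborel \<Omega>) (\<lambda>z. ereal \<bar>u z\<bar>)"

text \<open>\<open>\<phi>\<close> is \<open>C\<^sup>2\<close> in \<open>x\<close> and \<open>C\<^sup>1\<close> in \<open>t\<close> on the open set \<open>U\<close>, with spatial gradient \<open>D\<phi>\<close>,
  spatial Hessian \<open>D2\<phi>\<close> and time derivative \<open>\<phi>t\<close>.\<close>

definition C21_on ::
  "((real^'n) \<times> real) set \<Rightarrow> ((real^'n) \<times> real \<Rightarrow> real) \<Rightarrow> ((real^'n) \<times> real \<Rightarrow> real^'n) \<Rightarrow>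
   ((real^'n) \<times> real \<Rightarrow> real^'n^'n) \<Rightarrow> ((real^'n) \<times> real \<Rightarrow> real) \<Rightarrow> bool" where
  "C21_on U \<phi> D\<phi> D2\<phi> \<phi>t \<longleftrightarrow>
     (\<forall>(x, t)\<in>U.
        ((\<lambda>y. \<phi> (y, t)) has_derivative (\<lambda>h. D\<phi> (x, t) \<bullet> h)) (at x) \<and>
        ((\<lambda>y. D\<phi> (y, t)) has_derivative (\<lambda>h. D2\<phi> (x, t) *v h)) (at x) \<and>
        ((\<lambda>s. \<phi> (x, s)) has_real_derivative \<phi>t (x, t)) (at t)) \<and>
     continuous_on U \<phi> \<and> continuous_on U D\<phi> \<and> continuous_on U D2\<phi> \<and> continuous_on U \<phi>t"

definition C1_on :: "real set \<Rightarrow> (real \<Rightarrow> real) \<Rightarrow> (real \<Rightarrow> real) \<Rightarrow> bool" where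
  "C1_on I \<psi> \<psi>' \<longleftrightarrow>
     (\<forall>t\<in>I. (\<psi> has_real_derivative \<psi>' t) (at t)) \<and> continuous_on I \<psi>'"

text \<open>The sets \<open>Q\<^sub>r\<close> contain their final time slice, where \<open>u\<close> is not defined at later times.
  Neighbourhoods are therefore taken relative to \<open>\<Omega>\<close>: the cylinder of radius \<open>\<delta>\<close> around
  \<open>(x0, t0)\<close> has to lie in \<open>\<Omega>\<close>, except that at a point of the final time slice it is replaced by
  its part \<open>t \<le> t0\<close>. The set \<open>time_window \<Omega> x0 t0 \<delta>\<close> is the resulting range of times.\<close>

definition admissible_radius :: "((real^'n) \<times> real) set \<Rightarrow> real^'n \<Rightarrow> real \<Rightarrow> real \<Rightarrow> bool" where
  "admissible_radius \<Omega> x0 t0 \<delta> \<longleftrightarrow> \<delta> > 0 \<and>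
     (ball x0 \<delta> \<times> {t0 - \<delta><..<t0 + \<delta>} \<subseteq> \<Omega> \<or>
      (ball x0 \<delta> \<times> {t0 - \<delta><..<t0 + \<delta>}) \<inter> \<Omega> = ball x0 \<delta> \<times> {t0 - \<delta><..t0})"

definition time_window :: "((real^'n) \<times> real) set \<Rightarrow> real^'n \<Rightarrow> real \<Rightarrow> real \<Rightarrow> real set" where
  "time_window \<Omega> x0 t0 \<delta> = {t \<in> {t0 - \<delta><..<t0 + \<delta>}. (x0, t) \<in> \<Omega>}"

text \<open>The equation is \<open>u\<^sub>t = (|\<nu> Du + p|\<^sup>2 + \<epsilon>\<^sup>2)\<^bsup>\<gamma>/2\<^esup> F(D\<^sup>2u) + f\<close> in \<open>\<Omega>\<close>. The suprema and infima over
  time are extended real, since \<open>\<psi>\<close> need not be bounded on its open interval.\<close>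

definition visc_subsolution ::
  "real \<Rightarrow> real^'n \<Rightarrow> real \<Rightarrow> real \<Rightarrow> (real^'n^'n \<Rightarrow> real) \<Rightarrow> ((real^'n) \<times> real \<Rightarrow> real) \<Rightarrow>
   ((real^'n) \<times> real) set \<Rightarrow> ((real^'n) \<times> real \<Rightarrow> real) \<Rightarrow> bool" where
  "visc_subsolution \<nu> p \<epsilon> \<gamma> F f \<Omega> u \<longleftrightarrow> continuous_on \<Omega> u \<and>
     (\<forall>x0 t0. (x0, t0) \<in> \<Omega> \<longrightarrow>
       (\<forall>U \<phi> D\<phi> D2\<phi> \<phi>t.
          open U \<and> (x0, t0) \<in> U \<and> C21_on U \<phi> D\<phi> D2\<phi> \<phi>t \<and>
          \<phi> (x0, t0) = u (x0, t0) \<and> (\<forall>z\<in>U \<inter> \<Omega>. u z \<le> \<phi> z) \<and>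
          \<nu> *\<^sub>R D\<phi> (x0, t0) + p \<noteq> 0
          \<longrightarrow> \<phi>t (x0, t0) \<le>
                ((norm (\<nu> *\<^sub>R D\<phi> (x0, t0) + p))\<^sup>2 + \<epsilon>\<^sup>2) powr (\<gamma> / 2) * F (D2\<phi> (x0, t0))
                + f (x0, t0)) \<and>
       (let v = (\<lambda>(x, t). \<nu> * u (x, t) + p \<bullet> x) in
        \<forall>\<delta> \<psi> \<psi>'.
          admissible_radius \<Omega> x0 t0 \<delta> \<and> C1_on {t0 - \<delta><..<t0 + \<delta>} \<psi> \<psi>' \<and>
          (\<forall>t\<in>time_window \<Omega> x0 t0 \<delta>. v (x0, t0) - \<psi> t0 \<ge> v (x0, t) - \<psi> t) \<and>
          (\<forall>x\<in>ball x0 \<delta>.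
             (SUP t\<in>time_window \<Omega> x0 t0 \<delta>. ereal (v (x, t) - \<psi> t)) = ereal (v (x0, t0) - \<psi> t0))
          \<longrightarrow> \<psi>' t0 \<le> \<nu> * f (x0, t0)))"

definition visc_supersolution ::
  "real \<Rightarrow> real^'n \<Rightarrow> real \<Rightarrow> real \<Rightarrow> (real^'n^'n \<Rightarrow> real) \<Rightarrow> ((real^'n) \<times> real \<Rightarrow> real) \<Rightarrow>
   ((real^'n) \<times> real) set \<Rightarrow> ((real^'n) \<times> real \<Rightarrow> real) \<Rightarrow> bool" where
  "visc_supersolution \<nu> p \<epsilon> \<gamma> F f \<Omega> u \<longleftrightarrow> continuous_on \<Omega> u \<and>
     (\<forall>x0 t0. (x0, t0) \<in> \<Omega> \<longrightarrow>
       (\<forall>U \<phi> D\<phi> D2\<phi> \<phi>t.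
          open U \<and> (x0, t0) \<in> U \<and> C21_on U \<phi> D\<phi> D2\<phi> \<phi>t \<and>
          \<phi> (x0, t0) = u (x0, t0) \<and> (\<forall>z\<in>U \<inter> \<Omega>. u z \<ge> \<phi> z) \<and>
          \<nu> *\<^sub>R D\<phi> (x0, t0) + p \<noteq> 0
          \<longrightarrow> \<phi>t (x0, t0) \<ge>
                ((norm (\<nu> *\<^sub>R D\<phi> (x0, t0) + p))\<^sup>2 + \<epsilon>\<^sup>2) powr (\<gamma> / 2) * F (D2\<phi> (x0, t0))
                + f (x0, t0)) \<and>
       (let v = (\<lambda>(x, t). \<nu> * u (x, t) + p \<bullet> x) in
        \<forall>\<delta> \<psi> \<psi>'.
          admissible_radius \<Omega> x0 t0 \<delta> \<and> C1_on {t0 - \<delta><..<t0 + \<delta>} \<psi> \<psi>' \<and>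
          (\<forall>t\<in>time_window \<Omega> x0 t0 \<delta>. v (x0, t0) - \<psi> t0 \<le> v (x0, t) - \<psi> t) \<and>
          (\<forall>x\<in>ball x0 \<delta>.
             (INF t\<in>time_window \<Omega> x0 t0 \<delta>. ereal (v (x, t) - \<psi> t)) = ereal (v (x0, t0) - \<psi> t0))
          \<longrightarrow> \<psi>' t0 \<ge> \<nu> * f (x0, t0)))"

definition visc_solution ::
  "real \<Rightarrow> real^'n \<Rightarrow> real \<Rightarrow> real \<Rightarrow> (real^'n^'n \<Rightarrow> real) \<Rightarrow> ((real^'n) \<times> real \<Rightarrow> real) \<Rightarrow>
   ((real^'n) \<times> real) set \<Rightarrow> ((real^'n) \<times> real \<Rightarrow> real) \<Rightarrow> bool" where
  "visc_solution \<nu> p \<epsilon> \<gamma> F f \<Omega> u \<longleftrightarrow>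
     visc_subsolution \<nu> p \<epsilon> \<gamma> F f \<Omega> u \<and> visc_supersolution \<nu> p \<epsilon> \<gamma> F f \<Omega> u"

end

theory Submission imports Defs
begin

text \<open>
  The equation is rescaled so that \<open>w = (u - a x\<^sub>n) / (b - a)\<close>, or its mirror image, satisfies
  \<open>0 \<le> w \<le> x\<^sub>n\<close> and \<open>w\<^sub>t = |q + \<theta> Dw|\<^sup>\<gamma> F(D\<^sup>2w)\<close> with \<open>|q| = 1\<close> and \<open>q\<^sub>n \<le> - \<theta> / 2\<close>. Small gradients
  and gradients close to \<open>e\<^sub>n\<close> are then nondegenerate, and a dichotomy holds: either \<open>w\<close> is small at
  height \<open>h\<close>, and a barrier in the layer \<open>x\<^sub>n < h\<close> improves the upper bound, or \<open>w\<close> is not small at some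
  interior point. In the latter case \<open>w\<close> was already not small a little earlier near that point (a
  comparison function with exactly degenerate slope), hence on a whole ball of universal radius
  (doubling of variables), this positivity is carried to height \<open>h\<close> at later times by a moving bump,
  and a second barrier improves the lower bound. So the interval of slopes enclosing \<open>u / x\<^sub>n\<close>
  shrinks geometrically on intrinsically scaled cylinders; the initial interval comes from a boundary
  barrier, and this is where \<open>\<gamma> > -1\<close> enters.

  The doubling of variables needs an Ishii type lemma. It is proved through Rademacher's theorem
  and the differentiability of the gradient map of a semiconvex function at almost every point
  touched by paraboloids.
\<close>

text \<open>Where \<open>q + \<theta> Dw\<close> vanishes the equation is degenerate or singular and
  admits very few test functions. So each comparison function either keeps this vector away from 0
  or starts from exactly critical slope and departs like |x|^(2j), with j so large that gradient
  power times Hessian stays bounded. The number \<theta>, the width of the slope interval over the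
  size of the full gradient, can be anywhere in (0, 2], so all constants must be uniform in it: for
  large \<theta> the critical slope is within reach of Dw, for small \<theta> the vector q
  dominates. Positivity cannot be spread by an argument that crosses the critical slope blindly; a
  modulus of continuity, obtained for small \<theta> in two stages, and a bump with small gradient
  do it instead. The time scale r^2 m^(-\<gamma>), m being the size of the full gradient, leaves the
  ellipticity constants unchanged. A barrier with slope M and Hessian of order M yields
  M^(1+\<gamma>), which does not decay as M grows if \<gamma> > -1; this is why the initial slopes
  are bounded.\<close>

section \<open>Covering arguments and Rademacher's theorem\<close>

text \<open>Applying \<open>step\<close> n times to \<open>V0\<close> covers \<open>S\<close>, up to
  a null set, by an open set of measure at most \<open>th ^ n\<close> times that of
  \<open>V0\<close>. This turns a Vitali covering that wins only a fixed factor, as for sets of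
  oscillating slopes or porous sets, into nullity.\<close>

lemma negligible_shrinking_cover:
 fixes S :: "'a::euclidean_space set"
 assumes th: "0 <= th" "th < 1" and V0: "open V0" "V0 \<in> lmeasurable" "S \<subseteq> V0"
  and step: "\<And>V. open V ==> V \<in> lmeasurable ==>
   \<exists>W. open W & W \<in> lmeasurable & measure lebesgue W <= th * measure lebesgue V & negligible (S \<inter> V - W)"
 shows "negligible S"
proof -
 let ?m = "measure lebesgue V0"
 have it: "\<exists>W. open W & W \<in> lmeasurable & measure lebesgue W <= th ^ n * ?m & negligible (S - W)" for n
 proof (induction n)
  case 0
  show ?case using V0 by (intro exI[of _ V0]) (auto simp: Diff_eq_empty_iff[THEN iffD2])
 next
  case (Suc n)
  then obtain W where W: "open W" "W \<in> lmeasurable" "measure lebesgue W <= th ^ n * ?m" "negligible (S - W)" by blast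
  obtain X where X: "open X" "X \<in> lmeasurable" "measure lebesgue X <= th * measure lebesgue W" "negligible (S \<inter> W - X)"
   using step[OF W(1,2)] by blast
  have "S - X \<subseteq> (S - W) \<union> (S \<inter> W - X)" by auto
  then have "negligible (S - X)" using negligible_subset negligible_Un W(4) X(4) by blast
  moreover have "measure lebesgue X <= th ^ Suc n * ?m"
   using X(3) mult_left_mono[OF W(3) th(1)] by (simp add: mult.assoc)
  ultimately show ?case using X by blast
 qed
 have lim: "(%n. th ^ n * ?m) \<longlonglongrightarrow> 0"
  using th by (intro tendsto_mult_left_zero LIMSEQ_power_zero) auto
 show ?thesis unfolding negligible_outer_le
 proof (intro allI impI)
  fix e :: real assume "e > 0"
  then obtain n where n: "th ^ n * ?m < e"
   using order_tendstoD(2)[OF lim] by (auto simp: eventually_sequentially)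
  obtain W where W: "open W" "W \<in> lmeasurable" "measure lebesgue W <= th ^ n * ?m" "negligible (S - W)" using it by blast
  have 1: "W \<union> (S - W) \<in> lmeasurable" by (rule fmeasurable.Un[OF W(2) negligible_imp_measurable[OF W(4)]])
  have "measure lebesgue (W \<union> (S - W)) <= measure lebesgue W + measure lebesgue (S - W)"
   by (rule measure_Un_le) (use W in \<open>auto simp: negligible_imp_sets fmeasurableD\<close>)
  also have "... <= e" using W n by (simp add: negligible_imp_measure0)
  finally have "measure lebesgue (W \<union> (S - W)) <= e" .
  then show "\<exists>T. S \<subseteq> T & T \<in> lmeasurable & measure lebesgue T <= e"
   using 1 by (intro exI[of _ "W \<union> (S - W)"]) (simp only: Un_Diff_cancel Un_upper2 simp_thms)
 qed
qed

lemma negligible_lipschitz_image: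
 fixes f :: "'a::euclidean_space => 'b::euclidean_space"
 assumes "DIM('a) <= DIM('b)" "negligible S" "\<And>x y. x \<in> S ==> y \<in> S ==> norm (f x - f y) <= B * norm (x - y)"
 shows "negligible (f ` S)"
proof (rule negligible_locally_Lipschitz_image[OF assms(1,2)])
 fix x assume "x \<in> S"
 then show "\<exists>T B. open T & x \<in> T & (\<forall>y\<in>S \<inter> T. norm (f y - f x) <= B * norm (y - x))"
  using assms(3) by (intro exI[of _ UNIV] exI[of _ B]) auto
qed

text \<open>The Vitali covering theorem is applied in the image, to intervals
  \<open>[f x, f y]\<close> of slope at most \<alpha>. They are disjoint, so the intervals below
  them are disjoint in \<open>V\<close>, and the images have total length at most \<alpha> times
  that of \<open>V\<close>. The Lipschitz inverse carries the null remainder back. Used once with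
  slope \<alpha> and once for the inverse function with slope 1/\<beta>, it yields the factor
  \<alpha>/\<beta>.\<close>

lemma slope_cover:
 fixes f g :: "real => real"
 assumes mono: "\<And>x y. x < y ==> f x < f y" and gf: "\<And>x. g (f x) = x" and fg: "\<And>y. f (g y) = y"
  and contf: "continuous_on UNIV f" and lipg: "\<And>x y. \<bar>g x - g y\<bar> <= L * \<bar>x - y\<bar>"
  and V: "open V" "V \<in> lmeasurable" and al: "\<alpha> >= 0"
  and S: "\<And>x d. x \<in> S ==> d > 0 ==> \<exists>y. y ~= x & \<bar>y - x\<bar> < d & \<bar>f y - f x\<bar> <= \<alpha> * \<bar>y - x\<bar>"
 obtains W where "open W" "W \<subseteq> V" "open (f ` W)" "f ` W \<in> lmeasurable"
  "measure lebesgue (f ` W) <= \<alpha> * measure lebesgue V" "negligible (S \<inter> V - W)"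
proof -
 define K where "K = {(x::real, y). x < y & {x..y} \<subseteq> V & f y - f x <= \<alpha> * (y - x)}"
 define a where "a = (%(x, y). (f x + f y) / 2)"
 define r where "r = (%(x, y). (f y - f x) / 2)"
 have cb: "cball (a i) (r i) = {f (fst i)..f (snd i)}" "ball (a i) (r i) = {f (fst i)<..<f (snd i)}" for i
  by (auto simp: a_def r_def case_prod_unfold cball_def ball_def dist_real_def abs_le_iff abs_less_iff field_simps)
 have fin: "emeasure lborel {x<..<y} ~= top" for x y :: real by (cases "x <= y") auto
 have mIoo: "Henstock_Kurzweil_Integration.content {x<..<y} = y - x" if "x < y" for x y :: real
  using that by (simp add: measure_lborel_Ioo)
 have fle: "f x <= f y \<longleftrightarrow> x <= y" for x y using mono by (metis le_less linorder_not_less)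
 have fless: "f x < f y \<longleftrightarrow> x < y" for x y using mono by (metis linorder_neqE not_less_iff_gr_or_eq)
 have img: "f ` {x<..<y} = {f x<..<f y}" for x y
 proof
  show "{f x<..<f y} \<subseteq> f ` {x<..<y}"
  proof
   fix z assume "z \<in> {f x<..<f y}"
   then have "x < g z" "g z < y" using fless[of x "g z"] fless[of "g z" y] by (auto simp: fg)
   then show "z \<in> f ` {x<..<y}" by (metis fg greaterThanLessThan_iff image_eqI)
  qed
 qed (auto simp: fless)
 have "\<exists>i. i \<in> K & z \<in> cball (a i) (r i) & r i < d" if z: "z \<in> f ` (S \<inter> V)" and d: "d > 0" for z d
 proof -
  obtain x where x: "x \<in> S" "x \<in> V" "z = f x" using z by auto
  obtain e1 where e1: "e1 > 0" "\<And>y. \<bar>y - x\<bar> < e1 ==> \<bar>f y - f x\<bar> < d"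
   using contf d unfolding continuous_on_iff dist_real_def by (metis UNIV_I)
  obtain e2 where e2: "e2 > 0" "ball x e2 \<subseteq> V" using V(1) x(2) open_contains_ball by blast
  obtain y where y: "y ~= x" "\<bar>y - x\<bar> < min e1 e2" "\<bar>f y - f x\<bar> <= \<alpha> * \<bar>y - x\<bar>"
   using S[OF x(1), of "min e1 e2"] e1 e2 by auto
  have sub: "{min x y..max x y} \<subseteq> V"
   using e2(2) y(2) by (intro subset_trans[OF _ e2(2)]) (auto simp: dist_real_def)
  have "(min x y, max x y) \<in> K" using y sub fless[of x y] fless[of y x] unfolding K_def
   by (auto simp: min_def max_def abs_if split: if_splits)
  moreover have "z \<in> cball (a (min x y, max x y)) (r (min x y, max x y))"
   unfolding cb x(3) by (simp add: fle)
  moreover have "r (min x y, max x y) < d"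
  proof -
   have "\<bar>f y - f x\<bar> < d" using e1(2)[of y] y(2) by linarith
   then show ?thesis using d by (auto simp: r_def min_def max_def)
  qed
  ultimately show ?thesis by blast
 qed
 moreover have "\<And>i. i \<in> K ==> 0 < r i" by (auto simp: K_def r_def mono)
 ultimately obtain C where C: "countable C" "C \<subseteq> K"
   "pairwise (%i j. disjnt (cball (a i) (r i)) (cball (a j) (r j))) C"
   "negligible(f ` (S \<inter> V) - (\<Union>i \<in> C. cball (a i) (r i)))"
  using Vitali_covering_theorem_cballs[of K r "f ` (S \<inter> V)" a] by blast
 define W where "W = (\<Union>i\<in>C. {fst i<..<snd i})"
 have fW: "f ` W = (\<Union>i\<in>C. {f (fst i)<..<f (snd i)})" unfolding W_def image_UN img ..
 have WV: "W \<subseteq> V" using C(2) unfolding W_def K_def by fastforce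
 have bound: "measure lebesgue (\<Union>i\<in>F. {f (fst i)<..<f (snd i)}) <= \<alpha> * measure lebesgue V" if F: "F \<subseteq> C" "finite F" for F
 proof -
  have dj: "disjoint_family_on (%i. {fst i<..<snd i}) F"
  proof -
   have "{fst i<..<snd i} \<inter> {fst j<..<snd j} = {}" if "i \<in> F" "j \<in> F" "i ~= j" for i j
   proof -
    have "disjnt (cball (a i) (r i)) (cball (a j) (r j))" using C(3) F that unfolding pairwise_def by blast
    then show ?thesis unfolding cb disjnt_def
     by (auto simp: disjoint_iff fle)
   qed
   then show ?thesis unfolding disjoint_family_on_def by blast
  qed
  have "measure lebesgue (\<Union>i\<in>F. {f (fst i)<..<f (snd i)}) <= (\<Sum>i\<in>F. measure lebesgue {f (fst i)<..<f (snd i)})"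
   by (rule measure_UNION_le) (use F in auto)
  also have "... <= (\<Sum>i\<in>F. \<alpha> * (snd i - fst i))"
   using F C(2) by (intro sum_mono) (auto simp: K_def mIoo mono subset_iff)
  also have "... = \<alpha> * (\<Sum>i\<in>F. measure lebesgue {fst i<..<snd i})"
   unfolding sum_distrib_left using F C(2) by (intro sum.cong) (auto simp: K_def mIoo subset_iff)
  also have "(\<Sum>i\<in>F. measure lebesgue {fst i<..<snd i}) = measure lebesgue (\<Union>i\<in>F. {fst i<..<snd i})"
   by (rule measure_finite_Union[symmetric]) (use F dj in \<open>auto simp: fin\<close>)
  also have "\<alpha> * ... <= \<alpha> * measure lebesgue V"
   by (intro mult_left_mono measure_mono_fmeasurable al V) (use WV F in \<open>auto simp: W_def\<close>)
  finally show ?thesis .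
 qed
 show thesis
 proof
  show "open W" unfolding W_def by auto
  show "W \<subseteq> V" by fact
  show "open (f ` W)" unfolding fW by auto
  show "f ` W \<in> lmeasurable" unfolding fW
   by (rule fmeasurable_UN_bound[OF C(1) _ bound]) auto
  show "measure lebesgue (f ` W) <= \<alpha> * measure lebesgue V" unfolding fW
   by (rule measure_UN_bound[OF C(1) _ bound]) auto
  have "negligible (f ` (S \<inter> V) - f ` W)"
  proof -
   have "negligible (\<Union>i\<in>C. {f (fst i), f (snd i)})" using C(1) by (intro negligible_countable_Union) auto
   moreover have "f ` (S \<inter> V) - f ` W \<subseteq> (f ` (S \<inter> V) - (\<Union>i \<in> C. cball (a i) (r i))) \<union> (\<Union>i\<in>C. {f (fst i), f (snd i)})"
    unfolding fW cb by force
   ultimately show ?thesis using C(4) negligible_Un negligible_subset by blast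
  qed
  then have "negligible (g ` (f ` (S \<inter> V) - f ` W))"
   by (rule negligible_lipschitz_image[OF order_refl, of _ _ L]) (use lipg in auto)
  moreover have "S \<inter> V - W \<subseteq> g ` (f ` (S \<inter> V) - f ` W)"

  proof
   fix x assume x: "x \<in> S \<inter> V - W"
   have "f x \<notin> f ` W" using x gf by (metis DiffD2 imageE)
   then show "x \<in> g ` (f ` (S \<inter> V) - f ` W)" using x gf[of x] by (metis DiffD1 DiffI imageI)
  qed
  ultimately show "negligible (S \<inter> V - W)" using negligible_subset by blast
 qed
qed

text \<open>Lebesgue's argument: where lower and upper derivates differ, rationals \<alpha> <
  \<beta> separate them. Covering first by small slopes of \<open>F\<close> and then by small slopes
  of its inverse multiplies the measure by \<alpha>/\<beta> < 1.\<close>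

lemma lipschitz_real_differentiable_ae:
 fixes f :: "real => real"
 assumes L: "\<And>x y. \<bar>f x - f y\<bar> <= L * \<bar>x - y\<bar>"
 shows "negligible {x. \<not> f differentiable (at x)}"
proof -
 have L0: "L >= 0" using L[of 1 0] by simp
 \<comment> \<open>The extra slope \<open>L + 1\<close> puts all difference quotients of
   \<open>F\<close> into \<open>[1, 2 * L + 1]\<close>, so that \<open>F\<close> is a bijection and
   both \<open>F\<close> and its inverse are Lipschitz.\<close>
 define F where "F x = f x + (L + 1) * x" for x
 have Flow: "y - x <= F y - F x" "F y - F x <= (2 * L + 1) * (y - x)" if "x <= y" for x y
  using L[of y x] that by (auto simp: F_def abs_le_iff algebra_simps)
 have mono: "F x < F y" if "x < y" for x y using Flow(1)[of x y] that by auto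
 have contF: "continuous_on UNIV F"
 proof -
  have "(2 * L + 1)-lipschitz_on UNIV F"
  proof (rule lipschitz_onI)
   fix x y show "dist (F x) (F y) <= (2 * L + 1) * dist x y"
    using Flow[of x y] Flow[of y x] by (cases "x <= y") (auto simp: dist_real_def)
  qed (use L0 in auto)
  then show ?thesis by (rule lipschitz_on_continuous_on)
 qed
 have "\<exists>x. F x = y" for y
 proof -
  have "F (- \<bar>y - F 0\<bar>) <= y" using Flow(1)[of "- \<bar>y - F 0\<bar>" 0] by auto
  moreover have "y <= F \<bar>y - F 0\<bar>" using Flow(1)[of 0 "\<bar>y - F 0\<bar>"] by auto
  ultimately show ?thesis
   using IVT'[of F "- \<bar>y - F 0\<bar>" y "\<bar>y - F 0\<bar>"] continuous_on_subset[OF contF] by auto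
 qed
 then obtain G where FG: "\<And>y. F (G y) = y" by metis
 have inj: "F x = F y ==> x = y" for x y using mono by (metis linorder_neqE less_irrefl)
 have GF: "G (F x) = x" for x using FG inj by blast
 have Gmono: "G x < G y" if "x < y" for x y
  using mono[of "G y" "G x"] FG that by (metis linorder_neqE not_less_iff_gr_or_eq)
 have lipG: "\<bar>G x - G y\<bar> <= 1 * \<bar>x - y\<bar>" for x y
  using Flow(1)[of "G x" "G y"] Flow(1)[of "G y" "G x"] by (cases "G x <= G y") (auto simp: FG)
 have contG: "continuous_on UNIV G"
  by (rule lipschitz_on_continuous_on[of 1]) (use lipG in \<open>auto intro!: lipschitz_onI simp: dist_real_def\<close>)
 have lipF: "\<bar>F x - F y\<bar> <= (2*L+1) * \<bar>x - y\<bar>" for x y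
  using Flow[of x y] Flow[of y x] by (cases "x <= y") (auto simp: abs_if)
 define Q where "Q x y = (F y - F x) / (y - x)" for x y
 have Qpos: "Q x y = \<bar>F y - F x\<bar> / \<bar>y - x\<bar>" if "x ~= y" for x y
  using mono[of x y] mono[of y x] that by (cases "x < y") (auto simp: Q_def field_simps)
 define S where "S \<alpha> \<beta> R = {x. \<bar>x\<bar> < R & (\<forall>d>0. \<exists>y. y ~= x & \<bar>y - x\<bar> < d & Q x y <= \<alpha>) &
   (\<forall>d>0. \<exists>y. y ~= x & \<bar>y - x\<bar> < d & Q x y >= \<beta>)}" for \<alpha> \<beta> R
 have neg: "negligible (S \<alpha> \<beta> R)" if ab: "0 < \<alpha>" "\<alpha> < \<beta>" for \<alpha> \<beta> R
 proof (rule negligible_shrinking_cover[of "\<alpha> / \<beta>" "ball 0 R"])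
  show "0 <= \<alpha> / \<beta>" "\<alpha> / \<beta> < 1" using ab by auto
  show "open (ball (0::real) R)" "ball (0::real) R \<in> lmeasurable" by auto
  show "S \<alpha> \<beta> R \<subseteq> ball 0 R" by (auto simp: S_def)
  fix V :: "real set" assume V: "open V" "V \<in> lmeasurable"
  have s1: "\<exists>y. y ~= x & \<bar>y - x\<bar> < d & \<bar>F y - F x\<bar> <= \<alpha> * \<bar>y - x\<bar>" if xd: "x \<in> S \<alpha> \<beta> R" "d > 0" for x d
  proof -
   obtain y where "y ~= x" "\<bar>y - x\<bar> < d" "Q x y <= \<alpha>" using xd unfolding S_def by blast
   then show ?thesis by (intro exI[of _ y]) (auto simp: Qpos field_simps)
  qed
  obtain W where W: "open W" "W \<subseteq> V" "open (F ` W)" "F ` W \<in> lmeasurable"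
   "measure lebesgue (F ` W) <= \<alpha> * measure lebesgue V" "negligible (S \<alpha> \<beta> R \<inter> V - W)"
   by (rule slope_cover[OF mono GF FG contF lipG V _ s1]) (use ab in auto)
  have s2: "\<exists>y. y ~= z & \<bar>y - z\<bar> < d & \<bar>G y - G z\<bar> <= (1/\<beta>) * \<bar>y - z\<bar>" if xd: "z \<in> F ` S \<alpha> \<beta> R" "d > 0" for z d
  proof -
   obtain x where x: "x \<in> S \<alpha> \<beta> R" "z = F x" using xd by auto
   have "d / (2 * L + 1) > 0" using xd L0 by auto
   then obtain y where y: "y ~= x" "\<bar>y - x\<bar> < d / (2*L+1)" "Q x y >= \<beta>" using x(1) unfolding S_def by blast
   have "\<bar>F y - F x\<bar> <= (2*L+1) * \<bar>y - x\<bar>" using lipF by auto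
   also have "... < d" using y(2) L0 by (simp add: field_simps)
   finally have "\<bar>F y - F x\<bar> < d" .
   moreover have "F y ~= F x" using inj y(1) by blast
   moreover have "\<bar>y - x\<bar> <= (1/\<beta>) * \<bar>F y - F x\<bar>" using y(1,3) ab by (auto simp: Qpos field_simps)
   ultimately show ?thesis using x(2) GF by (intro exI[of _ "F y"]) auto
  qed
  obtain X where X: "open X" "X \<subseteq> F ` W" "open (G ` X)" "G ` X \<in> lmeasurable"
   "measure lebesgue (G ` X) <= (1/\<beta>) * measure lebesgue (F ` W)" "negligible (F ` S \<alpha> \<beta> R \<inter> F ` W - X)"
   by (rule slope_cover[OF Gmono FG GF contG lipF W(3,4) _ s2]) (use ab in auto)
  have "negligible (G ` (F ` S \<alpha> \<beta> R \<inter> F ` W - X))"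
   by (rule negligible_lipschitz_image[OF order_refl X(6), of _ 1]) (use lipG in auto)
  moreover have "S \<alpha> \<beta> R \<inter> V - G ` X \<subseteq> (S \<alpha> \<beta> R \<inter> V - W) \<union> G ` (F ` S \<alpha> \<beta> R \<inter> F ` W - X)"
  proof
   fix x assume x: "x \<in> S \<alpha> \<beta> R \<inter> V - G ` X"
   show "x \<in> (S \<alpha> \<beta> R \<inter> V - W) \<union> G ` (F ` S \<alpha> \<beta> R \<inter> F ` W - X)"
   proof (cases "x \<in> W")
    case True
    have "F x \<notin> X" using x GF[of x] by (metis Diff_iff imageI)
    then have "F x \<in> F ` S \<alpha> \<beta> R \<inter> F ` W - X" using x True by auto
    then show ?thesis using GF[of x] by (metis UnCI imageI)
   qed (use x in auto)
  qed
  ultimately have "negligible (S \<alpha> \<beta> R \<inter> V - G ` X)"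
   using W(6) negligible_Un negligible_subset by blast
  moreover have "measure lebesgue (G ` X) <= \<alpha> / \<beta> * measure lebesgue V"
   using X(5) W(5) ab by (simp add: field_simps)
  ultimately show "\<exists>W. open W & W \<in> lmeasurable & measure lebesgue W <= \<alpha> / \<beta> * measure lebesgue V &
   negligible (S \<alpha> \<beta> R \<inter> V - W)" using X by blast
 qed
 have cover: "{x. \<not> f differentiable (at x)} \<subseteq> (\<Union>(\<alpha>,\<beta>,n)\<in>{(\<alpha>,\<beta>,n). \<alpha> \<in> \<rat> & \<beta> \<in> \<rat> & 0 < \<alpha> & \<alpha> < \<beta>}. S \<alpha> \<beta> (real n))"
 proof
  fix x assume "x \<in> {x. \<not> f differentiable (at x)}"
  then have nd: "\<not> f differentiable (at x)" by simp
  have Qb: "1 <= Q x y & Q x y <= 2*L+1" if "y ~= x" for y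
   using Flow[of x y] Flow[of y x] that by (cases "x < y") (auto simp: Q_def field_simps)
  show "x \<in> (\<Union>(\<alpha>,\<beta>,n)\<in>{(\<alpha>,\<beta>,n). \<alpha> \<in> \<rat> & \<beta> \<in> \<rat> & 0 < \<alpha> & \<alpha> < \<beta>}. S \<alpha> \<beta> (real n))"
  proof (rule ccontr)
   assume not: "\<not> ?thesis"
   obtain n where n: "\<bar>x\<bar> < real n" using reals_Archimedean2 by blast
   have sep: "\<not> ((\<forall>d>0. \<exists>y. y ~= x & \<bar>y - x\<bar> < d & Q x y <= \<alpha>) & (\<forall>d>0. \<exists>y. y ~= x & \<bar>y - x\<bar> < d & Q x y >= \<beta>))"
    if "\<alpha> \<in> \<rat>" "\<beta> \<in> \<rat>" "0 < \<alpha>" "\<alpha> < \<beta>" for \<alpha> \<beta>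
    using not that n unfolding S_def by blast
   \<comment> \<open>\<open>Sup T\<close> is the upper derivate of \<open>F\<close> at
     \<open>x\<close>. The lower one cannot be smaller, since rationals between the two would put
     \<open>x\<close> into one of the sets \<open>S\<close>.\<close>
   define T where "T = {b. \<forall>d>0. \<exists>y. y ~= x & \<bar>y - x\<bar> < d & Q x y >= b}"
   have T1: "1 \<in> T" unfolding T_def
   proof (clarify)
    fix d :: real assume "d > 0"
    then show "\<exists>y. y ~= x & \<bar>y - x\<bar> < d & 1 <= Q x y" using Qb[of "x + d/2"] by (intro exI[of _ "x + d/2"]) auto
   qed
   have Tb: "b <= 2*L+1" if bT: "b \<in> T" for b
   proof -
    obtain y where "y ~= x" "Q x y >= b" using bT zero_less_one unfolding T_def by blast
    then show ?thesis using Qb[of y] by linarith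
   qed
   define s where "s = Sup T"
   have bdd: "bdd_above T" using Tb unfolding bdd_above_def by blast
   have s1: "1 <= s" unfolding s_def by (rule cSup_upper[OF T1 bdd])
   have up: "\<exists>d>0. \<forall>y. y ~= x & \<bar>y - x\<bar> < d --> Q x y < s + e" if "e > 0" for e
   proof -
    have "s + e \<notin> T" using cSup_upper[OF _ bdd, of "s+e"] that unfolding s_def by auto
    then show ?thesis unfolding T_def by (auto simp: not_le)
   qed
   have lo: "\<exists>d>0. \<forall>y. y ~= x & \<bar>y - x\<bar> < d --> Q x y > s - e" if e: "e > 0" for e
   proof (rule ccontr)
    assume A: "\<not> ?thesis"
    \<comment> \<open>As \<open>s >= 1\<close>, cutting \<open>e\<close> at 1/2 keeps the rational
      \<alpha> positive.\<close>
    define e' where "e' = min e (1/2)"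
    have e'0: "e' > 0" using e by (auto simp: e'_def)
    obtain \<alpha> where al: "\<alpha> \<in> \<rat>" "s - e' < \<alpha>" "\<alpha> < s - e'/2" using Rats_dense_in_real[of "s-e'" "s-e'/2"] e'0 by auto
    obtain \<beta> where be: "\<beta> \<in> \<rat>" "s - e'/2 < \<beta>" "\<beta> < s" using Rats_dense_in_real[of "s-e'/2" s] e'0 by auto
    obtain b where b: "b \<in> T" "\<beta> < b" using less_cSupD[of T \<beta>] T1 be unfolding s_def by auto
    have h2: "\<forall>d>0. \<exists>y. y ~= x & \<bar>y - x\<bar> < d & Q x y >= \<beta>"
    proof (intro allI impI)
     fix d :: real assume "d > 0"
     then obtain y where "y ~= x" "\<bar>y - x\<bar> < d" "Q x y >= b" using b(1) unfolding T_def by blast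
     then show "\<exists>y. y ~= x & \<bar>y - x\<bar> < d & Q x y >= \<beta>" using b(2) by (intro exI[of _ y]) auto
    qed
    have h1: "\<forall>d>0. \<exists>y. y ~= x & \<bar>y - x\<bar> < d & Q x y <= \<alpha>"
    proof (intro allI impI)
     fix d :: real assume "d > 0"
     then obtain y where "y ~= x" "\<bar>y - x\<bar> < d" "Q x y <= s - e" using A by (meson not_le)
     then show "\<exists>y. y ~= x & \<bar>y - x\<bar> < d & Q x y <= \<alpha>" using al by (intro exI[of _ y]) (auto simp: e'_def)
    qed
    have "0 < \<alpha>" "\<alpha> < \<beta>" using al be s1 by (auto simp: e'_def)
    then show False using sep[OF al(1) be(1)] h1 h2 by blast
   qed
   have "((%y. Q x y) \<longlongrightarrow> s) (at x)"
   proof (rule tendstoI)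
    fix e :: real assume e: "e > 0"
    obtain d1 where "d1 > 0" "\<forall>y. y ~= x & \<bar>y - x\<bar> < d1 --> Q x y < s + e" using up[OF e] by blast
    moreover obtain d2 where "d2 > 0" "\<forall>y. y ~= x & \<bar>y - x\<bar> < d2 --> Q x y > s - e" using lo[OF e] by blast
    ultimately show "\<forall>\<^sub>F y in at x. dist (Q x y) s < e"
     unfolding eventually_at dist_real_def by (intro exI[of _ "min d1 d2"]) (auto simp: abs_less_iff)
   qed
   then have "(F has_real_derivative s) (at x)" unfolding has_field_derivative_iff Q_def .
   then have "((%x. F x - (L+1) * x) has_real_derivative (s - (L+1))) (at x)"
    by (auto intro!: derivative_eq_intros)
   then have "f differentiable (at x)" unfolding F_def
    by (auto simp: real_differentiable_def)
   then show False using nd by blast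
  qed
 qed
 have "countable {(\<alpha>::real,\<beta>::real,n::nat). \<alpha> \<in> \<rat> & \<beta> \<in> \<rat> & 0 < \<alpha> & \<alpha> < \<beta>}"
  by (rule countable_subset[of _ "\<rat> \<times> \<rat> \<times> UNIV"]) (auto intro!: countable_SIGMA countable_rat)
 then have "negligible (\<Union>(\<alpha>,\<beta>,n)\<in>{(\<alpha>,\<beta>,n::nat). \<alpha> \<in> \<rat> & \<beta> \<in> \<rat> & 0 < \<alpha> & \<alpha> < \<beta>}. S \<alpha> \<beta> (real n))"
  by (intro negligible_countable_Union) (auto intro: neg)
 then show ?thesis using cover negligible_subset by blast
qed

text \<open>Tonelli's theorem for the indicator of \<open>B\<close> at \<open>x + t b\<close> with
  \<open>t\<close> in \<open>[0, 1]\<close>: integrating over \<open>t\<close> first gives 0,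
  integrating over \<open>x\<close> first gives the measure of \<open>B\<close> by translation
  invariance. No change of coordinates adapted to \<open>b\<close> is involved.\<close>

lemma negligible_if_lines_negligible:
 fixes B :: "'a::euclidean_space set" and b :: 'a
 assumes B: "B \<in> sets borel" and sl: "\<And>x. negligible {t::real. x + t *\<^sub>R b \<in> B}"
 shows "negligible B"
proof -
 define f :: "'a => real => ennreal" where "f x t = indicator B (x + t *\<^sub>R b) * indicator {0..1} t" for x t
 have m: "(%(x, t). f x t) \<in> borel_measurable (lborel \<Otimes>\<^sub>M lborel)"
  unfolding f_def using B by measurable
 have 1: "(\<integral>\<^sup>+t. f x t \<partial>lborel) = 0" for x
 proof -
  have "AE t in lborel. x + t *\<^sub>R b \<notin> B"
  proof -
   have "AE t in lebesgue. t \<notin> {t. x + t *\<^sub>R b \<in> B}"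
    using sl[of x] unfolding negligible_iff_null_sets by (rule AE_not_in)
   moreover have "{t. x + t *\<^sub>R b \<in> B} \<in> sets lborel" using B by measurable
   ultimately show ?thesis by (simp add: AE_completion_iff)
  qed
  then have "AE t in lborel. f x t = 0" by (rule AE_mp) (auto simp: f_def)
  then show ?thesis using nn_integral_cong_AE[of "f x" "%_. 0" lborel] by simp
 qed
 have 2: "(\<integral>\<^sup>+x. f x t \<partial>lborel) = emeasure lborel B * indicator {0..1} t" for t
 proof -
  have "(%x::'a. x + t *\<^sub>R b) \<in> measurable lborel borel" by simp
  from measurable_compose[OF this borel_measurable_indicator[OF B]]
  have mB: "(%x. indicator B (x + t *\<^sub>R b) :: ennreal) \<in> borel_measurable lborel" .
  have "(\<integral>\<^sup>+x. f x t \<partial>lborel) = (\<integral>\<^sup>+x. indicator B (x + t *\<^sub>R b) \<partial>lborel) * indicator {0..1} t"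
   unfolding f_def
   by (rule nn_integral_multc[OF mB])
  also have "(\<integral>\<^sup>+x. indicator B (x + t *\<^sub>R b) \<partial>lborel) = (\<integral>\<^sup>+x. indicator B x \<partial>(distr lborel borel ((+) (t *\<^sub>R b))))"
   using B by (subst nn_integral_distr) (auto simp: add.commute)
  also have "... = emeasure lborel B" using B by (simp add: lborel_distr_plus)
  finally show ?thesis .
 qed
 have "(\<integral>\<^sup>+t. (\<integral>\<^sup>+x. f x t \<partial>lborel) \<partial>lborel) = (\<integral>\<^sup>+x. (\<integral>\<^sup>+t. f x t \<partial>lborel) \<partial>lborel)"
  using lborel_pair.Fubini[OF m] by simp
 then have "emeasure lborel B = 0" unfolding 1 2 by (simp add: nn_integral_cmult)
 then have "B \<in> null_sets lborel" using B by auto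
 then show ?thesis by (simp add: negligible_iff_null_sets null_sets_completionI)
qed

lemma real_limit_at_zero_if_Cauchy:
 fixes q :: "real => real"
 assumes "\<And>e. e > 0 ==> \<exists>d>0. \<forall>s t. 0 < \<bar>s\<bar> & \<bar>s\<bar> < d & 0 < \<bar>t\<bar> & \<bar>t\<bar> < d --> \<bar>q s - q t\<bar> <= e"
 shows "\<exists>D. (q \<longlongrightarrow> D) (at 0)"
proof -
 define X where "X n = q (1 / real (Suc n))" for n
 have "Cauchy X" unfolding Cauchy_altdef2
 proof (intro allI impI)
  fix e :: real assume "e > 0"
  then obtain d where d: "d > 0" "\<forall>s t. 0 < \<bar>s\<bar> & \<bar>s\<bar> < d & 0 < \<bar>t\<bar> & \<bar>t\<bar> < d --> \<bar>q s - q t\<bar> <= e/2"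
   using assms[of "e/2"] by auto
  obtain N where N: "1 / real (Suc N) < d" using d(1) nat_approx_posE by blast
  have "1 / real (Suc n) < d" if "n >= N" for n
   using N that by (meson frac_le le_less_trans less_eq_real_def of_nat_0_less_iff of_nat_le_iff zero_less_Suc Suc_le_mono zero_le_one)
  then have "dist (X n) (X N) < e" if "n >= N" for n
   using d(2)[rule_format, of "1 / real (Suc n)" "1 / real (Suc N)"] that N \<open>e > 0\<close> unfolding X_def dist_real_def by fastforce
  then show "\<exists>N. \<forall>n\<ge>N. dist (X n) (X N) < e" by blast
 qed
 then obtain D where D: "X \<longlonglongrightarrow> D" using Cauchy_convergent_iff convergent_def by blast
 have "(q \<longlongrightarrow> D) (at 0)"
 proof (rule tendstoI)
  fix e :: real assume "e > 0"
  then obtain d where d: "d > 0" "\<forall>s t. 0 < \<bar>s\<bar> & \<bar>s\<bar> < d & 0 < \<bar>t\<bar> & \<bar>t\<bar> < d --> \<bar>q s - q t\<bar> <= e/2"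
   using assms[of "e/2"] by auto
  have "eventually (%n. 1 / real (Suc n) < d) sequentially"
   using LIMSEQ_inverse_real_of_nat order_tendstoD(2)[of _ 0 sequentially d] d(1) by (simp add: inverse_eq_divide)
  moreover have "eventually (%n. dist (X n) D < e/2) sequentially" using D \<open>e > 0\<close> tendstoD half_gt_zero by blast
  ultimately have "eventually (%n. 1 / real (Suc n) < d & dist (X n) D < e/2) sequentially" by (rule eventually_conj)
  then obtain n where n: "1 / real (Suc n) < d" "dist (X n) D < e/2" by (auto simp: eventually_sequentially)
  have "dist (q t) D < e" if "t ~= 0" "dist t 0 < d" for t
  proof -
   have "\<bar>q t - X n\<bar> <= e/2" unfolding X_def
    by (rule d(2)[rule_format]) (use that n(1) in \<open>auto simp del: of_nat_Suc\<close>)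
   then show ?thesis using n(2) unfolding dist_real_def by linarith
  qed
  then show "\<forall>\<^sub>F t in at 0. dist (q t) D < e" unfolding eventually_at using d(1) by auto
 qed
 then show ?thesis by blast
qed

lemma real_differentiable_at_0_iff:
 fixes g :: "real => real"
 shows "g differentiable (at 0) \<longleftrightarrow> (\<exists>D. ((%s. (g s - g 0) / s) \<longlongrightarrow> D) (at 0))"
 by (simp add: real_differentiable_def has_field_derivative_iff)

text \<open>The Cauchy criterion for difference quotients writes the good set as a countable
  intersection of countable unions of the closed sets \<open>A n k\<close>. So the bad set is Borel
  and can be tested on the lines parallel to \<open>b\<close>.\<close>

lemma lipschitz_line_differentiable_ae:
 fixes f :: "'a::euclidean_space => real" and b :: 'a
 assumes L: "\<And>x y. \<bar>f x - f y\<bar> <= L * norm (x - y)"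
 shows "negligible {x. \<not> (%t. f (x + t *\<^sub>R b)) differentiable (at 0)}"
proof -
 have L0: "L >= 0"
 proof -
  obtain i :: 'a where "i \<in> Basis" using nonempty_Basis by blast
  then show ?thesis using L[of i 0] by simp
 qed
 have contf: "continuous_on UNIV f"
  by (rule lipschitz_on_continuous_on[of L]) (use L L0 in \<open>auto intro!: lipschitz_onI simp: dist_norm\<close>)
 define q where "q s x = (f (x + s *\<^sub>R b) - f x) / s" for s x
 have contq: "continuous_on UNIV (q s)" for s
  unfolding q_def by (cases "s = 0") (auto intro!: continuous_intros continuous_on_compose2[OF contf])
 define A where "A n k = {x. \<forall>s t. 0 < \<bar>s\<bar> & \<bar>s\<bar> < 1 / real (Suc k) & 0 < \<bar>t\<bar> & \<bar>t\<bar> < 1 / real (Suc k)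
   --> \<bar>q s x - q t x\<bar> <= 1 / real (Suc n)}" for n k
 have "closed (A n k)" for n k
  unfolding A_def Collect_all_eq
  by (intro closed_INT ballI closed_Collect_imp open_Collect_const closed_Collect_le continuous_intros contq)
 then have Ab: "A n k \<in> sets borel" for n k by (rule borel_closed)
 define N where "N = - (\<Inter>n. \<Union>k. A n k)"
 have Nb: "N \<in> sets borel" unfolding N_def Compl_eq_Diff_UNIV using Ab by measurable
 have diff_iff: "x \<notin> N \<longleftrightarrow> (%t. f (x + t *\<^sub>R b)) differentiable (at 0)" for x
 proof
  assume x: "x \<notin> N"
  have "\<exists>D. ((%s. q s x) \<longlongrightarrow> D) (at 0)"
  proof (rule real_limit_at_zero_if_Cauchy)
   fix e :: real assume "e > 0"
   then obtain n where n: "1 / real (Suc n) < e" using nat_approx_posE by blast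
   obtain k where "x \<in> A n k" using x unfolding N_def by blast
   then show "\<exists>d>0. \<forall>s t. 0 < \<bar>s\<bar> & \<bar>s\<bar> < d & 0 < \<bar>t\<bar> & \<bar>t\<bar> < d --> \<bar>q s x - q t x\<bar> <= e"
    using n unfolding A_def by (intro exI[of _ "1 / real (Suc k)"]) fastforce
  qed
  then show "(%t. f (x + t *\<^sub>R b)) differentiable (at 0)" unfolding real_differentiable_at_0_iff q_def by simp
 next
  assume "(%t. f (x + t *\<^sub>R b)) differentiable (at 0)"
  then obtain D where D: "((%s. q s x) \<longlongrightarrow> D) (at 0)" unfolding real_differentiable_at_0_iff q_def by auto
  have "\<exists>k. x \<in> A n k" for n
  proof -
   obtain d where d: "d > 0" "\<And>s. s ~= 0 ==> dist s 0 < d ==> dist (q s x) D < 1 / real (Suc n) / 2"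
    using tendstoD[OF D, of "1 / real (Suc n) / 2"] unfolding eventually_at by auto
   obtain k where k: "1 / real (Suc k) < d" using d(1) nat_approx_posE by blast
   have "x \<in> A n k" unfolding A_def
   proof (clarify)
    fix s t :: real assume st: "0 < \<bar>s\<bar>" "\<bar>s\<bar> < 1 / real (Suc k)" "0 < \<bar>t\<bar>" "\<bar>t\<bar> < 1 / real (Suc k)"
    have "dist (q s x) D < 1 / real (Suc n) / 2" "dist (q t x) D < 1 / real (Suc n) / 2"
     by (rule d(2); use st k in \<open>simp add: dist_real_def del: of_nat_Suc\<close>)+
    moreover have "\<bar>y - z\<bar> <= e" if "dist y D < e / 2" "dist z D < e / 2" for y z e :: real
     using that unfolding dist_real_def by linarith
    ultimately show "\<bar>q s x - q t x\<bar> <= 1 / real (Suc n)" by blast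
   qed
   then show ?thesis ..
  qed
  then show "x \<notin> N" unfolding N_def by blast
 qed
 have "negligible N"
 proof (rule negligible_if_lines_negligible[OF Nb])
  fix x
  define g where "g t = f (x + t *\<^sub>R b)" for t
  have "negligible {t. \<not> g differentiable (at t)}"
  proof (rule lipschitz_real_differentiable_ae)
   fix s t show "\<bar>g s - g t\<bar> <= (L * norm b) * \<bar>s - t\<bar>"
    using L[of "x + s *\<^sub>R b" "x + t *\<^sub>R b"] by (simp add: g_def scaleR_left_diff_distrib[symmetric] mult.assoc mult.commute[of "norm b"])
  qed
  moreover have "{t. x + t *\<^sub>R b \<in> N} \<subseteq> {t. \<not> g differentiable (at t)}"
  proof (clarify)
   fix t assume t: "x + t *\<^sub>R b \<in> N" "g differentiable (at t)"
   obtain D where "(g has_real_derivative D) (at t)" using t(2) by (auto simp: real_differentiable_def)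
   then have "((%s. g (t + s)) has_real_derivative D) (at 0)" using DERIV_shift[of g D 0 t] by (simp add: add.commute)
   then have "(%s. f ((x + t *\<^sub>R b) + s *\<^sub>R b)) differentiable (at 0)"
    unfolding g_def real_differentiable_def by (auto simp: algebra_simps)
   then show False using diff_iff t(1) by blast
  qed
  ultimately show "negligible {t. x + t *\<^sub>R b \<in> N}" using negligible_subset by blast
 qed
 moreover have "{x. \<not> (%t. f (x + t *\<^sub>R b)) differentiable (at 0)} = N" using diff_iff by blast
 ultimately show ?thesis by simp
qed

text \<open>A Vitali covering of \<open>S\<close> by balls, each with its hole removed, has measure
  at most \<open>th\<close> times that of the surrounding open set, where \<open>1 - th\<close> is
  the volume fraction of a hole.\<close>

lemma negligible_porous:
 fixes S :: "'a::euclidean_space set"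
 assumes c: "c > 0" and por: "\<And>x d. x \<in> S ==> d > 0 ==>
  \<exists>r y. 0 < r & r < d & ball y (c * r) \<subseteq> ball x r & ball y (c * r) \<inter> S = {}"
 shows "negligible S"
proof -
 define th where "th = 1 - (min c 1 / 2) ^ DIM('a)"
 have th: "0 <= th" "th < 1" using c by (auto simp: th_def min_def power_le_one)
 have bdd: "negligible (S \<inter> ball 0 R)" for R
 proof (rule negligible_shrinking_cover[OF th, of "ball 0 R"])
  show "open (ball (0::'a) R)" "ball (0::'a) R \<in> lmeasurable" "S \<inter> ball 0 R \<subseteq> ball 0 R" by auto
  fix V :: "'a set" assume V: "open V" "V \<in> lmeasurable"
  define K where "K = {(x, r, y). 0 < r & cball x r \<subseteq> V & ball y (c * r) \<subseteq> ball x r & ball y (c * r) \<inter> S = {}}"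
  define a :: "'a \<times> real \<times> 'a => 'a" where "a = fst"
  define r :: "'a \<times> real \<times> 'a => real" where "r i = fst (snd i)" for i
  define y :: "'a \<times> real \<times> 'a => 'a" where "y i = snd (snd i)" for i
  \<comment> \<open>Smaller closed holes make the sets \<open>P i\<close> open, and lie well inside
    the balls that are known to avoid \<open>S\<close>.\<close>
  define cm where "cm = min c 1 / 2"
  have cm: "0 < cm" "cm < 1" "cm < c" using c by (auto simp: cm_def min_def)
  have K: "0 < r i" "cball (a i) (r i) \<subseteq> V" "ball (y i) (c * r i) \<subseteq> ball (a i) (r i)" "ball (y i) (c * r i) \<inter> S = {}" if "i \<in> K" for i
   using that by (auto simp: K_def a_def r_def y_def)
  have "\<exists>i. i \<in> K & x \<in> cball (a i) (r i) & r i < d" if x: "x \<in> S \<inter> V" and d: "d > 0" for x d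
  proof -
   obtain e where e: "e > 0" "cball x e \<subseteq> V" using V(1) x open_contains_cball by blast
   obtain s z where "0 < s" "s < min d e" "ball z (c * s) \<subseteq> ball x s" "ball z (c * s) \<inter> S = {}"
    using por[of x "min d e"] x d e by auto
   then show ?thesis using e
    by (intro exI[of _ "(x, s, z)"]) (auto simp: K_def a_def r_def subset_iff)
  qed
  then obtain C where C: "countable C" "C \<subseteq> K"
   "pairwise (%i j. disjnt (cball (a i) (r i)) (cball (a j) (r j))) C"
   "negligible((S \<inter> V) - (\<Union>i \<in> C. cball (a i) (r i)))"
   using Vitali_covering_theorem_cballs[of K r "S \<inter> V" a] K(1) by blast
  define P where "P i = ball (a i) (r i) - cball (y i) (cm * r i)" for i
  have sub: "cball (y i) (cm * r i) \<subseteq> ball (a i) (r i)" if "i \<in> K" for i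
  proof -
   have "cm * r i < c * r i" using cm K(1)[OF that] by auto
   then show ?thesis using K(3)[OF that] by (auto simp: subset_iff)
  qed
  have mP: "measure lebesgue (P i) = th * measure lebesgue (ball (a i) (r i))" if "i \<in> K" for i
  proof -
   have "measure lebesgue (P i) = measure lebesgue (ball (a i) (r i)) - measure lebesgue (cball (y i) (cm * r i))"
    unfolding P_def by (rule measurable_measure_Diff) (use sub[OF that] in auto)
   also have "... = th * measure lebesgue (ball (a i) (r i))"
    using K(1)[OF that] cm(1) by (simp add: content_ball content_cball th_def cm_def[symmetric] power_mult_distrib algebra_simps)
   finally show ?thesis .
  qed
  have bound: "measure lebesgue (\<Union>i\<in>F. P i) <= th * measure lebesgue V" if F: "F \<subseteq> C" "finite F" for F
  proof -
   have FK: "F \<subseteq> K" using F C by auto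
   have dj: "disjoint_family_on (%i. ball (a i) (r i)) F"
   proof -
    have "ball (a i) (r i) \<inter> ball (a j) (r j) = {}" if "i \<in> F" "j \<in> F" "i ~= j" for i j
    proof -
     have "disjnt (cball (a i) (r i)) (cball (a j) (r j))" using C(3) F that unfolding pairwise_def by blast
     then show ?thesis unfolding disjnt_def by (metis ball_subset_cball disjoint_iff subset_iff)
    qed
    then show ?thesis unfolding disjoint_family_on_def by blast
   qed
   have "measure lebesgue (\<Union>i\<in>F. P i) <= (\<Sum>i\<in>F. measure lebesgue (P i))"
    by (rule measure_UNION_le) (use F in \<open>auto simp: P_def\<close>)
   also have "... = (\<Sum>i\<in>F. th * measure lebesgue (ball (a i) (r i)))"
    using FK by (intro sum.cong) (auto simp: mP)
   also have "... = th * (\<Sum>i\<in>F. measure lebesgue (ball (a i) (r i)))" by (simp add: sum_distrib_left)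
   also have "(\<Sum>i\<in>F. measure lebesgue (ball (a i) (r i))) = measure lebesgue (\<Union>i\<in>F. ball (a i) (r i))"
    by (rule measure_finite_Union[symmetric])
     (use F dj in \<open>auto simp: lmeasurable_ball[THEN fmeasurableD2, simplified]\<close>)
   also have "th * ... <= th * measure lebesgue V"
   proof (intro mult_left_mono measure_mono_fmeasurable th V)
    show "(\<Union>i\<in>F. ball (a i) (r i)) \<subseteq> V"
     using K(2) FK ball_subset_cball by fastforce
    show "(\<Union>i\<in>F. ball (a i) (r i)) \<in> sets lebesgue" using F(2) by (intro sets.finite_UN) auto
   qed
   finally show ?thesis .
  qed
  have PS: "S \<inter> ball (a i) (r i) \<subseteq> P i" if "i \<in> K" for i
  proof -
   have "cm * r i < c * r i" using cm K(1)[OF that] by auto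
   then have "cball (y i) (cm * r i) \<subseteq> ball (y i) (c * r i)" by auto
   then show ?thesis using K(4)[OF that] unfolding P_def by blast
  qed
  have ns: "negligible (\<Union>i\<in>C. sphere (a i) (r i))" using C(1) by (auto intro: negligible_sphere)
  have "negligible (S \<inter> ball 0 R \<inter> V - (\<Union>i\<in>C. P i))"
  proof (rule negligible_subset[OF negligible_Un[OF C(4) ns]], rule subsetI)
   fix x assume x: "x \<in> S \<inter> ball 0 R \<inter> V - (\<Union>i\<in>C. P i)"
   show "x \<in> (S \<inter> V - (\<Union>i\<in>C. cball (a i) (r i))) \<union> (\<Union>i\<in>C. sphere (a i) (r i))"
   proof (cases "\<exists>i\<in>C. x \<in> cball (a i) (r i)")
    case True
    then obtain i where i: "i \<in> C" "x \<in> cball (a i) (r i)" by blast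
    have "x \<notin> ball (a i) (r i)" using PS[of i] i C(2) x by blast
    then have "x \<in> sphere (a i) (r i)" using i(2) by auto
    then show ?thesis using i(1) by blast
   qed (use x in auto)
  qed
  moreover have "(\<Union>i\<in>C. P i) \<in> lmeasurable" "measure lebesgue (\<Union>i\<in>C. P i) <= th * measure lebesgue V"
   by (rule fmeasurable_UN_bound[OF C(1) _ bound] measure_UN_bound[OF C(1) _ bound]; auto simp: P_def)+
  moreover have "open (\<Union>i\<in>C. P i)" unfolding P_def by (intro open_UN) auto
  ultimately show "\<exists>W. open W & W \<in> lmeasurable & measure lebesgue W <= th * measure lebesgue V & negligible (S \<inter> ball 0 R \<inter> V - W)"
   by blast
 qed
 have "S \<subseteq> (\<Union>n::nat. S \<inter> ball 0 (real n))"
 proof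
  fix x assume "x \<in> S"
  moreover obtain n where "norm x < real n" using reals_Archimedean2 by blast
  ultimately show "x \<in> (\<Union>n::nat. S \<inter> ball 0 (real n))" by auto
 qed
 moreover have "negligible (\<Union>n::nat. S \<inter> ball 0 (real n))" by (intro negligible_countable_Union) (auto intro: bdd)
 ultimately show ?thesis using negligible_subset by blast
qed

text \<open>Partial derivatives exist almost everywhere; porosity supplies linearity.
  \<open>S n k a\<close> collects the points whose partial difference quotients up to scale
  \<open>1 / (k+1)\<close> agree with \<open>a\<close> within \<open>1 / (n+1)\<close>. Where
  \<open>S n k a\<close> is not porous, every corner of the coordinate path from \<open>x\<close> to
  \<open>x + h\<close> has a point of \<open>S n k a\<close> so close that the Lipschitz bound pays
  for moving there. Hence the increments along the path add up to nearly
  \<open>a \<bullet> h\<close>.\<close>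

lemma rademacher_real:
 fixes f :: "'a::euclidean_space => real"
 assumes L: "\<And>x y. \<bar>f x - f y\<bar> <= L * norm (x - y)"
 shows "negligible {x. \<not> f differentiable (at x)}"
proof -
 have L0: "L >= 0"
 proof -
  obtain i :: 'a where "i \<in> Basis" using nonempty_Basis by blast
  then show ?thesis using L[of i 0] by simp
 qed
 define N0 where "N0 = (\<Union>b\<in>Basis. {x. \<not> (%t. f (x + t *\<^sub>R b)) differentiable (at 0)})"
 have N0: "negligible N0" unfolding N0_def
  by (intro negligible_Union finite_imageI finite_Basis) (auto intro: lipschitz_line_differentiable_ae[OF L])
 obtain D :: "'a set" where D: "countable D" "\<And>X. open X ==> X ~= {} ==> \<exists>d\<in>D. d \<in> X"
  by (rule countable_dense_setE) blast
 define S where "S n k a = {x. \<forall>b\<in>Basis. \<forall>t. \<bar>t\<bar> < 1 / real (Suc k) -->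
   \<bar>f (x + t *\<^sub>R b) - f x - t * (a \<bullet> b)\<bar> <= \<bar>t\<bar> / real (Suc n)}" for n k :: nat and a :: 'a
 \<comment> \<open>The relative distance allowed to \<open>S n k a\<close>: with
   \<open>r = 2 * norm h\<close>, two moves by \<open>c n * r\<close> cost
   \<open>4 * L * c n * norm h\<close>, at most \<open>norm h / (n+1)\<close>.\<close>
 define c where "c n = 1 / (4 * (L + 1) * real (Suc n))" for n :: nat
 have c0: "c n > 0" for n using L0 by (auto simp: c_def)
 have cL: "4 * L * c n <= 1 / real (Suc n)" for n
 proof -
  have "4 * (L + 1) * c n = 1 / real (Suc n)" using L0 by (simp add: c_def del: of_nat_Suc)
  then show ?thesis using c0[of n] by (simp add: algebra_simps)
 qed
 have c1: "c n <= 1/4" for n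
 proof -
  have "1 * 1 <= (L + 1) * real (Suc n)" using L0 by (intro mult_mono) auto
  then have "1 / (4 * ((L + 1) * real (Suc n))) <= 1 / (4 * 1)" by (intro divide_left_mono) auto
  then show ?thesis by (simp only: c_def mult.assoc mult_1_right)
 qed
 define Por where "Por n k a = {x \<in> S n k a. \<forall>d>0. \<exists>r y. 0 < r & r < d & ball y (c n * r) \<subseteq> ball x r & ball y (c n * r) \<inter> S n k a = {}}" for n k a
 have nPor: "negligible (Por n k a)" for n k a
 proof (rule negligible_porous[OF c0[of n]])
  fix x d assume "x \<in> Por n k a" "(d::real) > 0"
  then obtain r y where "0 < r" "r < d" "ball y (c n * r) \<subseteq> ball x r" "ball y (c n * r) \<inter> S n k a = {}"
   unfolding Por_def by blast
  then show "\<exists>r y. 0 < r & r < d & ball y (c n * r) \<subseteq> ball x r & ball y (c n * r) \<inter> Por n k a = {}"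
   by (intro exI[of _ r] exI[of _ y]) (auto simp: Por_def)
 qed
 define Z where "Z = N0 \<union> (\<Union>(n,k,a)\<in>UNIV \<times> UNIV \<times> D. Por n k a)"
 have "negligible Z" unfolding Z_def using D(1)
  by (intro negligible_Un N0 negligible_countable_Union) (auto intro!: nPor)
 moreover have "f differentiable (at x)" if xZ: "x \<notin> Z" for x
 proof -
  have "\<forall>b\<in>Basis. \<exists>d. ((%t. f (x + t *\<^sub>R b)) has_real_derivative d) (at 0)"
   using xZ unfolding Z_def N0_def by (auto simp: real_differentiable_def)
  then obtain d where d: "\<And>b. b \<in> Basis ==> ((%t. f (x + t *\<^sub>R b)) has_real_derivative d b) (at 0)" by metis
  define \<alpha> :: 'a where "\<alpha> = (\<Sum>b\<in>Basis. d b *\<^sub>R b)"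
  have ab: "\<alpha> \<bullet> b = d b" if "b \<in> Basis" for b using that by (simp add: \<alpha>_def)
  have est: "\<exists>e>0. \<forall>h. norm h < e --> \<bar>f (x + h) - f x - \<alpha> \<bullet> h\<bar> <= (2 * real DIM('a) + 1) / real (Suc n) * norm h" for n
  proof -
   define \<epsilon> where "\<epsilon> = 1 / (2 * real (Suc n))"
   have e0: "\<epsilon> > 0" by (simp add: \<epsilon>_def)
   obtain a where a: "a \<in> D" "norm (a - \<alpha>) < \<epsilon>"
    using D(2)[of "ball \<alpha> \<epsilon>"] e0 by (auto simp: dist_norm norm_minus_commute)
   have "\<forall>b\<in>Basis. \<exists>e>0. \<forall>t. \<bar>t\<bar> < e --> \<bar>f (x + t *\<^sub>R b) - f x - t * d b\<bar> <= \<epsilon> * \<bar>t\<bar>"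
   proof
    fix b :: 'a assume b: "b \<in> Basis"
    have "((%t. f (x + t *\<^sub>R b)) has_derivative (*) (d b)) (at 0)" using d[OF b] by (simp add: has_field_derivative_def)
    then show "\<exists>e>0. \<forall>t. \<bar>t\<bar> < e --> \<bar>f (x + t *\<^sub>R b) - f x - t * d b\<bar> <= \<epsilon> * \<bar>t\<bar>"
     using e0 unfolding has_derivative_at_alt by (auto simp: mult.commute)
   qed
   then obtain e where e: "\<And>b. b \<in> Basis ==> e b > 0"
     "\<And>b t. b \<in> Basis ==> \<bar>t\<bar> < e b ==> \<bar>f (x + t *\<^sub>R b) - f x - t * d b\<bar> <= \<epsilon> * \<bar>t\<bar>" by metis
   define e0 where "e0 = Min (e ` Basis)"
   have e0: "e0 > 0" "\<And>b. b \<in> Basis ==> e0 <= e b" using e(1) by (auto simp: e0_def)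
   obtain k where k: "1 / real (Suc k) < e0" using e0(1) nat_approx_posE by blast
   have xS: "x \<in> S n k a" unfolding S_def
   proof (clarify)
    fix b :: 'a and t :: real assume b: "b \<in> Basis" and t: "\<bar>t\<bar> < 1 / real (Suc k)"
    have "\<bar>f (x + t *\<^sub>R b) - f x - t * d b\<bar> <= \<epsilon> * \<bar>t\<bar>" using e(2)[OF b, of t] e0(2)[OF b] k t by linarith
    moreover have "\<bar>t * (a \<bullet> b) - t * d b\<bar> <= \<epsilon> * \<bar>t\<bar>"
    proof -
     have "\<bar>(a - \<alpha>) \<bullet> b\<bar> <= \<epsilon>" using Basis_le_norm[OF b, of "a - \<alpha>"] a(2) by linarith
     then have "\<bar>t\<bar> * \<bar>a \<bullet> b - d b\<bar> <= \<bar>t\<bar> * \<epsilon>" using ab[OF b] by (intro mult_left_mono) (auto simp: inner_diff_left)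
     then show ?thesis by (simp add: abs_mult[symmetric] right_diff_distrib mult.commute)
    qed
    moreover have "\<epsilon> * \<bar>t\<bar> + \<epsilon> * \<bar>t\<bar> = \<bar>t\<bar> / real (Suc n)" by (simp add: \<epsilon>_def field_simps del: of_nat_Suc)
    ultimately show "\<bar>f (x + t *\<^sub>R b) - f x - t * (a \<bullet> b)\<bar> <= \<bar>t\<bar> / real (Suc n)" by linarith
   qed
   have "x \<notin> Por n k a" using xZ a(1) unfolding Z_def by blast
   then obtain d0 where d0: "d0 > 0" "\<And>r y. 0 < r ==> r < d0 ==> ball y (c n * r) \<subseteq> ball x r ==> ball y (c n * r) \<inter> S n k a ~= {}"
    using xS unfolding Por_def by blast
   define m where "m = min (d0 / 2) (1 / real (Suc k))"
   have main: "\<bar>f (x + h) - f x - a \<bullet> h\<bar> <= real DIM('a) * (2 / real (Suc n) * norm h)" if h: "norm h < m" for h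
   proof (cases "h = 0")
    case False
    have part: "norm (\<Sum>b\<in>B. (h \<bullet> b) *\<^sub>R b) <= norm h" if "B \<subseteq> Basis" for B
    proof -
     have "(norm (\<Sum>b\<in>B. (h \<bullet> b) *\<^sub>R b))^2 = (\<Sum>b\<in>B. (h \<bullet> b)^2)"
     proof -
      have "(\<Sum>b\<in>B. (h \<bullet> b) *\<^sub>R b) \<bullet> (\<Sum>b\<in>B. (h \<bullet> b) *\<^sub>R b) = (\<Sum>b\<in>B. (h \<bullet> b)^2)"
      proof -
       have "(\<Sum>b\<in>B. (h \<bullet> b) *\<^sub>R b) \<bullet> i = h \<bullet> i" if "i \<in> B" for i
        unfolding inner_sum_left using that \<open>B \<subseteq> Basis\<close> finite_subset[OF \<open>B \<subseteq> Basis\<close> finite_Basis]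
        by (subst sum.remove[of _ i]) (auto simp: inner_Basis subset_iff intro!: sum.neutral)
       then show ?thesis by (simp add: inner_sum_right power2_eq_square)
      qed
      then show ?thesis by (simp add: power2_norm_eq_inner)
     qed
     also have "... <= (\<Sum>b\<in>Basis. (h \<bullet> b)^2)" using that by (intro sum_mono2) auto
     also have "... = (norm h)^2" unfolding power2_norm_eq_inner euclidean_inner[of h h] by (simp add: power2_eq_square)
     finally show ?thesis by (rule power2_le_imp_le) simp
    qed
    have "\<bar>f (x + (\<Sum>b\<in>B. (h \<bullet> b) *\<^sub>R b)) - f x - (\<Sum>b\<in>B. (h \<bullet> b) * (a \<bullet> b))\<bar> <= real (card B) * (2 / real (Suc n) * norm h)"
     if "B \<subseteq> Basis" for B
    proof -
     have "finite B" using that finite_subset finite_Basis by blast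
     then show ?thesis using that
     proof (induction B rule: finite_induct)
      case (insert b B)
      define y where "y = x + (\<Sum>b\<in>B. (h \<bullet> b) *\<^sub>R b)"
      define r where "r = 2 * norm h"
      have r: "0 < r" "r < d0" using False h by (auto simp: r_def m_def)
      have "ball y (c n * r) \<subseteq> ball x r"
      proof
       fix z assume "z \<in> ball y (c n * r)"
       then have "dist y z < c n * r" by simp
       moreover have "c n * r <= 1/4 * r" using r c1[of n] by (intro mult_right_mono) auto
       moreover have "dist x y <= norm h" using part[of B] insert.prems by (simp add: y_def dist_norm)
       ultimately have "dist x z < r" using dist_triangle[of x z y] r unfolding r_def by linarith
       then show "z \<in> ball x r" by simp
      qed
      then obtain z where z: "z \<in> S n k a" "dist y z < c n * r" using d0(2)[OF r] by fastforce
      define t where "t = h \<bullet> b"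
      have b: "b \<in> Basis" using insert.prems by simp
      have t: "\<bar>t\<bar> <= norm h" unfolding t_def using Basis_le_norm[OF b] by simp
      have "\<bar>t\<bar> < 1 / real (Suc k)" using t h by (auto simp: m_def)
      then have 1: "\<bar>f (z + t *\<^sub>R b) - f z - t * (a \<bullet> b)\<bar> <= \<bar>t\<bar> / real (Suc n)" using z(1) b unfolding S_def by blast
      have 2: "\<bar>f (y + t *\<^sub>R b) - f (z + t *\<^sub>R b)\<bar> <= L * (c n * r)"
       using L[of "y + t *\<^sub>R b" "z + t *\<^sub>R b"] mult_left_mono[OF less_imp_le[OF z(2)] L0] by (simp add: dist_norm)
      have 3: "\<bar>f y - f z\<bar> <= L * (c n * r)"
       using L[of y z] mult_left_mono[OF less_imp_le[OF z(2)] L0] by (simp add: dist_norm)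
      have 4: "2 * (L * (c n * r)) <= 1 / real (Suc n) * norm h"
       using mult_right_mono[OF cL[of n], of "norm h"] by (simp add: r_def mult_ac)
      have 5: "\<bar>t\<bar> / real (Suc n) <= 1 / real (Suc n) * norm h" using t by (simp add: divide_right_mono)
      have 6: "\<bar>f (y + t *\<^sub>R b) - f y - t * (a \<bullet> b)\<bar> <= 2 / real (Suc n) * norm h"
      proof -
       have "2 / real (Suc n) * norm h = 1 / real (Suc n) * norm h + 1 / real (Suc n) * norm h" by (simp add: field_simps del: of_nat_Suc)
       then show ?thesis using 1 2 3 4 5 by linarith
      qed
      have 7: "\<bar>f y - f x - (\<Sum>b\<in>B. (h \<bullet> b) * (a \<bullet> b))\<bar> <= real (card B) * (2 / real (Suc n) * norm h)"
       using insert unfolding y_def by blast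
      have e1: "x + (\<Sum>b\<in>insert b B. (h \<bullet> b) *\<^sub>R b) = y + t *\<^sub>R b" using insert.hyps by (simp add: y_def t_def add_ac)
      have e2: "(\<Sum>b\<in>insert b B. (h \<bullet> b) * (a \<bullet> b)) = (\<Sum>b\<in>B. (h \<bullet> b) * (a \<bullet> b)) + t * (a \<bullet> b)" using insert.hyps by (simp add: t_def)
      have e3: "real (card (insert b B)) * Q = real (card B) * Q + Q" for Q
       using insert.hyps by (simp add: distrib_right)
      have tri: "\<bar>w - u - (s + r)\<bar> <= c + Q" if "\<bar>w - v - r\<bar> <= Q" "\<bar>v - u - s\<bar> <= c" for w v u s r c Q :: real
       using that by linarith
      show ?case unfolding e1 e2 e3 by (rule tri[OF 6 7])
     qed simp
    qed
    from this[OF order_refl] show ?thesis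
     by (simp add: euclidean_representation euclidean_inner[of a h] mult.commute)
   qed simp
   show ?thesis
   proof (intro exI[of _ m] conjI allI impI)
    show "m > 0" using d0 by (simp add: m_def)
    fix h :: 'a assume h: "norm h < m"
    have "\<bar>(a - \<alpha>) \<bullet> h\<bar> <= \<epsilon> * norm h"
     using Cauchy_Schwarz_ineq2[of "a - \<alpha>" h] mult_right_mono[OF less_imp_le[OF a(2)], of "norm h"] by simp
    moreover have "\<epsilon> * norm h <= 1 / real (Suc n) * norm h" by (intro mult_right_mono) (auto simp: \<epsilon>_def field_simps simp del: of_nat_Suc)
    moreover have "(2 * real DIM('a) + 1) / real (Suc n) * norm h = real DIM('a) * (2 / real (Suc n) * norm h) + 1 / real (Suc n) * norm h"
     by (simp add: field_simps del: of_nat_Suc)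
    ultimately show "\<bar>f (x + h) - f x - \<alpha> \<bullet> h\<bar> <= (2 * real DIM('a) + 1) / real (Suc n) * norm h"
     using main[OF h] by (simp add: inner_diff_left)
   qed
  qed
  have "(f has_derivative (%h. \<alpha> \<bullet> h)) (at x)"
   unfolding has_derivative_at_alt
  proof (intro conjI allI impI bounded_linear_inner_right)
   fix e :: real assume "e > 0"
   then have "e / (2 * real DIM('a) + 1) > 0" by (intro divide_pos_pos) auto
   then obtain n where n: "1 / real (Suc n) < e / (2 * real DIM('a) + 1)" using nat_approx_posE by blast
   have n': "(2 * real DIM('a) + 1) / real (Suc n) <= e" using n by (simp add: field_simps del: of_nat_Suc)
   obtain \<delta> where dd: "\<delta> > 0" "\<forall>h. norm h < \<delta> --> \<bar>f (x + h) - f x - \<alpha> \<bullet> h\<bar> <= (2 * real DIM('a) + 1) / real (Suc n) * norm h" using est by blast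
   have "norm (f y - f x - \<alpha> \<bullet> (y - x)) <= e * norm (y - x)" if "norm (y - x) < \<delta>" for y
    using dd(2)[rule_format, OF that] mult_right_mono[OF n', of "norm (y - x)"] by simp
   then show "\<exists>d>0. \<forall>y. norm (y - x) < d --> norm (f y - f x - \<alpha> \<bullet> (y - x)) <= e * norm (y - x)" using dd(1) by blast
  qed
  then show ?thesis unfolding differentiable_def by blast
 qed
 ultimately show ?thesis by (auto intro: negligible_subset)
qed

theorem rademacher:
 fixes f :: "'a::euclidean_space => 'b::euclidean_space"
 assumes L: "\<And>x y. norm (f x - f y) <= L * norm (x - y)"
 shows "negligible {x. \<not> f differentiable (at x)}"
proof -
 have "{x. \<not> f differentiable (at x)} = (\<Union>i\<in>Basis. {x. \<not> (%x. f x \<bullet> i) differentiable (at x)})"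
  by (subst differentiable_componentwise_within) auto
 moreover have "negligible {x. \<not> (%x. f x \<bullet> i) differentiable (at x)}" if "i \<in> Basis" for i
 proof (rule rademacher_real)
  fix x y show "\<bar>f x \<bullet> i - f y \<bullet> i\<bar> <= L * norm (x - y)"
   using L[of x y] Basis_le_norm[OF that, of "f x - f y"] by (simp add: inner_diff_left)
 qed
 ultimately show ?thesis by (auto intro!: negligible_Union)
qed

section \<open>Second order expansions of convex functions and the theorem on sums\<close>

text \<open>Telescoping over equal steps: the linear terms add up to \<open>a\<close>, the quadratic
  ones to \<open>b\<close> over the number of steps. Exchanging \<open>s\<close> and
  \<open>s'\<close> turns the lower bound on increments into an upper bound. This replaces
  integrating a subgradient along a segment.\<close>

lemma partition_lipschitz_bound:
 fixes \<Psi> :: "real => real"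
 assumes a: "a >= 0" and b: "b >= 0"
  and st: "\<And>s s'. 0 <= s ==> s <= 1 ==> 0 <= s' ==> s' <= 1 ==> \<Psi> s' - \<Psi> s >= - (\<bar>s' - s\<bar> * a) - (s' - s)^2 * b"
 shows "\<bar>\<Psi> 1 - \<Psi> 0\<bar> <= a"
proof -
 have "\<bar>\<Psi> 1 - \<Psi> 0\<bar> <= a + b / real (Suc n)" for n
 proof -
  define N where "N = real (Suc n)"
  have N: "N > 0" by (simp add: N_def)
  have step: "\<bar>\<Psi> (real (Suc i) / N) - \<Psi> (real i / N)\<bar> <= a / N + b / N^2" if "i <= n" for i
  proof -
   have 1: "0 <= real i / N" "real i / N <= 1" "0 <= real (Suc i) / N" "real (Suc i) / N <= 1"
    using that N by (auto simp: N_def divide_le_eq)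
   have d: "real (Suc i) / N - real i / N = 1 / N" by (simp add: diff_divide_distrib[symmetric])
   have d': "\<bar>real (Suc i) / N - real i / N\<bar> = 1 / N" "\<bar>real i / N - real (Suc i) / N\<bar> = 1 / N"
    unfolding d abs_minus_commute[of "real i / N"] using N by simp_all
   have d2: "(real (Suc i) / N - real i / N)^2 = 1 / N^2" "(real i / N - real (Suc i) / N)^2 = 1 / N^2"
    unfolding power2_commute[of "real i / N"] d by (simp_all add: power_divide)
   show ?thesis using st[OF 1(1,2,3,4)] st[OF 1(3,4,1,2)] unfolding d' d2 by (simp add: abs_le_iff)
  qed
  have "\<bar>\<Psi> (real m / N) - \<Psi> 0\<bar> <= real m * (a / N + b / N^2)" if "m <= Suc n" for m
   using that
  proof (induction m)
   case (Suc m)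
   have "\<bar>\<Psi> (real (Suc m) / N) - \<Psi> 0\<bar> <= \<bar>\<Psi> (real (Suc m) / N) - \<Psi> (real m / N)\<bar> + \<bar>\<Psi> (real m / N) - \<Psi> 0\<bar>" by linarith
   also have "... <= (a / N + b / N^2) + real m * (a / N + b / N^2)" using step[of m] Suc by simp
   finally show ?case by (simp add: distrib_right)
  qed simp
  from this[of "Suc n", folded N_def] have "\<bar>\<Psi> 1 - \<Psi> 0\<bar> <= N * (a / N + b / N^2)" using N by simp
  also have "... = a + b / N" using N by (simp add: field_simps power2_eq_square)
  finally show ?thesis unfolding N_def .
 qed
 moreover have "(%n. a + b / real (Suc n)) \<longlonglongrightarrow> a + 0"
  by (intro tendsto_add tendsto_const) (use tendsto_mult_right_zero[OF LIMSEQ_inverse_real_of_nat, of b] in \<open>simp add: divide_inverse\<close>)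
 ultimately show ?thesis by (intro LIMSEQ_le_const[of "%n. a + b / real (Suc n)"]) auto
qed

text \<open>\<open>h\<close> is convex, so \<open>J\<close>, the inverse of the relation between
  \<open>z\<close> and \<open>z\<close> plus a subgradient at \<open>z\<close>, is nonexpansive and
  differentiable almost everywhere; the image under \<open>J\<close> of its bad points is null. At a
  point touched from above by a paraboloid the subgradient is unique, and nearby subgradients differ
  from it at most linearly in the distance. This makes the derivative \<open>D\<close> of
  \<open>J\<close> injective, and the inverse of \<open>D\<close> minus the identity is the Hessian
  of \<open>h\<close>.\<close>

lemma alexandrov_at_touched_points:
 fixes h :: "'a::euclidean_space => real"
 assumes sub: "\<And>z. \<exists>g. norm g <= B & (\<forall>z'. h z' >= h z + g \<bullet> (z' - z))"
 shows "\<exists>Z. negligible Z & (\<forall>z g M \<delta>. z \<notin> Z --> \<delta> > 0 --> (\<forall>k. norm k < \<delta> --> h (z + k) <= h z + g \<bullet> k + M * (norm k)^2) -->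
   (\<exists>A. linear A & (\<forall>\<epsilon>>0. \<exists>\<delta>>0. \<forall>k. norm k < \<delta> -->
    \<bar>h (z + k) - h z - g \<bullet> k - (k \<bullet> A k) / 2\<bar> <= \<epsilon> * (norm k)^2)))"
proof -
 define isub where "isub z g \<longleftrightarrow> (\<forall>z'. h z' >= h z + g \<bullet> (z' - z))" for z g
 have ex: "\<exists>g. norm g <= B & isub z g" for z using sub[of z] by (auto simp: isub_def)
 have B0: "B >= 0" using ex[of 0] norm_ge_zero order_trans by blast
 have lip1: "h z - h z' <= B * norm (z - z')" for z z'
 proof -
  obtain g where g: "norm g <= B" "isub z g" using ex by blast
  have "h z' >= h z + g \<bullet> (z' - z)" using g(2) by (simp add: isub_def)
  moreover have "\<bar>g \<bullet> (z' - z)\<bar> <= B * norm (z - z')"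
   using Cauchy_Schwarz_ineq2[of g "z' - z"] mult_right_mono[OF g(1), of "norm (z - z')"] by (simp add: norm_minus_commute)
  ultimately show ?thesis by linarith
 qed
 have conth: "continuous_on UNIV h"
 proof (rule lipschitz_on_continuous_on[of B])
  show "B-lipschitz_on UNIV h"
  proof (rule lipschitz_onI)
   fix x y show "dist (h x) (h y) <= B * dist x y"
    using lip1[of x y] lip1[of y x] by (simp add: dist_norm norm_minus_commute abs_le_iff)
  qed (rule B0)
 qed
 \<comment> \<open>A minimiser of \<open>h\<close> plus half the squared distance to \<zeta> has
   \<zeta> - z as a subgradient. Minimising over a ball is enough because \<open>h\<close> is
   \<open>B\<close>-Lipschitz.\<close>
 have "\<exists>z. isub z (\<zeta> - z)" for \<zeta>
 proof -
  define m where "m z = h z + (norm (z - \<zeta>))^2 / 2" for z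
  have "continuous_on (cball \<zeta> (2 * B + 1)) m" unfolding m_def
   by (intro continuous_intros continuous_on_subset[OF conth]) auto
  moreover have "cball \<zeta> (2 * B + 1) ~= {}" using B0 by simp
  ultimately obtain z where z: "z \<in> cball \<zeta> (2*B+1)" "\<And>y. y \<in> cball \<zeta> (2*B+1) ==> m z <= m y"
   using continuous_attains_inf[OF compact_cball] by metis
  have zmin: "m z <= m y" for y
  proof (cases "y \<in> cball \<zeta> (2*B+1)")
   case False
   then have n: "norm (y - \<zeta>) > 2 * B + 1" by (simp add: dist_norm norm_minus_commute)
   have "norm (y - \<zeta>) * (norm (y - \<zeta>) / 2 - B) >= 0" using n B0 by (intro mult_nonneg_nonneg) auto
   then have "B * norm (y - \<zeta>) <= (norm (y - \<zeta>))^2 / 2" by (simp add: algebra_simps power2_eq_square)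
   then have "m \<zeta> <= m y" using lip1[of \<zeta> y] by (simp add: m_def norm_minus_commute)
   moreover have "m z <= m \<zeta>" using z(2) B0 by simp
   ultimately show ?thesis by linarith
  qed (use z in auto)
  have "isub z (\<zeta> - z)" unfolding isub_def
  proof (rule allI, rule ccontr)
   fix z' assume neg: "\<not> h z' >= h z + (\<zeta> - z) \<bullet> (z' - z)"
   define d where "d = z' - z"
   define \<Delta> where "\<Delta> = h z + (\<zeta> - z) \<bullet> d - h z'"
   have D: "\<Delta> > 0" using neg by (simp add: \<Delta>_def d_def)
   define t where "t = min 1 (\<Delta> / ((norm d)^2 + 1))"
   have t: "0 < t" "t <= 1" using D by (auto simp: t_def intro!: divide_pos_pos add_nonneg_pos)
   have t2: "t * (norm d)^2 <= \<Delta>"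
   proof -
    have "t * (norm d)^2 <= \<Delta> / ((norm d)^2 + 1) * (norm d)^2" by (intro mult_right_mono) (auto simp: t_def)
    also have "... = \<Delta> * ((norm d)^2 / ((norm d)^2 + 1))" by simp
    also have "... <= \<Delta> * 1" using D by (intro mult_left_mono) (auto simp: divide_le_eq_1 add_nonneg_pos)
    also have "... = \<Delta>" by simp
    finally show ?thesis .
   qed
   obtain g where g: "isub (z + t *\<^sub>R d) g" using ex by blast
   have c1: "h z >= h (z + t *\<^sub>R d) - t * (g \<bullet> d)" using g[unfolded isub_def, rule_format, of z] by simp
   have c2: "h z' >= h (z + t *\<^sub>R d) + (1 - t) * (g \<bullet> d)"
   proof -
    have "z' - (z + t *\<^sub>R d) = (1 - t) *\<^sub>R d" by (simp add: d_def algebra_simps)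
    then show ?thesis using g[unfolded isub_def, rule_format, of z'] by simp
   qed
   have cv: "h (z + t *\<^sub>R d) <= (1 - t) * h z + t * h z'"
    using mult_left_mono[OF c1, of "1 - t"] mult_left_mono[OF c2, of t] t by (simp add: algebra_simps)
   have "m z <= m (z + t *\<^sub>R d)" by (rule zmin)
   moreover have "(norm (z + t *\<^sub>R d - \<zeta>))^2 = (norm (z - \<zeta>))^2 + 2 * t * (d \<bullet> (z - \<zeta>)) + t^2 * (norm d)^2"
    unfolding power2_norm_eq_inner
    by (simp add: inner_add_left inner_add_right inner_diff_left inner_diff_right inner_commute algebra_simps power2_eq_square)
   ultimately have "h z <= (1 - t) * h z + t * h z' + t * (d \<bullet> (z - \<zeta>)) + t^2 * (norm d)^2 / 2"
    using cv unfolding m_def by (simp add: field_simps)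
   then have "0 <= t * (h z' - h z + d \<bullet> (z - \<zeta>) + t * (norm d)^2 / 2)" by (simp add: algebra_simps power2_eq_square)
   then have "0 <= h z' - h z + d \<bullet> (z - \<zeta>) + t * (norm d)^2 / 2" using t by (simp add: zero_le_mult_iff)
   moreover have "h z' - h z + d \<bullet> (z - \<zeta>) = - \<Delta>" by (simp add: \<Delta>_def inner_diff_left inner_diff_right inner_commute)
   ultimately show False using t2 D by linarith
  qed
  then show ?thesis ..
 qed
 then obtain J where J: "\<And>\<zeta>. isub (J \<zeta>) (\<zeta> - J \<zeta>)" by metis
 have mono: "(g - g') \<bullet> (z - z') >= 0" if "isub z g" "isub z' g'" for z g z' g'
  using that(1)[unfolded isub_def, rule_format, of z'] that(2)[unfolded isub_def, rule_format, of z]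
  by (simp add: inner_diff_left inner_diff_right)
 have Jinv: "J (z + g) = z" if "isub z g" for z g
 proof -
  define z1 where "z1 = J (z + g)"
  have "(g - (z + g - z1)) \<bullet> (z - z1) >= 0" using mono[OF that J[of "z + g"]] by (simp add: z1_def)
  moreover have "g - (z + g - z1) = - (z - z1)" by simp
  ultimately have "(norm (z - z1))^2 <= 0" by (simp only: inner_minus_left power2_norm_eq_inner)
  then show ?thesis by (simp add: z1_def)
 qed
 have Jlip: "norm (J x - J y) <= 1 * norm (x - y)" for x y
 proof -
  have "0 <= ((x - J x) - (y - J y)) \<bullet> (J x - J y)" by (rule mono[OF J J])
  then have "(norm (J x - J y))^2 <= (x - y) \<bullet> (J x - J y)"
   by (simp add: power2_norm_eq_inner inner_diff_left inner_diff_right)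
  also have "... <= norm (x - y) * norm (J x - J y)" by (rule norm_cauchy_schwarz)
  finally have "norm (J x - J y) * norm (J x - J y) <= norm (x - y) * norm (J x - J y)" by (simp add: power2_eq_square)
  then show ?thesis by (cases "norm (J x - J y) = 0") auto
 qed
 define Z where "Z = J ` {\<zeta>. \<not> J differentiable (at \<zeta>)}"
 have negZ: "negligible Z" unfolding Z_def
  by (rule negligible_lipschitz_image[OF order_refl rademacher[OF Jlip] Jlip])
 show ?thesis
 proof (intro exI[of _ Z] conjI negZ allI impI)
  fix z g M \<delta>
  assume zZ: "z \<notin> Z" and d0: "\<delta> > (0::real)" and up1: "\<forall>k. norm k < \<delta> --> h (z + k) <= h z + g \<bullet> k + M * (norm k)^2"
  have up0: "\<And>k. norm k < \<delta> ==> h (z + k) <= h z + g \<bullet> k + M * (norm k)^2" using up1 by blast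
  define M' where "M' = max M 1"
  have M': "M' > 0" by (simp add: M'_def)
  have up: "h (z + k) <= h z + g \<bullet> k + M' * (norm k)^2" if "norm k < \<delta>" for k
   using up0[OF that] mult_right_mono[of M M' "(norm k)^2"] by (simp add: M'_def)
  \<comment> \<open>A second subgradient \<open>g0\<close> would make \<open>h\<close> exceed the
    paraboloid in the direction \<open>g0 - g\<close> at small distances.\<close>
  have uniq: "g0 = g" if g0: "isub z g0" for g0
  proof (rule ccontr)
   assume ne: "g0 ~= g"
   define e where "e = g0 - g"
   have e: "norm e > 0" using ne by (simp add: e_def)
   define t where "t = min (\<delta> / (2 * norm e)) (1 / (2 * M'))"
   have t: "t > 0" "t * norm e < \<delta>" "t * M' < 1"
   proof -
    show "t > 0" using e d0 M' by (simp add: t_def)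
    have "t * norm e <= \<delta> / (2 * norm e) * norm e" using e by (intro mult_right_mono) (auto simp: t_def)
    then show "t * norm e < \<delta>" using e d0 by simp
    have "t * M' <= 1 / (2 * M') * M'" using M' by (intro mult_right_mono) (auto simp: t_def)
    then show "t * M' < 1" using M' by simp
   qed
   have "h (z + t *\<^sub>R e) >= h z + g0 \<bullet> (t *\<^sub>R e)" using g0[unfolded isub_def, rule_format, of "z + t *\<^sub>R e"] by simp
   moreover have "h (z + t *\<^sub>R e) <= h z + g \<bullet> (t *\<^sub>R e) + M' * (norm (t *\<^sub>R e))^2" using t by (intro up) simp
   moreover have "(norm e)^2 = g0 \<bullet> e - g \<bullet> e" unfolding power2_norm_eq_inner by (simp add: e_def inner_diff_left)
   ultimately have "t * (norm e)^2 <= M' * (t * norm e)^2" using t(1) by (simp add: right_diff_distrib)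
   then have "t * (norm e)^2 * (1 - t * M') <= 0" by (simp add: power_mult_distrib algebra_simps power2_eq_square)
   moreover have "t * (norm e)^2 * (1 - t * M') > 0" using t e by (intro mult_pos_pos) auto
   ultimately show False by linarith
  qed
  have sg: "isub z g" using ex[of z] uniq by blast
  \<comment> \<open>From \<open>z + k\<close> one moves by \<open>norm k\<close> in the direction of
    \<open>g' - g\<close>. The end point is within \<open>2 * norm k\<close> of \<open>z\<close>,
    and the square of this 2 is the factor 4.\<close>
  have gl: "norm (g' - g) <= 4 * M' * norm k" if k: "norm k < \<delta> / 2" and g': "isub (z + k) g'" for k g'
  proof (cases "g' = g")
   case False
   define e where "e = g' - g"
   have e: "norm e > 0" using False by (simp add: e_def)
   define l where "l = (norm k / norm e) *\<^sub>R e"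
   have nl: "norm l = norm k" using e by (simp add: l_def)
   have nkl: "norm (k + l) <= 2 * norm k" using norm_triangle_ineq[of k l] nl by linarith
   have "h (z + (k + l)) >= h (z + k) + g' \<bullet> l" using g'[unfolded isub_def, rule_format, of "z + (k + l)"] by (simp add: algebra_simps)
   moreover have "h (z + k) >= h z + g \<bullet> k" using sg[unfolded isub_def, rule_format, of "z + k"] by simp
   moreover have "h (z + (k + l)) <= h z + g \<bullet> (k + l) + M' * (norm (k + l))^2" using nkl k by (intro up) simp
   ultimately have "e \<bullet> l <= M' * (norm (k + l))^2" by (simp add: e_def inner_diff_left inner_add_right)
   also have "... <= M' * (2 * norm k)^2" using nkl M' by (intro mult_left_mono power_mono) auto
   also have "e \<bullet> l = norm k * norm e" using e by (simp add: l_def power2_norm_eq_inner[symmetric] power2_eq_square)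
   finally have *: "norm k * norm e <= norm k * (4 * M' * norm k)" by (simp add: power2_eq_square algebra_simps)
   show ?thesis
   proof (cases "k = 0")
    case True
    then show ?thesis using uniq g' False by simp
   next
    case False
    then show ?thesis using * by (simp add: e_def)
   qed
  qed (use M' in simp)
  define \<zeta> where "\<zeta> = z + g"
  have Jz: "J \<zeta> = z" unfolding \<zeta>_def by (rule Jinv[OF sg])
  have "J differentiable (at \<zeta>)" using zZ Jz unfolding Z_def by blast
  then obtain D where D: "(J has_derivative D) (at \<zeta>)" unfolding differentiable_def by blast
  have linD: "linear D" using D has_derivative_linear by blast
  have Dest: "\<exists>d>0. \<forall>w. norm w < d --> norm (J (\<zeta> + w) - z - D w) <= e * norm w" if e0: "e > 0" for e
  proof -
   obtain d where d: "d > 0" "\<forall>y. norm (y - \<zeta>) < d --> norm (J y - J \<zeta> - D (y - \<zeta>)) <= e * norm (y - \<zeta>)"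
    using D e0 unfolding has_derivative_at_alt by blast
   have "norm (J (\<zeta> + w) - z - D w) <= e * norm w" if "norm w < d" for w
    using d(2)[rule_format, of "\<zeta> + w"] that Jz by simp
   then show ?thesis using d(1) by blast
  qed
  \<comment> \<open>If \<open>D v = 0\<close>, then \<open>J\<close> moves \<zeta> + w away from
    \<open>z\<close> by a \<open>k\<close> much smaller than \<open>w\<close>. But \<open>w\<close>
    is \<open>k\<close> plus a difference of subgradients, so \<open>gl\<close> bounds it by a fixed
    multiple of \<open>norm k\<close>.\<close>
  have "inj D" unfolding linear_injective_0[OF linD]
  proof (intro allI impI, rule ccontr)
   fix v assume v: "D v = 0" "v ~= 0"
   define e where "e = 1 / (2 * (4 * M' + 1))"
   have e: "e > 0" using M' by (simp add: e_def)
   obtain d where d: "d > 0" "\<forall>w. norm w < d --> norm (J (\<zeta> + w) - z - D w) <= e * norm w" using Dest[OF e] by blast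
   define t where "t = min (d / (2 * norm v)) (\<delta> / (4 * e * norm v))"
   have t: "t > 0" using d d0 v e by (simp add: t_def)
   define w where "w = t *\<^sub>R v"
   have w0: "norm w > 0" using t v by (simp add: w_def)
   have nw: "norm w = t * norm v" using t by (simp add: w_def)
   have "norm w <= d / (2 * norm v) * norm v" unfolding nw by (intro mult_right_mono) (auto simp: t_def)
   then have wd: "norm w < d" using d v by simp
   have "norm w <= \<delta> / (4 * e * norm v) * norm v" unfolding nw by (intro mult_right_mono) (auto simp: t_def)
   then have we: "e * norm w < \<delta> / 2" using e v d0 by (simp add: field_simps)
   define k where "k = J (\<zeta> + w) - z"
   have "D w = 0" using v linD by (simp add: w_def linear_scale)
   then have kn: "norm k <= e * norm w" using d(2)[rule_format, OF wd] by (simp add: k_def)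
   have "isub (z + k) (\<zeta> + w - (z + k))" using J[of "\<zeta> + w"] by (simp add: k_def)
   then have "norm (\<zeta> + w - (z + k) - g) <= 4 * M' * norm k" using kn we by (intro gl) auto
   moreover have "\<zeta> + w - (z + k) - g = w - k" by (simp add: \<zeta>_def)
   moreover have "norm w <= norm (w - k) + norm k" using norm_triangle_ineq[of "w - k" k] by simp
   ultimately have "norm w <= (4 * M' + 1) * norm k" by (simp add: algebra_simps)
   also have "... <= (4 * M' + 1) * (e * norm w)" using kn M' by (intro mult_left_mono) auto
   also have "... = norm w / 2"
   proof -
    have "(4 * M' + 1) * e = 1/2" using M' by (simp add: e_def field_simps)
    then show ?thesis by (simp add: mult.assoc[symmetric])
   qed
   finally show False using w0 by simp
  qed
  then obtain Di where Di: "linear Di" "Di \<circ> D = id" using linear_injective_left_inverse[OF linD] by blast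
  obtain BD where BD: "BD > 0" "\<And>x. norm (Di x) <= BD * norm x" using linear_bounded_pos[OF Di(1)] by blast
  define A where "A k = Di k - k" for k
  have linA: "linear A" unfolding A_def using Di(1) by (intro linear_compose_sub linear_id[unfolded id_def])
  \<comment> \<open>With \<open>w = k + (g' - g)\<close> one has
    \<open>J (\<zeta> + w) = z + k\<close>; applying the inverse of \<open>D\<close> expresses
    \<open>g' - g\<close> through \<open>k\<close>.\<close>
  have gradexp: "\<exists>d>0. \<forall>k g'. norm k < d & isub (z + k) g' --> norm (g' - g - A k) <= \<epsilon> * norm k" if eps: "\<epsilon> > 0" for \<epsilon>
  proof -
   define C where "C = 1 + 4 * M'"
   have C: "C > 0" using M' by (simp add: C_def)
   obtain d where d: "d > 0" "\<forall>w. norm w < d --> norm (J (\<zeta> + w) - z - D w) <= \<epsilon> / (BD * C) * norm w"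
    using Dest[of "\<epsilon> / (BD * C)"] eps BD C by auto
   show ?thesis
   proof (intro exI[of _ "min (\<delta> / 2) (d / C)"] conjI allI impI)
    show "min (\<delta> / 2) (d / C) > 0" using d0 d C by simp
    fix k g' assume "norm k < min (\<delta> / 2) (d / C) & isub (z + k) g'"
    then have k: "norm k < \<delta> / 2" "norm k < d / C" and g': "isub (z + k) g'" by auto
    define w where "w = k + (g' - g)"
    have "norm w <= norm k + norm (g' - g)" unfolding w_def by (rule norm_triangle_ineq)
    then have w: "norm w <= C * norm k" using gl[OF k(1) g'] by (simp add: C_def algebra_simps)
    then have "norm w < d" using k(2) C by (simp add: field_simps)
    moreover have "J (\<zeta> + w) = z + k" using Jinv[OF g'] by (simp add: w_def \<zeta>_def algebra_simps)
    ultimately have "norm (k - D w) <= \<epsilon> / (BD * C) * norm w" using d(2) by fastforce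
    also have "... <= \<epsilon> / (BD * C) * (C * norm k)" using w eps BD C by (intro mult_left_mono) auto
    also have "... = \<epsilon> / BD * norm k" using C by simp
    finally have *: "norm (k - D w) <= \<epsilon> / BD * norm k" .
    have "Di (k - D w) = Di k - w" using Di by (simp add: linear_diff o_def fun_eq_iff)
    moreover have "g' - g - A k = - (Di k - w)" by (simp add: A_def w_def)
    ultimately have "norm (g' - g - A k) = norm (Di (k - D w))" by (simp only: norm_minus_cancel)
    also have "... <= BD * norm (k - D w)" by (rule BD)
    also have "... <= BD * (\<epsilon> / BD * norm k)" using * BD by (intro mult_left_mono) auto
    also have "... = \<epsilon> * norm k" using BD by simp
    finally show "norm (g' - g - A k) <= \<epsilon> * norm k" .
   qed
  qed
  show "\<exists>A. linear A & (\<forall>\<epsilon>>0. \<exists>\<delta>>0. \<forall>k. norm k < \<delta> --> \<bar>h (z + k) - h z - g \<bullet> k - (k \<bullet> A k) / 2\<bar> <= \<epsilon> * (norm k)^2)"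
  proof (intro exI[of _ A] conjI linA allI impI)
   fix \<epsilon> :: real assume "\<epsilon> > 0"
   then obtain d where d: "d > 0" "\<forall>k g'. norm k < d & isub (z + k) g' --> norm (g' - g - A k) <= \<epsilon> * norm k" using gradexp by blast
   show "\<exists>\<delta>>0. \<forall>k. norm k < \<delta> --> \<bar>h (z + k) - h z - g \<bullet> k - (k \<bullet> A k) / 2\<bar> <= \<epsilon> * (norm k)^2"
   proof (intro exI[of _ d] conjI allI impI d(1))
    fix k :: 'a assume k: "norm k < d"
    define \<kappa> where "\<kappa> = k \<bullet> A k"
    \<comment> \<open>The error of the second order expansion along the segment;
      \<open>gradexp\<close> controls its increments.\<close>
    define \<Psi> where "\<Psi> s = h (z + s *\<^sub>R k) - h z - s * (g \<bullet> k) - s^2 / 2 * \<kappa>" for s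
    have "\<bar>\<Psi> 1 - \<Psi> 0\<bar> <= \<epsilon> * (norm k)^2"
    proof (rule partition_lipschitz_bound[of _ "\<bar>\<kappa>\<bar> / 2"])
     show "0 <= \<epsilon> * (norm k)^2" using \<open>\<epsilon> > 0\<close> by simp
     fix s s' :: real assume s: "0 <= s" "s <= 1" "0 <= s'" "s' <= 1"
     obtain g' where g': "isub (z + s *\<^sub>R k) g'" using ex by blast
     have "norm (s *\<^sub>R k) <= 1 * norm k" unfolding norm_scaleR using s by (intro mult_right_mono) auto
     then have "norm (g' - g - A (s *\<^sub>R k)) <= \<epsilon> * norm (s *\<^sub>R k)" using d(2)[rule_format, of "s *\<^sub>R k" g'] g' k by auto
     also have "... <= \<epsilon> * norm k" using \<open>\<epsilon> > 0\<close> \<open>norm (s *\<^sub>R k) <= 1 * norm k\<close> by (intro mult_left_mono) auto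
     finally have 1: "norm (g' - g - s *\<^sub>R A k) <= \<epsilon> * norm k" using linA by (simp add: linear_scale)
     have 2: "\<bar>(g' - g) \<bullet> k - s * \<kappa>\<bar> <= \<epsilon> * (norm k)^2"
     proof -
      have "(g' - g) \<bullet> k - s * \<kappa> = (g' - g - s *\<^sub>R A k) \<bullet> k" by (simp add: \<kappa>_def inner_diff_left inner_commute[of "A k" k])
      also have "\<bar>...\<bar> <= norm (g' - g - s *\<^sub>R A k) * norm k" by (rule Cauchy_Schwarz_ineq2)
      also have "... <= \<epsilon> * norm k * norm k" using 1 by (intro mult_right_mono) auto
      finally show ?thesis by (simp add: power2_eq_square mult.assoc)
     qed
     have 3: "h (z + s' *\<^sub>R k) >= h (z + s *\<^sub>R k) + (s' - s) * (g' \<bullet> k)"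
     proof -
      have "(z + s' *\<^sub>R k) - (z + s *\<^sub>R k) = (s' - s) *\<^sub>R k" by (simp add: algebra_simps)
      then show ?thesis using g'[unfolded isub_def, rule_format, of "z + s' *\<^sub>R k"] by simp
     qed
     have 4: "(s' - s) * ((g' - g) \<bullet> k - s * \<kappa>) >= - (\<bar>s' - s\<bar> * (\<epsilon> * (norm k)^2))"
     proof -
      have "\<bar>(s' - s) * ((g' - g) \<bullet> k - s * \<kappa>)\<bar> <= \<bar>s' - s\<bar> * (\<epsilon> * (norm k)^2)"
       unfolding abs_mult using 2 by (intro mult_left_mono) auto
      then show ?thesis by linarith
     qed
     have 5: "(s' - s)^2 * \<kappa> / 2 <= (s' - s)^2 * (\<bar>\<kappa>\<bar> / 2)" by (simp add: mult_left_mono)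
     have "\<Psi> s' - \<Psi> s = h (z + s' *\<^sub>R k) - h (z + s *\<^sub>R k) - (s' - s) * (g \<bullet> k) - (s'^2 - s^2) / 2 * \<kappa>"
      by (simp add: \<Psi>_def algebra_simps diff_divide_distrib)
     also have "... >= (s' - s) * (g' \<bullet> k) - (s' - s) * (g \<bullet> k) - (s'^2 - s^2) / 2 * \<kappa>" using 3 by simp
     also have "(s' - s) * (g' \<bullet> k) - (s' - s) * (g \<bullet> k) - (s'^2 - s^2) / 2 * \<kappa> = (s' - s) * ((g' - g) \<bullet> k - s * \<kappa>) - (s' - s)^2 * \<kappa> / 2"
      by (simp add: inner_diff_left power2_eq_square field_simps)
     finally show "\<Psi> s' - \<Psi> s >= - (\<bar>s' - s\<bar> * (\<epsilon> * (norm k)^2)) - (s' - s)^2 * (\<bar>\<kappa>\<bar> / 2)" using 4 5 by linarith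
    qed simp
    then show "\<bar>h (z + k) - h z - g \<bullet> k - (k \<bullet> A k) / 2\<bar> <= \<epsilon> * (norm k)^2" by (simp add: \<Psi>_def \<kappa>_def)
   qed
  qed
 qed
qed

text \<open>The function \<open>S\<close> is the sup-convolution of \<open>\<phi>\<close> over a ball; \<open>e * S + norm^2 / 2\<close> is a
 supremum of affine functions whose slopes are the maximisers \<open>Y\<close>.\<close>

lemma sup_convolution:
 fixes \<phi> :: "'a::euclidean_space => real"
 assumes cont: "continuous_on (cball 0 \<rho>) \<phi>" and rho: "\<rho> > 0" and e: "e > 0"
 obtains S Y Z where "negligible Z" "continuous_on UNIV S" "\<And>z. Y z \<in> cball 0 \<rho>"
  "\<And>z. S z = \<phi> (Y z) - (norm (z - Y z))^2 / (2 * e)"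
  "\<And>z y. y \<in> cball 0 \<rho> ==> \<phi> y - (norm (z - y))^2 / (2 * e) <= S z"
  "\<And>z k. S (z + k) >= S z + ((1/e) *\<^sub>R (Y z - z)) \<bullet> k - (norm k)^2 / (2 * e)"
  "\<And>z g M \<delta>. z \<notin> Z ==> \<delta> > 0 ==> (\<And>k. norm k < \<delta> ==> S (z + k) <= S z + g \<bullet> k + M * (norm k)^2) ==>
   \<exists>A. linear A & (\<forall>\<epsilon>>0. \<exists>\<delta>>0. \<forall>k. norm k < \<delta> -->
    \<bar>S (z + k) - S z - g \<bullet> k - (k \<bullet> A k) / 2\<bar> <= \<epsilon> * (norm k)^2)"
proof -
 have "\<exists>y\<in>cball 0 \<rho>. \<forall>y'\<in>cball 0 \<rho>. \<phi> y' - (norm (z - y'))^2 / (2 * e) <= \<phi> y - (norm (z - y))^2 / (2 * e)" for z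
  by (rule continuous_attains_sup) (use rho e in \<open>auto intro!: continuous_intros cont\<close>)
 then obtain Y where Y: "\<And>z. Y z \<in> cball 0 \<rho>"
  "\<And>z y. y \<in> cball 0 \<rho> ==> \<phi> y - (norm (z - y))^2 / (2 * e) <= \<phi> (Y z) - (norm (z - Y z))^2 / (2 * e)" by metis
 define S where "S z = \<phi> (Y z) - (norm (z - Y z))^2 / (2 * e)" for z
 define h where "h z = e * S z + (norm z)^2 / 2" for z
 have Sh: "S z = (h z - (norm z)^2 / 2) / e" for z using e by (simp add: h_def)
 have haff: "h z >= e * \<phi> y + z \<bullet> y - (norm y)^2 / 2" if "y \<in> cball 0 \<rho>" for z y
 proof -
  have "e * S z >= e * (\<phi> y - (norm (z - y))^2 / (2 * e))" using Y(2)[OF that, of z] e unfolding S_def by (intro mult_left_mono) auto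
  also have "e * (\<phi> y - (norm (z - y))^2 / (2 * e)) = e * \<phi> y - (norm (z - y))^2 / 2" using e by (simp add: field_simps)
  also have "(norm (z - y))^2 = (norm z)^2 - 2 * (z \<bullet> y) + (norm y)^2"
   unfolding power2_norm_eq_inner by (simp add: inner_diff_left inner_diff_right inner_commute)
  finally show ?thesis by (simp add: h_def field_simps)
 qed
 have heq: "h z = e * \<phi> (Y z) + z \<bullet> Y z - (norm (Y z))^2 / 2" for z
 proof -
  have "(norm (z - Y z))^2 = (norm z)^2 - 2 * (z \<bullet> Y z) + (norm (Y z))^2"
   unfolding power2_norm_eq_inner by (simp add: inner_diff_left inner_diff_right inner_commute)
  moreover have "e * S z = e * \<phi> (Y z) - (norm (z - Y z))^2 / 2" using e by (simp add: S_def right_diff_distrib)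
  ultimately show ?thesis unfolding h_def by argo
 qed
 have sub: "h z' >= h z + Y z \<bullet> (z' - z)" for z z'
  using haff[OF Y(1)[of z], of z'] heq[of z] by (simp add: inner_diff_right inner_commute)
 have conth: "continuous_on UNIV h"
 proof (rule lipschitz_on_continuous_on[of \<rho>], rule lipschitz_onI)
  fix x y
  have 1: "\<bar>Y a \<bullet> (b - a)\<bar> <= \<rho> * norm (b - a)" for a b
   using Cauchy_Schwarz_ineq2[of "Y a" "b - a"] mult_right_mono[of "norm (Y a)" \<rho> "norm (b - a)"] Y(1)[of a] by auto
  show "dist (h x) (h y) <= \<rho> * dist x y"
   using sub[of x y] sub[of y x] 1[of x y] 1[of y x] by (simp add: dist_norm norm_minus_commute abs_le_iff)
 qed (use rho in auto)
 have sub': "\<exists>g. norm g <= \<rho> & (\<forall>z'. h z' >= h z + g \<bullet> (z' - z))" for z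
  using Y(1)[of z] sub[of z] by (intro exI[of _ "Y z"]) auto
 obtain Z where Z: "negligible Z" "\<forall>z g M \<delta>. z \<notin> Z --> \<delta> > 0 --> (\<forall>k. norm k < \<delta> --> h (z + k) <= h z + g \<bullet> k + M * (norm k)^2) -->
   (\<exists>A. linear A & (\<forall>\<epsilon>>0. \<exists>\<delta>>0. \<forall>k. norm k < \<delta> -->
    \<bar>h (z + k) - h z - g \<bullet> k - (k \<bullet> A k) / 2\<bar> <= \<epsilon> * (norm k)^2))"
  using alexandrov_at_touched_points[OF sub'] by (elim exE conjE)
 have nk: "(norm (z + k))^2 = (norm z)^2 + 2 * (z \<bullet> k) + (norm k)^2" for z k :: 'a
  unfolding power2_norm_eq_inner by (simp add: inner_add_left inner_add_right inner_commute)
 show thesis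
 proof
  show "negligible Z" by fact
  show "continuous_on UNIV S" unfolding Sh using e by (intro continuous_intros conth) auto
  show "Y z \<in> cball 0 \<rho>" for z by (rule Y)
  show "S z = \<phi> (Y z) - (norm (z - Y z))^2 / (2 * e)" for z by (rule S_def)
  show "\<phi> y - (norm (z - y))^2 / (2 * e) <= S z" if "y \<in> cball 0 \<rho>" for z y using Y(2)[OF that] by (simp add: S_def)
  show "S (z + k) >= S z + ((1/e) *\<^sub>R (Y z - z)) \<bullet> k - (norm k)^2 / (2 * e)" for z k
  proof -
   have "h (z + k) >= h z + Y z \<bullet> k" using sub[of z "z + k"] by simp
   then have "0 <= (h (z + k) - h z - Y z \<bullet> k) / e" using e by simp
   also have "... = S (z + k) - (S z + ((1/e) *\<^sub>R (Y z - z)) \<bullet> k - (norm k)^2 / (2 * e))"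
    unfolding Sh nk using e by (simp add: field_simps inner_diff_left)
   finally show ?thesis by simp
  qed
  fix z g M \<delta> assume z: "z \<notin> Z" "(\<delta>::real) > 0" and up: "\<And>k. norm k < \<delta> ==> S (z + k) <= S z + g \<bullet> k + M * (norm k)^2"
  have "h (z + k) <= h z + (e *\<^sub>R g + z) \<bullet> k + (e * M + 1/2) * (norm k)^2" if "norm k < \<delta>" for k
   using mult_left_mono[OF up[OF that], of e] e unfolding h_def nk by (simp add: field_simps inner_add_left)
  then have "\<forall>k. norm k < \<delta> --> h (z + k) <= h z + (e *\<^sub>R g + z) \<bullet> k + (e * M + 1/2) * (norm k)^2" by blast
  from Z(2)[rule_format, OF z this[rule_format]] obtain A where A: "linear A" "\<And>\<epsilon>. \<epsilon> > 0 ==> \<exists>\<delta>>0. \<forall>k. norm k < \<delta> -->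
   \<bar>h (z + k) - h z - (e *\<^sub>R g + z) \<bullet> k - (k \<bullet> A k) / 2\<bar> <= \<epsilon> * (norm k)^2" by blast
  define A' where "A' k = (1/e) *\<^sub>R (A k - k)" for k
  have linA': "linear A'" unfolding A'_def using A(1)
   by (intro linear_compose_scale_right linear_compose_sub linear_id[unfolded id_def])
  have eq: "S (z + k) - S z - g \<bullet> k - (k \<bullet> A' k) / 2 = (h (z + k) - h z - (e *\<^sub>R g + z) \<bullet> k - (k \<bullet> A k) / 2) / e" for k
   unfolding Sh nk A'_def using e by (simp add: field_simps inner_add_left inner_diff_right power2_norm_eq_inner)
  show "\<exists>A. linear A & (\<forall>\<epsilon>>0. \<exists>\<delta>>0. \<forall>k. norm k < \<delta> --> \<bar>S (z + k) - S z - g \<bullet> k - (k \<bullet> A k) / 2\<bar> <= \<epsilon> * (norm k)^2)"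
  proof (intro exI[of _ A'] conjI linA' allI impI)
   fix \<epsilon> :: real assume "\<epsilon> > 0"
   then obtain d where d: "d > 0" "\<forall>k. norm k < d --> \<bar>h (z + k) - h z - (e *\<^sub>R g + z) \<bullet> k - (k \<bullet> A k) / 2\<bar> <= (\<epsilon> * e) * (norm k)^2"
    using A(2)[of "\<epsilon> * e"] e by auto
   show "\<exists>\<delta>>0. \<forall>k. norm k < \<delta> --> \<bar>S (z + k) - S z - g \<bullet> k - (k \<bullet> A' k) / 2\<bar> <= \<epsilon> * (norm k)^2"
   proof (intro exI[of _ d] conjI d(1) allI impI)
    fix k :: 'a assume "norm k < d"
    then show "\<bar>S (z + k) - S z - g \<bullet> k - (k \<bullet> A' k) / 2\<bar> <= \<epsilon> * (norm k)^2"
     using d(2)[rule_format, of k] e unfolding eq by (simp add: abs_divide divide_le_eq mult_ac)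
   qed
  qed
 qed
qed

lemma negligible_Times_UNIV:
 fixes Z :: "'a::euclidean_space set"
 assumes "negligible Z"
 shows "negligible (Z \<times> (UNIV :: 'b::euclidean_space set))" "negligible ((UNIV :: 'b set) \<times> Z)"
proof -
 obtain N where N: "N \<in> null_sets lborel" "Z \<subseteq> N"
  using assms unfolding negligible_iff_null_sets by (auto elim: null_sets_completion_iff2[THEN iffD1, elim_format])
 have 1: "N \<times> (UNIV :: 'b set) \<in> null_sets (lborel \<Otimes>\<^sub>M lborel)"
  using N(1) by (intro lborel.times_in_null_sets1) auto
 have 2: "(UNIV :: 'b set) \<times> N \<in> null_sets (lborel \<Otimes>\<^sub>M lborel)"
  using N(1) by (intro lborel.times_in_null_sets2) auto
 have "negligible (N \<times> (UNIV :: 'b set))" "negligible ((UNIV :: 'b set) \<times> N)"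
  using 1 2 unfolding lborel_prod negligible_iff_null_sets by (auto intro: null_sets_completionI)
 then show "negligible (Z \<times> (UNIV :: 'b::euclidean_space set))" "negligible ((UNIV :: 'b set) \<times> Z)"
  using N(2) by (auto elim!: negligible_subset)
qed

text \<open>The theorem on sums in approximate form: instead of limiting jets there are expansions
  with error \<epsilon> at points near 0. After sup-convolution the function \<open>f\<close> is
  semiconvex. The set \<open>K\<close> of points where an affine function of small slope touches
  \<open>f\<close> from above is mapped by the slope onto a whole ball, and the slope is locally
  Lipschitz on \<open>K\<close>. So \<open>K\<close> is not null and contains a point at which both
  sup-convolutions have second order expansions.\<close>

lemma ishii_lemma_at_origin:
 fixes u v :: "'a::euclidean_space => real" and T :: "'a \<times> 'a => 'a \<times> 'a"
 assumes rho: "\<rho> > 0" and cu: "continuous_on (cball 0 \<rho>) u" and cv: "continuous_on (cball 0 \<rho>) v"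
  and u0: "u 0 = 0" and v0: "v 0 = 0"
  and linT: "linear T" and symT: "\<And>x y. T x \<bullet> y = x \<bullet> T y"
  and max: "\<And>k l. norm k <= \<rho> ==> norm l <= \<rho> ==> u k - v l <= (k, l) \<bullet> T (k, l)"
  and eps: "\<epsilon> > 0"
 obtains a b p q A B \<delta> where "norm a < \<epsilon>" "norm b < \<epsilon>" "norm p < \<epsilon>" "norm q < \<epsilon>" "linear A" "linear B" "\<delta> > 0"
  "\<And>k. norm k < \<delta> ==> u (a + k) <= u a + p \<bullet> k + (k \<bullet> A k) / 2 + \<epsilon> * (norm k)^2"
  "\<And>k. norm k < \<delta> ==> v (b + k) >= v b + q \<bullet> k + (k \<bullet> B k) / 2 - \<epsilon> * (norm k)^2"
  "\<And>k l. (k \<bullet> A k) / 2 - (l \<bullet> B l) / 2 <= (k, l) \<bullet> T (k, l) + \<epsilon> * ((norm k)^2 + (norm l)^2)"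
proof -
 obtain b where b: "b > 0" "\<And>x. norm (T x) <= b * norm x" using linear_bounded_pos[OF linT] by blast
 have Bup: "\<bar>x \<bullet> T y\<bar> <= b * norm x * norm y" for x y
  using Cauchy_Schwarz_ineq2[of x "T y"] mult_left_mono[OF b(2)[of y], of "norm x"] by (simp add: mult_ac)
 have Bexp: "(z + k) \<bullet> T (z + k) = z \<bullet> T z + 2 * (T z \<bullet> k) + k \<bullet> T k" for z k
  using symT[of z k] by (simp add: linear_add[OF linT] inner_add_left inner_add_right inner_commute)
 obtain M1 where M1: "\<forall>y\<in>cball 0 \<rho>. \<bar>u y\<bar> <= M1"
  using compact_imp_bounded[OF compact_continuous_image[OF cu compact_cball]] unfolding bounded_iff by auto
 obtain M2 where M2: "\<forall>y\<in>cball 0 \<rho>. \<bar>v y\<bar> <= M2"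
  using compact_imp_bounded[OF compact_continuous_image[OF cv compact_cball]] unfolding bounded_iff by auto
 define M where "M = max 1 (max M1 M2)"
 have M: "M > 0" "\<And>y. y \<in> cball 0 \<rho> ==> \<bar>u y\<bar> <= M" "\<And>y. y \<in> cball 0 \<rho> ==> \<bar>v y\<bar> <= M"
  using M1 M2 by (fastforce simp: M_def)+
 define \<sigma> where "\<sigma> = \<epsilon> / 2"
 define r where "r = min (\<rho> / 4) (min (\<epsilon> / 4) (\<epsilon> / (8 * (b + \<sigma> + 1))))"
 have sig: "\<sigma> > 0" using eps by (simp add: \<sigma>_def)
 have r: "r > 0" "r <= \<rho> / 4" "r <= \<epsilon> / 4"
  using rho eps b(1) sig by (simp_all add: r_def min.coboundedI1 min.coboundedI2 add_pos_pos del: distrib_left_numeral min_less_iff_disj)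
 have r4: "(2 * b + 2 * \<sigma>) * r <= \<epsilon> / 4"
 proof -
  have "(2 * b + 2 * \<sigma>) * r <= (2 * (b + \<sigma> + 1)) * (\<epsilon> / (8 * (b + \<sigma> + 1)))"
   using b sig r(1) by (intro mult_mono) (auto simp: r_def)
  also have "... = \<epsilon> / 4"
  proof -
   have "b + \<sigma> + 1 ~= 0" using b sig by linarith
   then show ?thesis by (simp add: divide_simps)
  qed
  finally show ?thesis .
 qed
 define \<delta> where "\<delta> = min (\<epsilon> / 4) (\<sigma> * r / 4)"
 have del: "\<delta> > 0" "\<delta> <= \<epsilon> / 4" "\<delta> <= \<sigma> * r / 4" using eps sig r(1) by (simp_all add: \<delta>_def)
 \<comment> \<open>With these bounds the errors \<open>8 * b * \<rho> * d\<close> and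
   \<open>\<delta> * r\<close> together stay below \<open>\<sigma> * r^2\<close>, which keeps the
   maxima of the tilted \<open>f\<close> off the sphere of radius \<open>r\<close>.\<close>
 define d where "d = min (\<rho> / 4) (min (\<epsilon> / 4) (\<sigma> * r^2 / (16 * b * \<rho>)))"
 have d: "d > 0" "d <= \<rho> / 4" "d <= \<epsilon> / 4" "d <= \<sigma> * r^2 / (16 * b * \<rho>)" using rho eps sig r(1) b(1) by (simp_all add: d_def min.coboundedI1 min.coboundedI2)
 \<comment> \<open>Since the values vary by at most \<open>2 * M\<close>, a maximiser in the
   sup-convolution lies within \<open>sqrt (4 * M * e) = d\<close> of its centre.\<close>
 define e where "e = d^2 / (4 * M)"
 have e: "e > 0" "4 * M * e = d^2" using d M by (auto simp: e_def)
 obtain S1 Y1 Z1 where S1: "negligible Z1" "continuous_on UNIV S1" "\<And>z. Y1 z \<in> cball 0 \<rho>"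
  "\<And>z. S1 z = u (Y1 z) - (norm (z - Y1 z))^2 / (2 * e)"
  "\<And>z y. y \<in> cball 0 \<rho> ==> u y - (norm (z - y))^2 / (2 * e) <= S1 z"
  "\<And>z k. S1 (z + k) >= S1 z + ((1/e) *\<^sub>R (Y1 z - z)) \<bullet> k - (norm k)^2 / (2 * e)"
  "\<And>z g M \<delta>. z \<notin> Z1 ==> \<delta> > 0 ==> (\<And>k. norm k < \<delta> ==> S1 (z + k) <= S1 z + g \<bullet> k + M * (norm k)^2) ==>
   \<exists>A. linear A & (\<forall>\<epsilon>>0. \<exists>\<delta>>0. \<forall>k. norm k < \<delta> -->
    \<bar>S1 (z + k) - S1 z - g \<bullet> k - (k \<bullet> A k) / 2\<bar> <= \<epsilon> * (norm k)^2)"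
  using sup_convolution[OF cu rho e(1)] by metis
 have cv': "continuous_on (cball 0 \<rho>) (%z. - v z)" by (intro continuous_intros cv)
 obtain S2 Y2 Z2 where S2: "negligible Z2" "continuous_on UNIV S2" "\<And>z. Y2 z \<in> cball 0 \<rho>"
  "\<And>z. S2 z = - v (Y2 z) - (norm (z - Y2 z))^2 / (2 * e)"
  "\<And>z y. y \<in> cball 0 \<rho> ==> - v y - (norm (z - y))^2 / (2 * e) <= S2 z"
  "\<And>z k. S2 (z + k) >= S2 z + ((1/e) *\<^sub>R (Y2 z - z)) \<bullet> k - (norm k)^2 / (2 * e)"
  "\<And>z g M \<delta>. z \<notin> Z2 ==> \<delta> > 0 ==> (\<And>k. norm k < \<delta> ==> S2 (z + k) <= S2 z + g \<bullet> k + M * (norm k)^2) ==>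
   \<exists>A. linear A & (\<forall>\<epsilon>>0. \<exists>\<delta>>0. \<forall>k. norm k < \<delta> -->
    \<bar>S2 (z + k) - S2 z - g \<bullet> k - (k \<bullet> A k) / 2\<bar> <= \<epsilon> * (norm k)^2)"
  using sup_convolution[OF cv' rho e(1)] by metis
 have close: "norm (z - y) <= d" if "\<bar>w y\<bar> <= M" "\<bar>w z\<bar> <= M" "w z <= w y - (norm (z - y))^2 / (2 * e)" for w :: "'a => real" and z y
 proof -
  have "(norm (z - y))^2 / (2 * e) <= 2 * M" using that by linarith
  then have "(norm (z - y))^2 <= d^2" using e by (simp add: divide_le_eq mult_ac)
  then show ?thesis using d(1) power2_le_imp_le by (metis less_imp_le)
 qed
 have near1: "norm (z - Y1 z) <= d" if "z \<in> cball 0 \<rho>" for z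
  using close[of u "Y1 z" z] M(2)[OF that] M(2)[OF S1(3)[of z]] S1(5)[OF that, of z] S1(4)[of z] by simp
 have near2: "norm (z - Y2 z) <= d" if "z \<in> cball 0 \<rho>" for z
  using close[of "%z. - v z" "Y2 z" z] M(3)[OF that] M(3)[OF S2(3)[of z]] S2(5)[OF that, of z] S2(4)[of z] by simp
 define f where "f z = S1 (fst z) + S2 (snd z) - z \<bullet> T z - \<sigma> * (norm z)^2" for z
 have contf: "continuous_on UNIV f" unfolding f_def
  by (intro continuous_intros continuous_on_compose2[OF S1(2)] continuous_on_compose2[OF S2(2)] linear_continuous_on linear_conv_bounded_linear[THEN iffD1, OF linT]) auto
 have f0: "f 0 >= 0" using S1(5)[of 0 0] S2(5)[of 0 0] rho by (simp add: f_def u0 v0 linear_0[OF linT])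
 \<comment> \<open>The maximum inequality survives sup-convolution up to the effect of shifting both
   arguments by at most \<open>d\<close>.\<close>
 have fub: "f z <= 8 * b * \<rho> * d - \<sigma> * (norm z)^2" if z: "norm z <= r" for z
 proof -
  have zz: "fst z \<in> cball 0 \<rho>" "snd z \<in> cball 0 \<rho>" using z r norm_fst_le[of "fst z" "snd z"] norm_snd_le[of "snd z" "fst z"] by auto
  define y where "y = (Y1 (fst z), Y2 (snd z))"
  define w where "w = y - z"
  have nw: "norm w <= 2 * d"
  proof -
   have "norm w <= norm (fst w) + norm (snd w)" by (metis norm_Pair_le prod.collapse)
   then show ?thesis using near1[OF zz(1)] near2[OF zz(2)] by (simp add: w_def y_def norm_minus_commute)
  qed
  have "S1 (fst z) + S2 (snd z) <= u (Y1 (fst z)) - v (Y2 (snd z))"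
  proof -
   have "0 <= (norm x)^2 / (2 * e)" for x :: 'a using e(1) by simp
   from this[of "fst z - Y1 (fst z)"] this[of "snd z - Y2 (snd z)"] show ?thesis
    using S1(4)[of "fst z"] S2(4)[of "snd z"] by linarith
  qed
  also have "... <= y \<bullet> T y" unfolding y_def using S1(3) S2(3) by (intro max) auto
  also have "y = z + w" by (simp add: w_def)
  also have "(z + w) \<bullet> T (z + w) = z \<bullet> T z + 2 * (T z \<bullet> w) + w \<bullet> T w" by (rule Bexp)
  finally have 1: "f z <= 2 * (T z \<bullet> w) + w \<bullet> T w - \<sigma> * (norm z)^2" by (simp add: f_def)
  have "\<bar>w \<bullet> T z\<bar> <= b * (2 * d) * \<rho>"
   by (rule order_trans[OF Bup mult_mono[OF mult_left_mono[OF nw]]]) (use z r(2) b(1) rho d(1) in auto)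
  moreover have "\<bar>w \<bullet> T w\<bar> <= b * (2 * d) * (2 * d)"
   by (rule order_trans[OF Bup mult_mono[OF mult_left_mono[OF nw]]]) (use nw b(1) d(1) in auto)
  moreover have "b * (2 * d) * (2 * d) <= b * (2 * d) * \<rho>" using d b rho by (intro mult_left_mono) auto
  moreover have "8 * b * \<rho> * d = 4 * (b * (2 * d) * \<rho>)" "0 <= b * (2 * d) * \<rho>" using b(1) d(1) rho by auto
  ultimately show ?thesis using 1 inner_commute[of "T z" w] by linarith
 qed
 define K where "K = {z. norm z < r & (\<exists>p. norm p < \<delta> & (\<forall>z'. norm z' <= r --> f z' - p \<bullet> z' <= f z - p \<bullet> z))}"
 define c where "c = 1 / (2 * e) + b + \<sigma>"
 have c: "c > 0" using e b sig by (simp add: c_def add_pos_pos)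
 \<comment> \<open>The slope of a lower supporting paraboloid of \<open>f\<close> at
   \<open>z\<close>, read off from the maximisers. An affine function touching \<open>f\<close> from
   above at an interior point must have this slope.\<close>
 define G where "G z = ((1/e) *\<^sub>R (Y1 (fst z) - fst z), (1/e) *\<^sub>R (Y2 (snd z) - snd z)) - 2 *\<^sub>R T z - (2 * \<sigma>) *\<^sub>R z" for z
 have nexp: "(norm (z + k))^2 = (norm z)^2 + 2 * (z \<bullet> k) + (norm k)^2" for z k :: "'a \<times> 'a"
  unfolding power2_norm_eq_inner by (simp add: inner_add_left inner_add_right inner_commute)
 have npair: "(norm k)^2 = (norm (fst k))^2 + (norm (snd k))^2" for k :: "'a \<times> 'a" by (simp add: norm_prod_def)
 have flow: "f (z + k) >= f z + G z \<bullet> k - c * (norm k)^2" for z k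
 proof -
  have "k \<bullet> T k <= b * (norm k)^2" using Bup[of k k] by (simp add: power2_eq_square mult_ac)
  moreover have "G z \<bullet> k = ((1/e) *\<^sub>R (Y1 (fst z) - fst z)) \<bullet> fst k + ((1/e) *\<^sub>R (Y2 (snd z) - snd z)) \<bullet> snd k - 2 * (T z \<bullet> k) - 2 * \<sigma> * (z \<bullet> k)"
   by (simp only: G_def inner_diff_left inner_scaleR_left inner_prod_def[of "(_, _)"] fst_conv snd_conv)
  moreover have "c * (norm k)^2 = (norm (fst k))^2 / (2 * e) + (norm (snd k))^2 / (2 * e) + b * (norm k)^2 + \<sigma> * (norm k)^2"
   by (simp add: c_def npair[of k] algebra_simps add_divide_distrib)
  ultimately show ?thesis using S1(6)[of "fst z" "fst k"] S2(6)[of "snd z" "snd k"]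
   unfolding f_def fst_add snd_add Bexp nexp by (simp add: algebra_simps)
 qed
 have KG: "norm p < \<delta> ==> (\<And>z'. norm z' <= r ==> f z' - p \<bullet> z' <= f z - p \<bullet> z) ==> norm z < r ==> G z = p" for p z
 proof (rule ccontr)
  assume mx: "\<And>z'. norm z' <= r ==> f z' - p \<bullet> z' <= f z - p \<bullet> z" and zr: "norm z < r" and ne: "G z ~= p"
  define w where "w = G z - p"
  have w: "norm w > 0" using ne by (simp add: w_def)
  define t where "t = min ((r - norm z) / norm w) (1 / (2 * c))"
  have t: "t > 0" using zr w c by (simp add: t_def)
  have "t * norm w <= (r - norm z) / norm w * norm w" by (intro mult_right_mono) (auto simp: t_def)
  then have "norm (t *\<^sub>R w) <= r - norm z" using w t by simp
  then have "norm (z + t *\<^sub>R w) <= r" using norm_triangle_ineq[of z "t *\<^sub>R w"] by linarith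
  from mx[OF this] flow[of z "t *\<^sub>R w"] have "G z \<bullet> (t *\<^sub>R w) - p \<bullet> (t *\<^sub>R w) <= c * (norm (t *\<^sub>R w))^2" by (simp add: inner_add_right)
  then have "t * (norm w)^2 <= c * (t * norm w)^2" using t by (simp add: w_def power2_norm_eq_inner inner_diff_left right_diff_distrib[symmetric])
  then have "t * (norm w)^2 * (1 - c * t) <= 0" by (simp add: power_mult_distrib algebra_simps power2_eq_square)
  moreover have "c * t <= c * (1 / (2 * c))" using c by (intro mult_left_mono) (auto simp: t_def)
  then have "1 - c * t > 0" using c by simp
  then have "t * (norm w)^2 * (1 - c * t) > 0" using t w by (intro mult_pos_pos) auto
  ultimately show False by linarith
 qed
 have Kp: "norm (G z) < \<delta> & norm z < r & (\<forall>z'. norm z' <= r --> f z' - G z \<bullet> z' <= f z - G z \<bullet> z)" if zK: "z \<in> K" for z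
 proof -
  obtain p where p: "norm z < r" "norm p < \<delta>" "\<And>z'. norm z' <= r ==> f z' - p \<bullet> z' <= f z - p \<bullet> z" using zK unfolding K_def by blast
  have "G z = p" using p by (intro KG) auto
  then show ?thesis using p by auto
 qed
 have surj: "ball 0 \<delta> \<subseteq> G ` K"
 proof
  fix p :: "'a \<times> 'a" assume "p \<in> ball 0 \<delta>"
  then have p: "norm p < \<delta>" by simp
  have "\<exists>z\<in>cball 0 r. \<forall>z'\<in>cball 0 r. f z' - p \<bullet> z' <= f z - p \<bullet> z"
   by (rule continuous_attains_sup) (use r in \<open>auto intro!: continuous_intros continuous_on_subset[OF contf]\<close>)
  then obtain z where z': "z \<in> cball 0 r" "\<forall>z'\<in>cball 0 r. f z' - p \<bullet> z' <= f z - p \<bullet> z" by blast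
  have z: "norm z <= r" "\<And>z'. norm z' <= r ==> f z' - p \<bullet> z' <= f z - p \<bullet> z"
   using z'(1) z'(2)[rule_format, unfolded mem_cball_0] by auto
  have "0 <= f z - p \<bullet> z" using z(2)[of 0] f0 r by simp
  moreover have "\<bar>p \<bullet> z\<bar> <= \<delta> * r" by (rule order_trans[OF Cauchy_Schwarz_ineq2 mult_mono]) (use p z(1) del(1) in auto)
  ultimately have "\<sigma> * (norm z)^2 <= 8 * b * \<rho> * d + \<delta> * r" using fub[OF z(1)] by linarith
  moreover have "8 * b * \<rho> * d <= \<sigma> * r^2 / 2"
   using mult_left_mono[OF d(4), of "8 * b * \<rho>"] b(1) rho by (simp add: field_simps)
  moreover have "\<delta> * r <= \<sigma> * r^2 / 4" using mult_right_mono[OF del(3), of r] r by (simp add: power2_eq_square)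
  moreover have "0 < \<sigma> * r^2" using sig r by simp
  ultimately have "\<sigma> * (norm z)^2 < \<sigma> * r^2" by linarith
  then have "norm z < r" using sig r(1) by (simp add: power2_less_imp_less)
  then have "z \<in> K" "G z = p" using KG[OF p z(2)] p z(2) unfolding K_def by blast+
  then show "p \<in> G ` K" by blast
 qed
 \<comment> \<open>On \<open>K\<close> the function has paraboloids below and affine functions
   above, so \<open>G\<close> is locally Lipschitz there. It would map a null set to a null set, but
   its image contains a ball.\<close>
 have "\<not> negligible K"
 proof
  assume "negligible K"
  then have "negligible (G ` K)"
  proof (rule negligible_locally_Lipschitz_image[OF order_refl])
   fix z assume z: "z \<in> K"
   define s where "s = (r - norm z) / 4"
   have s: "s > 0" using Kp[OF z] by (simp add: s_def)
   show "\<exists>T B. open T & z \<in> T & (\<forall>y\<in>K \<inter> T. norm (G y - G z) <= B * norm (y - z))"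
   proof (intro exI[of _ "ball z s"] exI[of _ "2 * c"] conjI ballI)
    fix y assume y: "y \<in> K \<inter> ball z s"
    show "norm (G y - G z) <= 2 * c * norm (y - z)"
    proof (cases "G y = G z")
     case False
     define dd where "dd = y - z"
     define w where "w = G y - G z"
     have w: "norm w > 0" using False by (simp add: w_def)
     define k where "k = (norm dd / norm w) *\<^sub>R w"
     have nk: "norm k = norm dd" using w by (simp add: k_def)
     have nd: "norm dd < s" using y by (simp add: dd_def dist_norm norm_minus_commute)
     have "norm (z + (dd + k)) <= norm z + (norm dd + norm k)" by (meson add_left_mono norm_triangle_le norm_triangle_ineq)
     then have "norm (y + k) <= r" using nk nd s by (simp add: dd_def s_def add.assoc)
     then have 1: "f (y + k) - G z \<bullet> (y + k) <= f z - G z \<bullet> z" using Kp[OF z] by blast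
     have 2: "f (y + k) >= f y + G y \<bullet> k - c * (norm k)^2" by (rule flow)
     have 3: "f y >= f z + G z \<bullet> dd - c * (norm dd)^2" using flow[of z dd] by (simp add: dd_def)
     have "w \<bullet> k <= c * (norm k)^2 + c * (norm dd)^2" using 1 2 3 by (simp add: w_def dd_def inner_diff_left inner_diff_right inner_add_right)
     moreover have "w \<bullet> k = norm dd * norm w" using w by (simp add: k_def power2_norm_eq_inner[symmetric] power2_eq_square)
     ultimately have "norm dd * norm w <= norm dd * (2 * c * norm dd)" unfolding nk by (simp add: power2_eq_square mult_ac)
     moreover have "norm dd > 0"  using False by (auto simp: dd_def)
     ultimately show ?thesis by (simp add: w_def dd_def)
    qed (use c in simp)
   qed (use s in auto)
  qed
  then have "negligible (ball (0::'a \<times> 'a) \<delta>)" using surj negligible_subset by blast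
  then show False using open_not_negligible[of "ball (0::'a \<times> 'a) \<delta>"] del by auto
 qed
 moreover have "negligible (Z1 \<times> (UNIV::'a set) \<union> (UNIV::'a set) \<times> Z2)"
  by (intro negligible_Un negligible_Times_UNIV S1(1) S2(1))
 ultimately have "\<not> K \<subseteq> Z1 \<times> (UNIV::'a set) \<union> (UNIV::'a set) \<times> Z2" using negligible_subset by blast
 then obtain z where zK: "z \<in> K" "z \<notin> Z1 \<times> (UNIV::'a set) \<union> (UNIV::'a set) \<times> Z2" by blast
 have z: "z \<in> K" "fst z \<notin> Z1" "snd z \<notin> Z2" using zK by (simp_all add: mem_Times_iff)
 define p where "p = G z"
 have p: "norm p < \<delta>" and zr: "norm z < r" and mx: "\<And>z'. norm z' <= r ==> f z' - p \<bullet> z' <= f z - p \<bullet> z" using Kp[OF z(1)] by (auto simp: p_def)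
 define g where "g = p + 2 *\<^sub>R T z + (2 * \<sigma>) *\<^sub>R z"
 have ng: "norm g < \<epsilon>"
 proof -
  have "norm g <= norm p + 2 * norm (T z) + 2 * \<sigma> * norm z" unfolding g_def using sig
   by (intro norm_triangle_le add_mono) auto
  also have "... <= norm p + (2 * b + 2 * \<sigma>) * norm z" using b(2)[of z] by (simp add: algebra_simps)
  also have "... <= norm p + (2 * b + 2 * \<sigma>) * r" using zr b sig by (intro add_left_mono mult_left_mono) auto
  also have "... < \<epsilon>" using p del r4 eps by linarith
  finally show ?thesis .
 qed
 have key: "S1 (fst z + fst k) + S2 (snd z + snd k) <= S1 (fst z) + S2 (snd z) + g \<bullet> k + k \<bullet> T k + \<sigma> * (norm k)^2"
  if "norm k < r - norm z" for k
 proof -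
  have "norm (z + k) <= r" using that norm_triangle_ineq[of z k] by linarith
  from mx[OF this] show ?thesis unfolding f_def fst_add snd_add Bexp nexp by (simp add: g_def inner_add_left inner_add_right algebra_simps)
 qed
 have rz: "r - norm z > 0" using zr by simp
 have up1: "S1 (fst z + k) <= S1 (fst z) + fst g \<bullet> k + (b + \<sigma>) * (norm k)^2" if "norm k < r - norm z" for k
  using key[of "(k, 0)"] that Bup[of "(k,0)" "(k,0)"] by (simp add: inner_prod_def power2_eq_square algebra_simps)
 have up2: "S2 (snd z + k) <= S2 (snd z) + snd g \<bullet> k + (b + \<sigma>) * (norm k)^2" if "norm k < r - norm z" for k
  using key[of "(0, k)"] that Bup[of "(0,k)" "(0,k)"] by (simp add: inner_prod_def power2_eq_square algebra_simps)
 obtain A1 where A1: "linear A1" "\<And>\<epsilon>. \<epsilon> > 0 ==> \<exists>\<delta>>0. \<forall>k. norm k < \<delta> -->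
    \<bar>S1 (fst z + k) - S1 (fst z) - fst g \<bullet> k - (k \<bullet> A1 k) / 2\<bar> <= \<epsilon> * (norm k)^2"
  using S1(7)[OF z(2) rz up1] by blast
 obtain A2 where A2: "linear A2" "\<And>\<epsilon>. \<epsilon> > 0 ==> \<exists>\<delta>>0. \<forall>k. norm k < \<delta> -->
    \<bar>S2 (snd z + k) - S2 (snd z) - snd g \<bullet> k - (k \<bullet> A2 k) / 2\<bar> <= \<epsilon> * (norm k)^2"
  using S2(7)[OF z(3) rz up2] by blast
 obtain d1 where d1: "d1 > 0" "\<And>k. norm k < d1 ==> \<bar>S1 (fst z + k) - S1 (fst z) - fst g \<bullet> k - (k \<bullet> A1 k) / 2\<bar> <= \<sigma> * (norm k)^2"
  using A1(2)[OF sig] by blast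
 obtain d2 where d2: "d2 > 0" "\<And>k. norm k < d2 ==> \<bar>S2 (snd z + k) - S2 (snd z) - snd g \<bullet> k - (k \<bullet> A2 k) / 2\<bar> <= \<sigma> * (norm k)^2"
  using A2(2)[OF sig] by blast
 have zz: "fst z \<in> cball 0 \<rho>" "snd z \<in> cball 0 \<rho>" and zz': "norm (fst z) < r" "norm (snd z) < r"
  using zr r rho norm_fst_le[of "fst z" "snd z"] norm_snd_le[of "snd z" "fst z"] by auto
 have y1: "norm (Y1 (fst z)) <= r + d" using near1[OF zz(1)] zz'(1) norm_triangle_sub[of "Y1 (fst z)" "fst z"] by (simp add: norm_minus_commute)
 have y2: "norm (Y2 (snd z)) <= r + d" using near2[OF zz(2)] zz'(2) norm_triangle_sub[of "Y2 (snd z)" "snd z"] by (simp add: norm_minus_commute)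
 define dl where "dl = min (min d1 d2) (\<rho> / 2)"
 show thesis
 proof (rule that[of "Y1 (fst z)" "Y2 (snd z)" "fst g" "- snd g" A1 "%k. - A2 k" dl])
  show "norm (Y1 (fst z)) < \<epsilon>" "norm (Y2 (snd z)) < \<epsilon>" using y1 y2 r d eps by auto
  show "norm (fst g) < \<epsilon>" "norm (- snd g) < \<epsilon>" using ng norm_fst_le[of "fst g" "snd g"] norm_snd_le[of "snd g" "fst g"] by auto
  show "linear A1" by fact
  show "linear (%k. - A2 k)" using A2(1) by (rule linear_compose_neg)
  show "dl > 0" using d1 d2 rho by (simp add: dl_def)
 next
  fix k :: 'a assume k: "norm k < dl"
  have kd: "norm k < d1" "norm k < d2" using k by (auto simp: dl_def)
  have se: "\<sigma> * (norm k)^2 <= \<epsilon> * (norm k)^2" using eps by (intro mult_right_mono) (auto simp: \<sigma>_def)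
  \<comment> \<open>Translating the maximiser together with \<open>z\<close> leaves the quadratic
    penalty unchanged, so the expansion of \<open>S1\<close> at \<open>fst z\<close> bounds
    \<open>u\<close> at \<open>Y1 (fst z)\<close>.\<close>
  have "Y1 (fst z) + k \<in> cball 0 \<rho>" using y1 k r d norm_triangle_ineq[of "Y1 (fst z)" k] by (simp add: dl_def)
  from S1(5)[OF this, of "fst z + k"] S1(4)[of "fst z"]
  have "u (Y1 (fst z) + k) - u (Y1 (fst z)) <= S1 (fst z + k) - S1 (fst z)" by simp
  then show "u (Y1 (fst z) + k) <= u (Y1 (fst z)) + fst g \<bullet> k + (k \<bullet> A1 k) / 2 + \<epsilon> * (norm k)^2"
   using d1(2)[OF kd(1)] se by linarith
  have "Y2 (snd z) + k \<in> cball 0 \<rho>" using y2 k r d norm_triangle_ineq[of "Y2 (snd z)" k] by (simp add: dl_def)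
  from S2(5)[OF this, of "snd z + k"] S2(4)[of "snd z"]
  have "- v (Y2 (snd z) + k) + v (Y2 (snd z)) <= S2 (snd z + k) - S2 (snd z)" by simp
  then show "v (Y2 (snd z) + k) >= v (Y2 (snd z)) + (- snd g) \<bullet> k + (k \<bullet> - A2 k) / 2 - \<epsilon> * (norm k)^2"
   unfolding inner_minus_left inner_minus_right using d2(2)[OF kd(2)] se by linarith
 next
  fix k l :: 'a
  define m where "m = norm k + norm l + 1"
  have m: "m > 0" by (simp add: m_def add_nonneg_pos)
  \<comment> \<open>All terms are homogeneous of degree two, so the inequality for a small multiple
    of \<open>(k, l)\<close> is enough.\<close>
  define t where "t = min (min d1 d2) (r - norm z) / (2 * m)"
  have t: "t > 0" using d1 d2 rz m by (simp add: t_def)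
  have tm: "t * x < min (min d1 d2) (r - norm z)" if "0 <= x" "x <= m" for x
  proof -
   have "t * x <= t * m" using that t by (intro mult_left_mono) auto
   also have "... = min (min d1 d2) (r - norm z) / 2" using m by (simp add: t_def)
   also have "... < min (min d1 d2) (r - norm z)"
   proof -
    have "x / 2 < x" if "x > 0" for x :: real using that by simp
    then show ?thesis using d1(1) d2(1) rz by (metis min_less_iff_conj)
   qed
   finally show ?thesis .
  qed
  have 1: "norm (t *\<^sub>R k) < d1" "norm (t *\<^sub>R l) < d2" using tm[of "norm k"] tm[of "norm l"] t by (auto simp: m_def)
  have "norm (k, l) <= m" using norm_Pair_le[of k l] by (simp add: m_def)
  then have 2: "norm (t *\<^sub>R (k, l)) < r - norm z" using tm[of "norm (k, l)"] t by (simp del: scaleR_Pair)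
  have "(t *\<^sub>R k \<bullet> A1 (t *\<^sub>R k)) / 2 + (t *\<^sub>R l \<bullet> A2 (t *\<^sub>R l)) / 2 <= t *\<^sub>R (k, l) \<bullet> T (t *\<^sub>R (k, l)) + \<sigma> * (norm (t *\<^sub>R (k, l)))^2
    + \<sigma> * (norm (t *\<^sub>R k))^2 + \<sigma> * (norm (t *\<^sub>R l))^2"
   using key[OF 2] d1(2)[OF 1(1)] d2(2)[OF 1(2)] inner_prod_def[of g "t *\<^sub>R (k, l)"] by (simp add: abs_le_iff)
  then have "t^2 * ((k \<bullet> A1 k) / 2 + (l \<bullet> A2 l) / 2) <= t^2 * ((k, l) \<bullet> T (k, l) + 2 * \<sigma> * ((norm k)^2 + (norm l)^2))"
   unfolding linear_scale[OF A1(1)] linear_scale[OF A2(1)] linear_scale[OF linT] npair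
   using t by (simp add: power2_eq_square algebra_simps del: scaleR_Pair)
  then have "(k \<bullet> A1 k) / 2 + (l \<bullet> A2 l) / 2 <= (k, l) \<bullet> T (k, l) + 2 * \<sigma> * ((norm k)^2 + (norm l)^2)"
   using t by (simp add: mult_le_cancel_left)
  then show "(k \<bullet> A1 k) / 2 - (l \<bullet> - A2 l) / 2 <= (k, l) \<bullet> T (k, l) + \<epsilon> * ((norm k)^2 + (norm l)^2)"
   by (simp add: \<sigma>_def)
 qed
qed

section \<open>Symmetric matrices and uniform ellipticity\<close>

definition outer :: "real^'n => real^'n^'n" where
 "outer e = (\<chi> i j. e $ i * e $ j)"

lemma outer_mult [simp]: "outer e *v h = (e \<bullet> h) *\<^sub>R e"
 by (simp add: outer_def matrix_vector_mult_def vec_eq_iff inner_vec_def sum_distrib_left mult_ac)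

lemma outer_sym [simp]: "outer e \<in> sym_matrices"
 by (simp add: sym_matrices_def outer_def transpose_def vec_eq_iff mult.commute)

lemma mat_mult [simp]: "(mat c :: real^'n^'n) *v h = c *\<^sub>R h"
 by (simp add: mat_def matrix_vector_mult_def vec_eq_iff if_distrib[where f="%c. c * _"] cong: if_cong)

lemma mat_sym [simp]: "mat c \<in> sym_matrices"
 by (simp add: sym_matrices_def transpose_mat)

lemma sym_matrices_add [simp]: "M \<in> sym_matrices ==> N \<in> sym_matrices ==> M + N \<in> sym_matrices"
 by (auto simp: sym_matrices_def transpose_def vec_eq_iff)

lemma sym_matrices_diff [simp]: "M \<in> sym_matrices ==> N \<in> sym_matrices ==> M - N \<in> sym_matrices"
 by (auto simp: sym_matrices_def transpose_def vec_eq_iff)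

lemma sym_matrices_scaleR [simp]: "M \<in> sym_matrices ==> c *\<^sub>R M \<in> sym_matrices"
 by (auto simp: sym_matrices_def transpose_def vec_eq_iff)

lemma sym_matrices_minus [simp]: "M \<in> sym_matrices ==> - M \<in> sym_matrices"
 by (auto simp: sym_matrices_def transpose_def vec_eq_iff)

lemma sym_matrices_zero [simp]: "0 \<in> sym_matrices"
 by (auto simp: sym_matrices_def transpose_def vec_eq_iff)

lemma sym_matrices_nth: "M \<in> sym_matrices ==> M $ i $ j = M $ j $ i"
 by (auto simp: sym_matrices_def transpose_def vec_eq_iff)

lemma sym_matrices_inner: "M \<in> sym_matrices ==> (M *v x) \<bullet> y = x \<bullet> (M *v y)"
 by (metis (mono_tags, lifting) dot_lmul_matrix mem_Collect_eq sym_matrices_def vector_transpose_matrix inner_commute)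

lemma scaleR_matrix_mult: "(c *\<^sub>R M) *v x = c *\<^sub>R (M *v x)" for M :: "real^'n^'m"
 by (simp add: matrix_vector_mult_def vec_eq_iff sum_distrib_left mult_ac)

lemma trace_mult_eq: "trace (A ** B) = (\<Sum>i\<in>UNIV. \<Sum>j\<in>UNIV. A $ i $ j * B $ j $ i)" for A B :: "real^'n^'n"
 by (simp add: trace_def matrix_matrix_mult_def)

lemma trace_mult_add: "trace (A ** (B + C)) = trace (A ** B) + trace (A ** C)" for A B C :: "real^'n^'n"
 by (simp add: trace_mult_eq algebra_simps sum.distrib)

lemma trace_mult_diff: "trace (A ** (B - C)) = trace (A ** B) - trace (A ** C)" for A B C :: "real^'n^'n"
 by (simp add: trace_mult_eq algebra_simps sum_subtractf)

lemma trace_diff_mult: "trace ((A - B) ** C) = trace (A ** C) - trace (B ** C)" for A B C :: "real^'n^'n"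
 by (simp add: trace_mult_eq algebra_simps sum_subtractf)

lemma trace_mult_scaleR: "trace (A ** (c *\<^sub>R B)) = c * trace (A ** B)" for A B :: "real^'n^'n"
 by (simp add: trace_mult_eq sum_distrib_left mult_ac)

lemma trace_scaleR_mult: "trace ((c *\<^sub>R A) ** B) = c * trace (A ** B)" for A B :: "real^'n^'n"
 by (simp add: trace_mult_eq sum_distrib_left mult_ac)

lemma trace_outer: "trace (A ** outer e) = e \<bullet> (A *v e)" for A :: "real^'n^'n"
 by (simp add: trace_mult_eq outer_def inner_vec_def matrix_vector_mult_def sum_distrib_left mult_ac)

lemma trace_outer': "trace (outer e ** A) = e \<bullet> (A *v e)" for A :: "real^'n^'n"
 by (simp only: trace_mul_sym[of "outer e"] trace_outer)

lemma trace_mat: "trace (A ** mat c) = c * trace A" for A :: "real^'n^'n"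
 by (simp add: trace_def matrix_matrix_mult_def mat_def if_distrib sum_distrib_left mult.commute cong: if_cong)

text \<open>Eliminating one diagonal entry of \<open>B\<close> at a time writes \<open>B\<close> as a sum of rank one matrices.\<close>

lemma trace_psd_nsd_nonpos:
 fixes B P :: "real^'n^'n"
 assumes "B \<in> sym_matrices" "\<And>x. x \<bullet> (B *v x) >= 0" and P: "\<And>x. x \<bullet> (P *v x) <= 0"
 shows "trace (B ** P) <= 0"
 using assms(1,2)
proof (induction "card {i. B $ i $ i ~= 0}" arbitrary: B rule: less_induct)
 case less
 have ent: "axis i 1 \<bullet> (B *v axis j 1) = B $ i $ j" for i j
  by (simp add: matrix_vector_mult_basis column_def inner_axis' )
 have row0: "B $ i $ j = 0" if "B $ j $ j = 0" for i j
 proof (rule ccontr)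
  assume ne: "B $ i $ j ~= 0"
  have ex: "(axis i 1 + s *\<^sub>R axis j 1) \<bullet> (B *v (axis i 1 + s *\<^sub>R axis j 1)) = B $ i $ i + 2 * s * B $ i $ j" for s
   using ent[of i i] ent[of i j] ent[of j i] ent[of j j] that sym_matrices_nth[OF less.prems(1), of i j]
   by (simp add: matrix_vector_right_distrib matrix_vector_mult_scaleR inner_add_left inner_add_right algebra_simps)
  define s where "s = - (B $ i $ i + 1) / (2 * B $ i $ j)"
  have "B $ i $ i + 2 * s * B $ i $ j = -1" using ne by (simp add: s_def field_simps)
  then show False using less.prems(2)[of "axis i 1 + s *\<^sub>R axis j 1"] ex[of s] by linarith
 qed
 show ?case
 proof (cases "\<exists>i. B $ i $ i ~= 0")
  case False
  then have "B = 0" using row0 by (simp add: vec_eq_iff)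
  then show ?thesis unfolding trace_mult_eq by simp
 next
  case True
  then obtain i where i: "B $ i $ i ~= 0" by blast
  define b where "b = B $ i $ i"
  have b: "b > 0" using less.prems(2)[of "axis i 1"] ent[of i i] i by (simp add: b_def)
  define v where "v = B *v axis i 1"
  have vn: "v $ j = B $ j $ i" for j by (simp add: v_def matrix_vector_mult_basis column_def)
  define C where "C = B - (1/b) *\<^sub>R outer v"
  have Csym: "C \<in> sym_matrices" using less.prems(1) by (simp add: C_def)
  have Cpsd: "x \<bullet> (C *v x) >= 0" for x
  proof -
   define t where "t = - (v \<bullet> x) / b"
   have vx: "axis i 1 \<bullet> (B *v x) = v \<bullet> x" "x \<bullet> (B *v axis i 1) = v \<bullet> x"
    using sym_matrices_inner[OF less.prems(1), of "axis i 1" x] by (auto simp: v_def inner_commute)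
   have "0 <= (x + t *\<^sub>R axis i 1) \<bullet> (B *v (x + t *\<^sub>R axis i 1))" by (rule less.prems(2))
   also have "... = x \<bullet> (B *v x) + 2 * t * (v \<bullet> x) + t * t * b"
    using vx ent[of i i] by (simp add: matrix_vector_right_distrib matrix_vector_mult_scaleR inner_add_left inner_add_right algebra_simps b_def)
   also have "... = x \<bullet> (C *v x)"
    using b by (simp add: C_def t_def matrix_vector_mult_diff_rdistrib scaleR_matrix_mult inner_diff_right field_simps inner_commute)
   finally show ?thesis .
  qed
  have Cd: "C $ j $ j = B $ j $ j - (B $ j $ i)^2 / b" for j
   by (simp add: C_def outer_def vn power2_eq_square)
  have "{j. C $ j $ j ~= 0} \<subset> {j. B $ j $ j ~= 0}"
  proof (rule psubsetI)
   show "{j. C $ j $ j ~= 0} \<subseteq> {j. B $ j $ j ~= 0}"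
   proof (clarify)
    fix j assume "C $ j $ j ~= 0" "B $ j $ j = 0"
    moreover have "B $ j $ i = 0" using row0[of j i] sym_matrices_nth[OF less.prems(1), of i j] calculation(2) by simp
    ultimately show False by (simp add: Cd)
   qed
   have "C $ i $ i = 0" using b by (simp add: Cd b_def power2_eq_square)
   then show "{j. C $ j $ j ~= 0} ~= {j. B $ j $ j ~= 0}" using i by blast
  qed
  then have "card {j. C $ j $ j ~= 0} < card {j. B $ j $ j ~= 0}" by (intro psubset_card_mono) auto
  from less.hyps[OF this Csym Cpsd] have "trace (C ** P) <= 0" .
  moreover have "trace (C ** P) = trace (B ** P) - (1/b) * (v \<bullet> (P *v v))"
   by (simp add: C_def trace_diff_mult trace_scaleR_mult trace_outer')
  moreover have "(1/b) * (v \<bullet> (P *v v)) <= 0" using b P[of v] by (intro mult_nonneg_nonpos) auto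
  ultimately show ?thesis by linarith
 qed
qed

lemma trace_diff': "trace (A - B) = trace A - trace B" for A B :: "real^'n^'n"
 by (simp add: trace_def sum_subtractf)

lemma trace_outer_self: "trace (c *\<^sub>R outer e) = c * (norm e)^2" for e :: "real^'n"
 by (simp add: trace_def outer_def power2_norm_eq_inner inner_vec_def sum_distrib_left)

text \<open>The upper half of uniform ellipticity, with the supremum replaced by its upper bounds,
  so that no boundedness of the traces has to be shown. The lower half comes back on exchanging
  \<open>M\<close> and \<open>N\<close>. This form passes directly to reflected and rescaled
  operators.\<close>

definition elliptic_op :: "real => real => (real^'n^'n => real) => bool" where
 "elliptic_op lam Lam F \<longleftrightarrow> F 0 = 0 & (\<forall>M\<in>sym_matrices. \<forall>N\<in>sym_matrices. \<forall>c.
   (\<forall>A\<in>elliptic_matrices lam Lam. trace (A ** (M - N)) <= c) --> F M - F N <= c)"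

lemma elliptic_opD: "elliptic_op lam Lam F ==> M \<in> sym_matrices ==> N \<in> sym_matrices ==>
  (\<And>A. A \<in> elliptic_matrices lam Lam ==> trace (A ** (M - N)) <= c) ==> F M - F N <= c"
 by (simp add: elliptic_op_def)

lemma elliptic_opD0: "elliptic_op lam Lam F ==> M \<in> sym_matrices ==>
  (\<And>A. A \<in> elliptic_matrices lam Lam ==> trace (A ** M) <= c) ==> F M <= c"
 using elliptic_opD[of lam Lam F M 0 c] by (simp add: elliptic_op_def)

lemma elliptic_opD0': "elliptic_op lam Lam F ==> M \<in> sym_matrices ==>
  (\<And>A. A \<in> elliptic_matrices lam Lam ==> trace (A ** M) >= c) ==> F M >= c"
 using elliptic_opD[of lam Lam F 0 M "-c"] trace_mult_scaleR[of _ "-1" M] by (simp add: elliptic_op_def)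

lemma mat_in_elliptic: "lam <= Lam ==> mat lam \<in> elliptic_matrices lam Lam"
 by (simp add: elliptic_matrices_def loewner_le_def mult_right_mono)

lemma elliptic_op_of_uniformly_elliptic:
 fixes F :: "real^'n^'n => real"
 assumes "uniformly_elliptic lam Lam F" "F 0 = 0" "lam <= Lam"
 shows "elliptic_op lam Lam F"
 unfolding elliptic_op_def
proof (intro conjI ballI allI impI)
 fix M N :: "real^'n^'n" and c assume MN: "M \<in> sym_matrices" "N \<in> sym_matrices" and c: "\<forall>A\<in>elliptic_matrices lam Lam. trace (A ** (M - N)) <= c"
 have "pucci_plus lam Lam (M - N) <= c" unfolding pucci_plus_def
  by (rule cSUP_least) (use c mat_in_elliptic[OF assms(3)] in auto)
 then show "F M - F N <= c" using assms(1) MN unfolding uniformly_elliptic_def by fastforce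
qed (use assms in auto)

lemma elliptic_op_neg:
 fixes F :: "real^'n^'n => real"
 shows "elliptic_op lam Lam F ==> elliptic_op lam Lam (%M. - F (- M))"
 unfolding elliptic_op_def
proof (intro conjI ballI allI impI; elim conjE)
 fix M N :: "real^'n^'n" and c
 assume F: "\<forall>M\<in>sym_matrices. \<forall>N\<in>sym_matrices. \<forall>c. (\<forall>A\<in>elliptic_matrices lam Lam. trace (A ** (M - N)) <= c) --> F M - F N <= c"
  and MN: "M \<in> sym_matrices" "N \<in> sym_matrices" and c: "\<forall>A\<in>elliptic_matrices lam Lam. trace (A ** (M - N)) <= c"
 have "F (- N) - F (- M) <= c" by (rule F[rule_format]) (use MN c in auto)
 then show "- F (- M) - - F (- N) <= c" by simp
qed simp

lemma elliptic_op_scale: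
 fixes F :: "real^'n^'n => real"
 assumes F: "elliptic_op lam Lam F" and r: "r > 0"
 shows "elliptic_op lam Lam (%M. r * F ((1/r) *\<^sub>R M))"
 unfolding elliptic_op_def
proof (intro conjI ballI allI impI)
 show "r * F ((1/r) *\<^sub>R 0) = 0" using F by (simp add: elliptic_op_def)
 fix M N :: "real^'n^'n" and c
 assume MN: "M \<in> sym_matrices" "N \<in> sym_matrices" and c: "\<forall>A\<in>elliptic_matrices lam Lam. trace (A ** (M - N)) <= c"
 have "F ((1/r) *\<^sub>R M) - F ((1/r) *\<^sub>R N) <= c / r"
 proof (rule elliptic_opD[OF F])
  fix A :: "real^'n^'n" assume "A \<in> elliptic_matrices lam Lam"
  then have "trace (A ** (M - N)) <= c" using c by blast
  then show "trace (A ** ((1/r) *\<^sub>R M - (1/r) *\<^sub>R N)) <= c / r"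
   using r trace_mult_scaleR[of A "1/r" "M - N"] by (simp add: scaleR_diff_right divide_right_mono)
 qed (use MN in auto)
 then show "r * F ((1/r) *\<^sub>R M) - r * F ((1/r) *\<^sub>R N) <= c" using r by (simp add: field_simps)
qed

lemma elliptic_matrices_bounds:
 fixes A :: "real^'n^'n"
 assumes "A \<in> elliptic_matrices lam Lam"
 shows "lam * (norm x)^2 <= x \<bullet> (A *v x)" "x \<bullet> (A *v x) <= Lam * (norm x)^2"
  "real CARD('n) * lam <= trace A" "trace A <= real CARD('n) * Lam" "A \<in> sym_matrices"
proof -
 have 1: "lam * (norm x)^2 <= x \<bullet> (A *v x)" "x \<bullet> (A *v x) <= Lam * (norm x)^2" for x
  using assms by (auto simp: elliptic_matrices_def loewner_le_def power2_norm_eq_inner)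
 show "lam * (norm x)^2 <= x \<bullet> (A *v x)" "x \<bullet> (A *v x) <= Lam * (norm x)^2" by (rule 1)+
 have ent: "axis i 1 \<bullet> (A *v axis i 1) = A $ i $ i" for i
  by (simp add: matrix_vector_mult_basis column_def inner_axis')
 have d: "lam <= A $ i $ i" "A $ i $ i <= Lam" for i using 1[of "axis i 1"] by (simp_all add: ent norm_axis_1)
 show "real CARD('n) * lam <= trace A" unfolding trace_def using sum_mono[of UNIV "%_::'n. lam" "%i. A $ i $ i"] d by simp
 show "trace A <= real CARD('n) * Lam" unfolding trace_def using sum_mono[of UNIV "%i. A $ i $ i" "%_::'n. Lam"] d by simp
 show "A \<in> sym_matrices" using assms by (simp add: elliptic_matrices_def)
qed

text \<open>\<open>A\<close> minus \<open>lam\<close> times the projection onto \<open>e\<close> is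
  still positive semidefinite, and \<open>N - mat s\<close> is nonpositive. So the direction
  \<open>e\<close> alone contributes \<open>- lam * d\<close>, the gain that decides the doubling
  argument.\<close>

lemma trace_elliptic_le:
 fixes A N :: "real^'n^'n"
 assumes A: "A \<in> elliptic_matrices lam Lam" and lam: "0 < lam"
  and N: "\<And>x. x \<bullet> (N *v x) <= s * (norm x)^2" and s: "s >= 0"
  and e: "norm e = 1" "e \<bullet> (N *v e) <= s - d"
 shows "trace (A ** N) <= real CARD('n) * Lam * s - lam * d"
proof -
 note b = elliptic_matrices_bounds[OF A]
 define P where "P = N - mat s"
 have P: "x \<bullet> (P *v x) <= 0" for x
  using N[of x] by (simp add: P_def matrix_vector_mult_diff_rdistrib inner_diff_right power2_norm_eq_inner)
 have "trace ((A - lam *\<^sub>R outer e) ** P) <= 0"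
 proof (rule trace_psd_nsd_nonpos)
  show "A - lam *\<^sub>R outer e \<in> sym_matrices" using b(5) by simp
  fix x
  have "(e \<bullet> x)^2 <= (norm x)^2" using Cauchy_Schwarz_ineq2[of e x] e(1) by (simp add: abs_le_square_iff[symmetric])
  then have "lam * (e \<bullet> x)^2 <= lam * (norm x)^2" using lam by simp
  then show "0 <= x \<bullet> ((A - lam *\<^sub>R outer e) *v x)"
   using b(1)[of x] by (simp add: matrix_vector_mult_diff_rdistrib scaleR_matrix_mult inner_diff_right power2_eq_square inner_commute)
 qed (rule P)
 moreover have "trace ((A - lam *\<^sub>R outer e) ** P) = trace (A ** N) - s * trace A - lam * (e \<bullet> (N *v e) - s)"
  using e(1) by (simp add: P_def trace_diff_mult trace_scaleR_mult trace_diff' trace_outer_self algebra_simps trace_outer' trace_mult_diff trace_mat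
   matrix_vector_mult_diff_rdistrib inner_diff_right power2_norm_eq_inner[symmetric])
 moreover have "s * trace A <= s * (real CARD('n) * Lam)" using b(4) s by (intro mult_left_mono) auto
 moreover have "lam * (e \<bullet> (N *v e) - s) <= lam * (- d)" using e(2) lam by (intro mult_left_mono) auto
 ultimately show ?thesis by (simp add: algebra_simps)
qed

section \<open>The working notion of subsolution and its test functions\<close>

text \<open>The equation \<open>w\<^sub>t = |q + \<theta> Dw|\<^sup>\<gamma> F(D^2w)\<close>. At points of vanishing \<open>q + \<theta> Dw\<close> the condition
 is tested only with functions of the form \<open>A |x - x0|\<^bsup>2j\<^esup> + \<psi>(t)\<close> added to the critical affine function.\<close>

definition vsub :: "nat => real => (real^'n^'n => real) => real^'n => real => ((real^'n) \<times> real) set =>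
  ((real^'n) \<times> real => real) => bool" where
 "vsub j \<gamma> F q \<theta> \<Omega> w \<longleftrightarrow> continuous_on \<Omega> w &
  (\<forall>x0 t0 U \<phi> D\<phi> D2\<phi> \<phi>t. (x0, t0) \<in> \<Omega> --> open U --> (x0, t0) \<in> U --> C21_on U \<phi> D\<phi> D2\<phi> \<phi>t -->
   (\<forall>z\<in>U \<inter> \<Omega>. w z - \<phi> z <= w (x0, t0) - \<phi> (x0, t0)) --> q + \<theta> *\<^sub>R D\<phi> (x0, t0) ~= 0 -->
   \<phi>t (x0, t0) <= norm (q + \<theta> *\<^sub>R D\<phi> (x0, t0)) powr \<gamma> * F (D2\<phi> (x0, t0))) &
  (\<forall>x0 t0 \<delta> \<psi> \<psi>' A. (x0, t0) \<in> \<Omega> --> \<delta> > 0 --> C1_on {t0 - \<delta><..<t0 + \<delta>} \<psi> \<psi>' --> A >= 0 -->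
   (\<forall>x t. (x, t) \<in> \<Omega> --> norm (x - x0) < \<delta> --> \<bar>t - t0\<bar> < \<delta> -->
    \<theta> * w (x, t) + q \<bullet> x - A * norm (x - x0) ^ (2 * j) - \<psi> t <= \<theta> * w (x0, t0) + q \<bullet> x0 - \<psi> t0) -->
   \<psi>' t0 <= 0)"

lemma vsubD_cont: "vsub j \<gamma> F q \<theta> \<Omega> w ==> continuous_on \<Omega> w"
 by (simp add: vsub_def)

lemma vsubD:
 assumes "vsub j \<gamma> F q \<theta> \<Omega> w" "(x0, t0) \<in> \<Omega>" "open U" "(x0, t0) \<in> U" "C21_on U \<phi> D\<phi> D2\<phi> \<phi>t"
  "\<And>z. z \<in> U ==> z \<in> \<Omega> ==> w z - \<phi> z <= w (x0, t0) - \<phi> (x0, t0)" "q + \<theta> *\<^sub>R D\<phi> (x0, t0) ~= 0"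
 shows "\<phi>t (x0, t0) <= norm (q + \<theta> *\<^sub>R D\<phi> (x0, t0)) powr \<gamma> * F (D2\<phi> (x0, t0))"
 using assms unfolding vsub_def by (metis IntE)

lemma vsubD_crit:
 assumes "vsub j \<gamma> F q \<theta> \<Omega> w" "(x0, t0) \<in> \<Omega>" "\<delta> > 0" "C1_on {t0 - \<delta><..<t0 + \<delta>} \<psi> \<psi>'" "A >= 0"
  "\<And>x t. (x, t) \<in> \<Omega> ==> norm (x - x0) < \<delta> ==> \<bar>t - t0\<bar> < \<delta> ==>
    \<theta> * w (x, t) + q \<bullet> x - A * norm (x - x0) ^ (2 * j) - \<psi> t <= \<theta> * w (x0, t0) + q \<bullet> x0 - \<psi> t0"
 shows "\<psi>' t0 <= 0"
 by (rule assms(1)[unfolded vsub_def, THEN conjunct2, THEN conjunct2, rule_format, OF assms(2-6)])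

lemma vsub_subset:
 assumes w: "vsub j \<gamma> F q \<theta> \<Omega> w" and O: "open \<Omega>'" "\<Omega>' \<subseteq> \<Omega>"
 shows "vsub j \<gamma> F q \<theta> \<Omega>' w"
 unfolding vsub_def
proof (intro conjI allI impI)
 show "continuous_on \<Omega>' w" by (rule continuous_on_subset[OF vsubD_cont[OF w] O(2)])
next
 fix x0 t0 U \<phi> D\<phi> D2\<phi> \<phi>t
 assume a: "(x0, t0) \<in> \<Omega>'" "open U" "(x0, t0) \<in> U" "C21_on U \<phi> D\<phi> D2\<phi> \<phi>t"
  "\<forall>z\<in>U \<inter> \<Omega>'. w z - \<phi> z <= w (x0, t0) - \<phi> (x0, t0)" "q + \<theta> *\<^sub>R D\<phi> (x0, t0) ~= 0"
 have c: "C21_on (U \<inter> \<Omega>') \<phi> D\<phi> D2\<phi> \<phi>t"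
  using a(4) unfolding C21_on_def by (auto intro: continuous_on_subset)
 show "\<phi>t (x0, t0) <= norm (q + \<theta> *\<^sub>R D\<phi> (x0, t0)) powr \<gamma> * F (D2\<phi> (x0, t0))"
 proof (rule vsubD[OF w _ _ _ c])
  show "(x0, t0) \<in> \<Omega>" "open (U \<inter> \<Omega>')" "(x0, t0) \<in> U \<inter> \<Omega>'" using a(1-3) O by auto
  show "q + \<theta> *\<^sub>R D\<phi> (x0, t0) ~= 0" by (rule a)
 qed (use a(5) in blast)
next
 fix x0 t0 \<delta> \<psi> \<psi>' A
 assume a: "(x0, t0) \<in> \<Omega>'" "\<delta> > (0::real)" "C1_on {t0 - \<delta><..<t0 + \<delta>} \<psi> \<psi>'" "A >= (0::real)"
  "\<forall>x t. (x, t) \<in> \<Omega>' --> norm (x - x0) < \<delta> --> \<bar>t - t0\<bar> < \<delta> -->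
    \<theta> * w (x, t) + q \<bullet> x - A * norm (x - x0) ^ (2 * j) - \<psi> t <= \<theta> * w (x0, t0) + q \<bullet> x0 - \<psi> t0"
 obtain d where d: "d > 0" "ball (x0, t0) d \<subseteq> \<Omega>'" using O(1) a(1) open_contains_ball by blast
 define e where "e = min \<delta> (d / 2)"
 have e: "e > 0" "e <= \<delta>" "e <= d / 2" using a d by (auto simp: e_def)
 have in': "(x, t) \<in> \<Omega>'" if "norm (x - x0) < e" "\<bar>t - t0\<bar> < e" for x t
 proof -
  have "norm (x0 - x, t0 - t) <= norm (x0 - x) + \<bar>t0 - t\<bar>" using norm_Pair_le[of "x0 - x" "t0 - t"] by simp
  then have "dist (x0, t0) (x, t) < d" using that e unfolding dist_norm by (simp add: norm_minus_commute abs_minus_commute)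
  then show ?thesis using d by auto
 qed
 have 1: "(x0, t0) \<in> \<Omega>" using a(1) O by auto
 have 2: "C1_on {t0 - e<..<t0 + e} \<psi> \<psi>'" using a(3) e unfolding C1_on_def by (auto intro: continuous_on_subset)
 show "\<psi>' t0 <= 0"
 proof (rule vsubD_crit[OF w 1 e(1) 2 a(4)])
  show "\<theta> * w (x, t) + q \<bullet> x - A * norm (x - x0) ^ (2 * j) - \<psi> t <= \<theta> * w (x0, t0) + q \<bullet> x0 - \<psi> t0"
   if "norm (x - x0) < e" "\<bar>t - t0\<bar> < e" for x t
   using a(5)[rule_format, of x t] in'[OF that] that e by linarith
 qed
qed

lemma C21_on_subset: "C21_on U \<phi> D\<phi> D2\<phi> \<phi>t ==> V \<subseteq> U ==> C21_on V \<phi> D\<phi> D2\<phi> \<phi>t"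
 unfolding C21_on_def by (auto intro: continuous_on_subset)

lemma C21_on_add:
 assumes "C21_on U \<phi> D\<phi> D2\<phi> \<phi>t" "C21_on U \<psi> D\<psi> D2\<psi> \<psi>t"
 shows "C21_on U (%z. \<phi> z + \<psi> z) (%z. D\<phi> z + D\<psi> z) (%z. D2\<phi> z + D2\<psi> z) (%z. \<phi>t z + \<psi>t z)"
 using assms unfolding C21_on_def
 by (auto intro!: continuous_intros derivative_eq_intros simp: inner_add_left matrix_vector_mult_add_rdistrib fun_eq_iff split: prod.splits)

lemma C21_on_cmult:
 assumes "C21_on U \<phi> D\<phi> D2\<phi> \<phi>t"
 shows "C21_on U (%z. c * \<phi> z) (%z. c *\<^sub>R D\<phi> z) (%z. c *\<^sub>R D2\<phi> z) (%z. c * \<phi>t z)"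
 unfolding C21_on_def
proof (intro conjI ballI, clarify)
 fix x t assume "(x, t) \<in> U"
 then have d: "((%y. \<phi> (y, t)) has_derivative (%h. D\<phi> (x, t) \<bullet> h)) (at x)"
    "((%y. D\<phi> (y, t)) has_derivative (%h. D2\<phi> (x, t) *v h)) (at x)"
    "((%s. \<phi> (x, s)) has_real_derivative \<phi>t (x, t)) (at t)"
  using assms unfolding C21_on_def by auto
 show "((%y. c * \<phi> (y, t)) has_derivative (%h. c *\<^sub>R D\<phi> (x, t) \<bullet> h)) (at x) &
  ((%y. c *\<^sub>R D\<phi> (y, t)) has_derivative (%h. c *\<^sub>R D2\<phi> (x, t) *v h)) (at x) &
  ((%s. c * \<phi> (x, s)) has_real_derivative c * \<phi>t (x, t)) (at t)"
  using has_derivative_mult_right[OF d(1), of c] has_derivative_scaleR_right[OF d(2), of c] DERIV_cmult[OF d(3), of c]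
  by (simp add: scaleR_matrix_mult)
qed (use assms in \<open>auto simp: C21_on_def intro!: continuous_intros\<close>)

lemma C21_on_time:
 fixes \<psi> :: "real => real"
 assumes "C1_on I \<psi> \<psi>'" "open I"
 shows "C21_on (UNIV \<times> I) (%z::(real^'n) \<times> real. \<psi> (snd z)) (%_. 0) (%_. 0) (%z. \<psi>' (snd z))"
proof -
 have "continuous_on I \<psi>" using assms(1) unfolding C1_on_def
  by (meson DERIV_continuous_on DERIV_subset subset_UNIV)
 then have "continuous_on (UNIV \<times> I) (%z::(real^'n) \<times> real. \<psi> (snd z))" "continuous_on (UNIV \<times> I) (%z::(real^'n) \<times> real. \<psi>' (snd z))"
  using assms(1) unfolding C1_on_def by (auto intro!: continuous_on_compose2[of I _ _ snd] continuous_intros)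
 moreover have "((%_::real^'n. c) has_derivative (\<bullet>) 0) (at x)" for x :: "real^'n" and c :: real
  by (rule has_derivative_eq_rhs[OF has_derivative_const]) (simp add: fun_eq_iff)
 moreover have "((%_::real^'n. 0::real^'n) has_derivative (*v) 0) (at x)" for x :: "real^'n"
  by (rule has_derivative_eq_rhs[OF has_derivative_const]) (simp add: fun_eq_iff)
 ultimately show ?thesis using assms(1) unfolding C21_on_def C1_on_def by (simp only: fst_conv snd_conv split_paired_Ball_Sigma) simp
qed

lemma C21_on_affine: "C21_on U (%z. l \<bullet> fst z) (%_. l) (%_. 0) (%_. 0)"
 unfolding C21_on_def by (auto intro!: continuous_intros derivative_eq_intros)

text \<open>Where the exponents \<open>j - 1\<close> and \<open>j - 2\<close> are truncated, the
  factor \<open>real j\<close> or \<open>real (j - 1)\<close> vanishes. The case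
  \<open>j = 1\<close> serves the quadratic barriers.\<close>

lemma C21_on_power:
 "C21_on U (%z. ((fst z - y) \<bullet> (fst z - y)) ^ j) (%z. (2 * real j * ((fst z - y) \<bullet> (fst z - y)) ^ (j - 1)) *\<^sub>R (fst z - y))
  (%z. (2 * real j * ((fst z - y) \<bullet> (fst z - y)) ^ (j - 1)) *\<^sub>R mat 1
    + (4 * real j * real (j - 1) * ((fst z - y) \<bullet> (fst z - y)) ^ (j - 2)) *\<^sub>R outer (fst z - y)) (%_. 0)"
proof -
 have 1: "((%x. ((x - y) \<bullet> (x - y)) ^ i) has_derivative (%h. (2 * real i * ((x - y) \<bullet> (x - y)) ^ (i - 1)) * ((x - y) \<bullet> h))) (at x)" for i x
  by (auto intro!: derivative_eq_intros simp: inner_commute algebra_simps)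
 have 2: "((%x. (2 * real j * ((x - y) \<bullet> (x - y)) ^ (j - 1)) *\<^sub>R (x - y)) has_derivative
  (%h. ((2 * real j * ((x - y) \<bullet> (x - y)) ^ (j - 1)) *\<^sub>R mat 1
    + (4 * real j * real (j - 1) * ((x - y) \<bullet> (x - y)) ^ (j - 2)) *\<^sub>R outer (x - y)) *v h)) (at x)" for x
 proof -
  show ?thesis
   by (rule has_derivative_eq_rhs[OF has_derivative_scaleR[OF has_derivative_mult_right[OF 1[of "j - 1" x], of "2 * real j"] has_derivative_diff[OF has_derivative_ident has_derivative_const]]])
    (auto simp: fun_eq_iff numeral_2_eq_2 matrix_vector_mult_add_rdistrib scaleR_matrix_mult mult_ac)
 qed
 have 3: "continuous_on U (%z. outer (fst z - y))"
  unfolding outer_def by (intro continuous_on_vec_lambda continuous_intros)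
 show ?thesis unfolding C21_on_def
 proof (intro conjI ballI, clarify)
  fix x t
  show "((%ya. ((fst (ya, t) - y) \<bullet> (fst (ya, t) - y)) ^ j) has_derivative
     (\<bullet>) ((2 * real j * ((fst (x, t) - y) \<bullet> (fst (x, t) - y)) ^ (j - 1)) *\<^sub>R (fst (x, t) - y))) (at x) &
   ((%ya. (2 * real j * ((fst (ya, t) - y) \<bullet> (fst (ya, t) - y)) ^ (j - 1)) *\<^sub>R (fst (ya, t) - y)) has_derivative
     (*v) ((2 * real j * ((fst (x, t) - y) \<bullet> (fst (x, t) - y)) ^ (j - 1)) *\<^sub>R mat 1 +
     (4 * real j * real (j - 1) * ((fst (x, t) - y) \<bullet> (fst (x, t) - y)) ^ (j - 2)) *\<^sub>R outer (fst (x, t) - y))) (at x) &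
   ((%s. ((fst (x, s) - y) \<bullet> (fst (x, s) - y)) ^ j) has_real_derivative 0) (at t)"
   using 1[of j x] 2[of x] unfolding fst_conv inner_scaleR_left by simp
 qed (auto intro!: continuous_intros 3)
qed

lemma C21_on_coord_sq: "C21_on U (%z::(real^'n) \<times> real. (fst z $ k)^2) (%z. (2 * fst z $ k) *\<^sub>R axis k 1) (%_. 2 *\<^sub>R outer (axis k 1)) (%_. 0)"
proof -
 have e: "x $ k = axis k 1 \<bullet> x" for x :: "real^'n" by (simp add: inner_axis')
 show ?thesis unfolding C21_on_def e
  by (intro conjI ballI, clarify)
   (auto intro!: continuous_intros derivative_eq_intros simp: scaleR_matrix_mult inner_add_right fun_eq_iff algebra_simps)
qed

lemma sym_matricesI: "(\<And>x y. (M *v x) \<bullet> y = x \<bullet> (M *v y)) ==> M \<in> sym_matrices" for M :: "real^'n^'n"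
proof -
 assume a: "\<And>x y. (M *v x) \<bullet> y = x \<bullet> (M *v y)"
 have "M $ i $ j = M $ j $ i" for i j
  using a[of "axis i 1" "axis j 1"] by (simp add: matrix_vector_mult_basis column_def inner_axis inner_axis')
 then show ?thesis by (simp add: sym_matrices_def transpose_def vec_eq_iff)
qed

text \<open>The theorem on sums provides a linear map \<open>S\<close> that need not be symmetric.
  Only its symmetric part enters the quadratic test function, and only the space block
  \<open>X\<close> of that part enters the equation; the term with \<epsilon> adds
  \<open>2 * \<epsilon>\<close> to the Hessian.\<close>

lemma vsub_jet:
 fixes S :: "(real^'n) \<times> real => (real^'n) \<times> real"
 assumes w: "vsub j \<gamma> F q \<theta> \<Omega> w" and a: "a \<in> \<Omega>" and S: "linear S" and d: "\<delta> > 0"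
  and jet: "\<And>k. norm k < \<delta> ==> w (a + k) <= w a + p \<bullet> k + (k \<bullet> S k) / 2 + \<epsilon> * (norm k)^2"
  and ne: "q + \<theta> *\<^sub>R fst p ~= 0"
 shows "\<exists>X\<in>sym_matrices. (\<forall>h. h \<bullet> (X *v h) = (h, 0) \<bullet> S (h, 0)) &
  snd p <= norm (q + \<theta> *\<^sub>R fst p) powr \<gamma> * F (X + (2 * \<epsilon>) *\<^sub>R mat 1)"
proof -
 define G where "G k = (1/2) *\<^sub>R (S k + adjoint S k)" for k
 have linG: "linear G" unfolding G_def
  using S adjoint_linear[OF S] by (intro linear_compose_scale_right linear_compose_add)
 have sG: "G x \<bullet> y = x \<bullet> G y" for x y
  using adjoint_works[OF S, of x y] adjoint_works[OF S, of y x] by (simp add: G_def inner_add_left inner_add_right inner_commute)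
 have qG: "k \<bullet> G k = k \<bullet> S k" for k
  using adjoint_works[OF S, of k k] by (simp add: G_def inner_add_right inner_commute)
 define L where "L h = fst (G (h, 0))" for h
 have linL: "linear L" unfolding L_def
 proof (rule linearI)
  show "fst (G (x + y, 0)) = fst (G (x, 0)) + fst (G (y, 0))" for x y
   using linear_add[OF linG, of "(x, 0)" "(y, 0)"] by simp
  show "fst (G (c *\<^sub>R x, 0)) = c *\<^sub>R fst (G (x, 0))" for c x
   using linear_scale[OF linG, of c "(x, 0)"] by simp
 qed
 define X where "X = matrix L"
 have Xh: "X *v h = fst (G (h, 0))" for h using matrix_vector_mul(2)[OF linL] unfolding X_def L_def by meson
 have symX: "X \<in> sym_matrices"
  by (rule sym_matricesI) (use sG[of "(_, 0)" "(_, 0)"] in \<open>simp add: Xh inner_prod_def\<close>)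
 have X1: "h \<bullet> (X *v h) = (h, 0) \<bullet> S (h, 0)" for h
  using qG[of "(h, 0)"] by (simp add: Xh inner_prod_def)
 have blG: "bounded_linear G" using linG linear_conv_bounded_linear by blast
 define \<phi> where "\<phi> z = p \<bullet> (z - a) + ((z - a) \<bullet> G (z - a)) / 2 + \<epsilon> * ((z - a) \<bullet> (z - a))" for z
 define D\<phi> where "D\<phi> z = fst (p + G (z - a) + (2 * \<epsilon>) *\<^sub>R (z - a))" for z
 define \<phi>t where "\<phi>t z = snd (p + G (z - a) + (2 * \<epsilon>) *\<^sub>R (z - a))" for z
 have df: "(\<phi> has_derivative (%h. (p + G (z - a) + (2 * \<epsilon>) *\<^sub>R (z - a)) \<bullet> h)) (at z)" for z
 proof -
  have dz: "((%z. z - a) has_derivative (%h. h)) (at z)" by (auto intro!: derivative_eq_intros)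
  have dG: "((%z. G (z - a)) has_derivative G) (at z)" using bounded_linear.has_derivative[OF blG dz] by simp
  have dp: "((%z. p \<bullet> (z - a)) has_derivative (%h. p \<bullet> h)) (at z)" by (rule has_derivative_inner_right[OF dz])
  note d3 = has_derivative_add[OF has_derivative_add[OF dp has_derivative_mult_right[OF has_derivative_inner[OF dz dG], of "1/2"]]
    has_derivative_mult_right[OF has_derivative_inner[OF dz dz], of \<epsilon>]]
  have "G (z - a) \<bullet> h = (z - a) \<bullet> G h" for h by (rule sG)
  then show ?thesis using has_derivative_eq_rhs[OF d3, of "%h. (p + G (z - a) + (2 * \<epsilon>) *\<^sub>R (z - a)) \<bullet> h"]
   unfolding \<phi>_def by (simp add: fun_eq_iff inner_add_left inner_commute[of _ "z - a"] inner_commute[of _ "G (z - a)"])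
 qed
 have C: "C21_on UNIV \<phi> D\<phi> (%_. X + (2 * \<epsilon>) *\<^sub>R mat 1) \<phi>t"
  unfolding C21_on_def
 proof (intro conjI ballI, clarify)
  fix x t
  have "((%y. \<phi> (y, t)) has_derivative (%h. (p + G ((x, t) - a) + (2 * \<epsilon>) *\<^sub>R ((x, t) - a)) \<bullet> (h, 0))) (at x)"
   by (rule has_derivative_compose[OF _ df, of "%y. (y, t)" "%h. (h, 0)"]) (auto intro!: derivative_eq_intros)
  then have 1: "((%y. \<phi> (y, t)) has_derivative (%h. D\<phi> (x, t) \<bullet> h)) (at x)"
   by (simp add: D\<phi>_def inner_prod_def)
  have "((%y. D\<phi> (y, t)) has_derivative (%h. fst (G (h, 0)) + (2 * \<epsilon>) *\<^sub>R h)) (at x)"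
   unfolding D\<phi>_def
   by (auto intro!: derivative_eq_intros bounded_linear.has_derivative[OF blG])
  then have 2: "((%y. D\<phi> (y, t)) has_derivative (%h. (X + (2 * \<epsilon>) *\<^sub>R mat 1) *v h)) (at x)"
   by (simp add: matrix_vector_mult_add_rdistrib scaleR_matrix_mult Xh)
  have "((%s. \<phi> (x, s)) has_derivative (%h. (p + G ((x, t) - a) + (2 * \<epsilon>) *\<^sub>R ((x, t) - a)) \<bullet> (0, h))) (at t)"
   by (rule has_derivative_compose[OF _ df, of "%s. (x, s)" "%h. (0, h)"]) (auto intro!: derivative_eq_intros)
  then have 3: "((%s. \<phi> (x, s)) has_real_derivative \<phi>t (x, t)) (at t)"
   unfolding has_field_derivative_def by (simp add: \<phi>t_def inner_prod_def mult.commute[of _ "_ + _"])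
  show "((%y. \<phi> (y, t)) has_derivative (%h. D\<phi> (x, t) \<bullet> h)) (at x) &
   ((%y. D\<phi> (y, t)) has_derivative (%h. (X + (2 * \<epsilon>) *\<^sub>R mat 1) *v h)) (at x) &
   ((%s. \<phi> (x, s)) has_real_derivative \<phi>t (x, t)) (at t)" using 1 2 3 by blast
 next
  show "continuous_on UNIV \<phi>" unfolding \<phi>_def by (intro continuous_intros bounded_linear.continuous_on[OF blG]) simp
  show "continuous_on UNIV D\<phi>" unfolding D\<phi>_def by (intro continuous_intros bounded_linear.continuous_on[OF blG])
  show "continuous_on UNIV \<phi>t" unfolding \<phi>t_def by (intro continuous_intros bounded_linear.continuous_on[OF blG])
 qed auto
 obtain x0 t0 where xt: "a = (x0, t0)" by (cases a)
 have D0: "D\<phi> a = fst p" "\<phi>t a = snd p" "\<phi> a = 0" by (simp_all add: D\<phi>_def \<phi>t_def \<phi>_def linear_0[OF linG])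
 have "\<phi>t (x0, t0) <= norm (q + \<theta> *\<^sub>R D\<phi> (x0, t0)) powr \<gamma> * F (X + (2 * \<epsilon>) *\<^sub>R mat 1)"
 proof (rule vsubD[OF w _ _ _ C21_on_subset[OF C]])
  show "(x0, t0) \<in> \<Omega>" using a xt by simp
  show "open (ball a \<delta>)" "(x0, t0) \<in> ball a \<delta>" "ball a \<delta> \<subseteq> UNIV" using d xt by auto
  show "q + \<theta> *\<^sub>R D\<phi> (x0, t0) ~= 0" using ne D0 xt by simp
  fix z assume "z \<in> ball a \<delta>"
  then have "norm (z - a) < \<delta>" by (simp add: dist_norm norm_minus_commute)
  from jet[OF this] show "w z - \<phi> z <= w (x0, t0) - \<phi> (x0, t0)"
   using D0 xt by (simp add: \<phi>_def qG power2_norm_eq_inner)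
 qed
 then show ?thesis using symX X1 D0 xt by (intro bexI[of _ X]) auto
qed

section \<open>From the given viscosity solutions to \<open>vsub\<close>, and rescaling\<close>

lemma powr_norm_sq: "((norm v)^2 + 0^2) powr (\<gamma> / 2) = norm v powr \<gamma>"
proof (cases "norm v = 0")
 case False
 then show ?thesis using powr_powr[of "norm v" 2 "\<gamma> / 2"] by (simp add: powr_numeral)
qed simp

text \<open>Reflection expresses the supersolution property as a subsolution property for the
  operator \<open>- F (- M)\<close>, so that \<open>vsub\<close> can serve for both.\<close>

lemma visc_subsolution_neg:
 assumes "visc_supersolution 1 p 0 \<gamma> F (%_. 0) \<Omega> u"
 shows "visc_subsolution 1 (- p) 0 \<gamma> (%M. - F (- M)) (%_. 0) \<Omega> (%z. - u z)"
proof -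
 have c: "continuous_on \<Omega> u" and
  i: "\<And>x0 t0 U \<phi> D\<phi> D2\<phi> \<phi>t. (x0, t0) \<in> \<Omega> ==> open U & (x0, t0) \<in> U & C21_on U \<phi> D\<phi> D2\<phi> \<phi>t &
     \<phi> (x0, t0) = u (x0, t0) & (\<forall>z\<in>U \<inter> \<Omega>. u z >= \<phi> z) & 1 *\<^sub>R D\<phi> (x0, t0) + p ~= 0
     ==> \<phi>t (x0, t0) >= ((norm (1 *\<^sub>R D\<phi> (x0, t0) + p))^2 + 0^2) powr (\<gamma> / 2) * F (D2\<phi> (x0, t0)) + 0" and
  ii: "\<And>x0 t0 \<delta> \<psi> \<psi>'. (x0, t0) \<in> \<Omega> ==>
     admissible_radius \<Omega> x0 t0 \<delta> & C1_on {t0 - \<delta><..<t0 + \<delta>} \<psi> \<psi>' &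
     (\<forall>t\<in>time_window \<Omega> x0 t0 \<delta>. (1 * u (x0, t0) + p \<bullet> x0) - \<psi> t0 <= (1 * u (x0, t) + p \<bullet> x0) - \<psi> t) &
     (\<forall>x\<in>ball x0 \<delta>. (INF t\<in>time_window \<Omega> x0 t0 \<delta>. ereal ((1 * u (x, t) + p \<bullet> x) - \<psi> t)) = ereal ((1 * u (x0, t0) + p \<bullet> x0) - \<psi> t0))
     ==> \<psi>' t0 >= 1 * 0"
  using assms unfolding visc_supersolution_def Let_def prod.case by blast+
 show ?thesis unfolding visc_subsolution_def Let_def prod.case
 proof (intro conjI allI impI)
  show "continuous_on \<Omega> (%z. - u z)" using c by (intro continuous_intros)
 next
  fix x0 t0 U \<phi> D\<phi> D2\<phi> \<phi>t
  assume z: "(x0, t0) \<in> \<Omega>" and a: "open U & (x0, t0) \<in> U & C21_on U \<phi> D\<phi> D2\<phi> \<phi>t &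
    \<phi> (x0, t0) = - u (x0, t0) & (\<forall>z\<in>U \<inter> \<Omega>. - u z <= \<phi> z) & 1 *\<^sub>R D\<phi> (x0, t0) + - p ~= 0"
  have C: "C21_on U (%z. -1 * \<phi> z) (%z. (-1) *\<^sub>R D\<phi> z) (%z. (-1) *\<^sub>R D2\<phi> z) (%z. -1 * \<phi>t z)"
   using a by (intro C21_on_cmult) auto
  have "-1 * \<phi>t (x0, t0) >= ((norm (1 *\<^sub>R ((-1) *\<^sub>R D\<phi> (x0, t0)) + p))^2 + 0^2) powr (\<gamma> / 2) * F ((-1) *\<^sub>R D2\<phi> (x0, t0)) + 0"
  proof (rule i[OF z, of U "%z. -1 * \<phi> z" "%z. (-1) *\<^sub>R D\<phi> z" "%z. (-1) *\<^sub>R D2\<phi> z" "%z. -1 * \<phi>t z"], intro conjI C)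
   show "\<forall>z\<in>U \<inter> \<Omega>. -1 * \<phi> z <= u z"
   proof
    fix z assume "z \<in> U \<inter> \<Omega>"
    then have "- u z <= \<phi> z" using a by blast
    then show "-1 * \<phi> z <= u z" by simp
   qed
  qed (use a in auto)
  then show "\<phi>t (x0, t0) <= ((norm (1 *\<^sub>R D\<phi> (x0, t0) + - p))^2 + 0^2) powr (\<gamma> / 2) * - F (- D2\<phi> (x0, t0)) + 0"
   using norm_minus_commute[of "D\<phi> (x0, t0)" p] by (simp add: )
 next
  fix x0 t0 \<delta> \<psi> \<psi>'
  assume z: "(x0, t0) \<in> \<Omega>" and a: "admissible_radius \<Omega> x0 t0 \<delta> & C1_on {t0 - \<delta><..<t0 + \<delta>} \<psi> \<psi>' &
    (\<forall>t\<in>time_window \<Omega> x0 t0 \<delta>. 1 * - u (x0, t0) + - p \<bullet> x0 - \<psi> t0 >= 1 * - u (x0, t) + - p \<bullet> x0 - \<psi> t) &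
    (\<forall>x\<in>ball x0 \<delta>. (SUP t\<in>time_window \<Omega> x0 t0 \<delta>. ereal (1 * - u (x, t) + - p \<bullet> x - \<psi> t)) = ereal (1 * - u (x0, t0) + - p \<bullet> x0 - \<psi> t0))"
  have "- \<psi>' t0 >= 1 * 0"
  proof (rule ii[OF z, of \<delta> "%t. - \<psi> t" "%t. - \<psi>' t"], intro conjI)
   show "admissible_radius \<Omega> x0 t0 \<delta>" using a by blast
   show "C1_on {t0 - \<delta><..<t0 + \<delta>} (%t. - \<psi> t) (%t. - \<psi>' t)"
    using a unfolding C1_on_def by (auto intro!: DERIV_minus continuous_intros)
   show "\<forall>t\<in>time_window \<Omega> x0 t0 \<delta>. 1 * u (x0, t0) + p \<bullet> x0 - - \<psi> t0 <= 1 * u (x0, t) + p \<bullet> x0 - - \<psi> t"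
    using a by fastforce
   show "\<forall>x\<in>ball x0 \<delta>. (INF t\<in>time_window \<Omega> x0 t0 \<delta>. ereal (1 * u (x, t) + p \<bullet> x - - \<psi> t)) = ereal (1 * u (x0, t0) + p \<bullet> x0 - - \<psi> t0)"
   proof
    fix x assume x: "x \<in> ball x0 \<delta>"
    have "(INF t\<in>time_window \<Omega> x0 t0 \<delta>. ereal (1 * u (x, t) + p \<bullet> x - - \<psi> t))
     = (INF t\<in>time_window \<Omega> x0 t0 \<delta>. - ereal (1 * - u (x, t) + - p \<bullet> x - \<psi> t))" by (simp add: algebra_simps)
    also have "... = - (SUP t\<in>time_window \<Omega> x0 t0 \<delta>. ereal (1 * - u (x, t) + - p \<bullet> x - \<psi> t))"
     by (rule ereal_INF_uminus_eq)
    also have "... = ereal (1 * u (x0, t0) + p \<bullet> x0 - - \<psi> t0)" using a x by (simp add: algebra_simps)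
    finally show "(INF t\<in>time_window \<Omega> x0 t0 \<delta>. ereal (1 * u (x, t) + p \<bullet> x - - \<psi> t)) = ereal (1 * u (x0, t0) + p \<bullet> x0 - - \<psi> t0)" .
   qed
  qed
  then show "\<psi>' t0 <= 1 * 0" by simp
 qed
qed

lemma power_hessian_bound:
 fixes F :: "real^'n^'n => real" and z :: "real^'n"
 assumes F: "elliptic_op lam Lam F" and L: "0 < lam" "lam <= Lam" and j: "j >= 2" and a: "a >= 0"
 shows "F (a *\<^sub>R ((2 * real j * (z \<bullet> z) ^ (j - 1)) *\<^sub>R mat 1 + (4 * real j * real (j - 1) * (z \<bullet> z) ^ (j - 2)) *\<^sub>R outer z))
  <= a * Lam * (2 * real j * real CARD('n) + 4 * real j * real (j - 1)) * norm z ^ (2 * j - 2)"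
proof (rule elliptic_opD0[OF F])
 fix A :: "real^'n^'n" assume A: "A \<in> elliptic_matrices lam Lam"
 note b = elliptic_matrices_bounds[OF A]
 have s: "(z \<bullet> z) ^ (j - 1) = norm z ^ (2 * j - 2)" "(z \<bullet> z) ^ (j - 2) * (norm z)^2 = norm z ^ (2 * j - 2)"
 proof -
  have 1: "(z \<bullet> z) ^ i = norm z ^ (2 * i)" for i by (simp add: power_mult power2_norm_eq_inner)
  have "2 * (j - 1) = 2 * j - 2" "2 * (j - 2) + 2 = 2 * j - 2" using j by auto
  then show "(z \<bullet> z) ^ (j - 1) = norm z ^ (2 * j - 2)" "(z \<bullet> z) ^ (j - 2) * (norm z)^2 = norm z ^ (2 * j - 2)"
   unfolding 1 power_add[symmetric] by simp_all
 qed
 have "trace (A ** (a *\<^sub>R ((2 * real j * (z \<bullet> z) ^ (j - 1)) *\<^sub>R mat 1 + (4 * real j * real (j - 1) * (z \<bullet> z) ^ (j - 2)) *\<^sub>R outer z)))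
  = a * ((2 * real j * (z \<bullet> z) ^ (j - 1)) * trace A + (4 * real j * real (j - 1) * (z \<bullet> z) ^ (j - 2)) * (z \<bullet> (A *v z)))"
  by (simp only: trace_mult_scaleR trace_mult_add trace_mat trace_outer mult_1)
 also have "... <= a * ((2 * real j * (z \<bullet> z) ^ (j - 1)) * (real CARD('n) * Lam) + (4 * real j * real (j - 1) * (z \<bullet> z) ^ (j - 2)) * (Lam * (norm z)^2))"
  using a b(2)[of z] b(4) by (intro mult_left_mono add_mono) auto
 also have "... = a * ((2 * real j * (z \<bullet> z) ^ (j - 1)) * (real CARD('n) * Lam) + (4 * real j * real (j - 1)) * Lam * ((z \<bullet> z) ^ (j - 2) * (norm z)^2))"
  by (simp add: mult_ac)
 also have "... = a * Lam * (2 * real j * real CARD('n) + 4 * real j * real (j - 1)) * norm z ^ (2 * j - 2)"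
  unfolding s by (simp add: algebra_simps)
 finally show "trace (A ** (a *\<^sub>R ((2 * real j * (z \<bullet> z) ^ (j - 1)) *\<^sub>R mat 1 + (4 * real j * real (j - 1) * (z \<bullet> z) ^ (j - 2)) *\<^sub>R outer z)))
  <= a * Lam * (2 * real j * real CARD('n) + 4 * real j * real (j - 1)) * norm z ^ (2 * j - 2)" .
qed simp

text \<open>The gradient has order \<open>2 j - 1\<close> and the Hessian order
  \<open>2 j - 2\<close> in the distance to the centre, whence the exponent
  \<open>(2 j - 1) * (1 + \<gamma>) - 1\<close>. For large \<open>j\<close> it is positive even if
  \<gamma> < 0; this is why powers rather than paraboloids are used at critical points.\<close>

lemma power_operator_bound:
 fixes F :: "real^'n^'n => real" and z :: "real^'n"
 assumes F: "elliptic_op lam Lam F" and L: "0 < lam" "lam <= Lam" and j: "j >= 2" and a: "a > 0" and b: "b > 0" and z: "z ~= 0"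
 shows "norm (b *\<^sub>R (a *\<^sub>R ((2 * real j * (z \<bullet> z) ^ (j - 1)) *\<^sub>R z))) powr \<gamma> *
  F (a *\<^sub>R ((2 * real j * (z \<bullet> z) ^ (j - 1)) *\<^sub>R mat 1 + (4 * real j * real (j - 1) * (z \<bullet> z) ^ (j - 2)) *\<^sub>R outer z))
  <= ((2 * real j * a * b) powr \<gamma> * (a * Lam * (2 * real j * real CARD('n) + 4 * real j * real (j - 1)))) * norm z powr ((2 * real j - 1) * (1 + \<gamma>) - 1)"
proof -
 have n0: "norm z > 0" using z by simp
 have zz: "(z \<bullet> z) ^ (j - 1) = norm z ^ (2 * j - 2)"
 proof -
  have "2 * (j - 1) = 2 * j - 2" by simp
  then show ?thesis by (metis power_mult power2_norm_eq_inner)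
 qed
 have "norm (b *\<^sub>R (a *\<^sub>R ((2 * real j * (z \<bullet> z) ^ (j - 1)) *\<^sub>R z))) = (2 * real j * a * b) * norm z ^ (2 * j - 1)"
 proof -
  have "norm z ^ (2 * j - 1) = norm z ^ (2 * j - 2) * norm z" using j by (metis Suc_diff_Suc diff_Suc_1 numeral_2_eq_2 power_Suc2 zero_less_Suc One_nat_def Suc_le_eq le_less_trans lessI mult_2 add_Suc_right Suc_lessD trans_less_add1)
  then show ?thesis unfolding zz using a b by (simp add: mult_ac)
 qed
 also have "... powr \<gamma> = (2 * real j * a * b) powr \<gamma> * norm z powr ((2 * real j - 1) * \<gamma>)"
 proof -
  have "norm z ^ (2 * j - 1) = norm z powr (2 * real j - 1)"
   using n0 j by (subst powr_realpow[symmetric]) (auto simp: of_nat_diff)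
  then show ?thesis using a b j by (simp add: powr_mult powr_powr)
 qed
 finally have 1: "norm (b *\<^sub>R (a *\<^sub>R ((2 * real j * (z \<bullet> z) ^ (j - 1)) *\<^sub>R z))) powr \<gamma> = (2 * real j * a * b) powr \<gamma> * norm z powr ((2 * real j - 1) * \<gamma>)" .
 have 2: "norm z ^ (2 * j - 2) = norm z powr (2 * real j - 2)"
  using n0 j by (subst powr_realpow[symmetric]) (auto simp: of_nat_diff)
 have 3: "norm z powr ((2 * real j - 1) * \<gamma>) * norm z powr (2 * real j - 2) = norm z powr ((2 * real j - 1) * (1 + \<gamma>) - 1)"
  unfolding powr_add[symmetric] by (rule arg_cong[of _ _ "%e. norm z powr e"]) (simp add: algebra_simps)
 have "norm (b *\<^sub>R (a *\<^sub>R ((2 * real j * (z \<bullet> z) ^ (j - 1)) *\<^sub>R z))) powr \<gamma> *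
  F (a *\<^sub>R ((2 * real j * (z \<bullet> z) ^ (j - 1)) *\<^sub>R mat 1 + (4 * real j * real (j - 1) * (z \<bullet> z) ^ (j - 2)) *\<^sub>R outer z))
  <= ((2 * real j * a * b) powr \<gamma> * norm z powr ((2 * real j - 1) * \<gamma>)) * (a * Lam * (2 * real j * real CARD('n) + 4 * real j * real (j - 1)) * norm z ^ (2 * j - 2))"
  unfolding 1 by (intro mult_left_mono power_hessian_bound[OF F L j]) (use a in auto)
 also have "... = ((2 * real j * a * b) powr \<gamma> * (a * Lam * (2 * real j * real CARD('n) + 4 * real j * real (j - 1)))) * (norm z powr ((2 * real j - 1) * \<gamma>) * norm z powr (2 * real j - 2))"
  unfolding 2 by (simp add: mult_ac)
 finally show ?thesis unfolding 3 .
qed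

lemma C21_power_test:
 assumes "C1_on I \<psi> \<psi>'" "open I"
 shows "C21_on (UNIV \<times> I) (%z. (a * ((fst z - y) \<bullet> (fst z - y)) ^ j + l \<bullet> fst z) + \<psi> (snd z))
  (%z. (a *\<^sub>R ((2 * real j * ((fst z - y) \<bullet> (fst z - y)) ^ (j - 1)) *\<^sub>R (fst z - y)) + l) + 0)
  (%z. (a *\<^sub>R ((2 * real j * ((fst z - y) \<bullet> (fst z - y)) ^ (j - 1)) *\<^sub>R mat 1
    + (4 * real j * real (j - 1) * ((fst z - y) \<bullet> (fst z - y)) ^ (j - 2)) *\<^sub>R outer (fst z - y)) + 0) + 0)
  (%z. (a * 0 + 0) + \<psi>' (snd z))"
 by (intro C21_on_add C21_on_cmult C21_on_power C21_on_affine C21_on_time assms)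

lemma constant_if_quadratic_modulus:
 fixes M :: "'a::euclidean_space => real"
 assumes "\<And>x y. x \<in> ball x0 d ==> y \<in> ball x0 d ==> \<bar>M x - M y\<bar> <= C * (norm (x - y))^2" and x: "x \<in> ball x0 d"
 shows "M x = M x0"
proof -
 have x0: "x0 \<in> ball x0 d" using x by (metis ball_empty centre_in_ball empty_iff linorder_not_less)
 have "(M has_derivative (%h. 0)) (at y within ball x0 d)" if y: "y \<in> ball x0 d" for y
 proof -
  have "(M has_derivative (%h. 0)) (at y)" unfolding has_derivative_at_alt
  proof (intro conjI allI impI)
   fix e :: real assume e: "e > 0"
   obtain r where r: "r > 0" "ball y r \<subseteq> ball x0 d" using y open_ball open_contains_ball by blast
   define s where "s = min r (e / (\<bar>C\<bar> + 1))"
   have s: "s > 0" using r e by (simp add: s_def)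
   have "norm (M z - M y - 0) <= e * norm (z - y)" if z: "norm (z - y) < s" for z
   proof -
    have "z \<in> ball x0 d" using r z by (auto simp: s_def dist_norm norm_minus_commute)
    then have "\<bar>M z - M y\<bar> <= C * (norm (z - y))^2" using assms(1) y by blast
    also have "... <= (\<bar>C\<bar> + 1) * (norm (z - y))^2" by (intro mult_right_mono) auto
    also have "... = ((\<bar>C\<bar> + 1) * norm (z - y)) * norm (z - y)" by (simp add: power2_eq_square)
    also have "... <= e * norm (z - y)"
    proof (intro mult_right_mono)
     have "(\<bar>C\<bar> + 1) * norm (z - y) <= (\<bar>C\<bar> + 1) * (e / (\<bar>C\<bar> + 1))" using z by (intro mult_left_mono) (auto simp: s_def)
     then show "(\<bar>C\<bar> + 1) * norm (z - y) <= e" by simp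
    qed simp
    finally show ?thesis by simp
   qed
   then show "\<exists>d>0. \<forall>z. norm (z - y) < d --> norm (M z - M y - 0) <= e * norm (z - y)" using s by blast
  qed simp
  then show ?thesis by (rule has_derivative_at_withinI)
 qed
 then show ?thesis using has_derivative_zero_unique[OF convex_ball] x x0 by blast
qed

text \<open>Clause (ii) of the definition only tests functions that are locally constant in \<open>x\<close>. If
 \<open>A |x - x0|\<^bsup>2j\<^esup> + \<psi>(t)\<close> touches with \<open>\<psi>'(t0) > 0\<close>, then moving the centre \<open>y\<close> the touching point is always
 \<open>x = y\<close> (otherwise clause (i) is violated), so the touching height is locally constant in \<open>y\<close>.\<close>

lemma vsub_of_visc_subsolution:
 fixes F :: "real^'n^'n => real"
 assumes v: "visc_subsolution 1 p 0 \<gamma> F (%_. 0) \<Omega>' u" and O: "open \<Omega>" "\<Omega> \<subseteq> \<Omega>'"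
  and F: "elliptic_op lam Lam F" and L: "0 < lam" "lam <= Lam" and j: "j >= 2" and jg: "(2 * real j - 1) * (1 + \<gamma>) > 1"
 shows "vsub j \<gamma> F p 1 \<Omega> u"
proof -
 have c: "continuous_on \<Omega>' u" and
  i: "\<And>x0 t0 U \<phi> D\<phi> D2\<phi> \<phi>t. (x0, t0) \<in> \<Omega>' ==> open U ==> (x0, t0) \<in> U ==> C21_on U \<phi> D\<phi> D2\<phi> \<phi>t ==>
     \<phi> (x0, t0) = u (x0, t0) ==> (\<forall>z\<in>U \<inter> \<Omega>'. u z <= \<phi> z) ==> 1 *\<^sub>R D\<phi> (x0, t0) + p ~= 0
     ==> \<phi>t (x0, t0) <= ((norm (1 *\<^sub>R D\<phi> (x0, t0) + p))^2 + 0^2) powr (\<gamma> / 2) * F (D2\<phi> (x0, t0)) + 0" and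
  ii: "\<And>x0 t0 \<delta> \<psi> \<psi>'. (x0, t0) \<in> \<Omega>' ==>
     admissible_radius \<Omega>' x0 t0 \<delta> ==> C1_on {t0 - \<delta><..<t0 + \<delta>} \<psi> \<psi>' ==>
     (\<forall>t\<in>time_window \<Omega>' x0 t0 \<delta>. (1 * u (x0, t0) + p \<bullet> x0) - \<psi> t0 >= (1 * u (x0, t) + p \<bullet> x0) - \<psi> t) ==>
     (\<forall>x\<in>ball x0 \<delta>. (SUP t\<in>time_window \<Omega>' x0 t0 \<delta>. ereal ((1 * u (x, t) + p \<bullet> x) - \<psi> t)) = ereal ((1 * u (x0, t0) + p \<bullet> x0) - \<psi> t0))
     ==> \<psi>' t0 <= 1 * 0"
  using v unfolding visc_subsolution_def Let_def prod.case by blast+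
 have first: "\<phi>t (x0, t0) <= norm (p + 1 *\<^sub>R D\<phi> (x0, t0)) powr \<gamma> * F (D2\<phi> (x0, t0))"
  if a: "(x0, t0) \<in> \<Omega>" "open U" "(x0, t0) \<in> U" "C21_on U \<phi> D\<phi> D2\<phi> \<phi>t"
   "\<forall>z\<in>U \<inter> \<Omega>. u z - \<phi> z <= u (x0, t0) - \<phi> (x0, t0)" "p + 1 *\<^sub>R D\<phi> (x0, t0) ~= 0" for x0 t0 U \<phi> D\<phi> D2\<phi> \<phi>t
 proof -
  define k where "k = u (x0, t0) - \<phi> (x0, t0)"
  have "C1_on UNIV (%_. k) (%_. 0)" by (simp add: C1_on_def)
  from C21_on_time[OF this] have "C21_on (U \<inter> \<Omega>) (%z. k) (%_. 0) (%_. 0) (%z. 0)" by (rule C21_on_subset) auto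
  from C21_on_add[OF C21_on_subset[OF a(4)] this]
  have C: "C21_on (U \<inter> \<Omega>) (%z. \<phi> z + k) (%z. D\<phi> z + 0) (%z. D2\<phi> z + 0) (%z. \<phi>t z + 0)" by blast
  have "\<phi>t (x0, t0) + 0 <= ((norm (1 *\<^sub>R (D\<phi> (x0, t0) + 0) + p))^2 + 0^2) powr (\<gamma> / 2) * F (D2\<phi> (x0, t0) + 0) + 0"
  proof (rule i[OF _ _ _ C])
   show "(x0, t0) \<in> \<Omega>'" "open (U \<inter> \<Omega>)" "(x0, t0) \<in> U \<inter> \<Omega>" using a O by auto
   show "\<phi> (x0, t0) + k = u (x0, t0)" by (simp add: k_def)
   show "\<forall>z\<in>U \<inter> \<Omega> \<inter> \<Omega>'. u z <= \<phi> z + k"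
   proof
    fix z assume "z \<in> U \<inter> \<Omega> \<inter> \<Omega>'"
    then have "u z - \<phi> z <= u (x0, t0) - \<phi> (x0, t0)" using a(5) by blast
    then show "u z <= \<phi> z + k" by (simp add: k_def)
   qed
   show "1 *\<^sub>R (D\<phi> (x0, t0) + 0) + p ~= 0" using a(6) by (simp add: add.commute)
  qed
  then show ?thesis unfolding powr_norm_sq by (simp add: add.commute)
 qed
 show ?thesis unfolding vsub_def
 proof (intro conjI allI impI)
  show "continuous_on \<Omega> u" using c O continuous_on_subset by blast
 next
  fix x0 t0 U \<phi> D\<phi> D2\<phi> \<phi>t
  assume "(x0, t0) \<in> \<Omega>" "open U" "(x0, t0) \<in> U" "C21_on U \<phi> D\<phi> D2\<phi> \<phi>t"
   "\<forall>z\<in>U \<inter> \<Omega>. u z - \<phi> z <= u (x0, t0) - \<phi> (x0, t0)" "p + 1 *\<^sub>R D\<phi> (x0, t0) ~= 0"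
  then show "\<phi>t (x0, t0) <= norm (p + 1 *\<^sub>R D\<phi> (x0, t0)) powr \<gamma> * F (D2\<phi> (x0, t0))" by (rule first)
 next
  fix x0 t0 \<delta> \<psi> \<psi>' A
  assume z0: "(x0, t0) \<in> \<Omega>" and d: "\<delta> > (0::real)" and C1: "C1_on {t0 - \<delta><..<t0 + \<delta>} \<psi> \<psi>'" and A: "A >= (0::real)"
   and mx0: "\<forall>x t. (x, t) \<in> \<Omega> --> norm (x - x0) < \<delta> --> \<bar>t - t0\<bar> < \<delta> -->
    1 * u (x, t) + p \<bullet> x - A * norm (x - x0) ^ (2 * j) - \<psi> t <= 1 * u (x0, t0) + p \<bullet> x0 - \<psi> t0"
  define V where "V z = u z + p \<bullet> fst z" for z
  show "\<psi>' t0 <= 0"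
  proof (rule ccontr)
   assume "\<not> \<psi>' t0 <= 0"
   define cc where "cc = \<psi>' t0 / 2"
   have cc: "cc > 0" "\<psi>' t0 = 2 * cc" using \<open>\<not> \<psi>' t0 <= 0\<close> by (auto simp: cc_def)
   \<comment> \<open>Raising \<open>A\<close> to \<open>A + 1\<close> and adding
     \<open>(t - t0)^2\<close> to \<psi> makes the touching strict, so that maxima stay interior
     when the centre moves a little.\<close>
   define A2 where "A2 = A + 1"
   have A2: "A2 > 0" using A by (simp add: A2_def)
   define e where "e = (2 * real j - 1) * (1 + \<gamma>) - 1"
   have e: "e > 0" using jg by (simp add: e_def)
   define C where "C = (2 * real j * A2 * 1) powr \<gamma> * (A2 * Lam * (2 * real j * real CARD('n) + 4 * real j * real (j - 1)))"
   have "((%r. C * r powr e) \<longlongrightarrow> C * 0) (at_right 0)"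
    by (intro tendsto_mult tendsto_const tendsto_zero_powrI[OF tendsto_ident_at tendsto_const _ e])
     (auto simp: eventually_at_right_field intro!: exI[of _ 1])
   then have "eventually (%r. C * r powr e < cc) (at_right 0)" using cc(1) by (auto dest: order_tendstoD(2))
   then obtain r0 where r0: "r0 > 0" "\<And>r. 0 < r ==> r < r0 ==> C * r powr e < cc" unfolding eventually_at_right_field by auto
   have "isCont \<psi>' t0" using C1 d unfolding C1_on_def by (auto simp: continuous_on_eq_continuous_at)
   then obtain d1 where d1: "d1 > 0" "\<And>t. \<bar>t - t0\<bar> < d1 ==> \<bar>\<psi>' t - \<psi>' t0\<bar> < cc / 2"
    using cc unfolding continuous_at_eps_delta dist_real_def by (metis half_gt_zero)
   obtain d2 where d2: "d2 > 0" "ball (x0, t0) d2 \<subseteq> \<Omega>" using O(1) z0 open_contains_ball by blast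
   define s where "s = min (min (\<delta> / 2) (r0 / 4)) (min (min (d1 / 2) (d2 / 4)) (cc / 8))"
   have s: "s > 0" "s <= \<delta> / 2" "s <= r0 / 4" "s <= d1 / 2" "s <= d2 / 4" "s <= cc / 8"
    using d r0(1) d1(1) d2(1) cc(1) by (simp_all add: s_def min.coboundedI1 min.coboundedI2)
   define \<psi>2 where "\<psi>2 t = \<psi> t + (t - t0)^2" for t
   define \<psi>2' where "\<psi>2' t = \<psi>' t + 2 * (t - t0)" for t
   have C1': "C1_on {t0 - \<delta><..<t0 + \<delta>} \<psi>2 \<psi>2'"
    using C1 unfolding C1_on_def \<psi>2_def \<psi>2'_def by (auto intro!: derivative_eq_intros continuous_intros)
   have p2: "\<psi>2' t > cc" if "\<bar>t - t0\<bar> <= s" for t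
   proof -
    have "\<bar>\<psi>' t - \<psi>' t0\<bar> < cc / 2" using d1(1) that s by (intro d1(2)) linarith
    then have 1: "\<psi>' t > 2 * cc - cc / 2" unfolding cc(2) abs_less_iff by simp
    have "t - t0 >= - (cc / 8)" using that s(6) by (simp add: abs_le_iff)
    then have "2 * (t - t0) >= - (cc / 4)" by simp
    moreover have "2 * cc - cc / 2 - cc / 4 > cc" using cc(1) by simp
    ultimately show ?thesis using 1 unfolding \<psi>2'_def by linarith
   qed
   define K where "K = cball x0 s \<times> {t0 - s..t0 + s}"
   have KO: "(x, t) \<in> \<Omega>" if "norm (x - x0) <= s" "\<bar>t - t0\<bar> <= s" for x t
   proof -
    have "norm (x0 - x, t0 - t) <= norm (x0 - x) + \<bar>t0 - t\<bar>" using norm_Pair_le[of "x0 - x" "t0 - t"] by simp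
    then have "dist (x0, t0) (x, t) < d2" using that s d2(1) unfolding dist_norm by (simp add: norm_minus_commute abs_minus_commute)
    then show ?thesis using d2 by auto
   qed
   have Kin: "(x, t) \<in> K \<longleftrightarrow> norm (x - x0) <= s & \<bar>t - t0\<bar> <= s" for x t
    by (auto simp: K_def dist_norm norm_minus_commute abs_le_iff)
   have Ksub: "K \<subseteq> \<Omega>" using KO Kin by auto
   have Kcomp: "compact K" unfolding K_def by (intro compact_Times) auto
   have "continuous_on {t0 - \<delta><..<t0 + \<delta>} \<psi>2" using C1' unfolding C1_on_def
    by (meson DERIV_continuous_on DERIV_subset subset_UNIV)
   then have contp: "continuous_on {t0 - s..t0 + s} \<psi>2" by (rule continuous_on_subset) (use s d in auto)
   have contV: "continuous_on K V" unfolding V_def using c O Ksub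
    by (intro continuous_intros) (auto intro: continuous_on_subset)
   define G where "G y z = V z - A2 * norm (fst z - y) ^ (2 * j) - \<psi>2 (snd z)" for y z
   have contG: "continuous_on K (G y)" for y unfolding G_def
    by (intro continuous_intros contV continuous_on_compose2[OF contp, of _ snd]) (auto simp: K_def)
   have Gub: "G x0 (x, t) <= V (x0, t0) - \<psi> t0 - norm (x - x0) ^ (2 * j) - (t - t0)^2" if "(x, t) \<in> K" for x t
    using mx0[rule_format, of x t] that s d KO[of x t] unfolding Kin G_def V_def \<psi>2_def A2_def by (simp add: algebra_simps)
   have G0: "G x0 (x0, t0) = V (x0, t0) - \<psi> t0" using j by (simp add: G_def \<psi>2_def)
   have zp: "(0::real) ^ (2 * j) = 0" using j by simp
   \<comment> \<open>The strictness gained on the boundary of \<open>K\<close>. Centres within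
     \<open>d3\<close> of \<open>x0\<close> change the function by less than a quarter of
     it.\<close>
   define \<mu> where "\<mu> = min (s ^ (2 * j)) (s^2)"
   have mu: "\<mu> > 0" using s by (simp add: \<mu>_def)
   have bd: "G x0 (x, t) <= G x0 (x0, t0) - \<mu>" if "(x, t) \<in> K" "norm (x - x0) = s | \<bar>t - t0\<bar> = s" for x t
   proof -
    have m: "\<mu> <= s ^ (2 * j)" "\<mu> <= s^2" by (auto simp: \<mu>_def)
    have n: "0 <= norm (x - x0) ^ (2 * j)" "0 <= (t - t0)^2" by auto
    from that(2) show ?thesis
    proof
     assume "norm (x - x0) = s"
     then have "norm (x - x0) ^ (2 * j) = s ^ (2 * j)" by simp
     then show ?thesis using Gub[OF that(1)] G0 m n by linarith
    next
     assume "\<bar>t - t0\<bar> = s"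
     then have "(t - t0)^2 = s^2" by (metis power2_abs)
     then show ?thesis using Gub[OF that(1)] G0 m n by linarith
    qed
   qed
   have "uniformly_continuous_on (cball (0::real^'n) (2 * s)) (%x. A2 * norm x ^ (2 * j))"
    by (intro compact_uniformly_continuous continuous_intros) auto
   moreover have "\<mu> / 4 > 0" using mu by simp
   ultimately obtain \<eta> where eta1: "\<eta> > 0" "\<forall>x\<in>cball (0::real^'n) (2 * s). \<forall>y\<in>cball 0 (2 * s). dist y x < \<eta> -->
     dist (A2 * norm y ^ (2 * j)) (A2 * norm x ^ (2 * j)) < \<mu> / 4"
    unfolding uniformly_continuous_on_def by blast
   have eta: "\<eta> > 0" "norm x <= 2 * s ==> norm y <= 2 * s ==> dist y x < \<eta> ==>
     dist (A2 * norm y ^ (2 * j)) (A2 * norm x ^ (2 * j)) < \<mu> / 4" for x y :: "real^'n"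
    using eta1 by auto
   define d3 where "d3 = min (min s \<eta>) (1 / (A + 2))"
   have d3: "d3 > 0" "d3 <= s" "d3 <= \<eta>" "d3 <= 1 / (A + 2)" using s(1) eta(1) A by (simp_all add: d3_def min.coboundedI1)
   have Gy: "\<bar>G y z - G x0 z\<bar> < \<mu> / 4" if "norm (y - x0) < d3" "z \<in> K" for y z
   proof -
    have "norm (fst z - x0) <= s" using that(2) Kin[of "fst z" "snd z"] by simp
    moreover have "norm (fst z - y) <= norm (fst z - x0) + norm (y - x0)" using norm_triangle_ineq4[of "fst z - x0" "y - x0"] by simp
    ultimately have "dist (A2 * norm (fst z - y) ^ (2 * j)) (A2 * norm (fst z - x0) ^ (2 * j)) < \<mu> / 4"
     using that(1) d3 s(1) by (intro eta(2)) (auto simp: dist_norm norm_minus_commute)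
    then show ?thesis by (simp add: G_def dist_real_def abs_minus_commute)
   qed
   have key: "\<exists>t. \<bar>t - t0\<bar> < s & (\<forall>z\<in>K. G y z <= V (y, t) - \<psi>2 t)" if y: "norm (y - x0) < d3" for y
   proof -
    have "K ~= {}" using s(1) by (auto simp: K_def)
    then obtain z where z: "z \<in> K" "\<forall>z'\<in>K. G y z' <= G y z" using continuous_attains_sup[OF Kcomp _ contG] by blast
    obtain x t where xt: "z = (x, t)" by (cases z)
    have x0K: "(x0, t0) \<in> K" using s(1) by (simp add: Kin)
    have "G y (x0, t0) <= G y z" using z(2) x0K by blast
    then have "G y z >= G x0 (x0, t0) - \<mu> / 4" using Gy[OF y x0K] by linarith
    then have "G x0 z > G x0 (x0, t0) - \<mu>" using Gy[OF y z(1)] mu by linarith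
    then have int: "norm (x - x0) < s" "\<bar>t - t0\<bar> < s" using bd[of x t] z(1) Kin[of x t] xt by force+
    \<comment> \<open>Off the centre the gradient is not critical and the operator is below
      \<open>cc\<close> by the choice of \<open>r0\<close>, whereas the time derivative exceeds
      \<open>cc\<close>.\<close>
    have "x = y"
    proof (rule ccontr)
     assume ne: "x ~= y"
     define I where "I = {t0 - s<..<t0 + s}"
     have CI: "C1_on I \<psi>2 \<psi>2'" using C1' s d unfolding C1_on_def I_def by (auto intro: continuous_on_subset)
     define U where "U = ball x0 s \<times> I"
     note CT = C21_on_subset[OF C21_power_test[OF CI, of A2 y j "- p"], of U]
     have "(A2 * 0 + 0) + \<psi>2' (snd (x, t)) <= norm (p + 1 *\<^sub>R ((A2 *\<^sub>R ((2 * real j * ((fst (x, t) - y) \<bullet> (fst (x, t) - y)) ^ (j - 1)) *\<^sub>R (fst (x, t) - y)) + - p) + 0)) powr \<gamma> *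
      F ((A2 *\<^sub>R ((2 * real j * ((fst (x, t) - y) \<bullet> (fst (x, t) - y)) ^ (j - 1)) *\<^sub>R mat 1
    + (4 * real j * real (j - 1) * ((fst (x, t) - y) \<bullet> (fst (x, t) - y)) ^ (j - 2)) *\<^sub>R outer (fst (x, t) - y)) + 0) + 0)"
     proof (rule first[OF _ _ _ CT])
      show "(x, t) \<in> \<Omega>" using Ksub z(1) xt by auto
      show "open U" "open I" "U \<subseteq> UNIV \<times> I" by (auto simp: U_def I_def open_Times)
      show "(x, t) \<in> U" using int by (auto simp: U_def I_def dist_norm norm_minus_commute abs_less_iff)
      show "\<forall>z\<in>U \<inter> \<Omega>. u z - ((A2 * ((fst z - y) \<bullet> (fst z - y)) ^ j + - p \<bullet> fst z) + \<psi>2 (snd z))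
        <= u (x, t) - ((A2 * ((fst (x, t) - y) \<bullet> (fst (x, t) - y)) ^ j + - p \<bullet> fst (x, t)) + \<psi>2 (snd (x, t)))"
      proof
       fix z' assume "z' \<in> U \<inter> \<Omega>"
       then have "z' \<in> K" by (auto simp: U_def I_def K_def)
       then have "G y z' <= G y z" using z(2) by blast
       moreover have "norm w ^ (2 * j) = (w \<bullet> w) ^ j" for w :: "real^'n" by (simp add: power_mult power2_norm_eq_inner)
       ultimately show "u z' - ((A2 * ((fst z' - y) \<bullet> (fst z' - y)) ^ j + - p \<bullet> fst z') + \<psi>2 (snd z'))
        <= u (x, t) - ((A2 * ((fst (x, t) - y) \<bullet> (fst (x, t) - y)) ^ j + - p \<bullet> fst (x, t)) + \<psi>2 (snd (x, t)))"
        unfolding xt by (simp add: G_def V_def)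
      qed
      show "p + 1 *\<^sub>R ((A2 *\<^sub>R ((2 * real j * ((fst (x, t) - y) \<bullet> (fst (x, t) - y)) ^ (j - 1)) *\<^sub>R (fst (x, t) - y)) + - p) + 0) ~= 0"
       using ne A2 j by simp
     qed
     then have "\<psi>2' t <= norm (1 *\<^sub>R (A2 *\<^sub>R ((2 * real j * ((x - y) \<bullet> (x - y)) ^ (j - 1)) *\<^sub>R (x - y)))) powr \<gamma> *
      F (A2 *\<^sub>R ((2 * real j * ((x - y) \<bullet> (x - y)) ^ (j - 1)) *\<^sub>R mat 1
    + (4 * real j * real (j - 1) * ((x - y) \<bullet> (x - y)) ^ (j - 2)) *\<^sub>R outer (x - y)))"
      by (simp only: fst_conv snd_conv add_0_right add_0_left mult_zero_right scaleR_one) simp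
     also have "... <= C * norm (x - y) powr e" unfolding C_def e_def
      by (rule power_operator_bound[OF F L j A2]) (use ne in auto)
     also have "... < cc"
     proof (rule r0(2))
      show "0 < norm (x - y)" using ne by simp
      have "norm (x - y) <= norm (x - x0) + norm (y - x0)" using norm_triangle_ineq4[of "x - x0" "y - x0"] by simp
      then show "norm (x - y) < r0" using int y d3 s r0(1) by linarith
     qed
     finally show False using p2[of t] int by simp
    qed
    then have "G y z = V (y, t) - \<psi>2 t" using xt j by (simp add: G_def)
    then show ?thesis using z(2) int(2) by (intro exI[of _ t]) auto
   qed
   then obtain \<tau> where tau: "\<And>y. norm (y - x0) < d3 ==> \<bar>\<tau> y - t0\<bar> < s"
    "\<And>y z. norm (y - x0) < d3 ==> z \<in> K ==> G y z <= V (y, \<tau> y) - \<psi>2 (\<tau> y)" by metis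
   define M where "M y = V (y, \<tau> y) - \<psi>2 (\<tau> y)" for y
   \<comment> \<open>The maximum for the centre \<open>y\<close> dominates the value at the touching
     point that belongs to the centre \<open>x\<close>; exchanging the two gives a modulus of order
     \<open>2 j\<close>.\<close>
   have M1: "M x - A2 * norm (x - y) ^ (2 * j) <= M y" if "norm (x - x0) < d3" "norm (y - x0) < d3" for x y
   proof -
    have "(x, \<tau> x) \<in> K" using tau(1)[OF that(1)] that d3 by (simp add: Kin)
    from tau(2)[OF that(2) this] show ?thesis by (simp add: M_def G_def)
   qed
   have d31: "d3 <= 1/2" using d3(4) A by (meson divide_left_mono le_add_same_cancel2 mult_pos_pos order_trans zero_le_one add_nonneg_pos zero_less_numeral)
   have Mconst: "M y = M x0" if y: "norm (y - x0) < d3" for y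
   proof (rule constant_if_quadratic_modulus[of x0 d3 M A2])
    fix x y assume "x \<in> ball x0 d3" "y \<in> ball x0 d3"
    then have xy: "norm (x - x0) < d3" "norm (y - x0) < d3" by (auto simp: dist_norm norm_minus_commute)
    have "norm (x - y) <= norm (x - x0) + norm (y - x0)" using norm_triangle_ineq4[of "x - x0" "y - x0"] by simp
    then have "norm (x - y) <= 1" using xy d31 by linarith
    then have "norm (x - y) ^ (2 * j) <= norm (x - y) ^ 2" using j by (intro power_decreasing) auto
    then have "A2 * norm (x - y) ^ (2 * j) <= A2 * (norm (x - y))^2" using A2 by simp
    then show "\<bar>M x - M y\<bar> <= A2 * (norm (x - y))^2" using M1[OF xy] M1[OF xy(2,1)] by (simp add: norm_minus_commute[of y x] abs_le_iff)
   qed (use y in \<open>simp add: dist_norm norm_minus_commute\<close>)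
   have Mx0: "M x0 = V (x0, t0) - \<psi> t0"
   proof -
    have "(x0, t0) \<in> K" using s(1) by (simp add: Kin)
    from tau(2)[OF _ this, of x0] have "G x0 (x0, t0) <= M x0" using d3 by (simp add: M_def)
    moreover have "(x0, \<tau> x0) \<in> K" using tau(1)[of x0] d3 s(1) by (simp add: Kin)
    from Gub[OF this] have "M x0 <= V (x0, t0) - \<psi> t0 - (\<tau> x0 - t0)^2" by (simp add: M_def G_def zp)
    ultimately show ?thesis using G0 zero_le_power2[of "\<tau> x0 - t0"] by linarith
   qed
   \<comment> \<open>Clause (ii) asks for the same supremum at every \<open>x\<close> over one short
     time window, so the touching time must lie within \<open>d3\<close> of \<open>t0\<close>. The
     bound \<open>d3 <= 1 / (A + 2)\<close> achieves this.\<close>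
   have tclose: "\<bar>\<tau> y - t0\<bar> < d3" if y: "norm (y - x0) < d3" for y
   proof -
    have yK: "(y, \<tau> y) \<in> K" using tau(1)[OF y] y d3 by (simp add: Kin)
    have "G x0 (y, \<tau> y) = M y - A2 * norm (y - x0) ^ (2 * j)" by (simp add: M_def G_def)
    then have "M y - A2 * norm (y - x0) ^ (2 * j) <= V (x0, t0) - \<psi> t0 - norm (y - x0) ^ (2 * j) - (\<tau> y - t0)^2" using Gub[OF yK] by simp
    then have "(\<tau> y - t0)^2 <= A * norm (y - x0) ^ (2 * j)" using Mconst[OF y] Mx0 by (simp add: A2_def algebra_simps)
    also have "... <= A * norm (y - x0) ^ 4" using A j y d31 by (intro mult_left_mono power_decreasing) auto
    also have "... <= A * d3 ^ 4" using y A by (intro mult_left_mono power_mono) auto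
    also have "... < d3^2"
    proof -
     have "A * d3 <= A * (1 / (A + 2))" using d3 A by (intro mult_left_mono) auto
     also have "... < 1" using A by simp
     finally have "A * d3 < 1" .
     then have "(A * d3) * (d3 * d3^2) < 1 * (d3 * d3^2)" using d3(1) by (intro mult_strict_right_mono) auto
     also have "... <= 1 * (1 * d3^2)" using d31 d3(1) by (intro mult_left_mono mult_right_mono) auto
     finally show ?thesis by (simp add: power2_eq_square eval_nat_numeral mult_ac)
    qed
    finally show ?thesis using d3(1) by (metis abs_le_square_iff abs_of_pos linorder_not_less)
   qed
   have KO': "(x, t) \<in> \<Omega>'" if "norm (x - x0) < d3" "\<bar>t - t0\<bar> < d3" for x t
    using KO[of x t] that d3 O by auto
   have tw: "time_window \<Omega>' x0 t0 d3 = {t0 - d3<..<t0 + d3}"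
    unfolding time_window_def using KO'[of x0] d3(1) by (auto simp: abs_less_iff)
   have adm: "admissible_radius \<Omega>' x0 t0 d3" unfolding admissible_radius_def
    using d3(1) KO' by (auto simp: dist_norm norm_minus_commute abs_less_iff)
   have "\<psi>2' t0 <= 1 * 0"
   proof (rule ii[OF _ adm])
    show "(x0, t0) \<in> \<Omega>'" using z0 O by auto
    show "C1_on {t0 - d3<..<t0 + d3} \<psi>2 \<psi>2'" using C1' d3 s d unfolding C1_on_def by (auto intro: continuous_on_subset)
    have Vle: "V (x, t) - \<psi>2 t <= V (x0, t0) - \<psi> t0" if "norm (x - x0) < d3" "\<bar>t - t0\<bar> < d3" for x t
    proof -
     have "(x, t) \<in> K" using that d3 by (simp add: Kin)
     from tau(2)[OF that(1) this] show ?thesis using Mconst[OF that(1)] Mx0 by (simp add: M_def G_def zp)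
    qed
    show "\<forall>t\<in>time_window \<Omega>' x0 t0 d3. (1 * u (x0, t0) + p \<bullet> x0) - \<psi>2 t0 >= (1 * u (x0, t) + p \<bullet> x0) - \<psi>2 t"
     unfolding tw using Vle[of x0] d3(1) by (auto simp: V_def \<psi>2_def abs_less_iff)
    show "\<forall>x\<in>ball x0 d3. (SUP t\<in>time_window \<Omega>' x0 t0 d3. ereal ((1 * u (x, t) + p \<bullet> x) - \<psi>2 t)) = ereal ((1 * u (x0, t0) + p \<bullet> x0) - \<psi>2 t0)"
    proof
     fix x assume "x \<in> ball x0 d3"
     then have x: "norm (x - x0) < d3" by (simp add: dist_norm norm_minus_commute)
     show "(SUP t\<in>time_window \<Omega>' x0 t0 d3. ereal ((1 * u (x, t) + p \<bullet> x) - \<psi>2 t)) = ereal ((1 * u (x0, t0) + p \<bullet> x0) - \<psi>2 t0)"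
      unfolding tw
     proof (rule antisym)
      show "(SUP t\<in>{t0 - d3<..<t0 + d3}. ereal ((1 * u (x, t) + p \<bullet> x) - \<psi>2 t)) <= ereal ((1 * u (x0, t0) + p \<bullet> x0) - \<psi>2 t0)"
       using Vle[OF x] by (intro SUP_least) (auto simp: V_def \<psi>2_def abs_less_iff)
      have "ereal ((1 * u (x0, t0) + p \<bullet> x0) - \<psi>2 t0) = ereal ((1 * u (x, \<tau> x) + p \<bullet> x) - \<psi>2 (\<tau> x))"
       using Mconst[OF x] Mx0 by (simp add: M_def V_def \<psi>2_def)
      also have "... <= (SUP t\<in>{t0 - d3<..<t0 + d3}. ereal ((1 * u (x, t) + p \<bullet> x) - \<psi>2 t))"
       using tclose[OF x] by (intro SUP_upper) (auto simp: abs_less_iff)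
      finally show "ereal ((1 * u (x0, t0) + p \<bullet> x0) - \<psi>2 t0) <= (SUP t\<in>{t0 - d3<..<t0 + d3}. ereal ((1 * u (x, t) + p \<bullet> x) - \<psi>2 t))" .
     qed
    qed
   qed
   then show False using cc by (simp add: \<psi>2'_def)
  qed
 qed
qed

text \<open>The old argument \<open>q + \<theta> Du\<close> is \<open>m\<close> times the new one,
  which moves the factor \<open>m powr \<gamma>\<close> into the operator. If
  \<open>T * m powr \<gamma> = r^2\<close>, as in \<open>slope_step_aux\<close>, the new operator is
  a mere scaling of \<open>F\<close> and keeps its ellipticity constants.\<close>

lemma vsub_transform:
 fixes u :: "(real^'n) \<times> real => real"
 assumes u: "vsub j \<gamma> F q \<theta> \<Omega> u" and pos: "c > 0" "r > 0" "T > 0" "m > 0" "\<theta> > 0"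
 shows "vsub j \<gamma> (%M. c * T * m powr \<gamma> * F ((1 / (c * r^2)) *\<^sub>R M)) ((1/m) *\<^sub>R (q - (\<theta> / (c * r)) *\<^sub>R l)) (\<theta> / (c * r * m))
  {z. (r *\<^sub>R fst z, T * snd z) \<in> \<Omega>} (%z. c * u (r *\<^sub>R fst z, T * snd z) + l \<bullet> fst z)"
  (is "vsub j \<gamma> ?F ?q ?\<theta> ?O ?w")
 unfolding vsub_def
proof (intro conjI allI impI)
 show "continuous_on ?O ?w"
  by (intro continuous_intros continuous_on_compose2[OF vsubD_cont[OF u]]) auto
next
 fix x0 t0 U \<phi> D\<phi> D2\<phi> \<phi>t
 assume z: "(x0, t0) \<in> ?O" and U: "open U" "(x0, t0) \<in> U" and C: "C21_on U \<phi> D\<phi> D2\<phi> \<phi>t"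
  and mx: "\<forall>z\<in>U \<inter> ?O. ?w z - \<phi> z <= ?w (x0, t0) - \<phi> (x0, t0)" and ne: "?q + ?\<theta> *\<^sub>R D\<phi> (x0, t0) ~= 0"
 define \<sigma> where "\<sigma> z = ((1/r) *\<^sub>R fst z, (1/T) * snd z)" for z :: "(real^'n) \<times> real"
 define U' where "U' = \<sigma> -` U"
 have cs: "continuous_on A \<sigma>" for A unfolding \<sigma>_def by (intro continuous_intros)
 have oU: "open U'" unfolding U'_def by (rule open_vimage[OF U(1) cs])
 have s0: "\<sigma> (r *\<^sub>R x, T * t) = (x, t)" for x t using pos by (simp add: \<sigma>_def)
 define P where "P z = (1/c) * (\<phi> (\<sigma> z) - l \<bullet> fst (\<sigma> z))" for z
 define DP where "DP z = (1/(c*r)) *\<^sub>R (D\<phi> (\<sigma> z) - l)" for z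
 define D2P where "D2P z = (1 / (c * r^2)) *\<^sub>R D2\<phi> (\<sigma> z)" for z
 define Pt where "Pt z = (1 / (c*T)) * \<phi>t (\<sigma> z)" for z
 have CP: "C21_on U' P DP D2P Pt" unfolding C21_on_def
 proof (intro conjI ballI, clarify)
  fix x t assume "(x, t) \<in> U'"
  then have in': "((1/r) *\<^sub>R x, (1/T) * t) \<in> U" by (simp add: U'_def \<sigma>_def)
  have d: "((%y. \<phi> (y, (1/T) * t)) has_derivative (%h. D\<phi> ((1/r) *\<^sub>R x, (1/T) * t) \<bullet> h)) (at ((1/r) *\<^sub>R x))"
   "((%y. D\<phi> (y, (1/T) * t)) has_derivative (%h. D2\<phi> ((1/r) *\<^sub>R x, (1/T) * t) *v h)) (at ((1/r) *\<^sub>R x))"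
   "((%s. \<phi> ((1/r) *\<^sub>R x, s)) has_real_derivative \<phi>t ((1/r) *\<^sub>R x, (1/T) * t)) (at ((1/T) * t))"
   using C in' unfolding C21_on_def by blast+
  have sc: "((%y. (1/r) *\<^sub>R y) has_derivative (%h. (1/r) *\<^sub>R h)) (at x)" by (auto intro!: derivative_eq_intros)
  have 1: "((%y. P (y, t)) has_derivative (%h. DP (x, t) \<bullet> h)) (at x)"
   unfolding P_def DP_def \<sigma>_def fst_conv snd_conv
   by (rule has_derivative_eq_rhs[OF has_derivative_mult_right[OF has_derivative_diff[OF has_derivative_compose[OF sc d(1)] has_derivative_inner_right[OF sc]]]])
    (simp add: fun_eq_iff inner_diff_left divide_simps)
  have 2: "((%y. DP (y, t)) has_derivative (%h. D2P (x, t) *v h)) (at x)"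
   unfolding DP_def D2P_def \<sigma>_def fst_conv snd_conv
   by (rule has_derivative_eq_rhs[OF has_derivative_scaleR_right[OF has_derivative_diff[OF has_derivative_compose[OF sc d(2)] has_derivative_const]]])
    (simp add: fun_eq_iff scaleR_matrix_mult matrix_vector_mult_scaleR power2_eq_square mult_ac)
  have 3: "((%s. P (x, s)) has_real_derivative Pt (x, t)) (at t)"
  proof -
   have "((%s. \<phi> ((1/r) *\<^sub>R x, (1/T) * s)) has_real_derivative \<phi>t ((1/r) *\<^sub>R x, (1/T) * t) * (1/T)) (at t)"
    by (rule DERIV_chain2[where f="%s. \<phi> ((1/r) *\<^sub>R x, s)" and g="%s. (1/T) * s" and x=t, OF d(3)]) (use pos in \<open>auto intro!: derivative_eq_intros\<close>)
   from DERIV_cmult[OF DERIV_diff[OF this DERIV_const[of "l \<bullet> ((1/r) *\<^sub>R x)"]], of "1/c"]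
   show ?thesis unfolding P_def Pt_def \<sigma>_def fst_conv snd_conv by (simp add: mult_ac)
  qed
  show "((%y. P (y, t)) has_derivative (%h. DP (x, t) \<bullet> h)) (at x) &
   ((%y. DP (y, t)) has_derivative (%h. D2P (x, t) *v h)) (at x) & ((%s. P (x, s)) has_real_derivative Pt (x, t)) (at t)"
   using 1 2 3 by blast
 next
  have cc: "continuous_on U' (%z. f (\<sigma> z))" if "continuous_on U f" for f :: "(real^'n) \<times> real => 'z::topological_space"
   by (rule continuous_on_compose2[OF that cs]) (auto simp: U'_def)
  have cs': "continuous_on U' (%z. fst (\<sigma> z))" by (intro continuous_intros cs)
  have cU: "continuous_on U \<phi>" "continuous_on U D\<phi>" "continuous_on U D2\<phi>" "continuous_on U \<phi>t" using C unfolding C21_on_def by auto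
  show "continuous_on U' P" unfolding P_def by (intro continuous_intros cc cs' cU)
  show "continuous_on U' DP" unfolding DP_def by (intro continuous_intros cc cs' cU)
  show "continuous_on U' D2P" unfolding D2P_def by (intro continuous_intros cc cs' cU)
  show "continuous_on U' Pt" unfolding Pt_def by (intro continuous_intros cc cs' cU)
 qed
 define X0 where "X0 = r *\<^sub>R x0"
 define T0 where "T0 = T * t0"
 have sX: "\<sigma> (X0, T0) = (x0, t0)" by (simp add: X0_def T0_def s0)
 have qe: "q + \<theta> *\<^sub>R DP (X0, T0) = m *\<^sub>R (?q + ?\<theta> *\<^sub>R D\<phi> (x0, t0))"
  unfolding DP_def sX using pos by (simp add: algebra_simps)
 have "Pt (X0, T0) <= norm (q + \<theta> *\<^sub>R DP (X0, T0)) powr \<gamma> * F (D2P (X0, T0))"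
 proof (rule vsubD[OF u _ oU _ CP])
  show "(X0, T0) \<in> \<Omega>" using z by (simp add: X0_def T0_def)
  show "(X0, T0) \<in> U'" using U(2) by (simp add: U'_def sX)
  show "q + \<theta> *\<^sub>R DP (X0, T0) ~= 0" unfolding qe using ne pos by simp
  fix y assume y: "y \<in> U'" "y \<in> \<Omega>"
  have ys: "(r *\<^sub>R fst (\<sigma> y), T * snd (\<sigma> y)) = y" using pos by (simp add: \<sigma>_def)
  have "\<sigma> y \<in> U \<inter> ?O" using y ys by (simp add: U'_def)
  then have "?w (\<sigma> y) - \<phi> (\<sigma> y) <= ?w (x0, t0) - \<phi> (x0, t0)" using mx by blast
  then have "c * (u y - P y) <= c * (u (X0, T0) - P (X0, T0))"
   unfolding ys P_def sX using pos by (simp add: X0_def T0_def right_diff_distrib)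
  then show "u y - P y <= u (X0, T0) - P (X0, T0)" using pos by simp
 qed
 then have "\<phi>t (x0, t0) <= c * T * (norm (m *\<^sub>R (?q + ?\<theta> *\<^sub>R D\<phi> (x0, t0))) powr \<gamma> * F ((1 / (c * r^2)) *\<^sub>R D2\<phi> (x0, t0)))"
  unfolding qe D2P_def Pt_def sX using pos by (simp add: field_simps)
 also have "norm (m *\<^sub>R (?q + ?\<theta> *\<^sub>R D\<phi> (x0, t0))) powr \<gamma> = m powr \<gamma> * norm (?q + ?\<theta> *\<^sub>R D\<phi> (x0, t0)) powr \<gamma>"
  unfolding norm_scaleR using pos by (simp add: powr_mult)
 finally show "\<phi>t (x0, t0) <= norm (?q + ?\<theta> *\<^sub>R D\<phi> (x0, t0)) powr \<gamma> * (c * T * m powr \<gamma> * F ((1 / (c * r^2)) *\<^sub>R D2\<phi> (x0, t0)))"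
  by (simp only: mult_ac)
next
 fix x0 t0 \<delta> \<psi> \<psi>' A
 assume z: "(x0, t0) \<in> ?O" and d: "\<delta> > (0::real)" and C1: "C1_on {t0 - \<delta><..<t0 + \<delta>} \<psi> \<psi>'" and A: "A >= (0::real)"
  and mx: "\<forall>x t. (x, t) \<in> ?O --> norm (x - x0) < \<delta> --> \<bar>t - t0\<bar> < \<delta> -->
    ?\<theta> * ?w (x, t) + ?q \<bullet> x - A * norm (x - x0) ^ (2 * j) - \<psi> t <= ?\<theta> * ?w (x0, t0) + ?q \<bullet> x0 - \<psi> t0"
 have V: "?\<theta> * ?w (x, t) + ?q \<bullet> x = (\<theta> * u (r *\<^sub>R x, T * t) + q \<bullet> (r *\<^sub>R x)) / (r * m)" for x t
  using pos by (simp add: inner_diff_left field_simps)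
 define e where "e = min (r * \<delta>) (T * \<delta>)"
 have e: "e > 0" "e <= r * \<delta>" "e <= T * \<delta>" using pos d by (auto simp: e_def)
 define \<Psi> where "\<Psi> s = r * m * \<psi> ((1/T) * s)" for s
 define \<Psi>' where "\<Psi>' s = (r * m / T) * \<psi>' ((1/T) * s)" for s
 have tin: "(1/T) * s \<in> {t0 - \<delta><..<t0 + \<delta>}" if "s \<in> {T * t0 - e<..<T * t0 + e}" for s
 proof -
  have "T * (t0 - \<delta>) < s" "s < T * (t0 + \<delta>)" using that e by (auto simp: algebra_simps)
  then show ?thesis using pos(3) by (simp add: field_simps)
 qed
 have C1': "C1_on {T * t0 - e<..<T * t0 + e} \<Psi> \<Psi>'" unfolding C1_on_def
 proof (intro conjI ballI)
  fix s assume "s \<in> {T * t0 - e<..<T * t0 + e}"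
  then have "(\<psi> has_real_derivative \<psi>' ((1/T) * s)) (at ((1/T) * s))" using C1 tin unfolding C1_on_def by blast
  moreover have "((%s. (1/T) * s) has_real_derivative 1/T) (at s)" using pos by (auto intro!: derivative_eq_intros)
  ultimately have "((%s. \<psi> ((1/T) * s)) has_real_derivative \<psi>' ((1/T) * s) * (1/T)) (at s)"
   by (rule DERIV_chain2[where f=\<psi> and g="%s. (1/T) * s"])
  note dd = DERIV_cmult[OF this, of "r * m"]
  have eq: "\<Psi> = (%s. r * m * \<psi> ((1/T) * s))" by (rule ext) (simp only: \<Psi>_def)
  show "(\<Psi> has_real_derivative \<Psi>' s) (at s)" unfolding eq
   by (rule DERIV_cong[OF dd]) (simp add: \<Psi>'_def)
 next
  have "continuous_on {T * t0 - e<..<T * t0 + e} (%s. \<psi>' ((1/T) * s))"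
  proof (rule continuous_on_compose2[of "{t0 - \<delta><..<t0 + \<delta>}" \<psi>' _ "%s. (1/T) * s"])
   show "continuous_on {t0 - \<delta><..<t0 + \<delta>} \<psi>'" using C1 by (simp add: C1_on_def)
   show "continuous_on {T * t0 - e<..<T * t0 + e} (%s. (1/T) * s)" by (intro continuous_intros)
   show "(%s. (1/T) * s) ` {T * t0 - e<..<T * t0 + e} \<subseteq> {t0 - \<delta><..<t0 + \<delta>}" using tin by blast
  qed
  then show "continuous_on {T * t0 - e<..<T * t0 + e} \<Psi>'" unfolding \<Psi>'_def by (intro continuous_intros)
 qed
 have zO: "(r *\<^sub>R x0, T * t0) \<in> \<Omega>" using z by simp
 have A': "r * m * A / r ^ (2 * j) >= 0" using pos A by simp
 have "\<Psi>' (T * t0) <= 0"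
 proof (rule vsubD_crit[OF u zO e(1) C1' A'])
  fix X s assume X: "(X, s) \<in> \<Omega>" "norm (X - r *\<^sub>R x0) < e" "\<bar>s - T * t0\<bar> < e"
  define x where "x = (1/r) *\<^sub>R X"
  define t where "t = (1/T) * s"
  have Xs: "X = r *\<^sub>R x" "s = T * t" using pos by (auto simp: x_def t_def)
  have n: "norm (X - r *\<^sub>R x0) = r * norm (x - x0)" unfolding Xs scaleR_diff_right[symmetric] using pos by simp
  have "\<bar>s - T * t0\<bar> = T * \<bar>t - t0\<bar>" unfolding Xs right_diff_distrib[symmetric] using pos by (simp add: abs_mult)
  then have "norm (x - x0) < \<delta>" "\<bar>t - t0\<bar> < \<delta>" using X e n pos by (smt (verit) mult_less_cancel_left_pos)+
  then have "?\<theta> * ?w (x, t) + ?q \<bullet> x - A * norm (x - x0) ^ (2 * j) - \<psi> t <= ?\<theta> * ?w (x0, t0) + ?q \<bullet> x0 - \<psi> t0"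
   using mx X(1) Xs by simp
  then have "(\<theta> * u (X, s) + q \<bullet> X) / (r * m) - A * norm (x - x0) ^ (2 * j) - \<psi> t <= (\<theta> * u (r *\<^sub>R x0, T * t0) + q \<bullet> (r *\<^sub>R x0)) / (r * m) - \<psi> t0"
   unfolding V Xs by simp
  then have "r * m * ((\<theta> * u (X, s) + q \<bullet> X) / (r * m) - A * norm (x - x0) ^ (2 * j) - \<psi> t) <= r * m * ((\<theta> * u (r *\<^sub>R x0, T * t0) + q \<bullet> (r *\<^sub>R x0)) / (r * m) - \<psi> t0)"
   using pos by (intro mult_left_mono) auto
  moreover have "r * m * A / r ^ (2 * j) * norm (X - r *\<^sub>R x0) ^ (2 * j) = r * m * (A * norm (x - x0) ^ (2 * j))"
   unfolding n using pos by (simp add: power_mult_distrib)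
  moreover have "\<Psi> s = r * m * \<psi> t" "\<Psi> (T * t0) = r * m * \<psi> t0" using pos by (auto simp: \<Psi>_def t_def)
  ultimately show "\<theta> * u (X, s) + q \<bullet> X - r * m * A / r ^ (2 * j) * norm (X - r *\<^sub>R x0) ^ (2 * j) - \<Psi> s
   <= \<theta> * u (r *\<^sub>R x0, T * t0) + q \<bullet> (r *\<^sub>R x0) - \<Psi> (T * t0)"
   using pos by (simp add: right_diff_distrib)
 qed
 moreover have "\<Psi>' (T * t0) = (r * m / T) * \<psi>' t0" using pos by (simp add: \<Psi>'_def)
 moreover have "r * m / T > 0" using pos by simp
 ultimately show "\<psi>' t0 <= 0" by (metis mult_pos_pos not_less)
qed

section \<open>Comparison with classical barriers\<close>

text \<open>The term \<open>\<mu> / (T - t)\<close> blows up at the final time, so the maximum is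
  attained at some \<open>t0 < T\<close> and can be treated as interior in time. \<mu> is chosen so
  that half of the positive value at \<open>(x1, t1)\<close> survives.\<close>

lemma barrier_touch:
 fixes f :: "(real^'n) \<times> real => real"
 assumes K: "compact K" and f: "continuous_on K f" and z1: "(x1, t1) \<in> K" "t1 < T" "f (x1, t1) > 0"
 obtains \<mu> x0 t0 where "\<mu> > 0" "(x0, t0) \<in> K" "t0 < T" "f (x0, t0) > 0"
  "\<And>x t. (x, t) \<in> K ==> t < T ==> f (x, t) - \<mu> / (T - t) <= f (x0, t0) - \<mu> / (T - t0)"
proof -
 define \<mu> where "\<mu> = f (x1, t1) * (T - t1) / 2"
 have mu: "\<mu> > 0" using z1 by (simp add: \<mu>_def)
 obtain M0 where M0: "\<forall>z\<in>K. \<bar>f z\<bar> <= M0"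
  using compact_imp_bounded[OF compact_continuous_image[OF f K]] unfolding bounded_iff by auto
 define M where "M = max M0 1"
 have M: "M > 0" "\<And>z. z \<in> K ==> f z <= M" using M0 by (fastforce simp: M_def)+
 define \<epsilon> where "\<epsilon> = \<mu> / M"
 have eps: "\<epsilon> > 0" using mu M by (simp add: \<epsilon>_def)
 have late: "f (x, t) - \<mu> / (T - t) <= 0" if "(x, t) \<in> K" "t < T" "t > T - \<epsilon>" for x t
 proof -
  have "\<mu> / (T - t) >= \<mu> / \<epsilon>" using that mu eps by (intro divide_left_mono) auto
  also have "\<mu> / \<epsilon> = M" using mu M by (simp add: \<epsilon>_def)
  finally show ?thesis using M(2)[OF that(1)] by linarith
 qed
 have hv: "y * D / 2 / D = y / 2" if "D > 0" for y D :: real using that by simp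
 have f1: "f (x1, t1) - \<mu> / (T - t1) > 0"
  using z1(3) hv[of "T - t1" "f (x1, t1)"] z1(2) unfolding \<mu>_def by linarith
 define K' where "K' = K \<inter> {z. snd z <= T - \<epsilon>}"
 have K'c: "compact K'" unfolding K'_def
  by (intro compact_Int_closed K closed_Collect_le continuous_intros)
 have "\<not> t1 > T - \<epsilon>" using late[OF z1(1,2)] f1 by linarith
 then have z1': "(x1, t1) \<in> K'" using z1(1) by (simp add: K'_def)
 have "continuous_on K' f" by (rule continuous_on_subset[OF f]) (auto simp: K'_def)
 moreover have "\<forall>z\<in>K'. T - snd z ~= 0" using eps by (auto simp: K'_def)
 ultimately have "continuous_on K' (%z. f z - \<mu> / (T - snd z))" by (intro continuous_intros)
 moreover have "K' ~= {}" using z1' by blast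
 ultimately have "\<exists>z\<in>K'. \<forall>z'\<in>K'. f z' - \<mu> / (T - snd z') <= f z - \<mu> / (T - snd z)"
  using continuous_attains_sup[OF K'c] by blast
 then obtain z where z: "z \<in> K'" "\<And>z'. z' \<in> K' ==> f z' - \<mu> / (T - snd z') <= f z - \<mu> / (T - snd z)" by blast
 obtain x0 t0 where xt: "z = (x0, t0)" by (cases z)
 have t0: "t0 < T" "(x0, t0) \<in> K" using z(1) xt eps by (auto simp: K'_def)
 have pos: "f (x0, t0) - \<mu> / (T - t0) > 0" using z(2)[OF z1'] f1 xt by simp
 show thesis
 proof (rule that[OF mu t0(2,1)])
  have "\<mu> / (T - t0) > 0" using mu t0 by simp
  then show "f (x0, t0) > 0" using pos by linarith
  fix x t assume "(x, t) \<in> K" "t < T"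
  then show "f (x, t) - \<mu> / (T - t) <= f (x0, t0) - \<mu> / (T - t0)"
   using late[of x t] pos z(2)[of "(x, t)"] xt by (cases "t > T - \<epsilon>") (auto simp: K'_def)
 qed
qed

lemma C1_penalty: "C1_on {..<T} (%t. \<mu> / (T - t)) (%t. \<mu> / (T - t)^2)"
 unfolding C1_on_def by (auto intro!: derivative_eq_intros continuous_intros simp: power2_eq_square)

text \<open>The barrier needs the supersolution inequality and a noncritical gradient only where
  \<open>w > \<phi>\<close>. The boundary values enter through \<open>int\<close>, which keeps that
  region inside. The derivative of the time penalty makes the inequality strict.\<close>

lemma barrier_comparison:
 fixes w :: "(real^'n) \<times> real => real"
 assumes w: "vsub j \<gamma> F q \<theta> \<Omega> w" and K: "compact K" and cw: "continuous_on K w" and cp: "continuous_on K \<phi>"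
  and G: "open G" "C21_on G \<phi> D\<phi> D2\<phi> \<phi>t"
  and int: "\<And>x t. (x, t) \<in> K ==> t < T ==> w (x, t) > \<phi> (x, t) ==> (x, t) \<in> interior K \<inter> \<Omega> \<inter> G"
  and sup: "\<And>x t. (x, t) \<in> K ==> (x, t) \<in> interior K \<inter> \<Omega> \<inter> G ==> t < T ==> w (x, t) > \<phi> (x, t) ==> q + \<theta> *\<^sub>R D\<phi> (x, t) ~= 0 &
    \<phi>t (x, t) >= norm (q + \<theta> *\<^sub>R D\<phi> (x, t)) powr \<gamma> * F (D2\<phi> (x, t))"
  and z: "(x, t) \<in> K" "t < T"
 shows "w (x, t) <= \<phi> (x, t)"
proof (rule ccontr)
 assume "\<not> ?thesis"
 then have "w (x, t) - \<phi> (x, t) > 0" by simp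
 moreover have "continuous_on K (%z. w z - \<phi> z)" by (intro continuous_intros cw cp)
 ultimately obtain \<mu> x0 t0 where m: "\<mu> > 0" "(x0, t0) \<in> K" "t0 < T" "w (x0, t0) - \<phi> (x0, t0) > 0"
  "\<And>x t. (x, t) \<in> K ==> t < T ==> w (x, t) - \<phi> (x, t) - \<mu> / (T - t) <= w (x0, t0) - \<phi> (x0, t0) - \<mu> / (T - t0)"
  using barrier_touch[OF K, of "%z. w z - \<phi> z" x t T] z by blast
 have in0: "(x0, t0) \<in> interior K \<inter> \<Omega> \<inter> G" using int[OF m(2,3)] m(4) by simp
 note s = sup[OF m(2) in0 m(3)]
 define U where "U = interior K \<inter> G \<inter> (UNIV \<times> {..<T})"
 have C: "C21_on U (%z. \<phi> z + \<mu> / (T - snd z)) (%z. D\<phi> z + 0) (%z. D2\<phi> z + 0) (%z. \<phi>t z + \<mu> / (T - snd z)^2)"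
  by (intro C21_on_add C21_on_subset[OF G(2)] C21_on_subset[OF C21_on_time[OF C1_penalty]]) (auto simp: U_def)
 have "\<phi>t (x0, t0) + \<mu> / (T - snd (x0, t0))^2 <= norm (q + \<theta> *\<^sub>R (D\<phi> (x0, t0) + 0)) powr \<gamma> * F (D2\<phi> (x0, t0) + 0)"
 proof (rule vsubD[OF w _ _ _ C])
  show "(x0, t0) \<in> \<Omega>" using in0 by simp
  show "open U" unfolding U_def using G(1) by (intro open_Int open_Times) auto
  show "(x0, t0) \<in> U" using in0 m(3) by (simp add: U_def)
  show "q + \<theta> *\<^sub>R (D\<phi> (x0, t0) + 0) ~= 0" using s m(4) by simp
  fix z assume "z \<in> U"
  then have "z \<in> K" "snd z < T" using interior_subset by (auto simp: U_def)
  then show "w z - (\<phi> z + \<mu> / (T - snd z)) <= w (x0, t0) - (\<phi> (x0, t0) + \<mu> / (T - snd (x0, t0)))"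
   using m(5)[of "fst z" "snd z"] by simp
 qed
 moreover have "\<mu> / (T - t0)^2 > 0" using m by simp
 ultimately show False using s m(4) by simp
qed

section \<open>Doubling of variables\<close>

text \<open>\<open>X\<close> and \<open>Y\<close> are the two Hessians of the doubled problem,
  \<open>b1\<close> and \<open>b2\<close> the powers of the gradients, \<tau>1 and \<tau>2 the time
  derivatives. After division by the coefficients their relative difference \<rho> multiplies only a
  quantity of size \<open>Lam * G\<close>, while the direction \<open>e\<close> in which
  \<open>X - Y\<close> is very negative yields \<open>lam * d\<close>.\<close>

lemma elliptic_doubling_inequality:
 fixes F :: "real^'n^'n => real"
 assumes F: "elliptic_op lam Lam F" and L: "0 < lam" "lam <= Lam"
  and XY: "X \<in> sym_matrices" "Y \<in> sym_matrices" and b: "b1 > 0" "b2 > 0" "\<bar>b2 / b1 - 1\<bar> <= \<rho>" "\<rho> <= 1/2"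
  and t: "\<tau>1 <= b1 * F X" "b2 * F Y <= \<tau>2" "\<tau>1 >= \<tau>2 - K1" "K1 >= 0"
  and G: "G >= 0" "\<And>h. h \<bullet> (X *v h) <= G * (norm h)^2" "\<And>h. h \<bullet> (Y *v h) >= - G * (norm h)^2"
  and s: "s >= 0" "\<And>h. h \<bullet> ((X - Y) *v h) <= s * (norm h)^2" and e: "norm e = 1" "e \<bullet> ((X - Y) *v e) <= s - d"
 shows "lam * d <= real CARD('n) * Lam * s + 2 * \<rho> * (real CARD('n) * Lam * G) + 2 * K1 / b2"
proof -
 define G' where "G' = real CARD('n) * Lam * G"
 have G': "G' >= 0" using G L by (simp add: G'_def)
 have FX: "F X <= G'"
 proof (rule elliptic_opD0[OF F XY(1)])
  fix A :: "real^'n^'n" assume "A \<in> elliptic_matrices lam Lam"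
  from trace_elliptic_le[OF this L(1) G(2) G(1) e(1), of 0] show "trace (A ** X) <= G'"
   using G(2)[of e] e(1) by (simp add: G'_def)
 qed
 have FY: "F Y >= - G'"
 proof (rule elliptic_opD0'[OF F XY(2)])
  fix A :: "real^'n^'n" assume A: "A \<in> elliptic_matrices lam Lam"
  have m: "(- Y) *v h = - (Y *v h)" for h using scaleR_matrix_mult[of "-1" Y h] by simp
  have "h \<bullet> ((- Y) *v h) <= G * (norm h)^2" for h using G(3)[of h] by (simp add: m)
  from trace_elliptic_le[OF A L(1) this G(1) e(1), of 0] have "trace (A ** (- Y)) <= G'"
   using G(3)[of e] e(1) by (simp add: G'_def m)
  then show "- G' <= trace (A ** Y)" using trace_mult_scaleR[of A "-1" Y] by simp
 qed
 have FXY: "F X - F Y <= real CARD('n) * Lam * s - lam * d"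
  by (rule elliptic_opD[OF F XY], rule trace_elliptic_le[OF _ L(1) s(2) s(1) e])
 have q: "b2 / b1 >= 1/2" "b2 / b1 <= 3/2" using b(3,4) unfolding abs_le_iff by linarith+
 have b12: "b1 <= 2 * b2" "b2 <= 3/2 * b1" using q b(1,2) by (simp_all add: field_simps)
 define y where "y = \<tau>2 / b2"
 have y1: "y >= - G'" using t(2) FY b mult_left_mono[OF FY, of b2] by (simp add: y_def le_divide_eq mult_ac)
 have y2: "y <= 2 * G' + K1 / b2"
 proof -
  have "\<tau>2 <= b1 * G' + K1" using t mult_left_mono[OF FX, of b1] b by linarith
  also have "... <= 2 * b2 * G' + K1" using mult_right_mono[OF b12(1) G'] by simp
  finally have "\<tau>2 / b2 <= (2 * b2 * G' + K1) / b2" using b by (intro divide_right_mono) auto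
  also have "... = 2 * G' + K1 / b2" using b by (simp add: add_divide_distrib)
  finally show ?thesis by (simp add: y_def)
 qed
 have ya: "\<bar>y\<bar> <= 2 * G' + K1 / b2" using y1 y2 G' b t(4) by (simp add: abs_le_iff) (smt (verit) divide_nonneg_pos)
 have "F X >= (\<tau>2 - K1) / b1" using t b by (simp add: divide_le_eq mult.commute)
 moreover have "F Y <= y" using t(2) b by (simp add: y_def le_divide_eq mult.commute)
 ultimately have 1: "F X - F Y >= (\<tau>2 - K1) / b1 - y" by linarith
 define Z where "Z = y * (b2 / b1 - 1)"
 have 2: "(\<tau>2 - K1) / b1 - y = Z - K1 / b1" using b by (simp add: Z_def y_def field_simps)
 have rho0: "\<rho> >= 0" using b(3) by linarith
 have "\<bar>Z\<bar> <= (2 * G' + K1 / b2) * \<rho>" unfolding Z_def abs_mult using ya b(3) rho0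
  by (intro mult_mono) auto
 moreover have "K1 / b1 <= 3/2 * (K1 / b2)"
 proof -
  have "K1 * b2 <= K1 * (3/2 * b1)" using b12(2) t(4) by (intro mult_left_mono) auto
  then show ?thesis using b by (simp add: field_simps)
 qed
 moreover have "(2 * G' + K1 / b2) * \<rho> <= 2 * \<rho> * G' + 1/2 * (K1 / b2)"
 proof -
  have "K1 / b2 * \<rho> <= K1 / b2 * (1/2)" using b t(4) by (intro mult_left_mono) auto
  then show ?thesis by (simp add: algebra_simps)
 qed
 ultimately have "F X - F Y >= - (2 * \<rho> * G') - 2 * (K1 / b2)" using 1 2 by linarith
 then show ?thesis using FXY by (simp add: G'_def)
qed

text \<open>With \<open>a\<close> the radial part and \<open>b\<close> the squared tangential part
  of \<open>d + h\<close>, the squared norm is \<open>a^2 + b\<close>, at most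
  \<open>(a + b / (2 * a))^2\<close>. Replacing \<open>a\<close> by \<open>r\<close> in the
  denominator costs a term of third order.\<close>

lemma norm_add_upper:
 fixes d :: "'a::real_inner"
 assumes d: "d ~= 0" and eps: "\<epsilon> > 0"
 defines "r \<equiv> norm d" and "e \<equiv> (1 / norm d) *\<^sub>R d"
 shows "\<exists>\<delta>>0. \<forall>h. norm h < \<delta> --> norm (d + h) <= r + e \<bullet> h + ((norm h)^2 - (e \<bullet> h)^2) / (2 * r) + \<epsilon> * (norm h)^2"
proof -
 have r: "r > 0" using d by (simp add: r_def)
 have e: "norm e = 1" "d = r *\<^sub>R e" using d by (simp_all add: e_def r_def)
 define \<delta> where "\<delta> = min (r / 2) (\<epsilon> * r^2)"
 have "norm (d + h) <= r + e \<bullet> h + ((norm h)^2 - (e \<bullet> h)^2) / (2 * r) + \<epsilon> * (norm h)^2" if h: "norm h < \<delta>" for h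
 proof -
  have h1: "norm h < r / 2" "norm h <= \<epsilon> * r^2" using h by (auto simp: \<delta>_def)
  have eh: "\<bar>e \<bullet> h\<bar> <= norm h" using Cauchy_Schwarz_ineq2[of e h] e by simp
  define a where "a = r + e \<bullet> h"
  define b where "b = (norm h)^2 - (e \<bullet> h)^2"
  have a: "a >= r / 2" using eh h1 by (simp add: a_def abs_le_iff)
  have a0: "a > 0" using a r by linarith
  have b: "0 <= b" "b <= (norm h)^2" using eh by (auto simp: b_def abs_le_square_iff[symmetric])
  have "(norm (d + h))^2 = a^2 + b"
  proof -
   have "(norm (d + h))^2 = (norm d)^2 + 2 * (d \<bullet> h) + (norm h)^2"
    unfolding power2_norm_eq_inner by (simp add: inner_add_left inner_add_right inner_commute)
   moreover have "d \<bullet> h = r * (e \<bullet> h)" using arg_cong[OF e(2), of "%d. d \<bullet> h"] by simp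
   ultimately show ?thesis by (simp add: a_def b_def r_def[symmetric] power2_sum)
  qed
  also have "... <= a^2 + b + (b / (2 * a))^2" by simp
  also have "... = (a + b / (2 * a))^2"
  proof -
   have "2 * a * (b / (2 * a)) = b" using a0 by simp
   then show ?thesis by (simp only: power2_sum)
  qed
  finally have sq: "(norm (d + h))^2 <= (a + b / (2 * a))^2" .
  have "0 <= b / (2 * a)" using a0 b(1) by simp
  then have "norm (d + h) <= a + b / (2 * a)" using a0 by (intro power2_le_imp_le[OF sq]) linarith
  moreover have "b / (2 * a) - b / (2 * r) <= \<epsilon> * (norm h)^2"
  proof -
   have "b / (2 * a) - b / (2 * r) = b * (r - a) / (2 * a * r)" using a r by (simp add: field_simps)
   also have "... <= (norm h)^2 * norm h / (r * r)"
   proof (rule frac_le)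
    show "0 < r * r" using r by simp
    show "r * r <= 2 * a * r" using a r by (intro mult_right_mono) auto
    have "r - a <= norm h" using eh by (simp add: a_def abs_le_iff)
    then have "b * (r - a) <= b * norm h" using b by (intro mult_left_mono) auto
    also have "... <= (norm h)^2 * norm h" using b by (intro mult_right_mono) auto
    finally show "b * (r - a) <= (norm h)^2 * norm h" .
   qed simp
   also have "... <= (norm h)^2 * (\<epsilon> * r^2) / (r * r)" using h1 r by (intro divide_right_mono mult_left_mono) auto
   also have "... = \<epsilon> * (norm h)^2" using r by (simp add: power2_eq_square)
   finally show ?thesis .
  qed
  ultimately show ?thesis by (simp add: a_def b_def)
 qed
 moreover have "\<delta> > 0" using r eps by (simp add: \<delta>_def)
 ultimately show ?thesis by blast
qed

text \<open>As \<open>g' > 0\<close> and \<open>g'' <= 0\<close>, the upper bound for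
  \<open>norm (d + h)\<close> is inserted into the linear term and the lower bound
  \<open>r + e \<bullet> h\<close> into the quadratic one.\<close>

lemma radial_upper_expansion:
 fixes d :: "'a::real_inner"
 assumes d: "d ~= 0" and eps: "\<epsilon> > 0" and g': "g' > 0" and g'': "g'' <= 0"
 defines "r \<equiv> norm d" and "e \<equiv> (1 / norm d) *\<^sub>R d"
 assumes gt: "\<And>\<epsilon>. \<epsilon> > 0 ==> \<exists>\<delta>>0. \<forall>s. \<bar>s\<bar> < \<delta> --> g (r + s) <= g r + g' * s + g'' / 2 * s^2 + \<epsilon> * s^2"
 shows "\<exists>\<delta>>0. \<forall>h. norm h < \<delta> --> g (norm (d + h)) <= g r + g' * (e \<bullet> h) + g'' / 2 * (e \<bullet> h)^2
   + g' / (2 * r) * ((norm h)^2 - (e \<bullet> h)^2) + \<epsilon> * (norm h)^2"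
proof -
 have r: "r > 0" using d by (simp add: r_def)
 have e: "norm e = 1" "d = r *\<^sub>R e" using d by (simp_all add: e_def r_def)
 define \<epsilon>1 where "\<epsilon>1 = \<epsilon> / (4 * (g' + 1))"
 have e1: "\<epsilon>1 > 0" "g' * \<epsilon>1 <= \<epsilon> / 4"
 proof -
  show "\<epsilon>1 > 0" using eps g' by (simp add: \<epsilon>1_def)
  have "g' * \<epsilon>1 = (g' / (g' + 1)) * (\<epsilon> / 4)" using g' by (simp add: \<epsilon>1_def field_simps)
  also have "... <= 1 * (\<epsilon> / 4)" using g' eps by (intro mult_right_mono) auto
  finally show "g' * \<epsilon>1 <= \<epsilon> / 4" by simp
 qed
 obtain \<delta>1 where d1: "\<delta>1 > 0" "\<forall>s. \<bar>s\<bar> < \<delta>1 --> g (r + s) <= g r + g' * s + g'' / 2 * s^2 + \<epsilon>/4 * s^2"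
  using gt[of "\<epsilon>/4"] eps by auto
 obtain \<delta>2 where d2: "\<delta>2 > 0" "\<forall>h. norm h < \<delta>2 --> norm (d + h) <= r + e \<bullet> h + ((norm h)^2 - (e \<bullet> h)^2) / (2 * r) + \<epsilon>1 * (norm h)^2"
  using norm_add_upper[OF d e1(1)] unfolding r_def e_def by blast
 define C where "C = 1 / (2 * r) + \<epsilon>1"
 have C: "C > 0" using r e1 by (simp add: C_def add_pos_pos)
 define \<delta> where "\<delta> = min (min \<delta>1 \<delta>2) (\<epsilon> / (4 * (\<bar>g''\<bar> * C + 1)))"
 have "g (norm (d + h)) <= g r + g' * (e \<bullet> h) + g'' / 2 * (e \<bullet> h)^2
   + g' / (2 * r) * ((norm h)^2 - (e \<bullet> h)^2) + \<epsilon> * (norm h)^2" if h: "norm h < \<delta>" for h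
 proof -
  define s where "s = norm (d + h) - r"
  define y where "y = e \<bullet> h"
  define b where "b = (norm h)^2 - y^2"
  have yh: "\<bar>y\<bar> <= norm h" using Cauchy_Schwarz_ineq2[of e h] e by (simp add: y_def)
  have b: "0 <= b" "b <= (norm h)^2" using yh by (auto simp: b_def abs_le_square_iff[symmetric])
  have sh: "\<bar>s\<bar> <= norm h" unfolding s_def r_def using norm_triangle_ineq3[of "d + h" d] by simp
  have hd: "norm h < \<delta>1" "norm h < \<delta>2" "norm h <= \<epsilon> / (4 * (\<bar>g''\<bar> * C + 1))" using h by (auto simp: \<delta>_def)
  have s_up: "s <= y + b / (2 * r) + \<epsilon>1 * (norm h)^2" using d2(2) hd(2) by (auto simp: s_def y_def b_def)
  have s_lo: "s >= y"
  proof -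
   have "e \<bullet> d = r" using arg_cong[OF e(2), of "%d. e \<bullet> d"] e(1) by (simp add: norm_eq_1)
   then have "e \<bullet> (d + h) = r + y" by (simp add: inner_add_right y_def)
   moreover have "e \<bullet> (d + h) <= norm (d + h)" using norm_cauchy_schwarz[of e "d + h"] e(1) by simp
   ultimately show ?thesis by (simp add: s_def)
  qed
  have sy: "s - y <= C * (norm h)^2"
  proof -
   have "b / (2 * r) <= (norm h)^2 / (2 * r)" using b r by (intro divide_right_mono) auto
   then show ?thesis using s_up by (simp add: C_def algebra_simps)
  qed
  have sq: "y^2 - s^2 <= 2 * norm h * (C * (norm h)^2)"
  proof -
   have "y^2 - s^2 = - (s + y) * (s - y)" by (simp add: power2_eq_square algebra_simps)
   also have "... <= 2 * norm h * (s - y)" using s_lo sh yh by (intro mult_right_mono) (auto simp: abs_le_iff)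
   also have "... <= 2 * norm h * (C * (norm h)^2)" using sy by (intro mult_left_mono) auto
   finally show ?thesis .
  qed
  have t1: "g (r + s) <= g r + g' * s + g'' / 2 * s^2 + \<epsilon>/4 * s^2" using d1(2) sh hd(1) by auto
  have t2: "g' * s <= g' * y + g' / (2 * r) * b + \<epsilon>/4 * (norm h)^2"
  proof -
   have "g' * s <= g' * (y + b / (2 * r) + \<epsilon>1 * (norm h)^2)" using s_up g' by (intro mult_left_mono) auto
   moreover have "(g' * \<epsilon>1) * (norm h)^2 <= \<epsilon>/4 * (norm h)^2" using e1(2) by (intro mult_right_mono) auto
   ultimately show ?thesis by (simp add: algebra_simps)
  qed
  have t3: "g'' / 2 * s^2 <= g'' / 2 * y^2 + \<epsilon>/4 * (norm h)^2"
  proof -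
   have "(- g'' / 2) * (y^2 - s^2) <= (- g'' / 2) * (2 * norm h * (C * (norm h)^2))" using sq g'' by (intro mult_left_mono) auto
   also have "... = (\<bar>g''\<bar> * C) * norm h * (norm h)^2" using g'' by simp
   also have "... <= \<epsilon>/4 * (norm h)^2"
   proof (intro mult_right_mono)
    have pos: "\<bar>g''\<bar> * C + 1 > 0" using C by (simp add: add_nonneg_pos)
    have "\<bar>g''\<bar> * C * norm h <= (\<bar>g''\<bar> * C + 1) * norm h" by (simp add: mult_right_mono)
    also have "... <= (\<bar>g''\<bar> * C + 1) * (\<epsilon> / (4 * (\<bar>g''\<bar> * C + 1)))" using hd(3) pos by (intro mult_left_mono) auto
    also have "... = \<epsilon>/4" using pos by (simp add: field_simps)
    finally show "\<bar>g''\<bar> * C * norm h <= \<epsilon>/4" .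
   qed simp
   finally show ?thesis by (simp add: algebra_simps)
  qed
  have t4: "\<epsilon>/4 * s^2 <= \<epsilon>/4 * (norm h)^2" using sh eps by (intro mult_left_mono) (auto simp: abs_le_square_iff[symmetric])
  have "r + s = norm (d + h)" by (simp add: s_def)
  then have "g (norm (d + h)) <= g r + g' * y + g'' / 2 * y^2 + g' / (2 * r) * b + 3 * (\<epsilon>/4 * (norm h)^2)"
   using t1 t2 t3 t4 by simp
  moreover have "3 * (\<epsilon>/4 * (norm h)^2) <= \<epsilon> * (norm h)^2" using eps by simp
  ultimately show ?thesis by (simp add: y_def b_def)
 qed
 moreover have "\<delta> > 0" using d1 d2 eps C by (auto simp: \<delta>_def intro!: divide_pos_pos mult_pos_pos add_nonneg_pos)
 ultimately show ?thesis by blast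
qed

lemma penalty_expansion:
 fixes D \<mu> s :: real
 assumes "D > 0" "\<mu> >= 0" "\<bar>s\<bar> <= D / 2"
 shows "\<mu> / (D - s) <= \<mu> / D + \<mu> / D^2 * s + 2 * \<mu> / D ^ 3 * s^2"
proof -
 have p: "D - s >= D / 2" using assms by (simp add: abs_le_iff)
 then have p0: "D - s > 0" using assms by linarith
 have "\<mu> / (D - s) = \<mu> / D + \<mu> / D^2 * s + \<mu> * s^2 / (D^2 * (D - s))"
  using assms(1) p0 by (simp add: field_simps power2_eq_square)
 also have "\<mu> * s^2 / (D^2 * (D - s)) <= \<mu> * s^2 / (D^2 * (D / 2))"
  using assms p p0 by (intro divide_left_mono mult_left_mono mult_pos_pos) auto
 also have "... = 2 * \<mu> / D ^ 3 * s^2" using assms(1) by (simp add: field_simps power2_eq_square power3_eq_cube)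
 finally show ?thesis by simp
qed

lemma positive_lower_bound:
 fixes xs :: "real list"
 assumes "list_all (%s. 0 < s) xs"
 obtains \<rho> where "\<rho> > 0" "list_all (%s. \<rho> <= s) xs"
proof -
 have "\<exists>\<rho>>0. list_all (%s. \<rho> <= s) xs" using assms
 proof (induction xs)
  case Nil
  show ?case by (intro exI[of _ 1]) simp
 next
  case (Cons a xs)
  then obtain \<rho> where r: "\<rho> > 0" "list_all (%s. \<rho> <= s) xs" by auto
  have "list_all (%s. min \<rho> a <= s) xs" using r(2) by (auto simp: list_all_iff)
  then show ?case using r(1) Cons.prems by (intro exI[of _ "min \<rho> a"]) auto
 qed
 then show ?thesis using that by blast
qed

text \<open>The function \<open>W\<close> is localised by \<open>K\<close> in space and past times
  and by \<mu> before the final time. Below the distance \<open>ra\<close> the modulus is already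
  known, so only \<open>ra < r < r0\<close> has to be excluded. \<open>N\<close> says that both
  gradients are noncritical with comparable coefficients; \<open>SC\<close> says that the concavity
  of \<open>g\<close> outweighs the localisation, the difference of the coefficients and the time
  terms.\<close>

lemma doubling_estimate:
 fixes w :: "(real^'n) \<times> real => real" and F :: "real^'n^'n => real"
 assumes F: "elliptic_op lam Lam F" and L: "0 < lam" "lam <= Lam"
  and sub: "vsub j \<gamma> F q \<theta> \<Omega> w" and sup: "vsub j \<gamma> (%M. - F (- M)) (- q) \<theta> \<Omega> (%z. - w z)"
  and Om: "open \<Omega>"
  and box: "\<And>x t. norm (x - x0) <= 2 * R ==> t0 - 1/4 <= t ==> t < T ==> (x, t) \<in> \<Omega> & 0 <= w (x, t) & w (x, t) <= 1"
  and R: "R > 0" and T: "t0 < T"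
  and K: "K * R^2 >= 2" "K >= 16"
  and r0: "0 < r0" "r0 <= R" and ra: "0 <= ra"
  and gcont: "continuous_on {0..r0} g" and g0: "\<And>r. 0 <= r ==> r <= r0 ==> 0 <= g r" and gr0: "g r0 >= 2"
  and known: "\<And>x y t. norm (x - x0) <= 2 * R ==> norm (y - x0) <= 2 * R ==> t0 - 1/4 <= t ==> t < T ==> norm (x - y) <= ra ==>
    w (x, t) - w (y, t) <= g (norm (x - y))"
  and gp: "\<And>r. ra < r ==> r < r0 ==> g' r > 0 & g'' r <= 0"
  and gt: "\<And>r \<epsilon>. ra < r ==> r < r0 ==> \<epsilon> > 0 ==> \<exists>\<delta>>0. \<forall>s. \<bar>s\<bar> < \<delta> --> g (r + s) <= g r + g' r * s + g'' r / 2 * s^2 + \<epsilon> * s^2"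
  and N: "\<And>r e \<xi>1 \<xi>2. ra < r ==> r < r0 ==> norm e = 1 ==> norm (\<xi>1 - g' r *\<^sub>R e) <= 2 * K * R + 1 ==> norm (\<xi>2 - g' r *\<^sub>R e) <= 1 ==>
    q + \<theta> *\<^sub>R \<xi>1 ~= 0 & q + \<theta> *\<^sub>R \<xi>2 ~= 0 &
    \<bar>norm (q + \<theta> *\<^sub>R \<xi>2) powr \<gamma> / norm (q + \<theta> *\<^sub>R \<xi>1) powr \<gamma> - 1\<bar> <= \<rho> r & norm (q + \<theta> *\<^sub>R \<xi>2) powr \<gamma> >= bm r"
  and bm: "\<And>r. ra < r ==> r < r0 ==> bm r > 0 & \<rho> r <= 1/2"
  and SC: "\<And>r. ra < r ==> r < r0 ==> real CARD('n) * Lam * (2 * K + 1) + 2 * \<rho> r * (real CARD('n) * Lam * (g' r / r + 2 * K + 1)) + 2 * (K + 1) / bm r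
    < 4 * lam * (- g'' r)"
  and y0: "norm (y0 - x0) <= r0"
 shows "w (x0, t0) - w (y0, t0) <= g (norm (x0 - y0))"
proof (rule ccontr)
 assume neg: "\<not> ?thesis"
 \<comment> \<open>Each of the two time penalties costs \<sigma> at \<open>t0\<close>, which leaves
   \<open>6 * \<sigma>\<close> for \<open>W\<close> at the centre.\<close>
 define \<sigma> where "\<sigma> = (w (x0, t0) - w (y0, t0) - g (norm (x0 - y0))) / 8"
 have K0: "K > 0" using K by linarith
 have in0: "0 <= w (x0, t0) & w (x0, t0) <= 1" "0 <= w (y0, t0)" using box[of x0 t0] box[of y0 t0] R T y0 r0 by auto
 have gy: "0 <= g (norm (x0 - y0))" using y0 by (intro g0) (auto simp: norm_minus_commute)
 have sg: "\<sigma> > 0" "\<sigma> <= 1/8" using neg in0 gy by (auto simp: \<sigma>_def)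
 \<comment> \<open>So close to \<open>t0\<close> that at later times \<open>- K * (t0 - t)\<close>
   gains at most \<sigma>.\<close>
 define T1 where "T1 = t0 + min ((T - t0) / 2) (\<sigma> / K)"
 have T1: "t0 < T1" "T1 < T" "K * (T1 - t0) <= \<sigma>"
 proof -
  show "t0 < T1" using T sg K0 by (simp add: T1_def)
  have "min ((T - t0) / 2) (\<sigma> / K) <= (T - t0) / 2" by (rule min.cobounded1)
  then show "T1 < T" using T unfolding T1_def by (simp add: field_simps)
  have "K * (T1 - t0) <= K * (\<sigma> / K)" using K0 by (intro mult_left_mono) (auto simp: T1_def)
  then show "K * (T1 - t0) <= \<sigma>" using K0 by simp
 qed
 define \<mu> where "\<mu> = \<sigma> * (T1 - t0)"
 have mu: "\<mu> > 0" "\<mu> / (T1 - t0) = \<sigma>" "\<mu> / 8 < T1 - t0"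
 proof -
  show "\<mu> > 0" "\<mu> / (T1 - t0) = \<sigma>" using sg T1 by (auto simp: \<mu>_def)
  have "\<sigma> * (T1 - t0) <= 1/8 * (T1 - t0)" using sg T1 by (intro mult_right_mono) auto
  then have "\<mu> <= 1/8 * (T1 - t0)" by (simp only: \<mu>_def)
  moreover have "T1 - t0 > 0" using T1 by simp
  ultimately show "\<mu> / 8 < T1 - t0" by (simp add: field_simps)
 qed
 \<comment> \<open>From \<open>T2\<close> on a single penalty is at least 8, more than
   \<open>w\<close> can compensate; so the maximum lies before \<open>T2\<close>, and the box can be
   closed there.\<close>
 define T2 where "T2 = T1 - \<mu> / 8"
 have T2: "t0 < T2" "T2 < T1" using mu by (auto simp: T2_def)
 define Bx where "Bx = cball x0 (2 * R) \<times> {t0 - 1/4..T2}"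
 have Bxin: "(x, t) \<in> Bx \<longleftrightarrow> norm (x - x0) <= 2 * R & t0 - 1/4 <= t & t <= T2" for x t
  by (auto simp: Bx_def dist_norm norm_minus_commute)
 have Bxbox: "(x, t) \<in> \<Omega> & 0 <= w (x, t) & w (x, t) <= 1" if "(x, t) \<in> Bx" for x t
  using box[of x t] that T2 T1 by (simp add: Bxin)
 have BxO: "Bx \<subseteq> \<Omega>" using Bxbox by auto
 have cwB: "continuous_on Bx w" by (rule continuous_on_subset[OF vsubD_cont[OF sub] BxO])
 have "uniformly_continuous_on Bx w" by (rule compact_uniformly_continuous[OF cwB]) (auto simp: Bx_def intro!: compact_Times)
 then obtain \<eta>0 where eta0: "\<eta>0 > 0" "\<forall>z\<in>Bx. \<forall>z'\<in>Bx. dist z' z < \<eta>0 --> dist (w z') (w z) < \<sigma>"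
  using sg(1) unfolding uniformly_continuous_on_def by blast
 define \<eta> where "\<eta> = min \<eta>0 (1/16)"
 have eta: "\<eta> > 0" "\<eta> <= 1/16" using eta0 by (auto simp: \<eta>_def)
 have etaw: "\<bar>w (y, t) - w (y, s)\<bar> < \<sigma>" if "(y, t) \<in> Bx" "(y, s) \<in> Bx" "\<bar>t - s\<bar> < \<eta>" for y t s
 proof -
  have "dist (y, t) (y, s) < \<eta>0" using that(3) by (simp add: dist_Pair_Pair dist_real_def \<eta>_def)
  then have "dist (w (y, t)) (w (y, s)) < \<sigma>" using eta0(2) that(1,2) by blast
  then show ?thesis by (simp add: dist_real_def)
 qed
 \<comment> \<open>A positive maximum forces \<open>M * (t - s)^2 <= 2\<close>, hence times closer
   than \<eta>; then \<open>s\<close> can be replaced by \<open>t\<close> at the cost of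
   \<sigma>.\<close>
 define M where "M = 4 / \<eta>^2"
 have M: "M > 0" using eta by (simp add: M_def)
 define W where "W z = w (fst z) - w (snd z) - g (norm (fst (fst z) - fst (snd z))) - K * (norm (fst (fst z) - x0))^2 - K * (t0 - snd (fst z))
   - \<mu> / (T1 - snd (fst z)) - \<mu> / (T1 - snd (snd z)) - M * (snd (fst z) - snd (snd z))^2" for z :: "((real^'n) \<times> real) \<times> ((real^'n) \<times> real)"
 define D where "D = (Bx \<times> Bx) \<inter> {z. norm (fst (fst z) - x0) <= R} \<inter> {z. norm (fst (fst z) - fst (snd z)) <= r0}"
 have Dc: "compact D" unfolding D_def
  by (intro compact_Int_closed closed_Collect_le continuous_intros compact_Times) (auto simp: Bx_def intro!: compact_Times)
 have Wc: "continuous_on D W"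
 proof -
  have 1: "continuous_on D (%z. w (fst z))" "continuous_on D (%z. w (snd z))"
   by (rule continuous_on_compose2[OF cwB]; auto intro!: continuous_intros simp: D_def)+
  have 2: "continuous_on D (%z. g (norm (fst (fst z) - fst (snd z))))"
   by (rule continuous_on_compose2[OF gcont]) (auto intro!: continuous_intros simp: D_def)
  have 3: "\<forall>z\<in>D. T1 - snd (fst z) ~= 0" "\<forall>z\<in>D. T1 - snd (snd z) ~= 0" using T2 by (auto simp: D_def Bx_def)
  show ?thesis unfolding W_def by (intro continuous_intros 1 2 3)
 qed
 have cen: "((x0, t0), (y0, t0)) \<in> D" using R T2 y0 r0 by (auto simp: D_def Bxin norm_minus_commute)
 have Wcen: "W ((x0, t0), (y0, t0)) = 6 * \<sigma>" using mu(2) by (simp add: W_def) (simp add: \<sigma>_def)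
 obtain z where z: "z \<in> D" "\<And>z'. z' \<in> D ==> W z' <= W z"
  using continuous_attains_sup[OF Dc _ Wc] cen by (metis empty_iff)
 obtain x t y s where zz: "z = ((x, t), (y, s))" by (metis prod.collapse)
 have W6: "W ((x, t), (y, s)) >= 6 * \<sigma>" using z(2)[OF cen] Wcen zz by simp
 have D1: "(x, t) \<in> Bx" "(y, s) \<in> Bx" "norm (x - x0) <= R" "norm (x - y) <= r0" using z(1) by (auto simp: zz D_def)
 define r where "r = norm (x - y)"
 have tT: "t <= T2" "s <= T2" "t0 - 1/4 <= t" "t0 - 1/4 <= s" using D1 by (auto simp: Bxin)
 have pt: "\<mu> / (T1 - t) > 0" "\<mu> / (T1 - s) > 0" using mu T2 tT by auto
 have Kt: "K * (t0 - t) >= - \<sigma>"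
 proof -
  have "K * (t - t0) <= K * (T1 - t0)" using tT T2 K0 by (intro mult_left_mono) auto
  then show ?thesis using T1(3) by (simp add: algebra_simps)
 qed
 have gr: "0 <= g r" using D1(4) by (intro g0) (auto simp: r_def)
 have Kx: "0 <= K * (norm (x - x0))^2" using K0 by simp
 have Mts: "0 <= M * (t - s)^2" using M by simp
 have wxy: "w (x, t) - w (y, s) <= 1" using Bxbox[OF D1(1)] Bxbox[OF D1(2)] by linarith
 have Wex: "W ((x, t), (y, s)) = w (x, t) - w (y, s) - g r - K * (norm (x - x0))^2 - K * (t0 - t) - \<mu> / (T1 - t) - \<mu> / (T1 - s) - M * (t - s)^2"
  by (simp add: W_def r_def)
 have ts: "\<bar>t - s\<bar> < \<eta>"
 proof -
  have "M * (t - s)^2 <= 2" using W6 Wex gr Kx Kt pt wxy sg by linarith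
  then have "(t - s)^2 <= \<eta>^2 / 2" using eta by (simp add: M_def field_simps)
  also have "... < \<eta>^2" using eta by simp
  finally show ?thesis using eta(1) by (metis abs_le_square_iff abs_of_pos linorder_not_less)
 qed
 have yt: "(y, t) \<in> Bx" using D1 by (simp add: Bxin)
 have wd: "w (x, t) - w (y, t) >= g r + K * (norm (x - x0))^2 + 4 * \<sigma>"
  using W6 Wex Kt pt Mts etaw[OF yt D1(2) ts] by linarith
 have wd1: "w (x, t) - w (y, t) <= 1" using Bxbox[OF D1(1)] Bxbox[OF yt] by linarith
 have rr0: "r < r0" using wd wd1 gr0 Kx sg D1(4) by (cases "r = r0") (auto simp: r_def)
 have xR: "norm (x - x0) < R"
 proof (rule ccontr)
  assume "\<not> ?thesis"
  then have "norm (x - x0) = R" using D1 by simp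
  then show False using wd wd1 gr sg K(1) by auto
 qed
 have rra: "ra < r"
 proof (rule ccontr)
  assume "\<not> ?thesis"
  then have "w (x, t) - w (y, t) <= g (norm (x - y))"
   using D1(1) yt tT T2 T1 by (intro known) (auto simp: Bxin r_def)
  then show False using wd Kx sg by (simp add: r_def)
 qed
 have tlow: "t0 - t <= 1/16"
 proof -
  have "K * (t0 - t) <= 1" using W6 Wex gr Kx pt Mts wxy sg by linarith
  show ?thesis
  proof (cases "t0 <= t")
   case False
   then have "16 * (t0 - t) <= K * (t0 - t)" using K by (intro mult_right_mono) auto
   then show ?thesis using \<open>K * (t0 - t) <= 1\<close> by argo
  qed simp
 qed
 have slow: "t0 - s <= 1/8" using tlow ts eta by (auto simp: abs_less_iff)
 have upt: "t < T2" "s < T2"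
 proof -
  have "\<mu> / (T1 - t) < 8" "\<mu> / (T1 - s) < 8" using W6 Wex gr Kx Kt pt Mts wxy sg by linarith+
  then have "\<mu> < 8 * (T1 - t)" "\<mu> < 8 * (T1 - s)" using T2 tT by (simp_all add: divide_less_eq)
  then show "t < T2" "s < T2" by (auto simp: T2_def)
 qed
 have rpos: "r > 0" using rra ra by linarith
 define d where "d = x - y"
 have d0: "d ~= 0" "norm d = r" using rpos by (auto simp: d_def r_def)
 define e where "e = (1 / norm d) *\<^sub>R d"
 have e1: "norm e = 1" using d0 rpos by (simp add: e_def)
 note gp' = gp[OF rra rr0]
 obtain \<delta>1 where d1: "\<delta>1 > 0" "\<forall>h. norm h < \<delta>1 --> g (norm (d + h)) <= g (norm d) + g' r * (e \<bullet> h) + g'' r / 2 * (e \<bullet> h)^2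
   + g' r / (2 * norm d) * ((norm h)^2 - (e \<bullet> h)^2) + 1/64 * (norm h)^2"
  using radial_upper_expansion[of d "1/64" "g' r" "g'' r" g] d0 gp' gt[OF rra rr0] unfolding e_def by auto
 have pos: "0 < \<delta>1 / 4" "0 < R - norm (x - x0)" "0 < (r0 - r) / 2" "0 < T2 - t" "0 < T2 - s" "0 < (T1 - t) / 2" "0 < (T1 - s) / 2"
  using d1(1) xR rr0 upt T2 tT by auto
 obtain \<rho>1 where rho1': "\<rho>1 > 0" "list_all (%s. \<rho>1 <= s) [\<delta>1 / 4, R - norm (x - x0), (r0 - r) / 2, 1/16, T2 - t, T2 - s, (T1 - t) / 2, (T1 - s) / 2, 1/64]"
  by (rule positive_lower_bound[of "[\<delta>1 / 4, R - norm (x - x0), (r0 - r) / 2, 1/16, T2 - t, T2 - s, (T1 - t) / 2, (T1 - s) / 2, 1/64]"])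
    (use pos in simp_all)
 have rho1: "\<rho>1 > 0" "\<rho>1 <= \<delta>1 / 4" "\<rho>1 <= R - norm (x - x0)" "\<rho>1 <= (r0 - r) / 2" "\<rho>1 <= 1/16" "\<rho>1 <= T2 - t" "\<rho>1 <= T2 - s" "\<rho>1 <= (T1 - t) / 2" "\<rho>1 <= (T1 - s) / 2" "\<rho>1 <= 1/64"
  using rho1' unfolding list.pred_inject by blast+
 have inD: "((x + h1, t + s1), (y + h2, s + s2)) \<in> D" if "norm h1 <= \<rho>1" "norm h2 <= \<rho>1" "\<bar>s1\<bar> <= \<rho>1" "\<bar>s2\<bar> <= \<rho>1" for h1 h2 s1 s2
 proof -
  have "norm (x + h1 - x0) <= norm (x - x0) + norm h1" using norm_triangle_ineq[of "x - x0" h1] by (simp add: algebra_simps)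
  then have 1: "norm (x + h1 - x0) <= R" using that rho1 by linarith
  have "norm (x + h1 - (y + h2)) <= norm (x - y) + (norm h1 + norm h2)"
   using norm_triangle_ineq[of "x - y" "h1 - h2"] norm_triangle_ineq4[of h1 h2] by (simp add: algebra_simps)
  then have 2: "norm (x + h1 - (y + h2)) <= r0" using that rho1 by (simp add: r_def)
  have "norm (y + h2 - x0) <= norm (x + h1 - x0) + norm (x + h1 - (y + h2))"
   using norm_triangle_ineq4[of "x + h1 - x0" "x + h1 - (y + h2)"] by (simp add: algebra_simps)
  then have 3: "norm (y + h2 - x0) <= 2 * R" using 1 2 r0 by linarith
  have "t0 - 1/4 <= t + s1" "t0 - 1/4 <= s + s2" "t + s1 <= T2" "s + s2 <= T2"
   using that rho1 tlow slow by (auto simp: abs_le_iff)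
  then show ?thesis using 1 2 3 R by (auto simp: D_def Bxin)
 qed
 define \<tau> where "\<tau> = 2 * M * (t - s)"
 define l1 where "l1 = (g' r *\<^sub>R e + (2 * K) *\<^sub>R (x - x0), \<tau> - K + \<mu> / (T1 - t)^2)"
 define l2 where "l2 = (- g' r *\<^sub>R e, - \<tau> + \<mu> / (T1 - s)^2)"
 define C where "C = max (2 * \<mu> / (T1 - t) ^ 3) (2 * \<mu> / (T1 - s) ^ 3)"
 \<comment> \<open>Half the Hessian of \<open>g (norm (x - y))\<close> in \<open>x - y\<close>, with
   1/64 as room for the Taylor error. \<open>Tm\<close> collects the bounds for all second order
   terms in both space-time points.\<close>
 define P where "P h = (g'' r / 2 - g' r / (2 * r)) *\<^sub>R ((e \<bullet> h) *\<^sub>R e) + (g' r / (2 * r) + 1/64) *\<^sub>R h" for h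
 have Padd: "P (a + b) = P a + P b" for a b by (simp add: P_def inner_add_right algebra_simps)
 have Psc: "P (c *\<^sub>R a) = c *\<^sub>R P a" for c a by (simp add: P_def algebra_simps)
 have Psym: "P a \<bullet> b = a \<bullet> P b" for a b by (simp add: P_def inner_add_left inner_add_right inner_commute)
 have Pq: "h \<bullet> P h = g'' r / 2 * (e \<bullet> h)^2 + g' r / (2 * r) * ((norm h)^2 - (e \<bullet> h)^2) + 1/64 * (norm h)^2" for h
  by (simp add: P_def inner_add_right inner_commute dot_square_norm power2_eq_square algebra_simps)
 define Tm where "Tm z = ((P (fst (fst z) - fst (snd z)) + K *\<^sub>R fst (fst z), C * snd (fst z) + M * (snd (fst z) - snd (snd z))),
   (- P (fst (fst z) - fst (snd z)), C * snd (snd z) - M * (snd (fst z) - snd (snd z))))" for z :: "((real^'n) \<times> real) \<times> ((real^'n) \<times> real)"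
 have Pdiff: "P (a - b) = P a - P b" for a b using Padd[of a "- b"] Psc[of "-1" b] by simp
 have linT: "linear Tm"
  by (rule linearI) (simp_all add: Tm_def Padd Psc Pdiff algebra_simps)
 have symT: "Tm a \<bullet> b = a \<bullet> Tm b" for a b
  by (simp add: Tm_def inner_prod_def inner_add_left inner_add_right Pdiff inner_diff_left inner_diff_right Psym algebra_simps)
 have Tq: "z \<bullet> Tm z = (fst (fst z) - fst (snd z)) \<bullet> P (fst (fst z) - fst (snd z)) + K * (norm (fst (fst z)))^2
   + C * (snd (fst z))^2 + C * (snd (snd z))^2 + M * (snd (fst z) - snd (snd z))^2" for z
  by (simp add: Tm_def inner_prod_def inner_add_right inner_diff_left dot_square_norm power2_eq_square algebra_simps)
 \<comment> \<open>Subtracting values and affine parts moves the maximum to the origin with value 0,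
   as the theorem on sums requires.\<close>
 define u where "u k = w ((x, t) + k) - w (x, t) - l1 \<bullet> k" for k
 define v where "v k = w ((y, s) + k) - w (y, s) + l2 \<bullet> k" for k
 have kin: "norm (fst k) <= \<rho>1 & \<bar>snd k\<bar> <= \<rho>1" if "norm k <= \<rho>1" for k :: "(real^'n) \<times> real"
  using that norm_fst_le[of "fst k" "snd k"] norm_snd_le[of "snd k" "fst k"] by auto
 have inBa: "(x, t) + k \<in> Bx" if "norm k <= \<rho>1" for k
  using inD[of "fst k" 0 "snd k" 0] kin[OF that] rho1(1) by (auto simp: D_def plus_prod_def)
 have inBb: "(y, s) + k \<in> Bx" if "norm k <= \<rho>1" for k
  using inD[of 0 "fst k" 0 "snd k"] kin[OF that] rho1(1) by (auto simp: D_def plus_prod_def)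
 have cu: "continuous_on (cball 0 \<rho>1) u"
 proof -
  have "continuous_on (cball 0 \<rho>1) (%k. w ((x, t) + k))"
   by (rule continuous_on_compose2[OF cwB]) (intro continuous_intros, rule image_subsetI, rule inBa, simp)
  then show ?thesis unfolding u_def by (intro continuous_intros)
 qed
 have cv: "continuous_on (cball 0 \<rho>1) v"
 proof -
  have "continuous_on (cball 0 \<rho>1) (%k. w ((y, s) + k))"
   by (rule continuous_on_compose2[OF cwB]) (intro continuous_intros, rule image_subsetI, rule inBb, simp)
  then show ?thesis unfolding v_def by (intro continuous_intros)
 qed
 have max: "u k - v l <= (k, l) \<bullet> Tm (k, l)" if kl: "norm k <= \<rho>1" "norm l <= \<rho>1" for k l
 proof -
  obtain h1 s1 where k: "k = (h1, s1)" by (cases k)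
  obtain h2 s2 where l: "l = (h2, s2)" by (cases l)
  have n: "norm h1 <= \<rho>1" "\<bar>s1\<bar> <= \<rho>1" "norm h2 <= \<rho>1" "\<bar>s2\<bar> <= \<rho>1" using kin[OF kl(1)] kin[OF kl(2)] k l by auto
  define h where "h = h1 - h2"
  have "W ((x + h1, t + s1), (y + h2, s + s2)) <= W ((x, t), (y, s))" using z(2)[OF inD[OF n(1,3,2,4)]] zz by simp
  then have 1: "w (x + h1, t + s1) - w (y + h2, s + s2) - (w (x, t) - w (y, s)) \<le>
    g (norm (x + h1 - (y + h2))) - g r + K * ((norm (x + h1 - x0))^2 - (norm (x - x0))^2) - K * s1
    + (\<mu> / (T1 - (t + s1)) - \<mu> / (T1 - t)) + (\<mu> / (T1 - (s + s2)) - \<mu> / (T1 - s)) + M * ((t + s1 - (s + s2))^2 - (t - s)^2)"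
   unfolding Wex by (simp add: W_def algebra_simps)
  have nh: "norm h < \<delta>1" using norm_triangle_ineq4[of h1 h2] n rho1(2) d1(1) by (simp add: h_def)
  have "x + h1 - (y + h2) = d + h" by (simp add: d_def h_def)
  then have 2: "g (norm (x + h1 - (y + h2))) - g r <= g' r * (e \<bullet> h) + h \<bullet> P h"
   using d1(2)[rule_format, OF nh] d0(2) unfolding Pq by simp
  have 3: "(norm (x + h1 - x0))^2 - (norm (x - x0))^2 = 2 * ((x - x0) \<bullet> h1) + (norm h1)^2"
   unfolding power2_norm_eq_inner by (simp add: inner_add_left inner_add_right inner_diff_left inner_diff_right inner_commute algebra_simps)
  have 4: "\<mu> / (T1 - (t + s1)) - \<mu> / (T1 - t) <= \<mu> / (T1 - t)^2 * s1 + C * s1^2"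
  proof -
   have "\<mu> / ((T1 - t) - s1) <= \<mu> / (T1 - t) + \<mu> / (T1 - t)^2 * s1 + 2 * \<mu> / (T1 - t) ^ 3 * s1^2"
    using mu(1) T2 tT n(2) rho1(8) by (intro penalty_expansion) auto
   moreover have "2 * \<mu> / (T1 - t) ^ 3 * s1^2 <= C * s1^2" by (intro mult_right_mono) (auto simp: C_def)
   ultimately show ?thesis by (simp add: algebra_simps)
  qed
  have 5: "\<mu> / (T1 - (s + s2)) - \<mu> / (T1 - s) <= \<mu> / (T1 - s)^2 * s2 + C * s2^2"
  proof -
   have "\<mu> / ((T1 - s) - s2) <= \<mu> / (T1 - s) + \<mu> / (T1 - s)^2 * s2 + 2 * \<mu> / (T1 - s) ^ 3 * s2^2"
    using mu(1) T2 tT n(4) rho1(9) by (intro penalty_expansion) auto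
   moreover have "2 * \<mu> / (T1 - s) ^ 3 * s2^2 <= C * s2^2" by (intro mult_right_mono) (auto simp: C_def)
   ultimately show ?thesis by (simp add: algebra_simps)
  qed
  have 6: "M * ((t + s1 - (s + s2))^2 - (t - s)^2) = \<tau> * s1 - \<tau> * s2 + M * (s1 - s2)^2"
   by (simp add: \<tau>_def power2_eq_square algebra_simps)
  have 7: "l1 \<bullet> k = g' r * (e \<bullet> h1) + 2 * K * ((x - x0) \<bullet> h1) + \<tau> * s1 - K * s1 + \<mu> / (T1 - t)^2 * s1"
   by (simp add: l1_def k inner_add_left algebra_simps)
  have 8: "l2 \<bullet> l = - (g' r * (e \<bullet> h2)) - \<tau> * s2 + \<mu> / (T1 - s)^2 * s2"
   by (simp add: l2_def l algebra_simps)
  have 9: "g' r * (e \<bullet> h) = g' r * (e \<bullet> h1) - g' r * (e \<bullet> h2)" by (simp add: h_def inner_diff_right right_diff_distrib)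
  have 10: "K * ((norm (x + h1 - x0))^2 - (norm (x - x0))^2) = 2 * K * ((x - x0) \<bullet> h1) + K * (norm h1)^2" unfolding 3 by (simp add: algebra_simps)
  have "u k - v l = (w (x + h1, t + s1) - w (y + h2, s + s2) - (w (x, t) - w (y, s))) - l1 \<bullet> k - l2 \<bullet> l"
   by (simp add: u_def v_def k l)
  also have "... <= h \<bullet> P h + K * (norm h1)^2 + C * s1^2 + C * s2^2 + M * (s1 - s2)^2"
   using 1 2 4 5 unfolding 6 7 8 9 10 by linarith
  also have "... = (k, l) \<bullet> Tm (k, l)" unfolding Tq by (simp add: k l h_def)
  finally show ?thesis .
 qed
 obtain a b p p' A B \<delta> where I: "norm a < \<rho>1" "norm b < \<rho>1" "norm p < \<rho>1" "norm p' < \<rho>1" "linear A" "linear B" "\<delta> > 0"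
  "\<And>k. norm k < \<delta> ==> u (a + k) <= u a + p \<bullet> k + (k \<bullet> A k) / 2 + \<rho>1 * (norm k)^2"
  "\<And>k. norm k < \<delta> ==> v (b + k) >= v b + p' \<bullet> k + (k \<bullet> B k) / 2 - \<rho>1 * (norm k)^2"
  "\<And>k l. (k \<bullet> A k) / 2 - (l \<bullet> B l) / 2 <= (k, l) \<bullet> Tm (k, l) + \<rho>1 * ((norm k)^2 + (norm l)^2)"
  by (rule ishii_lemma_at_origin[OF rho1(1) cu cv _ _ linT symT max rho1(1)]) (auto simp: u_def v_def)
 define \<epsilon> :: real where "\<epsilon> = 1/64"
 have pe: "\<rho>1 <= \<epsilon>" using rho1(10) by (simp add: \<epsilon>_def)
 have nk: "\<rho>1 * (norm k)^2 <= \<epsilon> * (norm k)^2" for k :: "(real^'n) \<times> real" using pe by (intro mult_right_mono) auto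
 define \<xi>1 where "\<xi>1 = fst (l1 + p)"
 define \<xi>2 where "\<xi>2 = fst (p' - l2)"
 have x1: "norm (\<xi>1 - g' r *\<^sub>R e) <= 2 * K * R + 1"
 proof -
  have "\<xi>1 - g' r *\<^sub>R e = (2 * K) *\<^sub>R (x - x0) + fst p" by (simp add: \<xi>1_def l1_def)
  then have "norm (\<xi>1 - g' r *\<^sub>R e) <= 2 * K * norm (x - x0) + norm (fst p)" using norm_triangle_ineq[of "(2 * K) *\<^sub>R (x - x0)" "fst p"] K0 by simp
  moreover have "2 * K * norm (x - x0) <= 2 * K * R" using xR K0 by (intro mult_left_mono) auto
  moreover have "norm (fst p) <= 1" using kin[of p] I(3) rho1(10) by auto
  ultimately show ?thesis by linarith
 qed
 have x2: "norm (\<xi>2 - g' r *\<^sub>R e) <= 1" using kin[of p'] I(4) rho1(10) by (simp add: \<xi>2_def l2_def)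
 note NN = N[OF rra rr0 e1 x1 x2]
 have jet1: "\<exists>X\<in>sym_matrices. (\<forall>h. h \<bullet> (X *v h) = (h, 0) \<bullet> A (h, 0)) &
  snd (l1 + p) <= norm (q + \<theta> *\<^sub>R fst (l1 + p)) powr \<gamma> * F (X + (2 * \<epsilon>) *\<^sub>R mat 1)"
 proof (rule vsub_jet[OF sub _ I(5) I(7)])
  show "(x, t) + a \<in> \<Omega>" using inBa[of a] I(1) BxO by auto
  show "q + \<theta> *\<^sub>R fst (l1 + p) ~= 0" using NN by (simp add: \<xi>1_def)
  fix k :: "(real^'n) \<times> real" assume "norm k < \<delta>"
  from I(8)[OF this] show "w ((x, t) + a + k) <= w ((x, t) + a) + (l1 + p) \<bullet> k + k \<bullet> A k / 2 + \<epsilon> * (norm k)^2"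
   using nk[of k] by (simp add: u_def inner_add_left inner_add_right add.assoc)
 qed
 then obtain X where X: "X \<in> sym_matrices" "\<And>h. h \<bullet> (X *v h) = (h, 0) \<bullet> A (h, 0)"
  "snd (l1 + p) <= norm (q + \<theta> *\<^sub>R \<xi>1) powr \<gamma> * F (X + (2 * \<epsilon>) *\<^sub>R mat 1)" unfolding \<xi>1_def by blast
 have jet2: "\<exists>X\<in>sym_matrices. (\<forall>h. h \<bullet> (X *v h) = (h, 0) \<bullet> (- B (h, 0))) &
  snd (l2 - p') <= norm (- q + \<theta> *\<^sub>R fst (l2 - p')) powr \<gamma> * - F (- (X + (2 * \<epsilon>) *\<^sub>R mat 1))"
 proof (rule vsub_jet[OF sup _ linear_compose_neg[OF I(6)] I(7)])
  show "(y, s) + b \<in> \<Omega>" using inBb[of b] I(2) BxO by auto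
  have "- q + \<theta> *\<^sub>R fst (l2 - p') = - (q + \<theta> *\<^sub>R \<xi>2)" by (simp add: \<xi>2_def algebra_simps)
  then show "- q + \<theta> *\<^sub>R fst (l2 - p') ~= 0" using NN by (metis neg_equal_0_iff_equal)
  fix k :: "(real^'n) \<times> real" assume "norm k < \<delta>"
  from I(9)[OF this] show "- w ((y, s) + b + k) <= - w ((y, s) + b) + (l2 - p') \<bullet> k + k \<bullet> - B k / 2 + \<epsilon> * (norm k)^2"
   using nk[of k] by (simp add: v_def inner_add_left inner_add_right inner_diff_left add.assoc)
 qed
 then obtain Y' where Y': "Y' \<in> sym_matrices" "\<And>h. h \<bullet> (Y' *v h) = (h, 0) \<bullet> (- B (h, 0))"
  "snd (l2 - p') <= norm (- q + \<theta> *\<^sub>R fst (l2 - p')) powr \<gamma> * - F (- (Y' + (2 * \<epsilon>) *\<^sub>R mat 1))" by blast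
 define X2 where "X2 = X + (2 * \<epsilon>) *\<^sub>R mat 1"
 define Y2 where "Y2 = - (Y' + (2 * \<epsilon>) *\<^sub>R mat 1)"
 have symXY: "X2 \<in> sym_matrices" "Y2 \<in> sym_matrices" using X(1) Y'(1) by (simp_all add: X2_def Y2_def)
 have mneg: "(- Z) *v h = - (Z *v h)" for Z :: "real^'n^'n" and h using scaleR_matrix_mult[of "-1" Z h] by simp
 have X2q: "h \<bullet> (X2 *v h) = (h, 0) \<bullet> A (h, 0) + 2 * \<epsilon> * (norm h)^2" for h
  by (simp add: X2_def matrix_vector_mult_add_rdistrib scaleR_matrix_mult inner_add_right X(2) power2_norm_eq_inner)
 have Y2q: "h \<bullet> (Y2 *v h) = (h, 0) \<bullet> B (h, 0) - 2 * \<epsilon> * (norm h)^2" for h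
 proof -
  have "Y2 *v h = - (Y' *v h + (2 * \<epsilon>) *\<^sub>R h)" unfolding Y2_def mneg matrix_vector_mult_add_rdistrib scaleR_matrix_mult by simp
  then show ?thesis using Y'(2)[of h] by (simp add: inner_diff_right power2_norm_eq_inner)
 qed
 have MI: "((h1, 0) \<bullet> A (h1, 0)) / 2 - ((h2, 0) \<bullet> B (h2, 0)) / 2 <= (h1 - h2) \<bullet> P (h1 - h2) + K * (norm h1)^2 + \<epsilon> * ((norm h1)^2 + (norm h2)^2)" for h1 h2
 proof -
  have "\<rho>1 * ((norm h1)^2 + (norm h2)^2) <= \<epsilon> * ((norm h1)^2 + (norm h2)^2)" using pe by (intro mult_right_mono) auto
  then show ?thesis using I(10)[of "(h1, 0)" "(h2, 0)"] unfolding Tq by simp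
 qed
 have Pub: "h \<bullet> P h <= (g' r / (2 * r) + 1/64) * (norm h)^2" for h
 proof -
  have "g'' r / 2 * (e \<bullet> h)^2 <= 0" using gp' by (intro mult_nonpos_nonneg) auto
  moreover have "g' r / (2 * r) * ((norm h)^2 - (e \<bullet> h)^2) <= g' r / (2 * r) * (norm h)^2" using gp' rpos by (intro mult_left_mono) auto
  ultimately show ?thesis unfolding Pq by (simp add: algebra_simps)
 qed
 have P0: "P 0 = 0" by (simp add: P_def)
 define G where "G = g' r / r + 2 * K + 1"
 have G0: "G >= 0" using gp' rpos K0 by (simp add: G_def)
 have G1: "h \<bullet> (X2 *v h) <= G * (norm h)^2" for h
 proof -
  have "(h, 0) \<bullet> A (h, 0) <= 2 * (h \<bullet> P h) + 2 * K * (norm h)^2 + 2 * \<epsilon> * (norm h)^2" using MI[of h 0] linear_0[OF I(6)]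
   by (simp add: zero_prod_def[symmetric])
  also have "... <= 2 * ((g' r / (2 * r) + 1/64) * (norm h)^2) + 2 * K * (norm h)^2 + 2 * \<epsilon> * (norm h)^2" using Pub[of h] by linarith
  finally have "h \<bullet> (X2 *v h) <= (g' r / r + 1/32 + 2 * K + 4 * \<epsilon>) * (norm h)^2" unfolding X2q using rpos by (simp add: field_simps)
  also have "... <= G * (norm h)^2" by (intro mult_right_mono) (auto simp: G_def \<epsilon>_def)
  finally show ?thesis .
 qed
 have G2: "h \<bullet> (Y2 *v h) >= - G * (norm h)^2" for h
 proof -
  have "(0 - h) \<bullet> P (0 - h) = h \<bullet> P h" using Psc[of "-1" h] by simp
  then have "- ((h, 0) \<bullet> B (h, 0)) <= 2 * (h \<bullet> P h) + 2 * \<epsilon> * (norm h)^2" using MI[of 0 h] linear_0[OF I(5)]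
   by (simp add: zero_prod_def[symmetric])
  also have "... <= 2 * ((g' r / (2 * r) + 1/64) * (norm h)^2) + 2 * \<epsilon> * (norm h)^2" using Pub[of h] by linarith
  finally have "- (h \<bullet> (Y2 *v h)) <= (g' r / r + 1/32 + 4 * \<epsilon>) * (norm h)^2" unfolding Y2q using rpos by (simp add: field_simps)
  also have "... <= G * (norm h)^2" using K0 by (intro mult_right_mono) (auto simp: G_def \<epsilon>_def)
  finally show ?thesis by simp
 qed
 have XYd: "h \<bullet> ((X2 - Y2) *v h) = (h, 0) \<bullet> A (h, 0) - (h, 0) \<bullet> B (h, 0) + 4 * \<epsilon> * (norm h)^2" for h
  unfolding matrix_vector_mult_diff_rdistrib inner_diff_right X2q Y2q by simp
 \<comment> \<open>Equal increments of both points cancel the part coming from \<open>g\<close>;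
   only the localisation remains.\<close>
 have s1: "h \<bullet> ((X2 - Y2) *v h) <= (2 * K + 1) * (norm h)^2" for h
 proof -
  have "(h, 0) \<bullet> A (h, 0) - (h, 0) \<bullet> B (h, 0) <= 2 * K * (norm h)^2 + 4 * \<epsilon> * (norm h)^2" using MI[of h h] by (simp add: P0)
  then have "h \<bullet> ((X2 - Y2) *v h) <= (2 * K + 8 * \<epsilon>) * (norm h)^2" unfolding XYd by (simp add: algebra_simps)
  also have "... <= (2 * K + 1) * (norm h)^2" by (intro mult_right_mono) (auto simp: \<epsilon>_def)
  finally show ?thesis .
 qed
 \<comment> \<open>Opposite increments \<open>e\<close> and \<open>- e\<close> double the argument
   of the quadratic form \<open>P\<close>, whence the factor 4 of \<open>g'' r\<close>.\<close>
 have s2: "e \<bullet> ((X2 - Y2) *v e) <= (2 * K + 1) - (- 4 * g'' r)"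
 proof -
  have ne: "(- e, 0) = - (e, 0::real)" by simp
  define ez where "ez = (e, 0::real)"
  have Bn: "(- e, 0) \<bullet> B (- e, 0) = (e, 0) \<bullet> B (e, 0)" unfolding ne ez_def[symmetric] linear_neg[OF I(6)] by simp
  have ee: "e \<bullet> e = 1" using e1 by (simp add: norm_eq_1)
  have "(2 *\<^sub>R e) \<bullet> P (2 *\<^sub>R e) = 4 * (g'' r / 2 + 1/64)" unfolding Psc using Pq[of e] e1 ee by simp
  moreover have "e - - e = 2 *\<^sub>R e" by (simp add: scaleR_2)
  ultimately have "((e, 0) \<bullet> A (e, 0)) / 2 - ((e, 0) \<bullet> B (e, 0)) / 2 <= 4 * (g'' r / 2 + 1/64) + K + 2 * \<epsilon>"
   using MI[of e "- e"] e1 Bn by simp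
  then show ?thesis unfolding XYd using e1 by (simp add: \<epsilon>_def)
 qed
 define b1 where "b1 = norm (q + \<theta> *\<^sub>R \<xi>1) powr \<gamma>"
 define b2 where "b2 = norm (q + \<theta> *\<^sub>R \<xi>2) powr \<gamma>"
 have b: "b1 > 0" "b2 > 0" "\<bar>b2 / b1 - 1\<bar> <= \<rho> r" "\<rho> r <= 1/2" "b2 >= bm r" "bm r > 0"
  using NN bm[OF rra rr0] by (auto simp: b1_def b2_def)
 have t1: "snd (l1 + p) <= b1 * F X2" using X(3) by (simp add: b1_def X2_def)
 have t2: "b2 * F Y2 <= snd (p' - l2)"
 proof -
  have "- q + \<theta> *\<^sub>R fst (l2 - p') = - (q + \<theta> *\<^sub>R \<xi>2)" by (simp add: \<xi>2_def algebra_simps)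
  then have "norm (- q + \<theta> *\<^sub>R fst (l2 - p')) = norm (q + \<theta> *\<^sub>R \<xi>2)" by (metis norm_minus_cancel)
  then have "snd (l2 - p') <= b2 * - F Y2" using Y'(3) by (simp add: b2_def Y2_def)
  then show ?thesis by simp
 qed
 \<comment> \<open>The terms from \<open>M * (t - s)^2\<close> agree and both penalties have the
   favourable sign, so only \<open>K\<close> and the small errors remain.\<close>
 have t3: "snd (l1 + p) >= snd (p' - l2) - (K + 1)"
 proof -
  have "\<bar>snd p\<bar> <= 1/64" "\<bar>snd p'\<bar> <= 1/64" using kin[of p] kin[of p'] I(3,4) rho1(10) by auto
  moreover have "\<mu> / (T1 - t)^2 >= 0" "\<mu> / (T1 - s)^2 >= 0" using mu by auto
  ultimately show ?thesis by (simp add: l1_def l2_def abs_le_iff)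
 qed
 have "lam * (- 4 * g'' r) <= real CARD('n) * Lam * (2 * K + 1) + 2 * \<rho> r * (real CARD('n) * Lam * G) + 2 * (K + 1) / b2"
  by (rule elliptic_doubling_inequality[OF F L symXY b(1-4) t1 t2 t3 _ G0 G1 G2 _ s1 e1 s2]) (use K0 in auto)
 moreover have "2 * (K + 1) / b2 <= 2 * (K + 1) / bm r" using b K0 by (intro divide_left_mono mult_pos_pos) auto
 ultimately show False using SC[OF rra rr0] by (simp add: G_def)
qed

section \<open>Barriers in the half cylinder for normalised solutions\<close>

lemma powr_two_sided:
 fixes B c \<gamma> :: real
 assumes B: "B >= 1" and c: "1/B <= c" "c <= B"
 shows "B powr (- \<bar>\<gamma>\<bar>) <= c powr \<gamma>" "c powr \<gamma> <= B powr \<bar>\<gamma>\<bar>"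
proof -
 have c0: "0 < 1/B" "0 < c" using B c(1) by (auto intro: less_le_trans[of 0 "1/B"])
 have inv: "(1/B) powr \<gamma> = B powr (- \<gamma>)" using B by (simp add: powr_divide powr_minus_divide)
 consider "\<gamma> >= 0" | "\<gamma> < 0" by linarith
 then have "B powr (- \<bar>\<gamma>\<bar>) <= c powr \<gamma> & c powr \<gamma> <= B powr \<bar>\<gamma>\<bar>"
 proof cases
  case 1
  then have "(1/B) powr \<gamma> <= c powr \<gamma>" "c powr \<gamma> <= B powr \<gamma>" using c c0 by (auto intro!: powr_mono2)
  then show ?thesis using 1 inv by simp
 next
  case 2
  then have "c powr \<gamma> <= (1/B) powr \<gamma>" "B powr \<gamma> <= c powr \<gamma>" using c c0 by (auto intro!: powr_mono2')
  then show ?thesis using 2 inv by simp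
 qed
 then show "B powr (- \<bar>\<gamma>\<bar>) <= c powr \<gamma>" "c powr \<gamma> <= B powr \<bar>\<gamma>\<bar>" by auto
qed

lemma elliptic_rank_one:
 fixes F :: "real^'n^'n => real"
 assumes F: "elliptic_op lam Lam F" and ab: "0 <= a" "0 <= b"
 shows "F (a *\<^sub>R mat 1 - b *\<^sub>R outer e) <= a * (real CARD('n) * Lam) - b * (lam * (norm e)^2)"
proof (rule elliptic_opD0[OF F])
 show "a *\<^sub>R mat 1 - b *\<^sub>R outer e \<in> sym_matrices" by simp
 fix A :: "real^'n^'n" assume A: "A \<in> elliptic_matrices lam Lam"
 have "a * trace A <= a * (real CARD('n) * Lam)" "b * (lam * (norm e)^2) <= b * (e \<bullet> (A *v e))"
  using elliptic_matrices_bounds[OF A] ab by (intro mult_left_mono; simp)+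
 then show "trace (A ** (a *\<^sub>R mat 1 - b *\<^sub>R outer e)) <= a * (real CARD('n) * Lam) - b * (lam * (norm e)^2)"
  by (simp add: trace_mult_diff trace_mult_scaleR trace_outer trace_mat)
qed

lemma C21_on_cong:
 assumes "C21_on U \<phi> D\<phi> D2\<phi> \<phi>t" "\<And>z. \<phi> z = \<psi> z" "\<And>z. D\<phi> z = D\<psi> z" "\<And>z. D2\<phi> z = D2\<psi> z" "\<And>z. \<phi>t z = \<psi>t z"
 shows "C21_on U \<psi> D\<psi> D2\<psi> \<psi>t"
proof -
 have "\<phi> = \<psi>" "D\<phi> = D\<psi>" "D2\<phi> = D2\<psi>" "\<phi>t = \<psi>t" using assms(2-5) by (intro ext; simp)+
 then show ?thesis using assms(1) by simp
qed

text \<open>The barriers of \<open>layer_barrier\<close>, \<open>short_time\<close> with small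
  \<theta>, and \<open>boundary_lipschitz\<close> are instances. The Hessian is written in the form
  to which \<open>elliptic_rank_one\<close> applies.\<close>

lemma C21_quadratic:
 fixes x0 :: "real^'n"
 shows "C21_on UNIV (%z. l \<bullet> fst z + c2 * (fst z $ k)^2 + c3 * (norm (fst z - x0))^2 + (c4 * snd z + c5))
  (%z. l + (2 * c2 * fst z $ k) *\<^sub>R axis k 1 + (2 * c3) *\<^sub>R (fst z - x0))
  (%z. (2 * c3) *\<^sub>R mat 1 - (- 2 * c2) *\<^sub>R outer (axis k 1)) (%z. c4)"
proof -
 have t: "C1_on UNIV (%t. c4 * t + c5) (%_. c4)" unfolding C1_on_def by (auto intro!: derivative_eq_intros)
 show ?thesis
  by (rule C21_on_cong[OF C21_on_add[OF C21_on_add[OF C21_on_add[OF C21_on_affine[of UNIV l] C21_on_cmult[OF C21_on_coord_sq[of UNIV k], of c2]]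
    C21_on_cmult[OF C21_on_power[of UNIV x0 1], of c3]] C21_on_time[OF t, unfolded UNIV_Times_UNIV]]])
   (simp_all add: power2_norm_eq_inner mult_ac)
qed

lemma barrier_comparison_open:
 fixes w :: "(real^'n) \<times> real => real"
 assumes w: "vsub j \<gamma> F q \<theta> \<Omega> w" and K: "compact K" and cw: "continuous_on K w"
  and C: "C21_on UNIV \<phi> D\<phi> D2\<phi> \<phi>t" and V: "open V" "V \<subseteq> K" "V \<subseteq> \<Omega>"
  and int: "\<And>x t. (x, t) \<in> K ==> t < T ==> w (x, t) > \<phi> (x, t) ==> (x, t) \<in> V"
  and sup: "\<And>x t. (x, t) \<in> V ==> q + \<theta> *\<^sub>R D\<phi> (x, t) ~= 0 &
    \<phi>t (x, t) >= norm (q + \<theta> *\<^sub>R D\<phi> (x, t)) powr \<gamma> * F (D2\<phi> (x, t))"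
  and z: "(x, t) \<in> K" "t < T"
 shows "w (x, t) <= \<phi> (x, t)"
proof -
 have cp: "continuous_on K \<phi>" using C unfolding C21_on_def by (blast intro: continuous_on_subset)
 show ?thesis
 proof (rule barrier_comparison[OF w K cw cp open_UNIV C _ _ z])
  fix x t assume a: "(x, t) \<in> K" "t < T" "w (x, t) > \<phi> (x, t)"
  show "(x, t) \<in> interior K \<inter> \<Omega> \<inter> UNIV" using int[OF a] V interior_maximal[OF V(2,1)] by auto
  show "q + \<theta> *\<^sub>R D\<phi> (x, t) ~= 0 & \<phi>t (x, t) >= norm (q + \<theta> *\<^sub>R D\<phi> (x, t)) powr \<gamma> * F (D2\<phi> (x, t))"
   by (rule sup[OF int[OF a]])
 qed
qed

text \<open>The final slice \<open>t = 0\<close> is left out to make the set open; its values are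
  recovered by continuity at the very end.\<close>

definition half_cyl :: "'n => ((real^'n) \<times> real) set" where
 "half_cyl k = {(x, t). norm x < 1 & 0 < x $ k & - 1 < t & t < 0}"

definition half_cyl_flat :: "'n => ((real^'n) \<times> real) set" where
 "half_cyl_flat k = {(x, t). norm x < 1 & 0 <= x $ k & - 1 < t & t < 0}"

text \<open>The barrier lies below \<open>l * x $ k\<close> by \<open>a\<close> times a bracket that
  is at most \<open>7/8 * h\<close> at height \<open>h\<close>. The bracket is not positive on the
  flat face, and is negative at distance 1/4 from \<open>x0\<close> and at time
  \<open>t0 - T\<close>, because the terms \<open>24 * h * (norm (x - x0))^2\<close> and
  \<open>3/2 * h / T * (t0 - t)\<close> reach \<open>3/2 * h\<close> there. Concavity of order
  \<open>1 / h\<close> in the normal direction pays for both terms.\<close>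

lemma layer_barrier:
 fixes w :: "(real^'n) \<times> real => real" and F :: "real^'n^'n => real"
 assumes F: "elliptic_op lam Lam F" and L: "0 < lam"
  and w: "vsub j \<gamma> F q \<theta> (half_cyl k) w" and cw: "continuous_on (half_cyl_flat k) w"
  and wl: "\<And>x t. (x, t) \<in> half_cyl_flat k ==> w (x, t) <= l * x $ k"
  and h: "0 < h" "h <= 1/192" and a: "a > 0" and T: "T > 0"
  and x0: "x0 $ k = 0" "norm x0 <= 1/4" and t0: "- 1 < t0 - T" "t0 < 0"
  and top: "\<And>x t. norm x <= 1/2 ==> x $ k = h ==> t0 - T <= t ==> t < 0 ==> w (x, t) <= (l - 7/8 * a) * h"
  and nd: "\<And>\<sigma> \<omega>. 3/4 <= \<sigma> ==> \<sigma> <= 1 ==> norm \<omega> <= 1/16 ==>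
    1/4 <= norm (q + \<theta> *\<^sub>R (l *\<^sub>R axis k 1 - a *\<^sub>R (\<sigma> *\<^sub>R axis k 1 + \<omega>))) & norm (q + \<theta> *\<^sub>R (l *\<^sub>R axis k 1 - a *\<^sub>R (\<sigma> *\<^sub>R axis k 1 + \<omega>))) <= 4"
  and sc: "3/2 * h / T <= 4 powr (- \<bar>\<gamma>\<bar>) * (lam / (4 * h) - 48 * h * (real CARD('n) * Lam))"
  and z: "0 <= s" "s <= h" "t0 - T <= t" "t < t0"
 shows "w (x0 + s *\<^sub>R axis k 1, t) <= (l - 3/4 * a) * s + 3/2 * a * h / T * (t0 - t)"
proof -
 define e :: "real^'n" where "e = axis k 1"
 have e: "norm e = 1" "e $ k = 1" "\<And>x. e \<bullet> x = x $ k" by (simp_all add: e_def norm_axis_1 inner_axis')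
 define \<phi> where "\<phi> = (%z. ((l - 3/4 * a) *\<^sub>R e) \<bullet> fst z + (- (a / (8 * h))) * (fst z $ k)^2 + (24 * a * h) * (norm (fst z - x0))^2 + (- (3/2 * a * h / T) * snd z + 3/2 * a * h / T * t0))"
 have ph: "\<phi> (x, t) = l * x $ k - a * (3/4 * x $ k + (x $ k)^2 / (8 * h) - 24 * h * (norm (x - x0))^2 - 3/2 * h / T * (t0 - t))" for x t
  unfolding \<phi>_def using e(3) by (simp add: algebra_simps diff_divide_distrib)
 define Kc where "Kc = (cball x0 (1/4) \<times> {t0 - T..t0}) \<inter> {z. 0 <= fst z $ k} \<inter> {z. fst z $ k <= h}"
 define V where "V = (ball x0 (1/4) \<times> {t0 - T<..<t0}) \<inter> {z. 0 < fst z $ k} \<inter> {z. fst z $ k < h}"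
 have half: "norm x <= 1/2" if "norm (x - x0) <= 1/4" for x
  using norm_triangle_ineq[of "x - x0" x0] that x0(2) by simp
 have KcI: "(x, t) \<in> Kc \<longleftrightarrow> norm (x - x0) <= 1/4 & t0 - T <= t & t <= t0 & 0 <= x $ k & x $ k <= h" for x t
  by (auto simp: Kc_def dist_norm norm_minus_commute)
 have VI: "(x, t) \<in> V \<longleftrightarrow> norm (x - x0) < 1/4 & t0 - T < t & t < t0 & 0 < x $ k & x $ k < h" for x t
  by (auto simp: V_def dist_norm norm_minus_commute)
 have Kcyl: "Kc \<subseteq> half_cyl_flat k"
 proof (rule subrelI)
  fix x t assume "(x, t) \<in> Kc"
  then show "(x, t) \<in> half_cyl_flat k" using half[of x] t0 by (auto simp: half_cyl_flat_def KcI)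
 qed
 have "w (x0 + s *\<^sub>R e, t) <= \<phi> (x0 + s *\<^sub>R e, t)"
 proof (rule barrier_comparison_open[OF w _ _ _ _ _ _ _ _ _ z(4)])
  show "compact Kc" unfolding Kc_def by (intro compact_Int_closed compact_Times closed_Collect_le continuous_intros) auto
  show "continuous_on Kc w" by (rule continuous_on_subset[OF cw Kcyl])
  show "C21_on UNIV \<phi> (%z. (l - 3/4 * a) *\<^sub>R e + (2 * (- (a / (8 * h))) * fst z $ k) *\<^sub>R axis k 1 + (2 * (24 * a * h)) *\<^sub>R (fst z - x0))
    (%z. (2 * (24 * a * h)) *\<^sub>R mat 1 - (- 2 * (- (a / (8 * h)))) *\<^sub>R outer (axis k 1)) (%z. - (3/2 * a * h / T))"
   unfolding \<phi>_def by (rule C21_quadratic)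
  show "open V" unfolding V_def by (intro open_Int open_Times open_Collect_less continuous_intros) auto
  show "V \<subseteq> Kc" by (auto simp: VI KcI)
  show "V \<subseteq> half_cyl k"
  proof (rule subrelI)
   fix x t assume "(x, t) \<in> V"
   then show "(x, t) \<in> half_cyl k" using half[of x] t0 by (auto simp: half_cyl_def VI)
  qed
  show "(x0 + s *\<^sub>R e, t) \<in> Kc" using z x0 h e by (simp add: KcI)
 next
  fix x t assume K: "(x, t) \<in> Kc" and t: "t < t0" and gt: "w (x, t) > \<phi> (x, t)"
  define s where "s = x $ k"
  define d where "d = norm (x - x0)"
  define \<tau> where "\<tau> = 3/2 * h / T * (t0 - t)"
  have s: "0 <= s" "s <= h" and d: "d <= 1/4" "0 <= d" and tT: "t0 - T <= t" using K by (auto simp: KcI s_def d_def)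
  have tau: "0 <= \<tau>" using t h T by (auto simp: \<tau>_def)
  have sq: "s^2 / (8 * h) <= s / 8"
   using mult_left_mono[OF s(2,1)] h by (simp add: power2_eq_square field_simps)
  have hd: "0 <= 24 * h * d^2" using h by simp
  have ph': "\<phi> (x, t) = l * s - a * (3/4 * s + s^2 / (8 * h) - 24 * h * d^2 - \<tau>)" unfolding ph by (simp add: s_def d_def \<tau>_def)
  have "w (x, t) <= l * s" using wl[of x t] Kcyl K by (auto simp: s_def)
  then have "0 < a * (3/4 * s + s^2 / (8 * h) - 24 * h * d^2 - \<tau>)" using gt ph' by linarith
  then have "0 < 3/4 * s + s^2 / (8 * h) - 24 * h * d^2 - \<tau>" using a by (simp add: zero_less_mult_iff)
  then have m: "24 * h * d^2 + \<tau> < 7/8 * s" using sq by linarith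
  have 1: "0 < s" using m hd tau by linarith
  have "24 * h * d^2 < h * 1" using m tau s h by linarith
  then have "h * (24 * d^2) < h * 1" by (simp add: mult_ac)
  then have "24 * d^2 < 1" using h by (simp only: mult_less_cancel_left_pos)
  then have 2: "d < 1/4" using d by (cases "d = 1/4") (auto simp: power2_eq_square)
  have "\<tau> < h" using m hd s h by linarith
  then have "h * (3/2 * (t0 - t) / T) < h * 1" by (simp add: \<tau>_def algebra_simps)
  then have "3/2 * (t0 - t) / T < 1" using h by (simp only: mult_less_cancel_left_pos)
  then have "3/2 * (t0 - t) < T" using T by (simp add: field_simps)
  then have 3: "t0 - T < t" using t by argo
  have 4: "s < h"
  proof (rule ccontr)
   assume "\<not> s < h"
   then have sh: "s = h" using s by simp
   have "w (x, t) <= (l - 7/8 * a) * h" using top[of x t] half[of x] d sh tT t t0 by (simp add: s_def d_def)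
   moreover have "3/4 * s + s^2 / (8 * h) - 24 * h * d^2 - \<tau> <= 7/8 * h" using hd tau sq sh by linarith
   then have "a * (3/4 * s + s^2 / (8 * h) - 24 * h * d^2 - \<tau>) <= a * (7/8 * h)" using a by simp
   ultimately show False using gt ph' sh by (simp add: algebra_simps)
  qed
  show "(x, t) \<in> V" using 1 2 3 4 t by (simp add: VI s_def d_def)
 next
  fix x t assume V: "(x, t) \<in> V"
  define D where "D = (l - 3/4 * a) *\<^sub>R e + (2 * (- (a / (8 * h))) * fst (x, t) $ k) *\<^sub>R axis k 1 + (2 * (24 * a * h)) *\<^sub>R (fst (x, t) - x0)"
  have De: "D = l *\<^sub>R axis k 1 - a *\<^sub>R ((3/4 + x $ k / (4 * h)) *\<^sub>R axis k 1 + (- (48 * h)) *\<^sub>R (x - x0))"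
   by (simp add: D_def e_def algebra_simps)
  have "norm ((- (48 * h)) *\<^sub>R (x - x0)) <= 48 * h * (1/4)" using V h by (simp add: VI del: scaleR_minus_left)
  also have "... <= 1/16" using h by simp
  finally have om: "norm ((- (48 * h)) *\<^sub>R (x - x0)) <= 1/16" .
  have sg: "3/4 <= 3/4 + x $ k / (4 * h)" "3/4 + x $ k / (4 * h) <= 1" using V h by (auto simp: VI field_simps)
  have n: "1/4 <= norm (q + \<theta> *\<^sub>R D)" "norm (q + \<theta> *\<^sub>R D) <= 4" using nd[OF sg om] unfolding De by auto
  define b where "b = norm (q + \<theta> *\<^sub>R D) powr \<gamma>"
  have b: "4 powr (- \<bar>\<gamma>\<bar>) <= b" using powr_two_sided(1)[of 4 "norm (q + \<theta> *\<^sub>R D)" \<gamma>] n by (simp add: b_def)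
  define Y where "Y = lam / (4 * h) - 48 * h * (real CARD('n) * Lam)"
  have FY: "F ((2 * (24 * a * h)) *\<^sub>R mat 1 - (- 2 * (- (a / (8 * h)))) *\<^sub>R outer (axis k 1)) <= - (a * Y)"
   using elliptic_rank_one[OF F, of "2 * (24 * a * h)" "- 2 * (- (a / (8 * h)))" "axis k 1"] a h
   by (simp add: norm_axis_1 Y_def algebra_simps)
  have "0 < 3/2 * h / T" using h T by simp
  then have "0 < 4 powr (- \<bar>\<gamma>\<bar>) * Y" using sc by (simp add: Y_def)
  then have Y0: "0 < Y" by (simp add: zero_less_mult_iff)
  have "b * F ((2 * (24 * a * h)) *\<^sub>R mat 1 - (- 2 * (- (a / (8 * h)))) *\<^sub>R outer (axis k 1)) <= b * (- (a * Y))"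
   using FY by (intro mult_left_mono) (auto simp: b_def)
  also have "... <= 4 powr (- \<bar>\<gamma>\<bar>) * (- (a * Y))" using b a Y0 by (intro mult_right_mono_neg) auto
  also have "... <= - (3/2 * a * h / T)" using mult_left_mono[OF sc, of a] a by (simp add: Y_def mult_ac)
  finally show "q + \<theta> *\<^sub>R ((l - 3/4 * a) *\<^sub>R e + (2 * (- (a / (8 * h))) * fst (x, t) $ k) *\<^sub>R axis k 1 + (2 * (24 * a * h)) *\<^sub>R (fst (x, t) - x0)) ~= 0 &
   norm (q + \<theta> *\<^sub>R ((l - 3/4 * a) *\<^sub>R e + (2 * (- (a / (8 * h))) * fst (x, t) $ k) *\<^sub>R axis k 1 + (2 * (24 * a * h)) *\<^sub>R (fst (x, t) - x0))) powr \<gamma> *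
   F ((2 * (24 * a * h)) *\<^sub>R mat 1 - (- 2 * (- (a / (8 * h)))) *\<^sub>R outer (axis k 1)) <= - (3/2 * a * h / T)"
   using n unfolding b_def D_def by auto
 qed
 moreover have "\<phi> (x0 + s *\<^sub>R e, t) <= (l - 3/4 * a) * s + 3/2 * a * h / T * (t0 - t)"
 proof -
  have "(x0 + s *\<^sub>R e) $ k = s" using x0 e by simp
  moreover have "norm (x0 + s *\<^sub>R e - x0) = s" using e z by simp
  moreover have "24 * h * s^2 <= s^2 / (8 * h)"
  proof -
   have "24 * h <= 1 / (8 * h)" using h mult_mono[of h "1/192" h "1/192"] by (simp add: field_simps)
   then show ?thesis using mult_right_mono[of "24 * h" "1 / (8 * h)" "s^2"] by simp
  qed
  ultimately have "a * (3/4 * s - 3/2 * h / T * (t0 - t)) <= a * (3/4 * s + s^2 / (8 * h) - 24 * h * s^2 - 3/2 * h / T * (t0 - t))"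
   using a by (intro mult_left_mono) auto
  with \<open>(x0 + s *\<^sub>R e) $ k = s\<close> \<open>norm (x0 + s *\<^sub>R e - x0) = s\<close> show ?thesis unfolding ph by (simp add: algebra_simps)
 qed
 ultimately show ?thesis by (simp add: e_def)
qed

text \<open>\<theta> is the width of the slope interval over the size of the full gradient, and
  \<open>q\<close> the direction of the full gradient at the lower end \<open>lo\<close>. The bound
  on \<open>q $ k\<close> records that \<open>lo\<close> is at most minus half the width; with
  \<open>norm q = 1\<close> it gives \<open>\<theta> <= 2\<close>. The condition on
  \<open>- w\<close> is the supersolution property of \<open>w\<close>.\<close>

definition canonical :: "'n => nat => real => real => real => (real^'n^'n => real) => real^'n => real => ((real^'n) \<times> real => real) => bool" where
 "canonical k j \<gamma> lam Lam F q \<theta> w \<longleftrightarrow> elliptic_op lam Lam F & norm q = 1 & 0 < \<theta> & q $ k <= - \<theta> / 2 &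
   vsub j \<gamma> F q \<theta> (half_cyl k) w & vsub j \<gamma> (%M. - F (- M)) (- q) \<theta> (half_cyl k) (%z. - w z) &
   continuous_on (half_cyl_flat k) w & (\<forall>x t. (x, t) \<in> half_cyl_flat k --> 0 <= w (x, t) & w (x, t) <= x $ k)"

lemma canonicalD:
 assumes "canonical k j \<gamma> lam Lam F q \<theta> w"
 shows "elliptic_op lam Lam F" "norm q = 1" "0 < \<theta>" "\<theta> <= 2" "vsub j \<gamma> F q \<theta> (half_cyl k) w"
  "vsub j \<gamma> (%M. - F (- M)) (- q) \<theta> (half_cyl k) (%z. - w z)" "continuous_on (half_cyl_flat k) w"
  "\<And>x t. (x, t) \<in> half_cyl_flat k ==> 0 <= w (x, t)" "\<And>x t. (x, t) \<in> half_cyl_flat k ==> w (x, t) <= x $ k"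
  "\<And>x t. (x, t) \<in> half_cyl_flat k ==> w (x, t) <= 1"
proof -
 show c: "elliptic_op lam Lam F" "norm q = 1" "0 < \<theta>" "vsub j \<gamma> F q \<theta> (half_cyl k) w"
  "vsub j \<gamma> (%M. - F (- M)) (- q) \<theta> (half_cyl k) (%z. - w z)" "continuous_on (half_cyl_flat k) w"
  "\<And>x t. (x, t) \<in> half_cyl_flat k ==> 0 <= w (x, t)" "\<And>x t. (x, t) \<in> half_cyl_flat k ==> w (x, t) <= x $ k"
  using assms unfolding canonical_def by auto
 have "\<bar>q $ k\<bar> <= 1" using component_le_norm_cart[of q k] c(2) by simp
 moreover have "q $ k <= - \<theta> / 2" using assms unfolding canonical_def by auto
 ultimately show "\<theta> <= 2" by simp
 fix x :: "real^'a" and t assume a: "(x, t) \<in> half_cyl_flat k"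
 have "x $ k <= norm x" using component_le_norm_cart[of x k] by simp
 then show "w (x, t) <= 1" using c(8)[OF a] a by (simp add: half_cyl_flat_def)
qed

lemma norm_add_bounds:
 fixes q v :: "'a::real_normed_vector"
 assumes "norm q = 1" "norm v <= c"
 shows "1 - c <= norm (q + v)" "norm (q + v) <= 1 + c"
 using norm_triangle_ineq[of q v] norm_diff_ineq[of q v] assms by auto

text \<open>If \<theta> is small against \<rho>, a quadratic barrier works, as its slope of order
  1/\<rho> cannot cancel \<open>q\<close>. Otherwise the barrier consists of the exactly critical
  slope \<xi> plus a power of the distance: off the centre \<open>power_operator_bound\<close>
  bounds the operator, and at the centre the critical clause of \<open>vsub\<close> applies.\<close>

lemma short_time:
 fixes k :: "'n::finite"
 assumes L: "0 < lam" "lam <= Lam" and j: "j >= 2" "(2 * real j - 1) * (1 + \<gamma>) > 1" and rho: "0 < \<rho>" "\<rho> <= 1" and kap: "0 < \<kappa>" "\<kappa> <= 1"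
 shows "\<exists>\<delta>>0. \<forall>(F :: real^'n^'n => real) q \<theta> w x0 t1 t. canonical k j \<gamma> lam Lam F q \<theta> w --> cball x0 \<rho> \<subseteq> {x. norm x < 1 & 0 < x $ k} -->
   - 1 < t1 --> (\<forall>x\<in>cball x0 \<rho>. w (x, t1) <= \<kappa>) --> t1 <= t --> t < t1 + \<delta> --> t < 0 --> w (x0, t) <= 2 * \<kappa>"
proof -
 define n where "n = real CARD('n)"
 define N1 where "N1 = 4 powr \<bar>\<gamma>\<bar> * (2 / \<rho>^2 * (n * Lam))"
 \<comment> \<open>In this smaller ball the critical affine part, of slope at most
   \<open>4 / \<rho>\<close>, is at most \<open>\<kappa> / 2\<close> in modulus.\<close>
 define \<rho>1 where "\<rho>1 = \<kappa> * \<rho> / 8"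
 have rho1: "0 < \<rho>1" "\<rho>1 <= \<rho>" "\<rho>1 <= 1"
 proof -
  have "\<kappa> * \<rho> <= 1 * \<rho>" using kap rho by (intro mult_right_mono) auto
  moreover from this have "\<kappa> * \<rho> <= 1" using rho by linarith
  ultimately show "0 < \<rho>1" "\<rho>1 <= \<rho>" "\<rho>1 <= 1" using kap rho by (auto simp: \<rho>1_def)
 qed
 define A where "A = 1 / \<rho>1 ^ (2 * j)"
 have A: "A > 0" using rho1 by (simp add: A_def)
 \<comment> \<open>Two powers occur because \<theta> ranges over \<open>[\<rho> / 4, 2]\<close> and
   the sign of \<gamma> decides which end is the worse one.\<close>
 define C2 where "C2 = ((2 * real j * A * 2) powr \<gamma> + (2 * real j * A * (\<rho> / 4)) powr \<gamma>) * (A * Lam * (2 * real j * n + 4 * real j * real (j - 1)))"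
 have C2: "C2 >= 0" using A L by (auto simp: C2_def n_def)
 define N where "N = max N1 C2 + 1"
 have N: "N > 0" "N >= N1" "N >= C2" using C2 by (auto simp: N_def)
 define \<delta> where "\<delta> = \<kappa> / (2 * N)"
 have del: "\<delta> > 0" using N kap by (simp add: \<delta>_def)
 have main: "w (x0, t) <= 2 * \<kappa>"
  if can: "canonical k j \<gamma> lam Lam F q \<theta> w" and sub: "cball x0 \<rho> \<subseteq> {x. norm x < 1 & 0 < x $ k}" and t1: "- 1 < t1"
   and init: "\<forall>x\<in>cball x0 \<rho>. w (x, t1) <= \<kappa>" and t: "t1 <= t" "t < t1 + \<delta>" "t < 0"
  for F :: "real^'n^'n => real" and q \<theta> w x0 t1 t
 proof -
  note c = canonicalD[OF can]
  have Nt: "N * (t - t1) <= \<kappa> / 2"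
  proof -
   have "N * (t - t1) <= N * \<delta>" using t N by (intro mult_left_mono) auto
   then show ?thesis using N by (simp add: \<delta>_def)
  qed
  define T where "T = t / 2"
  have T: "t < T" "T < 0" using t by (auto simp: T_def)
  show ?thesis
  proof (cases "\<theta> <= \<rho> / 4")
   case True
   define \<phi> where "\<phi> = (%z::(real^'n) \<times> real. 0 \<bullet> fst z + 0 * (fst z $ k)^2 + (1 / \<rho>^2) * (norm (fst z - x0))^2 + (N * snd z + (\<kappa> - N * t1)))"
   have ph: "\<phi> (x, s) = (norm (x - x0) / \<rho>)^2 + N * (s - t1) + \<kappa>" for x s by (simp add: \<phi>_def power_divide algebra_simps)
   have "w (x0, t) <= \<phi> (x0, t)"
   proof (rule barrier_comparison_open[OF c(5) _ _ _ _ _ _ _ _ _ T(1)])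
    show "compact (cball x0 \<rho> \<times> {t1..T})" by (intro compact_Times) auto
    have "cball x0 \<rho> \<times> {t1..T} \<subseteq> half_cyl_flat k" using sub t1 T by (force simp: half_cyl_flat_def)
    then show "continuous_on (cball x0 \<rho> \<times> {t1..T}) w" by (rule continuous_on_subset[OF c(7)])
    show "C21_on UNIV \<phi> (%z. 0 + (2 * 0 * fst z $ k) *\<^sub>R axis k 1 + (2 * (1 / \<rho>^2)) *\<^sub>R (fst z - x0)) (%z. (2 * (1 / \<rho>^2)) *\<^sub>R mat 1 - (- 2 * 0) *\<^sub>R outer (axis k 1)) (%z. N)"
     unfolding \<phi>_def by (rule C21_quadratic)
    show "open (ball x0 \<rho> \<times> {t1<..<T})" by (intro open_Times) auto
    show "ball x0 \<rho> \<times> {t1<..<T} \<subseteq> cball x0 \<rho> \<times> {t1..T}" by auto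
    show "ball x0 \<rho> \<times> {t1<..<T} \<subseteq> half_cyl k" using sub t1 T by (force simp: half_cyl_def)
    show "(x0, t) \<in> cball x0 \<rho> \<times> {t1..T}" using rho t T by auto
   next
    fix x s assume K: "(x, s) \<in> cball x0 \<rho> \<times> {t1..T}" and s: "s < T" and gt: "\<phi> (x, s) < w (x, s)"
    have Ns: "0 <= N * (s - t1)" using K N by auto
    have "(x, s) \<in> half_cyl_flat k" using K sub t1 T by (force simp: half_cyl_flat_def)
    then have w1: "w (x, s) <= 1" by (rule c(10))
    have "norm (x - x0) ~= \<rho>"
    proof
     assume "norm (x - x0) = \<rho>"
     then have "\<phi> (x, s) >= 1" using Ns kap rho by (simp add: ph)
     then show False using gt w1 by simp
    qed
    moreover have "s ~= t1"
    proof
     assume "s = t1"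
     then have "w (x, s) <= \<kappa>" using init K by auto
     moreover have "\<phi> (x, s) >= \<kappa>" using Ns by (simp add: ph)
     ultimately show False using gt by simp
    qed
    ultimately show "(x, s) \<in> ball x0 \<rho> \<times> {t1<..<T}" using K s by (auto simp: dist_norm norm_minus_commute)
   next
    fix x s assume K: "(x, s) \<in> ball x0 \<rho> \<times> {t1<..<T}"
    define v where "v = (2 * (1 / \<rho>^2)) *\<^sub>R (x - x0)"
    have "norm v <= 2 * (1 / \<rho>^2) * \<rho>" using K by (auto simp: v_def dist_norm norm_minus_commute intro!: divide_right_mono)
    then have "norm v <= 2 / \<rho>" using rho by (simp add: power2_eq_square)
    then have "\<theta> * norm v <= \<rho> / 4 * (2 / \<rho>)" using True c(3) rho by (intro mult_mono) auto
    then have "norm (\<theta> *\<^sub>R v) <= 1/2" using rho c(3) by simp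
    note b = norm_add_bounds[OF c(2) this]
    have "norm (q + \<theta> *\<^sub>R v) powr \<gamma> <= 4 powr \<bar>\<gamma>\<bar>" using b by (intro powr_two_sided) auto
    moreover have "F ((2 * (1 / \<rho>^2)) *\<^sub>R mat 1 - (- 2 * 0) *\<^sub>R outer (axis k 1)) <= 2 / \<rho>^2 * (n * Lam)"
     using elliptic_rank_one[OF c(1), of "2 * (1 / \<rho>^2)" "- 2 * 0" "axis k 1"] by (simp add: n_def)
    ultimately have "norm (q + \<theta> *\<^sub>R v) powr \<gamma> * F ((2 * (1 / \<rho>^2)) *\<^sub>R mat 1 - (- 2 * 0) *\<^sub>R outer (axis k 1)) <= N1"
     unfolding N1_def using L by (intro order_trans[OF mult_left_mono mult_right_mono]) (auto simp: n_def)
    then show "q + \<theta> *\<^sub>R (0 + (2 * 0 * fst (x, s) $ k) *\<^sub>R axis k 1 + (2 * (1 / \<rho>^2)) *\<^sub>R (fst (x, s) - x0)) ~= 0 &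
     norm (q + \<theta> *\<^sub>R (0 + (2 * 0 * fst (x, s) $ k) *\<^sub>R axis k 1 + (2 * (1 / \<rho>^2)) *\<^sub>R (fst (x, s) - x0))) powr \<gamma> *
     F ((2 * (1 / \<rho>^2)) *\<^sub>R mat 1 - (- 2 * 0) *\<^sub>R outer (axis k 1)) <= N"
     using b N(2) by (auto simp: v_def)
   qed
   then show ?thesis using Nt kap by (simp add: ph)
  next
   case False
   have th: "\<rho> / 4 < \<theta>" "0 < \<theta>" using False c(3) by auto
   define \<xi> where "\<xi> = - (1 / \<theta>) *\<^sub>R q"
   have xi: "\<theta> *\<^sub>R \<xi> = - q" "norm \<xi> <= 4 / \<rho>"
    using th rho c(2) by (auto simp: \<xi>_def field_simps)
   define f where "f z = w z - (3/2 * \<kappa> + A * ((fst z - x0) \<bullet> (fst z - x0)) ^ j + \<xi> \<bullet> (fst z - x0) + N * (snd z - t1))" for z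
   define Kc where "Kc = cball x0 \<rho>1 \<times> {t1..T}"
   have Ksub: "Kc \<subseteq> half_cyl_flat k"
   proof (rule subrelI)
    fix x s assume a: "(x, s) \<in> Kc"
    then have "x \<in> cball x0 \<rho>" using rho1 by (auto simp: Kc_def)
    then show "(x, s) \<in> half_cyl_flat k" using sub a t1 T by (auto simp: half_cyl_flat_def Kc_def intro: less_imp_le)
   qed
   have "compact Kc" unfolding Kc_def by (intro compact_Times) auto
   have "continuous_on Kc w" by (rule continuous_on_subset[OF c(7) Ksub])
   then have cf: "continuous_on Kc f" unfolding f_def by (intro continuous_intros)
   have fx: "f (x0, t) <= 0"
   proof (rule ccontr)
    assume "\<not> f (x0, t) <= 0"
    then have "f (x0, t) > 0" by simp
    moreover have "(x0, t) \<in> Kc" using rho1 t T by (auto simp: Kc_def)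
    ultimately obtain \<mu> y s where m: "\<mu> > 0" "(y, s) \<in> Kc" "s < T" "f (y, s) > 0"
     "\<And>x t. (x, t) \<in> Kc ==> t < T ==> f (x, t) - \<mu> / (T - t) <= f (y, s) - \<mu> / (T - s)"
     using barrier_touch[OF \<open>compact Kc\<close> cf _ T(1)] by blast
    have yK: "norm (y - x0) <= \<rho>1" "t1 <= s" using m(2) by (auto simp: Kc_def dist_norm norm_minus_commute)
    have "\<bar>\<xi> \<bullet> (y - x0)\<bar> <= norm \<xi> * norm (y - x0)" by (rule Cauchy_Schwarz_ineq2)
    also have "... <= 4 / \<rho> * \<rho>1" using xi yK rho by (intro mult_mono) auto
    also have "... = \<kappa> / 2" using rho by (simp add: \<rho>1_def)
    finally have xb: "\<bar>\<xi> \<bullet> (y - x0)\<bar> <= \<kappa> / 2" .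
    have Ns: "0 <= N * (s - t1)" using yK N by auto
    have Ay: "0 <= A * ((y - x0) \<bullet> (y - x0)) ^ j" using A by simp
    have fy: "w (y, s) > 3/2 * \<kappa> + A * ((y - x0) \<bullet> (y - x0)) ^ j + \<xi> \<bullet> (y - x0) + N * (s - t1)" using m(4) by (simp add: f_def)
    have "s ~= t1"
    proof
     assume "s = t1"
     then have "w (y, s) <= \<kappa>" using init yK rho1 by (auto simp: dist_norm norm_minus_commute)
     then show False using fy xb Ay Ns by linarith
    qed
    then have s1: "t1 < s" using yK by simp
    have "norm (y - x0) ~= \<rho>1"
    proof
     assume "norm (y - x0) = \<rho>1"
     then have "A * ((y - x0) \<bullet> (y - x0)) ^ j = 1" using rho1 by (simp add: A_def power_mult dot_square_norm)
     moreover have "w (y, s) <= 1" using c(10) Ksub m(2) by auto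
     ultimately show False using fy xb Ns kap by linarith
    qed
    then have y1: "norm (y - x0) < \<rho>1" using yK by simp
    have yO: "(y, s) \<in> half_cyl k" using sub y1 rho1 s1 m(3) T t1 by (force simp: half_cyl_def dist_norm norm_minus_commute)
    have C1: "C1_on {..<T} (%t. N * t + \<mu> / (T - t)) (%t. N + \<mu> / (T - t)^2)"
     unfolding C1_on_def by (auto intro!: derivative_eq_intros continuous_intros simp: power2_eq_square)
    have mp: "0 < \<mu> / (T - s)^2" using m by simp
    show False
    proof (cases "y = x0")
     \<comment> \<open>The gradient of the barrier is critical here, so the noncritical clause says
       nothing. Multiplying by \<theta> turns the barrier into the power plus a function of time
       that the critical clause admits.\<close>
     case True
     define d where "d = min \<rho>1 (min (s - t1) (T - s))"
     have d: "d > 0" "d <= \<rho>1" "d <= s - t1" "d <= T - s" using rho1 s1 m(3) by (auto simp: d_def)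
     have C1d: "C1_on {s - d<..<s + d} (%t. \<theta> * (N * t + \<mu> / (T - t))) (%t. \<theta> * (N + \<mu> / (T - t)^2))"
      using C1 d unfolding C1_on_def by (auto intro!: continuous_intros DERIV_cmult elim: continuous_on_subset)
     have "\<theta> * (N + \<mu> / (T - s)^2) <= 0"
     proof (rule vsubD_crit[OF c(5) _ d(1) C1d, where ?x0.0 = x0 and A = "\<theta> * A"])
      show "(x0, s) \<in> half_cyl k" using yO True by simp
      show "0 <= \<theta> * A" using A th by simp
      fix x t assume x: "norm (x - x0) < d" "\<bar>t - s\<bar> < d"
      have "(x, t) \<in> Kc" "t < T" using x d by (auto simp: Kc_def dist_norm norm_minus_commute abs_less_iff)
      then have "\<theta> * (f (x, t) - \<mu> / (T - t)) <= \<theta> * (f (x0, s) - \<mu> / (T - s))" using m(5)[of x t] True th by simp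
      moreover have "\<theta> * (\<xi> \<bullet> (x - x0)) = - (q \<bullet> (x - x0))" using arg_cong[OF xi(1), of "%v. v \<bullet> (x - x0)"] by simp
      moreover have "norm (x - x0) ^ (2 * j) = ((x - x0) \<bullet> (x - x0)) ^ j" by (simp add: power_mult dot_square_norm)
      ultimately show "\<theta> * w (x, t) + q \<bullet> x - \<theta> * A * norm (x - x0) ^ (2 * j) - \<theta> * (N * t + \<mu> / (T - t)) <= \<theta> * w (x0, s) + q \<bullet> x0 - \<theta> * (N * s + \<mu> / (T - s))"
       using j(1) by (simp add: f_def algebra_simps inner_diff_right power_0_left)
     qed
     moreover have "0 < \<theta> * (N + \<mu> / (T - s)^2)" using th N mp by (intro mult_pos_pos add_pos_pos) auto
     ultimately show False by simp
    next
     case False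
     define U where "U = ball x0 \<rho>1 \<times> {t1<..<T}"
     have CU: "C21_on U (%z. (A * ((fst z - x0) \<bullet> (fst z - x0)) ^ j + \<xi> \<bullet> fst z) + (N * snd z + \<mu> / (T - snd z)))
      (%z. (A *\<^sub>R ((2 * real j * ((fst z - x0) \<bullet> (fst z - x0)) ^ (j - 1)) *\<^sub>R (fst z - x0)) + \<xi>) + 0)
      (%z. (A *\<^sub>R ((2 * real j * ((fst z - x0) \<bullet> (fst z - x0)) ^ (j - 1)) *\<^sub>R mat 1
       + (4 * real j * real (j - 1) * ((fst z - x0) \<bullet> (fst z - x0)) ^ (j - 2)) *\<^sub>R outer (fst z - x0)) + 0) + 0)
      (%z. (A * 0 + 0) + (N + \<mu> / (T - snd z)^2))"
      by (rule C21_on_subset[OF C21_power_test[OF C1]]) (auto simp: U_def)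
     define g where "g = A *\<^sub>R ((2 * real j * ((y - x0) \<bullet> (y - x0)) ^ (j - 1)) *\<^sub>R (y - x0))"
     define H where "H = A *\<^sub>R ((2 * real j * ((y - x0) \<bullet> (y - x0)) ^ (j - 1)) *\<^sub>R mat 1 + (4 * real j * real (j - 1) * ((y - x0) \<bullet> (y - x0)) ^ (j - 2)) *\<^sub>R outer (y - x0))"
     have qg: "q + \<theta> *\<^sub>R ((g + \<xi>) + 0) = \<theta> *\<^sub>R g" using xi(1) by (simp add: scaleR_add_right)
     have g0: "\<theta> *\<^sub>R g ~= 0" using False A th j by (simp add: g_def)
     have "(A * 0 + 0) + (N + \<mu> / (T - snd (y, s))^2) <= norm (q + \<theta> *\<^sub>R ((g + \<xi>) + 0)) powr \<gamma> * F ((H + 0) + 0)"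
      unfolding g_def H_def
     proof (rule vsubD[OF c(5) yO _ _ CU, unfolded fst_conv])
      show "open U" unfolding U_def by (intro open_Times) auto
      show "(y, s) \<in> U" using y1 s1 m(3) by (simp add: U_def dist_norm norm_minus_commute)
      show "q + \<theta> *\<^sub>R (A *\<^sub>R ((2 * real j * ((y - x0) \<bullet> (y - x0)) ^ (j - 1)) *\<^sub>R (y - x0)) + \<xi> + 0) ~= 0" using qg g0 by (simp add: g_def)
      fix z assume "z \<in> U"
      then have "(fst z, snd z) \<in> Kc" "snd z < T" by (auto simp: U_def Kc_def)
      from m(5)[OF this] show "w z - ((A * ((fst z - x0) \<bullet> (fst z - x0)) ^ j + \<xi> \<bullet> fst z) + (N * snd z + \<mu> / (T - snd z)))
        <= w (y, s) - ((A * ((y - x0) \<bullet> (y - x0)) ^ j + \<xi> \<bullet> y) + (N * snd (y, s) + \<mu> / (T - snd (y, s))))"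
       by (simp add: f_def inner_diff_right right_diff_distrib)
     qed
     then have 1: "N + \<mu> / (T - s)^2 <= norm (\<theta> *\<^sub>R g) powr \<gamma> * F H" unfolding qg by simp
     have "norm (\<theta> *\<^sub>R g) powr \<gamma> * F H <= ((2 * real j * A * \<theta>) powr \<gamma> * (A * Lam * (2 * real j * n + 4 * real j * real (j - 1)))) * norm (y - x0) powr ((2 * real j - 1) * (1 + \<gamma>) - 1)"
      unfolding g_def H_def n_def using False by (intro power_operator_bound[OF c(1) L j(1) A th(2)]) auto
     also have "... <= C2 * 1"
     proof (intro mult_mono)
      have "(2 * real j * A * \<theta>) powr \<gamma> <= (2 * real j * A * 2) powr \<gamma> + (2 * real j * A * (\<rho> / 4)) powr \<gamma>"
      proof (cases "\<gamma> >= 0")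
       case True
       have "(2 * real j * A * \<theta>) powr \<gamma> <= (2 * real j * A * 2) powr \<gamma>" using True c(4) th A by (intro powr_mono2 mult_left_mono) auto
       then show ?thesis by (simp add: add_increasing2)
      next
       case False
       have "(2 * real j * A * \<theta>) powr \<gamma> <= (2 * real j * A * (\<rho> / 4)) powr \<gamma>" using False th A rho j by (intro powr_mono2' mult_left_mono mult_pos_pos) auto
       then show ?thesis by (simp add: add_increasing)
      qed
      then show "(2 * real j * A * \<theta>) powr \<gamma> * (A * Lam * (2 * real j * n + 4 * real j * real (j - 1))) <= C2"
       unfolding C2_def using A L by (intro mult_right_mono) (auto simp: n_def)
      show "norm (y - x0) powr ((2 * real j - 1) * (1 + \<gamma>) - 1) <= 1" using yK rho1 j(2) by (intro powr_le1) auto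
     qed (use C2 in auto)
     finally show False using 1 N(3) mp by linarith
    qed
   qed
   then show ?thesis using Nt kap j by (simp add: f_def power_0_left)
  qed
 qed
 show ?thesis by (intro exI[of _ \<delta>] conjI del allI impI) (rule main)
qed

lemma C21_bump:
 fixes x1 V :: "real^'n" and c N t1 \<rho> :: real
 defines "Y \<equiv> %z::(real^'n) \<times> real. fst z - (x1 + (snd z - t1) *\<^sub>R V)"
 defines "E \<equiv> %z::(real^'n) \<times> real. c * exp (- N * (snd z - t1))"
 shows "C21_on UNIV (%z. E z * (\<rho>^2 - Y z \<bullet> Y z)^2) (%z. (- 4 * E z * (\<rho>^2 - Y z \<bullet> Y z)) *\<^sub>R Y z)
  (%z. (- 4 * E z * (\<rho>^2 - Y z \<bullet> Y z)) *\<^sub>R mat 1 - (- 8 * E z) *\<^sub>R outer (Y z))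
  (%z. E z * (- N * (\<rho>^2 - Y z \<bullet> Y z)^2 + 4 * (\<rho>^2 - Y z \<bullet> Y z) * (Y z \<bullet> V)))"
proof -
 have P: "((%y. \<rho>^2 - (y - b) \<bullet> (y - b)) has_derivative (%h. - 2 * ((x - b) \<bullet> h))) (at x)" for b x :: "real^'n"
  by (auto intro!: derivative_eq_intros simp: inner_commute)
 have 1: "((%y. e0 * (\<rho>^2 - (y - b) \<bullet> (y - b))^2) has_derivative (%h. ((- 4 * e0 * (\<rho>^2 - (x - b) \<bullet> (x - b))) *\<^sub>R (x - b)) \<bullet> h)) (at x)" for b x :: "real^'n" and e0
  by (rule has_derivative_eq_rhs[OF has_derivative_mult_right[OF has_derivative_power[OF P]]]) (auto simp: fun_eq_iff)
 have 2: "((%y. (- 4 * e0 * (\<rho>^2 - (y - b) \<bullet> (y - b))) *\<^sub>R (y - b)) has_derivative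
   (%h. ((- 4 * e0 * (\<rho>^2 - (x - b) \<bullet> (x - b))) *\<^sub>R mat 1 - (- 8 * e0) *\<^sub>R outer (x - b)) *v h)) (at x)" for b x :: "real^'n" and e0
  by (rule has_derivative_eq_rhs[OF has_derivative_scaleR[OF has_derivative_mult_right[OF P, of "- 4 * e0"] has_derivative_diff[OF has_derivative_ident has_derivative_const]]])
   (auto simp: fun_eq_iff matrix_vector_mult_diff_rdistrib scaleR_matrix_mult)
 have 3: "((%s. c * exp (- N * (s - t1)) * (\<rho>^2 - (x - (x1 + (s - t1) *\<^sub>R V)) \<bullet> (x - (x1 + (s - t1) *\<^sub>R V)))^2) has_real_derivative
   c * exp (- N * (t - t1)) * (- N * (\<rho>^2 - (x - (x1 + (t - t1) *\<^sub>R V)) \<bullet> (x - (x1 + (t - t1) *\<^sub>R V)))^2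
    + 4 * (\<rho>^2 - (x - (x1 + (t - t1) *\<^sub>R V)) \<bullet> (x - (x1 + (t - t1) *\<^sub>R V))) * ((x - (x1 + (t - t1) *\<^sub>R V)) \<bullet> V))) (at t)" for x :: "real^'n" and t
 proof -
  define u where "u = x - x1"
  have q: "(x - (x1 + (s - t1) *\<^sub>R V)) \<bullet> (x - (x1 + (s - t1) *\<^sub>R V)) = u \<bullet> u - 2 * (s - t1) * (u \<bullet> V) + (s - t1)^2 * (V \<bullet> V)" for s
  proof -
   have "x - (x1 + (s - t1) *\<^sub>R V) = u - (s - t1) *\<^sub>R V" by (simp add: u_def)
   then show ?thesis by (simp only: inner_diff_left inner_diff_right inner_scaleR_left inner_scaleR_right inner_commute[of V u]) (simp add: power2_eq_square algebra_simps)
  qed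
  have v: "(x - (x1 + (t - t1) *\<^sub>R V)) \<bullet> V = u \<bullet> V - (t - t1) * (V \<bullet> V)" by (simp add: u_def inner_diff_left inner_add_left)
  define P where "P s = \<rho>^2 - (u \<bullet> u - 2 * (s - t1) * (u \<bullet> V) + (s - t1)^2 * (V \<bullet> V))" for s
  have dP: "(P has_real_derivative 2 * (u \<bullet> V - (t - t1) * (V \<bullet> V))) (at t)" unfolding P_def
   by (auto intro!: derivative_eq_intros simp: algebra_simps)
  have "((%s. c * exp (- N * (s - t1)) * (P s)^2) has_real_derivative c * exp (- N * (t - t1)) * (- N * (P t)^2 + 4 * P t * (u \<bullet> V - (t - t1) * (V \<bullet> V)))) (at t)"
   by (auto intro!: derivative_eq_intros dP simp: algebra_simps)
  then show ?thesis unfolding q v P_def .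
 qed
 have co: "continuous_on UNIV (%z. outer (Y z))" unfolding outer_def Y_def by (intro continuous_on_vec_lambda continuous_intros)
 have cY: "continuous_on UNIV Y" "continuous_on UNIV E" unfolding Y_def E_def by (intro continuous_intros)+
 show ?thesis unfolding C21_on_def
 proof (intro conjI ballI, clarify)
  fix x t
  show "((%y. E (y, t) * (\<rho>^2 - Y (y, t) \<bullet> Y (y, t))^2) has_derivative (\<bullet>) ((- 4 * E (x, t) * (\<rho>^2 - Y (x, t) \<bullet> Y (x, t))) *\<^sub>R Y (x, t))) (at x) &
   ((%y. (- 4 * E (y, t) * (\<rho>^2 - Y (y, t) \<bullet> Y (y, t))) *\<^sub>R Y (y, t)) has_derivative
     (*v) ((- 4 * E (x, t) * (\<rho>^2 - Y (x, t) \<bullet> Y (x, t))) *\<^sub>R mat 1 - (- 8 * E (x, t)) *\<^sub>R outer (Y (x, t)))) (at x) &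
   ((%s. E (x, s) * (\<rho>^2 - Y (x, s) \<bullet> Y (x, s))^2) has_real_derivative
     E (x, t) * (- N * (\<rho>^2 - Y (x, t) \<bullet> Y (x, t))^2 + 4 * (\<rho>^2 - Y (x, t) \<bullet> Y (x, t)) * (Y (x, t) \<bullet> V))) (at t)"
   unfolding E_def Y_def fst_conv snd_conv by (intro conjI 1 2 3)
 qed (auto intro!: continuous_intros co cY)
qed

lemma convex_half_ball: "convex {x :: real^'n. norm x < 1 & 0 < x $ k}"
proof -
 have "{x :: real^'n. norm x < 1 & 0 < x $ k} = ball 0 1 \<inter> {x. axis k 1 \<bullet> x > 0}" by (auto simp: inner_axis')
 then show ?thesis by (simp add: convex_Int convex_halfspace_gt)
qed

text \<open>The bump \<open>\<epsilon> exp (- N (s - t1)) (\<rho>^2 - |y|^2)^2\<close> is carried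
  from \<open>x1\<close> to \<open>x2\<close> at constant speed. Near the edge of its support the
  radial convexity makes it a subsolution, further inside the decay rate \<open>N\<close> does. Its
  gradient is so small that the coefficient stays between fixed positive bounds.\<close>

lemma moving_bump:
 fixes k :: "'n::finite"
 assumes L: "0 < lam" "lam <= Lam" and rho: "0 < \<rho>" "\<rho> <= 1" and kap: "0 < \<kappa>" and del: "0 < \<delta>"
 shows "\<exists>\<eta>>0. \<forall>(F :: real^'n^'n => real) q \<theta> w x1 x2 t1 t2. canonical k j \<gamma> lam Lam F q \<theta> w -->
   cball x1 \<rho> \<subseteq> {x. norm x < 1 & 0 < x $ k} --> cball x2 \<rho> \<subseteq> {x. norm x < 1 & 0 < x $ k} -->
   - 1 < t1 --> t1 + \<delta> <= t2 --> t2 < 0 --> (\<forall>x\<in>cball x1 \<rho>. \<kappa> <= w (x, t1)) --> \<eta> <= w (x2, t2)"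
proof -
 define n where "n = real CARD('n)"
 define B :: real where "B = 4 powr \<bar>\<gamma>\<bar>"
 define b0 :: real where "b0 = 4 powr (- \<bar>\<gamma>\<bar>)"
 have B: "B > 0" "b0 > 0" by (auto simp: B_def b0_def)
 define m0 where "m0 = 8 * lam * b0"
 have m0: "m0 > 0" using B L by (simp add: m0_def)
 define g where "g = 4 * \<rho> * (2 / \<delta>) + 4 * B * (n * Lam) + m0"
 \<comment> \<open>For this \<open>N\<close> the discriminant of
   \<open>N P^2 - g P + m0 \<rho>^2\<close> vanishes. The summand \<open>m0\<close> of
   \<open>g\<close> absorbs the \<open>P\<close> in \<open>m0 * (\<rho>^2 - P)\<close>.\<close>
 define N where "N = g^2 / (4 * m0 * \<rho>^2)"
 have N: "N >= 0" using m0 rho by (simp add: N_def)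
 have amgm: "g * P <= N * P^2 + m0 * \<rho>^2" for P
 proof -
  have "0 <= (g * P - 2 * m0 * \<rho>^2)^2 / (4 * m0 * \<rho>^2)" using m0 by simp
  also have "... = N * P^2 + m0 * \<rho>^2 - g * P" using m0 rho by (simp add: N_def power2_diff field_simps) (simp add: power2_eq_square)
  finally show ?thesis by simp
 qed
 \<comment> \<open>The cap 1/16 bounds the gradient of the bump by 1/4, hence \<theta> times the
   gradient by 1/2.\<close>
 define \<epsilon> where "\<epsilon> = min \<kappa> (1/16)"
 have eps: "\<epsilon> > 0" "\<epsilon> <= \<kappa>" "\<epsilon> <= 1/16" using kap by (auto simp: \<epsilon>_def)
 define \<eta> where "\<eta> = \<epsilon> * exp (- N) * \<rho> ^ 4"
 have eta: "\<eta> > 0" using eps rho by (simp add: \<eta>_def)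
 have main: "\<eta> <= w (x2, t2)"
  if can: "canonical k j \<gamma> lam Lam F q \<theta> w" and s1: "cball x1 \<rho> \<subseteq> {x. norm x < 1 & 0 < x $ k}" and s2: "cball x2 \<rho> \<subseteq> {x. norm x < 1 & 0 < x $ k}"
   and t: "- 1 < t1" "t1 + \<delta> <= t2" "t2 < 0" and init: "\<forall>x\<in>cball x1 \<rho>. \<kappa> <= w (x, t1)"
  for F :: "real^'n^'n => real" and q \<theta> w x1 x2 t1 t2
 proof -
  note c = canonicalD[OF can]
  have t12: "t1 < t2" using t del by simp
  define V where "V = (1 / (t2 - t1)) *\<^sub>R (x2 - x1)"
  have V: "norm V <= 2 / \<delta>"
  proof -
   have "x1 \<in> cball x1 \<rho>" "x2 \<in> cball x2 \<rho>" using rho by auto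
   then have "norm x1 < 1" "norm x2 < 1" using s1 s2 by blast+
   then have "norm (x2 - x1) <= 2" using norm_triangle_ineq4[of x2 x1] by linarith
   then show ?thesis using t t12 del by (simp add: V_def) (intro frac_le; simp)
  qed
  define Y where "Y = (%z::(real^'n) \<times> real. fst z - (x1 + (snd z - t1) *\<^sub>R V))"
  define E where "E = (%z::(real^'n) \<times> real. - \<epsilon> * exp (- N * (snd z - t1)))"
  define \<phi> where "\<phi> = (%z. E z * (\<rho>^2 - Y z \<bullet> Y z)^2)"
  have C: "C21_on UNIV \<phi> (%z. (- 4 * E z * (\<rho>^2 - Y z \<bullet> Y z)) *\<^sub>R Y z)
   (%z. (- 4 * E z * (\<rho>^2 - Y z \<bullet> Y z)) *\<^sub>R mat 1 - (- 8 * E z) *\<^sub>R outer (Y z))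
   (%z. E z * (- N * (\<rho>^2 - Y z \<bullet> Y z)^2 + 4 * (\<rho>^2 - Y z \<bullet> Y z) * (Y z \<bullet> V)))"
   unfolding \<phi>_def Y_def E_def by (rule C21_bump)
  \<comment> \<open>A point of the moving ball is a convex combination of the corresponding points
    in the two given balls, and the half ball is convex.\<close>
  have tube: "norm x < 1 & 0 < x $ k" if "norm (Y (x, s)) <= \<rho>" "t1 <= s" "s <= t2" for x s
  proof -
   define \<tau> where "\<tau> = (s - t1) / (t2 - t1)"
   have tau: "0 <= \<tau>" "\<tau> <= 1" using that t12 by (auto simp: \<tau>_def)
   define d where "d = Y (x, s)"
   have "x1 + d \<in> cball x1 \<rho>" "x2 + d \<in> cball x2 \<rho>" using that by (auto simp: d_def dist_norm)
   then have "x1 + d \<in> {x. norm x < 1 & 0 < x $ k}" "x2 + d \<in> {x. norm x < 1 & 0 < x $ k}" using s1 s2 by blast+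
   then have "(1 - \<tau>) *\<^sub>R (x1 + d) + \<tau> *\<^sub>R (x2 + d) \<in> {x. norm x < 1 & 0 < x $ k}"
    using tau by (intro convexD_alt[OF convex_half_ball]) auto
   moreover have "(1 - \<tau>) *\<^sub>R (x1 + d) + \<tau> *\<^sub>R (x2 + d) = x"
   proof -
    have "(s - t1) *\<^sub>R V = \<tau> *\<^sub>R (x2 - x1)" by (simp add: V_def \<tau>_def)
    then have "x = d + (x1 + \<tau> *\<^sub>R (x2 - x1))" by (simp add: d_def Y_def)
    then show ?thesis by (simp add: algebra_simps)
   qed
   ultimately show ?thesis by simp
  qed
  define Kc where "Kc = (cball 0 1 \<times> {t1..t2}) \<inter> {z. norm (Y z) <= \<rho>}"
  define Vo where "Vo = (UNIV \<times> {t1<..<t2}) \<inter> {z. norm (Y z) < \<rho>}"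
  have cY: "continuous_on UNIV Y" unfolding Y_def by (intro continuous_intros)
  have Kin: "(x, s) \<in> half_cyl_flat k" if "(x, s) \<in> Kc" for x s
   using that tube[of x s] t by (auto simp: Kc_def half_cyl_flat_def)
  have Ksub: "Kc \<subseteq> half_cyl_flat k" using Kin by (rule subrelI)
  have comp: "compact Kc" unfolding Kc_def
   by (intro compact_Int_closed compact_Times closed_Collect_le continuous_intros cY) auto
  have cwK: "continuous_on Kc (%z. - w z)" using continuous_on_subset[OF c(7) Ksub] by (intro continuous_intros)
  have bump: "- w (x, s) <= \<phi> (x, s)" if z: "(x, s) \<in> Kc" "s < t2" for x s
  proof (rule barrier_comparison_open[OF c(6) comp cwK C _ _ _ _ _ z])
   show "open Vo" unfolding Vo_def by (intro open_Int open_Times open_Collect_less continuous_intros cY) auto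
   show "Vo \<subseteq> Kc"
   proof (rule subrelI)
    fix x s assume "(x, s) \<in> Vo"
    then show "(x, s) \<in> Kc" using tube[of x s] by (auto simp: Vo_def Kc_def)
   qed
   show "Vo \<subseteq> half_cyl k"
   proof (rule subrelI)
    fix x s assume "(x, s) \<in> Vo"
    then show "(x, s) \<in> half_cyl k" using tube[of x s] t by (auto simp: Vo_def half_cyl_def)
   qed
  next
   fix x s assume K: "(x, s) \<in> Kc" and s: "s < t2" and gt: "\<phi> (x, s) < - w (x, s)"
   have "norm (Y (x, s)) ~= \<rho>"
   proof
    assume "norm (Y (x, s)) = \<rho>"
    then have "\<phi> (x, s) = 0" by (simp add: \<phi>_def dot_square_norm)
    then show False using gt c(8)[OF Kin[OF K]] by simp
   qed
   moreover have "s ~= t1"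
   proof
    assume st: "s = t1"
    then have "x \<in> cball x1 \<rho>" using K by (simp add: Kc_def Y_def dist_norm norm_minus_commute)
    then have w: "\<kappa> <= w (x, s)" using init st by auto
    have Yr: "(norm (Y (x, s)))^2 <= \<rho>^2" using K by (intro power_mono) (auto simp: Kc_def)
    have "(\<rho>^2 - Y (x, s) \<bullet> Y (x, s))^2 <= 1^2"
     unfolding dot_square_norm using Yr rho power_le_one[of \<rho> 2] zero_le_power2[of "norm (Y (x, s))"] by (intro power_mono; linarith)
    then have "\<epsilon> * (\<rho>^2 - Y (x, s) \<bullet> Y (x, s))^2 <= \<epsilon> * 1" using eps by (intro mult_left_mono) auto
    then have "- \<epsilon> <= \<phi> (x, s)" using st by (simp add: \<phi>_def E_def)
    then show False using gt w eps by simp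
   qed
   ultimately show "(x, s) \<in> Vo" using K s by (auto simp: Kc_def Vo_def)
  next
   fix x s assume Vo: "(x, s) \<in> Vo"
   define y where "y = Y (x, s)"
   define P where "P = \<rho>^2 - y \<bullet> y"
   define e1 where "e1 = - E (x, s)"
   have y: "norm y < \<rho>" using Vo by (simp add: Vo_def y_def)
   have y2: "y \<bullet> y < \<rho>^2" unfolding dot_square_norm using y by (intro power_strict_mono) auto
   have P: "0 < P" "P <= \<rho>^2" "P <= 1" using y2 rho power_le_one[of \<rho> 2] inner_ge_zero[of y] unfolding P_def by linarith+
   have e1: "0 < e1" "e1 <= \<epsilon>" using eps N Vo by (auto simp: e1_def E_def Vo_def)
   define D where "D = (4 * e1 * P) *\<^sub>R y"
   have "norm D = 4 * e1 * P * norm y" using e1 P by (simp add: D_def)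
   also have "... <= 4 * (1/16) * 1 * 1" using e1 eps P y rho by (intro mult_mono) auto
   finally have "\<theta> * norm D <= 2 * (1/4)" using c(3,4) by (intro mult_mono) auto
   then have nD: "norm (\<theta> *\<^sub>R D) <= 1/2" using c(3) by simp
   have nq: "norm (- q) = 1" using c(2) by simp
   note nb = norm_add_bounds[OF nq nD]
   define b where "b = norm (- q + \<theta> *\<^sub>R D) powr \<gamma>"
   have b: "b0 <= b" "b <= B" unfolding b_def b0_def B_def using nb by (intro powr_two_sided; simp)+
   define H where "H = (4 * e1 * P) *\<^sub>R mat 1 - (8 * e1) *\<^sub>R outer y"
   have FH: "- F (- H) <= 4 * e1 * P * (n * Lam) - 8 * e1 * (lam * (y \<bullet> y))"
    using elliptic_rank_one[OF elliptic_op_neg[OF c(1)], of "4 * e1 * P" "8 * e1" y] e1 P by (simp add: H_def n_def dot_square_norm)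
   have bp: "0 <= b" by (simp add: b_def)
   have "b * (- F (- H)) <= b * (4 * e1 * P * (n * Lam) - 8 * e1 * (lam * (y \<bullet> y)))" using FH bp by (rule mult_left_mono)
   also have "... = b * (4 * e1 * P * (n * Lam)) - b * (8 * e1 * (lam * (y \<bullet> y)))" by (simp add: algebra_simps)
   also have "... <= B * (4 * e1 * P * (n * Lam)) - b0 * (8 * e1 * (lam * (y \<bullet> y)))"
    using b e1 P L by (intro diff_mono mult_right_mono) (auto simp: n_def)
   also have "... = e1 * (4 * B * (n * Lam) * P - m0 * (\<rho>^2 - P))" by (simp add: P_def m0_def algebra_simps)
   finally have up: "b * (- F (- H)) <= e1 * (4 * B * (n * Lam) * P - m0 * (\<rho>^2 - P))" .
   have "y \<bullet> V <= norm y * norm V" by (rule norm_cauchy_schwarz)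
   also have "... <= \<rho> * (2 / \<delta>)" using y V rho by (intro mult_mono) auto
   finally have "4 * P * (y \<bullet> V) <= 4 * P * (\<rho> * (2 / \<delta>))" using P by (intro mult_left_mono) auto
   then have "4 * B * (n * Lam) * P - m0 * (\<rho>^2 - P) <= N * P^2 - 4 * P * (y \<bullet> V)" using amgm[of P] by (simp add: g_def algebra_simps)
   then have "e1 * (4 * B * (n * Lam) * P - m0 * (\<rho>^2 - P)) <= e1 * (N * P^2 - 4 * P * (y \<bullet> V))" using e1 by (intro mult_left_mono) auto
   then have fin: "b * (- F (- H)) <= E (x, s) * (- N * P^2 + 4 * P * (y \<bullet> V))" using up by (simp add: e1_def algebra_simps)
   have eqs: "(- 4 * E (x, s) * (\<rho>^2 - Y (x, s) \<bullet> Y (x, s))) *\<^sub>R Y (x, s) = D"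
    "(- 4 * E (x, s) * (\<rho>^2 - Y (x, s) \<bullet> Y (x, s))) *\<^sub>R mat 1 - (- 8 * E (x, s)) *\<^sub>R outer (Y (x, s)) = H"
    "\<rho>^2 - Y (x, s) \<bullet> Y (x, s) = P" "Y (x, s) = y"
    by (simp_all add: D_def H_def P_def y_def e1_def)
   show "- q + \<theta> *\<^sub>R ((- 4 * E (x, s) * (\<rho>^2 - Y (x, s) \<bullet> Y (x, s))) *\<^sub>R Y (x, s)) ~= 0 &
    norm (- q + \<theta> *\<^sub>R ((- 4 * E (x, s) * (\<rho>^2 - Y (x, s) \<bullet> Y (x, s))) *\<^sub>R Y (x, s))) powr \<gamma> *
    - F (- ((- 4 * E (x, s) * (\<rho>^2 - Y (x, s) \<bullet> Y (x, s))) *\<^sub>R mat 1 - (- 8 * E (x, s)) *\<^sub>R outer (Y (x, s))))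
    <= E (x, s) * (- N * (\<rho>^2 - Y (x, s) \<bullet> Y (x, s))^2 + 4 * (\<rho>^2 - Y (x, s) \<bullet> Y (x, s)) * (Y (x, s) \<bullet> V))"
    unfolding eqs(1,2) unfolding eqs(3) unfolding eqs(4) using fin nb by (auto simp: b_def)
  qed
  define y where "y s = x1 + (s - t1) *\<^sub>R V" for s
  have Yy: "Y (y s, s) = 0" for s by (simp add: Y_def y_def)
  have yK: "(y s, s) \<in> Kc" if "t1 <= s" "s <= t2" for s
   using that tube[of "y s" s] rho by (simp add: Kc_def Yy)
  have cl: "closure {t1..<t2} = {t1..t2}" using t12 by simp
  \<comment> \<open>The comparison holds only before \<open>t2\<close>; continuity along the path of
    the centre gives the value at \<open>t2\<close>.\<close>
  have "w (y t2, t2) >= \<eta>"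
  proof (rule continuous_ge_on_closure[of "{t1..<t2}" "%s. w (y s, s)"])
   have cy: "continuous_on {t1..t2} (%s. (y s, s))" unfolding y_def by (intro continuous_intros)
   have "(%s. (y s, s)) ` {t1..t2} \<subseteq> half_cyl_flat k" using yK Ksub by auto
   then show "continuous_on (closure {t1..<t2}) (%s. w (y s, s))" unfolding cl by (rule continuous_on_compose2[OF c(7) cy])
   show "t2 \<in> closure {t1..<t2}" unfolding cl using t12 by simp
   fix s assume s: "s \<in> {t1..<t2}"
   have "- w (y s, s) <= \<phi> (y s, s)" using s by (intro bump yK) auto
   then have "\<epsilon> * exp (- N * (s - t1)) * \<rho> ^ 4 <= w (y s, s)" by (simp add: \<phi>_def Yy E_def)
   moreover have "exp (- N) <= exp (- N * (s - t1))"
   proof -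
    have "N * (s - t1) <= N * 1" using N s t by (intro mult_left_mono) auto
    then show ?thesis by simp
   qed
   then have "\<eta> <= \<epsilon> * exp (- N * (s - t1)) * \<rho> ^ 4" unfolding \<eta>_def using eps rho by (intro mult_right_mono mult_left_mono) auto
   ultimately show "\<eta> <= w (y s, s)" by simp
  qed
  moreover have "y t2 = x2" using t12 by (simp add: y_def V_def)
  ultimately show ?thesis by simp
 qed
 show ?thesis by (intro exI[of _ \<eta>] conjI eta allI impI) (rule main)
qed

section \<open>Moduli of continuity in space\<close>

lemma powr_ratio:
 fixes a b \<gamma> :: real
 assumes a: "a > 0" and ab: "\<bar>b - a\<bar> <= a / 2"
 shows "\<bar>b powr \<gamma> / a powr \<gamma> - 1\<bar> <= (\<bar>\<gamma>\<bar> * 2 powr \<bar>\<gamma> - 1\<bar> + 1) * (\<bar>b - a\<bar> / a)"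
proof -
 define s where "s = b / a"
 have sa: "\<bar>s - 1\<bar> = \<bar>b - a\<bar> / a" using a by (simp add: s_def divide_diff_eq_iff abs_divide)
 have s: "s \<in> {1/2..3/2}"
 proof -
  have "\<bar>s - 1\<bar> <= 1/2" unfolding sa using ab a by (simp add: field_simps)
  then show ?thesis by (simp only: abs_le_iff) simp
 qed
 have bp: "b >= 0" using abs_le_D2[OF ab] a by argo
 have e: "b powr \<gamma> / a powr \<gamma> = s powr \<gamma>" using a bp by (simp add: s_def powr_divide)
 have "norm (s powr \<gamma> - 1 powr \<gamma>) <= (\<bar>\<gamma>\<bar> * 2 powr \<bar>\<gamma> - 1\<bar>) * norm (s - 1)"
 proof (rule field_differentiable_bound[of "{1/2..3/2}" "%x. x powr \<gamma>" "%x. \<gamma> * x powr (\<gamma> - 1)"])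
  fix x :: real assume x: "x \<in> {1/2..3/2}"
  have x0: "0 < x" "1/2 <= x" "x <= 2" using x by auto
  show "((%x. x powr \<gamma>) has_field_derivative \<gamma> * x powr (\<gamma> - 1)) (at x within {1/2..3/2})"
   by (rule has_field_derivative_at_within[OF has_real_derivative_powr[OF x0(1)]])
  have "x powr (\<gamma> - 1) <= 2 powr \<bar>\<gamma> - 1\<bar>" by (rule powr_two_sided(2)[OF _ x0(2,3)]) simp
  then have "\<bar>\<gamma>\<bar> * x powr (\<gamma> - 1) <= \<bar>\<gamma>\<bar> * 2 powr \<bar>\<gamma> - 1\<bar>" by (rule mult_left_mono) simp
  then show "norm (\<gamma> * x powr (\<gamma> - 1)) <= \<bar>\<gamma>\<bar> * 2 powr \<bar>\<gamma> - 1\<bar>" by (simp add: abs_mult)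
 next
  show "convex {1/2..3/2::real}" by simp
  show "s \<in> {1/2..3/2}" by (rule s)
  show "(1::real) \<in> {1/2..3/2}" by simp
 qed
 also have "... <= (\<bar>\<gamma>\<bar> * 2 powr \<bar>\<gamma> - 1\<bar> + 1) * norm (s - 1)" by (intro mult_right_mono) auto
 finally show ?thesis unfolding e using sa by simp
qed

lemma powr_taylor:
 fixes r \<beta> c0 c1 c2 :: real
 assumes r: "r > 0" and eps: "\<epsilon> > 0"
 shows "\<exists>\<delta>>0. \<forall>s. \<bar>s\<bar> < \<delta> --> c0 + c1 * (r + s) + c2 * (r + s) powr \<beta> \<le>
   c0 + c1 * r + c2 * r powr \<beta> + (c1 + c2 * \<beta> * r powr (\<beta> - 1)) * s + (c2 * \<beta> * (\<beta> - 1) * r powr (\<beta> - 2)) / 2 * s^2 + \<epsilon> * s^2"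
proof -
 define g1 where "g1 x = c2 * \<beta> * x powr (\<beta> - 1)" for x
 define g2 where "g2 = c2 * \<beta> * (\<beta> - 1) * r powr (\<beta> - 2)"
 have "(g1 has_real_derivative g2) (at r)" unfolding g1_def g2_def
  using r by (auto intro!: derivative_eq_intros has_real_derivative_powr simp: algebra_simps)
 then have "(g1 has_derivative (%h. g2 * h)) (at r)" by (simp add: has_field_derivative_def)
 then obtain d where d: "d > 0" "\<And>x. norm (x - r) < d ==> norm (g1 x - g1 r - g2 * (x - r)) <= \<epsilon> * norm (x - r)"
  unfolding has_derivative_at_alt using eps by blast
 define \<delta> where "\<delta> = min d r"
 have del: "\<delta> > 0" "\<delta> <= d" "\<delta> <= r" using d r by (auto simp: \<delta>_def)
 have "c2 * (r + s) powr \<beta> <= c2 * r powr \<beta> + g1 r * s + g2 / 2 * s^2 + \<epsilon> * s^2" if s: "\<bar>s\<bar> < \<delta>" for s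
 proof -
  define S where "S = {-\<bar>s\<bar>..\<bar>s\<bar>}"
  define h where "h y = c2 * (r + y) powr \<beta> - g1 r * y - g2 / 2 * y^2" for y
  have "norm (h s - h 0) <= (\<epsilon> * \<bar>s\<bar>) * norm (s - 0)"
  proof (rule field_differentiable_bound[of S h "%y. g1 (r + y) - g1 r - g2 * y"])
   fix y assume "y \<in> S"
   then have y: "\<bar>y\<bar> <= \<bar>s\<bar>" by (auto simp: S_def)
   then have ry: "0 < r + y" using s del by (auto simp: abs_if split: if_splits)
   show "(h has_field_derivative g1 (r + y) - g1 r - g2 * y) (at y within S)"
   proof -
    have "((%y. r + y) has_real_derivative 1) (at y)" by (auto intro!: derivative_eq_intros)
    from DERIV_fun_powr[OF this ry, of \<beta>]
    have dp: "((%y. (r + y) powr \<beta>) has_real_derivative \<beta> * (r + y) powr (\<beta> - 1)) (at y within S)"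
     by (simp add: has_field_derivative_at_within)
    show ?thesis
     using DERIV_diff[OF DERIV_diff[OF DERIV_cmult[OF dp, of c2] DERIV_cmult[OF DERIV_ident, of "g1 r"]] DERIV_cmult[OF DERIV_power[OF DERIV_ident, of 2], of "g2 / 2"]]
     unfolding h_def by (simp add: g1_def mult.assoc)
   qed
   have "norm (g1 (r + y) - g1 r - g2 * y) <= \<epsilon> * \<bar>y\<bar>" using d(2)[of "r + y"] y s del by simp
   also have "... <= \<epsilon> * \<bar>s\<bar>" using y eps by (intro mult_left_mono) auto
   finally show "norm (g1 (r + y) - g1 r - g2 * y) <= \<epsilon> * \<bar>s\<bar>" .
  qed (auto simp: S_def)
  then have "h s - h 0 <= \<epsilon> * s^2" by (simp add: power2_eq_square abs_mult_self_eq mult.assoc)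
  then show ?thesis by (simp add: h_def)
 qed
 then show ?thesis using del(1) by (intro exI[of _ \<delta>]) (auto simp: g1_def g2_def algebra_simps)
qed

text \<open>For \<open>g r = A0 / \<theta> * sqrt r\<close> the scaled slope
  \<open>G r = \<theta> * g' r\<close> dominates \<open>q\<close>, and the coefficients at the two
  points differ by a relative error of order \<open>1 / G r\<close>. As \<gamma> > -1, the
  coefficient is at least \<open>1 / (2 * G r)\<close>; the resulting time error of order
  \<open>G r\<close> is small against the concavity \<open>G r / (2 * \<theta> * r)\<close> once
  \<open>r0\<close> is small. The bound deteriorates as \<theta> tends to 0.\<close>

lemma sqrt_modulus:
 fixes lam Lam \<gamma> R K :: real
 assumes L: "0 < lam" "lam <= Lam" and gam: "\<gamma> > -1" and R: "R > 0" and K: "K * R^2 >= 2" "K >= 16"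
 shows "\<exists>r0 A0. 0 < r0 & r0 <= R & 4 / sqrt r0 <= A0 &
  (\<forall>(F :: real^'n^'n => real) q \<theta> \<Omega> w x0 t0 T y0. elliptic_op lam Lam F --> norm q = 1 --> 0 < \<theta> --> \<theta> <= 2 --> open \<Omega> -->
   vsub j \<gamma> F q \<theta> \<Omega> w --> vsub j \<gamma> (%M. - F (- M)) (- q) \<theta> \<Omega> (%z. - w z) -->
   (\<forall>x t. norm (x - x0) <= 2 * R --> t0 - 1/4 <= t --> t < T --> (x, t) \<in> \<Omega> & 0 <= w (x, t) & w (x, t) <= 1) --> t0 < T -->
   norm (y0 - x0) <= r0 --> w (x0, t0) - w (y0, t0) <= A0 / \<theta> * sqrt (norm (x0 - y0)))"
proof -
 define W where "W = real CARD('n) * Lam"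
 define P where "P = 2 * K * R + 1"
 define D where "D = 3 + 2 * P"
 define C where "C = \<bar>\<gamma>\<bar> * 2 powr \<bar>\<gamma> - 1\<bar> + 1"
 define E1 where "E1 = 2 * (W * (2 * K + 1))"
 \<comment> \<open>The part \<open>8 * D\<close> makes \<open>q\<close> and the shifts of the
   gradients harmless, \<open>8 * (C * D)\<close> makes the coefficient error at most 1/2, and the
   last two summands pay in \<open>SC\<close> for the localisation and for the coefficient error
   times curvature.\<close>
 define G0 where "G0 = 1 + 8 * D + 8 * (C * D) + 4 * E1 / lam + 16 * (C * D * W) / lam"
 define r0 where "r0 = min R (min 1 (lam / (16 * (K + 1))))"
 define A0 where "A0 = 2 * G0 + 4 / sqrt r0"
 have K0: "K > 0" using K by linarith
 have W: "W > 0" using L by (simp add: W_def)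
 have P: "P >= 1" using K0 R by (simp add: P_def)
 have D: "D >= 5" using P by (simp add: D_def)
 have C: "C >= 1" by (simp add: C_def)
 have E1: "E1 > 0" using W K0 by (simp add: E1_def)
 have G0: "G0 >= 1" "G0 >= 8 * D" "G0 >= 8 * (C * D)" "G0 >= 4 * E1 / lam" "G0 >= 16 * (C * D * W) / lam"
 proof -
  have "0 <= 4 * E1 / lam" "0 <= 16 * (C * D * W) / lam" "0 <= C * D" using E1 L C D W by auto
  then show "G0 >= 1" "G0 >= 8 * D" "G0 >= 8 * (C * D)" "G0 >= 4 * E1 / lam" "G0 >= 16 * (C * D * W) / lam"
   using D unfolding G0_def by linarith+
 qed
 have r0: "0 < r0" "r0 <= R" "r0 <= 1" "r0 <= lam / (16 * (K + 1))"
  using R L K0 by (auto simp: r0_def min.coboundedI2)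
 have r0K: "8 * (K + 1) * r0 <= lam / 2"
  using r0(4) K0 by (simp add: field_simps)
 have A0: "A0 >= 2 * G0" "A0 >= 4 / sqrt r0" "A0 > 0" using G0(1) r0 by (auto simp: A0_def add_pos_pos)
 have main: "w (x0, t0) - w (y0, t0) <= A0 / \<theta> * sqrt (norm (x0 - y0))"
  if F: "elliptic_op lam Lam F" and q: "norm q = 1" and th: "0 < \<theta>" "\<theta> <= 2" and Om: "open \<Omega>"
   and sub: "vsub j \<gamma> F q \<theta> \<Omega> w" and sup: "vsub j \<gamma> (%M. - F (- M)) (- q) \<theta> \<Omega> (%z. - w z)"
   and box: "\<forall>x t. norm (x - x0) <= 2 * R --> t0 - 1/4 <= t --> t < T --> (x, t) \<in> \<Omega> & 0 <= w (x, t) & w (x, t) <= 1"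
   and T: "t0 < T" and y0: "norm (y0 - x0) <= r0"
  for F :: "real^'n^'n => real" and q \<theta> \<Omega> w x0 t0 T y0
 proof -
  define G where "G r = A0 / 2 * r powr (- (1/2))" for r
  have GG: "G r >= G0" if "0 < r" "r < r0" for r
  proof -
   have "1 <= r powr (- (1/2))" using powr_mono'[of "- (1/2)" 0 r] that r0 by simp
   then have "A0 / 2 * 1 <= A0 / 2 * r powr (- (1/2))" using A0 by (intro mult_left_mono) auto
   then show ?thesis using A0(1) by (simp add: G_def)
  qed
  define g where "g r = 0 + 0 * r + A0 / \<theta> * r powr (1/2)" for r
  define g' where "g' r = 0 + A0 / \<theta> * (1/2) * r powr (1/2 - 1)" for r
  define g'' where "g'' r = A0 / \<theta> * (1/2) * (1/2 - 1) * r powr (1/2 - 2)" for r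
  have g'G: "g' r = G r / \<theta>" for r by (simp add: g'_def G_def)
  have g''G: "- g'' r = G r / (2 * \<theta> * r)" if "r > 0" for r
  proof -
   have "r powr (1/2 - 2) = r powr (- (1/2)) / r powr 1" using powr_diff[of r "- (1/2)" 1] by simp
   then show ?thesis using that by (simp add: g''_def G_def)
  qed
  have "w (x0, t0) - w (y0, t0) <= g (norm (x0 - y0))"
  proof (rule doubling_estimate[where g' = g' and g'' = g'' and \<rho> = "%r. C * (4 * D) / G r" and bm = "%r. 1 / (2 * G r)" and ra = 0,
     OF F L sub sup Om _ R T K r0(1,2) order_refl])
   show "(x, t) \<in> \<Omega> & 0 <= w (x, t) & w (x, t) <= 1" if "norm (x - x0) <= 2 * R" "t0 - 1/4 <= t" "t < T" for x t using box that by blast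
   have "continuous_on {0..r0} (%r. r powr (1/2))" by (rule continuous_on_powr') auto
   then show "continuous_on {0..r0} g" unfolding g_def by (intro continuous_on_add continuous_on_mult continuous_on_const continuous_on_id)
   show "0 <= g r" for r using A0 th by (simp add: g_def)
   show "2 <= g r0"
   proof -
    have "4 <= A0 * sqrt r0" using A0(2) r0 by (simp add: field_simps)
    moreover have "\<theta> * 2 <= 4" using th by simp
    ultimately have "2 <= A0 * sqrt r0 / \<theta>" using th by (simp add: field_simps)
    then show ?thesis using r0 by (simp add: g_def powr_half_sqrt)
   qed
   show "norm (y0 - x0) <= r0" by (rule y0)
   show "w (x, t) - w (y, t) <= g (norm (x - y))" if "norm (x - y) <= 0" for x y t using that by (simp add: g_def)
   fix r :: real assume r: "0 < r" "r < r0"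
   note Gr = GG[OF r]
   have G1: "G r > 0" "G r >= 1" using Gr G0(1) by linarith+
   have "0 < G r / (2 * \<theta> * r)" "0 < g' r" using G1 th r by (simp_all add: g'G)
   then show "0 < g' r & g'' r <= 0" using g''G[OF r(1)] by (intro conjI; linarith)
   show "\<exists>\<delta>>0. \<forall>s. \<bar>s\<bar> < \<delta> --> g (r + s) <= g r + g' r * s + g'' r / 2 * s^2 + \<epsilon> * s^2" if "\<epsilon> > 0" for \<epsilon>
    unfolding g_def g'_def g''_def by (rule powr_taylor[OF r(1) that])
   have rho: "C * (4 * D) / G r <= 1/2" using Gr G0(3) G1 by (simp add: field_simps)
   show "0 < 1 / (2 * G r) & C * (4 * D) / G r <= 1/2" using G1 rho by simp
   show "q + \<theta> *\<^sub>R \<xi>1 ~= 0 & q + \<theta> *\<^sub>R \<xi>2 ~= 0 &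
    \<bar>norm (q + \<theta> *\<^sub>R \<xi>2) powr \<gamma> / norm (q + \<theta> *\<^sub>R \<xi>1) powr \<gamma> - 1\<bar> <= C * (4 * D) / G r & norm (q + \<theta> *\<^sub>R \<xi>2) powr \<gamma> >= 1 / (2 * G r)"
    if e: "norm e = 1" and x1: "norm (\<xi>1 - g' r *\<^sub>R e) <= 2 * K * R + 1" and x2: "norm (\<xi>2 - g' r *\<^sub>R e) <= 1" for e \<xi>1 \<xi>2
   proof -
    define z1 where "z1 = q + \<theta> *\<^sub>R \<xi>1"
    define z2 where "z2 = q + \<theta> *\<^sub>R \<xi>2"
    have nG: "norm (G r *\<^sub>R e) = G r" using e G1 by simp
    have sp: "q + \<theta> *\<^sub>R \<xi> - G r *\<^sub>R e = q + \<theta> *\<^sub>R (\<xi> - g' r *\<^sub>R e)" for \<xi> using th by (simp add: g'G algebra_simps)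
    have nb: "norm (q + \<theta> *\<^sub>R \<xi> - G r *\<^sub>R e) <= D" if "norm (\<xi> - g' r *\<^sub>R e) <= P" for \<xi>
    proof -
     have "\<theta> * norm (\<xi> - g' r *\<^sub>R e) <= 2 * P" using that th by (intro mult_mono) auto
     then show ?thesis unfolding sp using norm_triangle_ineq[of q "\<theta> *\<^sub>R (\<xi> - g' r *\<^sub>R e)"] q th by (simp add: D_def)
    qed
    have d1: "norm (z1 - G r *\<^sub>R e) <= D" unfolding z1_def by (rule nb) (use x1 in \<open>simp add: P_def\<close>)
    have d2: "norm (z2 - G r *\<^sub>R e) <= D" unfolding z2_def by (rule nb) (use x2 P in linarith)
    have lo: "G r - D <= norm z1" "norm z2 <= G r + D" "G r - D <= norm z2"
     using norm_triangle_ineq2[of "G r *\<^sub>R e" z1] norm_triangle_ineq2[of z2 "G r *\<^sub>R e"] norm_triangle_ineq2[of "G r *\<^sub>R e" z2] d1 d2 nG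
     by (simp_all add: norm_minus_commute)
    have G8: "8 * D <= G r" using Gr G0(2) by linarith
    have z1l: "G r / 2 <= norm z1" and z2l: "1 <= norm z2" and z2u: "norm z2 <= 2 * G r" using lo G8 D by linarith+
    have "norm (\<xi>2 - \<xi>1) <= P + 1" using norm_triangle_ineq4[of "\<xi>2 - g' r *\<^sub>R e" "\<xi>1 - g' r *\<^sub>R e"] x1 x2 by (simp add: P_def)
    then have "\<theta> * norm (\<xi>2 - \<xi>1) <= 2 * (P + 1)" using th by (intro mult_mono) auto
    moreover have "z2 - z1 = \<theta> *\<^sub>R (\<xi>2 - \<xi>1)" by (simp add: z1_def z2_def algebra_simps)
    ultimately have "norm (z2 - z1) <= D" using th by (simp add: D_def)
    then have nd: "\<bar>norm z2 - norm z1\<bar> <= D" using norm_triangle_ineq3[of z2 z1] by linarith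
    have z10: "0 < norm z1" using z1l G1 by linarith
    have "\<bar>norm z2 - norm z1\<bar> <= norm z1 / 2" using nd z1l G8 D by linarith
    note pr = powr_ratio[OF z10 this, of \<gamma>, folded C_def]
    have "\<bar>norm z2 - norm z1\<bar> / norm z1 <= D / (G r / 2)" using nd z1l G1 by (intro frac_le) auto
    then have "C * (\<bar>norm z2 - norm z1\<bar> / norm z1) <= C * (D / (G r / 2))" using C by (intro mult_left_mono) auto
    also have "... <= C * (4 * D) / G r" using C D G1 by (simp add: field_simps)
    finally have 1: "\<bar>norm z2 powr \<gamma> / norm z1 powr \<gamma> - 1\<bar> <= C * (4 * D) / G r" using pr by linarith
    have "1 / (2 * G r) <= 1 / norm z2" using z2u z2l G1 by (intro divide_left_mono mult_pos_pos) linarith+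
    also have "... = norm z2 powr (- 1)" using z2l by (simp add: powr_minus_divide)
    also have "... <= norm z2 powr \<gamma>" using z2l gam by (intro powr_mono) auto
    finally have 2: "1 / (2 * G r) <= norm z2 powr \<gamma>" .
    have "z1 ~= 0" "z2 ~= 0" using z10 z2l by auto
    then show ?thesis using 1 2 unfolding z1_def z2_def by blast
   qed
   define X where "X = G r / (\<theta> * r)"
   have X0: "X > 0" using G1 th r by (simp add: X_def)
   have thr: "\<theta> * r <= 2 * r0" "0 < \<theta> * r" using th r by (auto intro: mult_mono)
   have Xl: "G0 / 2 <= X"
   proof -
    have "\<theta> * r <= 2" using thr(1) r0(3) by linarith
    then show ?thesis unfolding X_def using Gr G0(1) thr(2) by (intro frac_le) auto
   qed
   define \<rho> where "\<rho> = C * (4 * D) / G r"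
   have rho0: "0 <= \<rho>" using C D G1 by (simp add: \<rho>_def)
   have t1: "W * (2 * K + 1) + 2 * \<rho> * (W * (2 * K + 1)) <= lam / 2 * X"
   proof -
    have "2 * \<rho> * (W * (2 * K + 1)) <= 1 * (W * (2 * K + 1))" using rho W K0 by (intro mult_right_mono) (auto simp: \<rho>_def)
    then have "W * (2 * K + 1) + 2 * \<rho> * (W * (2 * K + 1)) <= E1" by (simp add: E1_def)
    also have "E1 <= lam / 2 * (G0 / 2)" using G0(4) L by (simp add: field_simps)
    also have "... <= lam / 2 * X" using Xl L by (intro mult_left_mono) auto
    finally show ?thesis .
   qed
   have t2: "2 * \<rho> * (W * X) <= lam / 2 * X"
   proof -
    have "16 * (C * D * W) / lam <= G r" using Gr G0(5) by linarith
    then have "16 * (C * D * W) <= G r * lam" using L by (simp add: field_simps)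
    then have "2 * \<rho> * W <= lam / 2" using G1 by (simp add: \<rho>_def field_simps)
    then show ?thesis using mult_right_mono[of "2 * \<rho> * W" "lam / 2" X] X0 by (simp add: mult.assoc)
   qed
   have t3: "2 * (K + 1) / (1 / (2 * G r)) <= lam / 2 * X"
   proof -
    have "4 * (K + 1) * (\<theta> * r) <= 4 * (K + 1) * (2 * r0)" using thr(1) K0 by (intro mult_left_mono) auto
    moreover have "4 * (K + 1) * (2 * r0) = 8 * (K + 1) * r0" by simp
    ultimately have "4 * (K + 1) * (\<theta> * r) <= lam / 2" using r0K by linarith
    then have "4 * (K + 1) * (\<theta> * r) * X <= lam / 2 * X" using X0 by (intro mult_right_mono) auto
    moreover have "\<theta> * r * X = G r" using th r by (simp add: X_def)
    then have "4 * (K + 1) * (\<theta> * r) * X = 4 * (K + 1) * G r" by (simp only: mult.assoc)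
    moreover have "2 * (K + 1) / (1 / (2 * G r)) = 4 * (K + 1) * G r" by simp
    ultimately show ?thesis by linarith
   qed
   have "g' r / r = X" using th r by (simp add: X_def g'G)
   then have "W * (2 * K + 1) + 2 * \<rho> * (W * (g' r / r + 2 * K + 1)) + 2 * (K + 1) / (1 / (2 * G r))
    = (W * (2 * K + 1) + 2 * \<rho> * (W * (2 * K + 1))) + 2 * \<rho> * (W * X) + 2 * (K + 1) / (1 / (2 * G r))" by (simp add: algebra_simps)
   also have "... <= 3 * (lam / 2 * X)" using t1 t2 t3 by linarith
   also have "... < 2 * lam * X" using L X0 by simp
   also have "... = 4 * lam * (- g'' r)" unfolding g''G[OF r(1)] X_def by simp
   finally show "real CARD('n) * Lam * (2 * K + 1) + 2 * (C * (4 * D) / G r) * (real CARD('n) * Lam * (g' r / r + 2 * K + 1)) + 2 * (K + 1) / (1 / (2 * G r)) < 4 * lam * (- g'' r)"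
    unfolding \<rho>_def W_def .
  qed
  then show ?thesis by (simp add: g_def powr_half_sqrt)
 qed
 show ?thesis by (intro exI[of _ r0] exI[of _ A0] conjI r0(1,2) A0(2) allI impI) (rule main)
qed

text \<open>Unless \<theta> is small, \<open>sqrt_modulus\<close> suffices. For small \<theta> a
  second doubling uses slopes up to \<open>Lc\<close>, for which \<open>q\<close> dominates. The
  coefficient error is then of order \<theta>, but it is multiplied by \<open>g' r / r\<close>, too
  large at very small distances. Below \<open>ra\<close>, of order \<theta>^2, the first modulus
  already gives \<kappa>/2.\<close>

lemma space_modulus:
 fixes lam Lam \<gamma> R \<kappa> :: real
 assumes L: "0 < lam" "lam <= Lam" and gam: "\<gamma> > -1" and R: "R > 0" and kap: "0 < \<kappa>" "\<kappa> <= 1"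
 shows "\<exists>r1>0. \<forall>(F :: real^'n^'n => real) q \<theta> \<Omega> w x0 t0 T y0. elliptic_op lam Lam F --> norm q = 1 --> 0 < \<theta> --> \<theta> <= 2 --> open \<Omega> -->
   vsub j \<gamma> F q \<theta> \<Omega> w --> vsub j \<gamma> (%M. - F (- M)) (- q) \<theta> \<Omega> (%z. - w z) -->
   (\<forall>x t. norm (x - x0) <= 3 * R --> t0 - 1/2 <= t --> t < T --> (x, t) \<in> \<Omega> & 0 <= w (x, t) & w (x, t) <= 1) --> t0 < T -->
   norm (y0 - x0) <= r1 --> w (x0, t0) - w (y0, t0) <= \<kappa>"
proof -
 define K where "K = 2 / R^2 + 16"
 have K: "K * R^2 >= 2" "K >= 16" "K > 0" using R by (auto simp: K_def field_simps add_pos_pos)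
 have KA: "(8 / R^2 + 16) * (R / 2)^2 >= 2" "8 / R^2 + 16 >= 16" "R / 2 > 0" using R by (auto simp: power_divide field_simps)
 obtain rA A0 where rA: "0 < rA" "rA <= R / 2" "4 / sqrt rA <= A0" and runA:
  "\<forall>(F :: real^'n^'n => real) q \<theta> \<Omega> w x0 t0 T y0. elliptic_op lam Lam F --> norm q = 1 --> 0 < \<theta> --> \<theta> <= 2 --> open \<Omega> -->
   vsub j \<gamma> F q \<theta> \<Omega> w --> vsub j \<gamma> (%M. - F (- M)) (- q) \<theta> \<Omega> (%z. - w z) -->
   (\<forall>x t. norm (x - x0) <= 2 * (R / 2) --> t0 - 1/4 <= t --> t < T --> (x, t) \<in> \<Omega> & 0 <= w (x, t) & w (x, t) <= 1) --> t0 < T -->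
   norm (y0 - x0) <= rA --> w (x0, t0) - w (y0, t0) <= A0 / \<theta> * sqrt (norm (x0 - y0))"
  using sqrt_modulus[OF L gam KA(3,1,2), where j = j and 'n = 'n] by blast
 have A0: "A0 > 0" using rA by (auto intro: less_le_trans[of 0 "4 / sqrt rA"])
 define W where "W = real CARD('n) * Lam"
 define P where "P = 2 * K * R + 1"
 define C where "C = \<bar>\<gamma>\<bar> * 2 powr \<bar>\<gamma> - 1\<bar> + 1"
 define B :: real where "B = 4 powr \<bar>\<gamma>\<bar>"
 define E2 where "E2 = 2 * (W * (2 * K + 1)) + 2 * (K + 1) * B"
 define r0 where "r0 = min R (min 1 (lam / E2))"
 define Lc where "Lc = 4 / r0"
 define E3 where "E3 = 16 * (C * W * (P + 1)) / lam"
 \<comment> \<open>In order, the four bounds give noncritical gradients, a coefficient error of at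
   most 1/2, \<open>ra <= r0\<close>, and the estimate \<open>E3r\<close>.\<close>
 define \<theta>0 where "\<theta>0 = min (1 / (2 * (Lc + P))) (min (1 / (4 * (C * (P + 1)))) (min (A0 * sqrt r0) (\<kappa> / (2 * A0 * (E3^2 + 1)))))"
 have W: "W > 0" using L by (simp add: W_def)
 have P: "P >= 1" using K R by (simp add: P_def)
 have C: "C >= 1" by (simp add: C_def)
 have B: "B > 0" by (simp add: B_def)
 have E2: "E2 > 0" using W K B by (simp add: E2_def add_pos_pos)
 have E3: "E3 >= 0" using C W P L by (simp add: E3_def)
 have r0: "0 < r0" "r0 <= R" "r0 <= 1" "r0 <= lam / E2" using R L E2 by (auto simp: r0_def min.coboundedI2)
 have Lc: "Lc > 0" using r0 by (simp add: Lc_def)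
 have CP: "0 < C * (P + 1)" using C P by simp
 have th0: "\<theta>0 > 0" using Lc P CP kap A0 r0 by (auto simp: \<theta>0_def add_pos_pos intro!: divide_pos_pos mult_pos_pos add_nonneg_pos)
 define r1 where "r1 = min (min r0 rA) (min (\<kappa> / (2 * Lc)) ((\<kappa> * \<theta>0 / A0)^2))"
 have r1: "r1 > 0" "r1 <= r0" "r1 <= rA" "r1 <= \<kappa> / (2 * Lc)" "r1 <= (\<kappa> * \<theta>0 / A0)^2"
  using r0 rA kap Lc th0 A0 by (auto simp: r1_def min.coboundedI1 min.coboundedI2)
 have main: "w (x0, t0) - w (y0, t0) <= \<kappa>"
  if F: "elliptic_op lam Lam F" and q: "norm q = 1" and th: "0 < \<theta>" "\<theta> <= 2" and Om: "open \<Omega>"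
   and sub: "vsub j \<gamma> F q \<theta> \<Omega> w" and sup: "vsub j \<gamma> (%M. - F (- M)) (- q) \<theta> \<Omega> (%z. - w z)"
   and box: "\<forall>x t. norm (x - x0) <= 3 * R --> t0 - 1/2 <= t --> t < T --> (x, t) \<in> \<Omega> & 0 <= w (x, t) & w (x, t) <= 1"
   and T: "t0 < T" and y0: "norm (y0 - x0) <= r1"
  for F :: "real^'n^'n => real" and q \<theta> \<Omega> w x0 t0 T y0
 proof -
  have A: "w (x, t) - w (y, t) <= A0 / \<theta> * sqrt (norm (x - y))"
   if x: "norm (x - x0) <= 2 * R" "t0 - 1/4 <= t" "t < T" and y: "norm (x - y) <= rA" for x y t
  proof (rule runA[rule_format, OF F q th Om sub sup _ x(3)])
   show "norm (y - x) <= rA" using y by (simp add: norm_minus_commute)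
   fix x' t' assume a: "norm (x' - x) <= 2 * (R / 2)" "t - 1/4 <= t'" "t' < T"
   have "norm (x' - x0) <= 3 * R" using norm_triangle_ineq[of "x' - x" "x - x0"] a x by simp
   moreover have "t0 - 1/2 <= t'" using a x by simp
   ultimately show "(x', t') \<in> \<Omega> & 0 <= w (x', t') & w (x', t') <= 1" using box a(3) by blast
  qed
  show ?thesis
  proof (cases "\<theta> <= \<theta>0")
   case False
   have "w (x0, t0) - w (y0, t0) <= A0 / \<theta> * sqrt (norm (x0 - y0))" using T R y0 r1 by (intro A) (auto simp: norm_minus_commute)
   also have "... <= A0 / \<theta>0 * (\<kappa> * \<theta>0 / A0)"
   proof (intro mult_mono)
    show "A0 / \<theta> <= A0 / \<theta>0" using False th0 A0 by (intro divide_left_mono) auto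
    have "norm (x0 - y0) <= (\<kappa> * \<theta>0 / A0)^2" using y0 r1(5) by (simp add: norm_minus_commute)
    then show "sqrt (norm (x0 - y0)) <= \<kappa> * \<theta>0 / A0" using kap th0 A0 by (intro real_le_lsqrt) auto
   qed (use A0 th0 in auto)
   also have "... = \<kappa>" using A0 th0 by simp
   finally show ?thesis .
  next
   case True
   have t1: "\<theta> <= 1 / (2 * (Lc + P))" "\<theta> <= 1 / (4 * (C * (P + 1)))" "\<theta> <= \<kappa> / (2 * A0 * (E3^2 + 1))" "\<theta> <= A0 * sqrt r0"
    using True by (auto simp: \<theta>0_def)
   have b1: "\<theta> * (Lc + P) <= 1/2" using t1(1) Lc P by (simp add: field_simps)
   have b2: "2 * (C * (P + 1) * \<theta>) <= 1/2" using t1(2) CP by (simp add: field_simps)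
   have b3: "\<theta> * E3^2 <= \<kappa> / (2 * A0)"
   proof -
    have "\<theta> * E3^2 <= \<theta> * (E3^2 + 1)" using th by (intro mult_left_mono) auto
    also have "... <= \<kappa> / (2 * A0 * (E3^2 + 1)) * (E3^2 + 1)" using t1(3) by (intro mult_right_mono) auto
    also have "... = \<kappa> / (2 * A0)" using A0 zero_le_power2[of E3] by (simp add: add_nonneg_eq_0_iff)
    finally show ?thesis .
   qed
   define ra where "ra = (\<kappa> * \<theta> / (2 * A0))^2"
   have ra0: "0 <= ra" by (simp add: ra_def)
   have kth: "0 < \<kappa> * \<theta> / (2 * A0)" using kap th A0 by simp
   have ra_rA: "ra <= rA"
   proof -
    have "\<kappa> * \<theta> <= 1 * 2" using kap th by (intro mult_mono) auto
    moreover have "4 <= A0 * sqrt rA" using rA by (simp add: field_simps)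
    moreover have "sqrt rA * (2 * A0) = 2 * (A0 * sqrt rA)" by simp
    ultimately have "\<kappa> * \<theta> <= sqrt rA * (2 * A0)" by linarith
    then have "\<kappa> * \<theta> / (2 * A0) <= sqrt rA" using A0 by (simp add: pos_divide_le_eq)
    then have "ra <= (sqrt rA)^2" unfolding ra_def using kth by (intro power_mono) auto
    then show ?thesis using rA by simp
   qed
   have ra_r0: "ra <= r0"
   proof -
    have "\<kappa> * \<theta> <= 1 * \<theta>" using kap th by (intro mult_right_mono) auto
    also have "... <= A0 * sqrt r0" using t1(4) by simp
    also have "... <= sqrt r0 * (2 * A0)" using A0 r0 by simp
    finally have "\<kappa> * \<theta> / (2 * A0) <= sqrt r0" using A0 by (simp add: pos_divide_le_eq)
    then have "ra <= (sqrt r0)^2" unfolding ra_def using kth by (intro power_mono) auto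
    then show ?thesis using r0 by simp
   qed
   \<comment> \<open>The constant \<kappa>/2 takes over the first modulus at distances up to
     \<open>ra\<close>. The power 5/4 keeps the slope between 0 and \<open>Lc\<close> and gives
     concavity of order \<open>r powr (- 3/4)\<close>.\<close>
   define g where "g r = \<kappa> / 2 + Lc * r + (- (Lc / 2)) * r powr (5/4)" for r
   define g' where "g' r = Lc + (- (Lc / 2)) * (5/4) * r powr (5/4 - 1)" for r
   define g'' where "g'' r = (- (Lc / 2)) * (5/4) * (5/4 - 1) * r powr (5/4 - 2)" for r
   have gl: "\<kappa> / 2 + Lc * r / 2 <= g r" "g r <= \<kappa> / 2 + Lc * r" if "0 <= r" "r <= r0" for r
   proof -
    have "r powr (5/4) <= r powr 1"
    proof (cases "r = 0")
     case False
     then show ?thesis using that r0(3) by (intro powr_mono') auto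
    qed simp
    then have "Lc / 2 * r powr (5/4) <= Lc / 2 * r" using Lc that by (intro mult_left_mono) auto
    moreover have "0 <= Lc / 2 * r powr (5/4)" using Lc by simp
    ultimately show "\<kappa> / 2 + Lc * r / 2 <= g r" "g r <= \<kappa> / 2 + Lc * r" by (auto simp: g_def)
   qed
   have "w (x0, t0) - w (y0, t0) <= g (norm (x0 - y0))"
   proof (rule doubling_estimate[where g' = g' and g'' = g'' and \<rho> = "%r. 2 * (C * (P + 1) * \<theta>)" and bm = "%r. 4 powr (- \<bar>\<gamma>\<bar>)" and ra = ra,
      OF F L sub sup Om _ R T K(1,2) r0(1,2) ra0])
    show "(x, t) \<in> \<Omega> & 0 <= w (x, t) & w (x, t) <= 1" if "norm (x - x0) <= 2 * R" "t0 - 1/4 <= t" "t < T" for x t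
     using box[rule_format, of x t] that R by simp
    have "continuous_on {0..r0} (%r. r powr (5/4))" by (rule continuous_on_powr') auto
    then show "continuous_on {0..r0} g" unfolding g_def by (intro continuous_on_add continuous_on_mult continuous_on_const continuous_on_id)
    show "0 <= g r" if "0 <= r" "r <= r0" for r
    proof -
     have "0 <= Lc * r / 2" using that Lc by simp
     then show ?thesis using gl(1)[OF that] kap by linarith
    qed
    show "2 <= g r0" using gl(1)[of r0] r0 kap by (simp add: Lc_def)
    show "norm (y0 - x0) <= r0" using y0 r1 by simp
    show "w (x, t) - w (y, t) <= g (norm (x - y))"
     if "norm (x - x0) <= 2 * R" "norm (y - x0) <= 2 * R" "t0 - 1/4 <= t" "t < T" and xy: "norm (x - y) <= ra" for x y t
    proof -
     have True: "norm (x - y) <= r0" using xy ra_r0 by simp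
     have "w (x, t) - w (y, t) <= A0 / \<theta> * sqrt (norm (x - y))" using that ra_rA by (intro A) auto
     also have "... <= A0 / \<theta> * (\<kappa> * \<theta> / (2 * A0))"
      using xy kth A0 th by (intro mult_left_mono real_le_lsqrt) (auto simp: ra_def)
     also have "... = \<kappa> / 2" using A0 th by simp
     also have "... <= g (norm (x - y))"
     proof -
      have "0 <= Lc * norm (x - y) / 2" using Lc by simp
      then show ?thesis using gl(1)[OF norm_ge_zero True] by linarith
     qed
     finally show ?thesis .
    qed
    fix r :: real assume r: "ra < r" "r < r0"
    have rp: "0 < r" "r <= 1" using r ra0 r0 by linarith+
    have q4: "0 < r powr (1/4)" "r powr (1/4) <= 1" using rp by (auto intro: powr_le1)
    have g'b: "0 < g' r" "g' r <= Lc"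
    proof -
     have "Lc * (5/8 * r powr (1/4)) <= Lc * (5/8 * 1)" "0 <= Lc * (5/8 * r powr (1/4))" using q4 Lc by (auto intro!: mult_left_mono)
     then show "0 < g' r" "g' r <= Lc" using Lc by (auto simp: g'_def)
    qed
    define Z where "Z = Lc * r powr (- (3/4))"
    have Z: "Z >= Lc" "Z > 0"
    proof -
     have "1 <= r powr (- (3/4))" using powr_mono'[of "- (3/4)" 0 r] rp by simp
     then show "Z >= Lc" using Lc by (simp add: Z_def)
     then show "Z > 0" using Lc by linarith
    qed
    have g''Z: "- g'' r = 5/32 * Z" by (simp add: g''_def Z_def)
    show "0 < g' r & g'' r <= 0" using g'b g''Z Z by simp
    show "\<exists>\<delta>>0. \<forall>s. \<bar>s\<bar> < \<delta> --> g (r + s) <= g r + g' r * s + g'' r / 2 * s^2 + \<epsilon> * s^2" if "\<epsilon> > 0" for \<epsilon>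
     unfolding g_def g'_def g''_def by (rule powr_taylor[OF rp(1) that])
    show "0 < 4 powr (- \<bar>\<gamma>\<bar>) & 2 * (C * (P + 1) * \<theta>) <= 1/2" using b2 by simp
    show "q + \<theta> *\<^sub>R \<xi>1 ~= 0 & q + \<theta> *\<^sub>R \<xi>2 ~= 0 &
     \<bar>norm (q + \<theta> *\<^sub>R \<xi>2) powr \<gamma> / norm (q + \<theta> *\<^sub>R \<xi>1) powr \<gamma> - 1\<bar> <= 2 * (C * (P + 1) * \<theta>) & norm (q + \<theta> *\<^sub>R \<xi>2) powr \<gamma> >= 4 powr (- \<bar>\<gamma>\<bar>)"
     if e: "norm e = 1" and x1: "norm (\<xi>1 - g' r *\<^sub>R e) <= 2 * K * R + 1" and x2: "norm (\<xi>2 - g' r *\<^sub>R e) <= 1" for e \<xi>1 \<xi>2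
    proof -
     have nb: "norm (\<theta> *\<^sub>R \<xi>) <= 1/2" if "norm (\<xi> - g' r *\<^sub>R e) <= P" for \<xi>
     proof -
      have "norm \<xi> <= norm (\<xi> - g' r *\<^sub>R e) + norm (g' r *\<^sub>R e)" using norm_triangle_ineq[of "\<xi> - g' r *\<^sub>R e" "g' r *\<^sub>R e"] by simp
      also have "... <= Lc + P" using that g'b e by simp
      finally have "\<theta> * norm \<xi> <= \<theta> * (Lc + P)" using th by (intro mult_left_mono) auto
      then have "\<theta> * norm \<xi> <= 1/2" using b1 by linarith
      then show ?thesis using th by simp
     qed
     define z1 where "z1 = q + \<theta> *\<^sub>R \<xi>1"
     define z2 where "z2 = q + \<theta> *\<^sub>R \<xi>2"
     have "norm (\<theta> *\<^sub>R \<xi>1) <= 1/2" by (rule nb) (use x1 in \<open>simp add: P_def\<close>)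
     note n1 = norm_add_bounds[OF q this, folded z1_def]
     have "norm (\<theta> *\<^sub>R \<xi>2) <= 1/2" by (rule nb) (use x2 P in linarith)
     note n2 = norm_add_bounds[OF q this, folded z2_def]
     have "norm (\<xi>2 - \<xi>1) <= P + 1" using norm_triangle_ineq4[of "\<xi>2 - g' r *\<^sub>R e" "\<xi>1 - g' r *\<^sub>R e"] x1 x2 by (simp add: P_def)
     then have "\<theta> * norm (\<xi>2 - \<xi>1) <= \<theta> * (P + 1)" using th by (intro mult_left_mono) auto
     moreover have "z2 - z1 = \<theta> *\<^sub>R (\<xi>2 - \<xi>1)" by (simp add: z1_def z2_def algebra_simps)
     ultimately have "norm (z2 - z1) <= \<theta> * (P + 1)" using th by simp
     then have nd: "\<bar>norm z2 - norm z1\<bar> <= \<theta> * (P + 1)" using norm_triangle_ineq3[of z2 z1] by linarith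
     have "1 * (\<theta> * (P + 1)) <= C * (\<theta> * (P + 1))" using C th P by (intro mult_right_mono) auto
     moreover have "2 * (C * (\<theta> * (P + 1))) <= 1/2" using b2 by (simp only: mult_ac)
     ultimately have "\<theta> * (P + 1) <= 1/4" by linarith
     then have "\<bar>norm z2 - norm z1\<bar> <= norm z1 / 2" using nd n1 by linarith
     moreover have z10: "0 < norm z1" using n1 by linarith
     ultimately have pr: "\<bar>norm z2 powr \<gamma> / norm z1 powr \<gamma> - 1\<bar> <= C * (\<bar>norm z2 - norm z1\<bar> / norm z1)" unfolding C_def by (intro powr_ratio)
     have "\<bar>norm z2 - norm z1\<bar> / norm z1 <= \<theta> * (P + 1) / (1/2)" using nd n1 th P by (intro frac_le) auto
     then have "C * (\<bar>norm z2 - norm z1\<bar> / norm z1) <= C * (\<theta> * (P + 1) / (1/2))" using C by (intro mult_left_mono) auto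
     then have 1: "\<bar>norm z2 powr \<gamma> / norm z1 powr \<gamma> - 1\<bar> <= 2 * (C * (P + 1) * \<theta>)" using pr by (simp add: mult_ac)
     have 2: "norm z2 powr \<gamma> >= 4 powr (- \<bar>\<gamma>\<bar>)" using n2 by (intro powr_two_sided) auto
     have "z1 ~= 0" "z2 ~= 0" using n1 n2 by auto
     then show ?thesis using 1 2 unfolding z1_def z2_def by blast
    qed
    define \<rho> where "\<rho> = 2 * (C * (P + 1) * \<theta>)"
    have rho: "0 <= \<rho>" "\<rho> <= 1/2" using b2 CP th by (auto simp: \<rho>_def)
    have s1: "E2 <= lam / 4 * Z"
    proof -
     have "E2 <= lam / r0" using r0 E2 by (simp add: field_simps)
     also have "... = lam / 4 * Lc" by (simp add: Lc_def)
     also have "... <= lam / 4 * Z" using Z L by (intro mult_left_mono) auto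
     finally show ?thesis .
    qed
    \<comment> \<open>Since \<open>ra\<close> is of order \<theta>^2, \<open>r powr (1/4)\<close> is
      at least of order \<open>sqrt \<theta>\<close>, which beats \<open>E3 * \<theta>\<close> for
      small \<theta>. This is what \<open>s2\<close> needs to compare \<theta>/r with
      \<open>r powr (- 3/4)\<close>.\<close>
    have E3r: "E3 * \<theta> <= r powr (1/4)"
    proof -
     have "(E3 * \<theta>)^2 = \<theta> * E3^2 * \<theta>" by (simp add: power2_eq_square)
     also have "... <= \<kappa> / (2 * A0) * \<theta>" using b3 th by (intro mult_right_mono) auto
     finally have "E3 * \<theta> <= sqrt (\<kappa> * \<theta> / (2 * A0))" by (intro real_le_rsqrt) simp
     also have "... = ra powr (1/4)"
     proof -
      have "ra = (\<kappa> * \<theta> / (2 * A0)) powr 2" unfolding ra_def using kth by (intro powr_numeral[symmetric]) auto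
      then have "ra powr (1/4) = (\<kappa> * \<theta> / (2 * A0)) powr (2 * (1/4))" by (simp only: powr_powr)
      also have "... = (\<kappa> * \<theta> / (2 * A0)) powr (1/2)" by simp
      finally show ?thesis using powr_half_sqrt[OF less_imp_le[OF kth]] by simp
     qed
     also have "... <= r powr (1/4)" using r ra0 by (intro powr_mono2) auto
     finally show ?thesis .
    qed
    have s2: "2 * \<rho> * (W * (g' r / r)) <= lam / 4 * Z"
    proof -
     have "2 * \<rho> * (W * (g' r / r)) <= 2 * \<rho> * (W * (Lc / r))" using g'b rho W rp by (intro mult_left_mono divide_right_mono) auto
     also have "... = (lam * E3) / 4 * (\<theta> * (Lc / r))"
     proof -
      have e: "lam * E3 = 16 * (C * W * (P + 1))" using L by (simp add: E3_def)
      show ?thesis unfolding e \<rho>_def by simp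
     qed
     also have "... = lam / 4 * (E3 * \<theta> * (Lc / r))" by simp
     also have "... <= lam / 4 * (r powr (1/4) * (Lc / r))" using E3r L Lc rp by (intro mult_left_mono mult_right_mono) auto
     also have "r powr (1/4) * (Lc / r) = Z"
     proof -
      have "r powr (1/4) / r powr 1 = r powr (1/4 - 1)" by (rule powr_diff[symmetric])
      then have "r powr (1/4) / r = r powr (- (3/4))" using rp by simp
      then show ?thesis unfolding Z_def by (metis mult.commute times_divide_eq_right)
     qed
     finally show ?thesis .
    qed
    have "2 * \<rho> * (W * (2 * K + 1)) <= 1 * (W * (2 * K + 1))" using rho W K by (intro mult_right_mono) auto
    then have s3: "W * (2 * K + 1) + 2 * \<rho> * (W * (2 * K + 1)) + 2 * (K + 1) * B <= lam / 4 * Z" using s1 by (simp add: E2_def)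
    have "W * (2 * K + 1) + 2 * \<rho> * (W * (g' r / r + 2 * K + 1)) + 2 * (K + 1) * B
     = (W * (2 * K + 1) + 2 * \<rho> * (W * (2 * K + 1)) + 2 * (K + 1) * B) + 2 * \<rho> * (W * (g' r / r))" by (simp add: algebra_simps)
    also have "... <= lam / 4 * Z + lam / 4 * Z" using s2 s3 by linarith
    also have "... < 4 * lam * (- g'' r)" unfolding g''Z using L Z by simp
    finally show "real CARD('n) * Lam * (2 * K + 1) + 2 * (2 * (C * (P + 1) * \<theta>)) * (real CARD('n) * Lam * (g' r / r + 2 * K + 1)) + 2 * (K + 1) / 4 powr (- \<bar>\<gamma>\<bar>) < 4 * lam * (- g'' r)"
     unfolding \<rho>_def W_def B_def by (simp add: powr_minus_divide)
   qed
   also have "... <= \<kappa> / 2 + Lc * norm (x0 - y0)" using y0 r1 by (intro gl(2)) (auto simp: norm_minus_commute)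
   also have "... <= \<kappa>"
   proof -
    have "Lc * norm (x0 - y0) <= Lc * (\<kappa> / (2 * Lc))" using y0 r1(4) Lc by (intro mult_left_mono) (auto simp: norm_minus_commute)
    then show ?thesis using Lc by simp
   qed
   finally show ?thesis .
  qed
 qed
 show ?thesis by (intro exI[of _ r1] conjI r1(1) allI impI) (rule main)
qed

section \<open>The dichotomy\<close>

text \<open>\<open>layer_barrier\<close> is applied on the normal through the foot \<open>x0\<close>
  of \<open>x\<close>; as \<open>t0\<close> decreases to \<open>t\<close>, the term with
  \<open>t0 - t\<close> disappears.\<close>

lemma layer_bound:
 fixes w :: "(real^'n) \<times> real => real" and F :: "real^'n^'n => real"
 assumes F: "elliptic_op lam Lam F" and L: "0 < lam"
  and w: "vsub j \<gamma> F q \<theta> (half_cyl k) w" and cw: "continuous_on (half_cyl_flat k) w"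
  and wl: "\<And>x t. (x, t) \<in> half_cyl_flat k ==> w (x, t) <= l * x $ k"
  and h: "0 < h" "h <= 1/192" and a: "a > 0" and T: "T > 0"
  and top: "\<And>x s. norm x <= 1/2 ==> x $ k = h ==> t - T <= s ==> s < 0 ==> w (x, s) <= (l - 7/8 * a) * h"
  and nd: "\<And>\<sigma> \<omega>. 3/4 <= \<sigma> ==> \<sigma> <= 1 ==> norm \<omega> <= 1/16 ==>
    1/4 <= norm (q + \<theta> *\<^sub>R (l *\<^sub>R axis k 1 - a *\<^sub>R (\<sigma> *\<^sub>R axis k 1 + \<omega>))) & norm (q + \<theta> *\<^sub>R (l *\<^sub>R axis k 1 - a *\<^sub>R (\<sigma> *\<^sub>R axis k 1 + \<omega>))) <= 4"
  and sc: "3/2 * h / T <= 4 powr (- \<bar>\<gamma>\<bar>) * (lam / (4 * h) - 48 * h * (real CARD('n) * Lam))"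
  and x: "norm x <= 1/4" "0 <= x $ k" "x $ k <= h" and t: "- 1 < t - T" "t < 0"
 shows "w (x, t) <= (l - 3/4 * a) * x $ k"
proof (rule field_le_epsilon)
 fix \<epsilon> :: real assume eps: "0 < \<epsilon>"
 define c where "c = 3/2 * a * h / T"
 have c: "c > 0" using a h T by (simp add: c_def)
 define t0 where "t0 = t + min (- t / 2) (min T (\<epsilon> / c))"
 have m: "0 < min (- t / 2) (min T (\<epsilon> / c))" using t T eps c by simp
 have "min (- t / 2) (min T (\<epsilon> / c)) <= - t / 2" "min (- t / 2) (min T (\<epsilon> / c)) <= T" "min (- t / 2) (min T (\<epsilon> / c)) <= \<epsilon> / c"
  by (simp_all add: min.coboundedI1 min.coboundedI2)
 then have t0: "t < t0" "t0 < 0" "t0 - T <= t" "t0 - t <= \<epsilon> / c" using m t unfolding t0_def by auto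
 define x0 where "x0 = x - x $ k *\<^sub>R axis k 1"
 have x0k: "x0 $ k = 0" by (simp add: x0_def axis_def)
 have "norm x0 <= norm x"
 proof -
  have "(axis k 1 :: real^'n) $ k = 1" by (simp add: axis_def)
  then have "x0 \<bullet> x0 = x \<bullet> x - x $ k * x $ k"
   by (simp add: x0_def inner_diff_left inner_diff_right inner_axis inner_axis')
  moreover have "0 <= x $ k * x $ k" by simp
  ultimately have "x0 \<bullet> x0 <= x \<bullet> x" by linarith
  then show ?thesis by (simp add: norm_le)
 qed
 then have x0n: "norm x0 <= 1/4" using x by simp
 have "w (x0 + x $ k *\<^sub>R axis k 1, t) <= (l - 3/4 * a) * x $ k + 3/2 * a * h / T * (t0 - t)"
  by (rule layer_barrier[OF F L w cw wl h a T x0k x0n _ t0(2) _ nd sc x(2,3) t0(3,1)]) (use top t t0 in auto)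
 also have "3/2 * a * h / T * (t0 - t) <= c * (\<epsilon> / c)" unfolding c_def[symmetric] using t0(4) c by (intro mult_left_mono) auto
 finally show "w (x, t) <= (l - 3/4 * a) * x $ k + \<epsilon>" using c by (simp add: x0_def)
qed

lemma layer_height:
 fixes lam W b T :: real
 assumes "0 < lam" "0 < W" "0 < b" "0 < T"
 obtains h where "0 < h" "h <= 1/192" "3/2 * h / T <= b * (lam / (4 * h) - 48 * h * W)"
proof -
 define h where "h = min (1/192) (min (lam / (384 * W)) (b * lam * T / 12))"
 have h: "0 < h" "h <= 1/192" "h <= lam / (384 * W)" "h <= b * lam * T / 12"
  using assms by (auto simp: h_def min.coboundedI1 min.coboundedI2)
 have h2: "h * h <= h" using h by (simp add: mult_left_le)
 have "384 * W * (h * h) <= 384 * W * h" using h2 assms by (intro mult_left_mono) auto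
 also have "... <= lam" using h(3) assms by (simp add: field_simps)
 finally have 1: "48 * h * W <= lam / (8 * h)" using h by (simp add: field_simps)
 have "12 * (h * h) <= b * lam * T" using h2 h(4) by linarith
 then have "3/2 * h / T <= b * (lam / (8 * h))" using h assms by (simp add: field_simps)
 also have "... <= b * (lam / (4 * h) - 48 * h * W)"
 proof (rule mult_left_mono)
  have "lam / (4 * h) = 2 * (lam / (8 * h))" by simp
  then show "lam / (8 * h) <= lam / (4 * h) - 48 * h * W" using 1 by linarith
 qed (use assms in simp)
 finally show ?thesis using that h by blast
qed

lemma open_half_cyl: "open (half_cyl k)"
proof -
 have "half_cyl k = (ball 0 1 \<times> {-1<..<0}) \<inter> {z. 0 < fst z $ k}" by (auto simp: half_cyl_def)
 then show ?thesis by (auto intro!: open_Int open_Times open_Collect_less continuous_intros)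
qed

definition slope_dichotomy :: "'n::finite => nat => real => real => real => real => real => real => bool" where
 "slope_dichotomy k j \<gamma> lam Lam \<eta> \<rho> \<tau> \<longleftrightarrow> (\<forall>(F :: real^'n^'n => real) q \<theta> w. canonical k j \<gamma> lam Lam F q \<theta> w -->
   (\<forall>x t. norm x < \<rho> --> 0 < x $ k --> - \<tau> < t --> t < 0 --> \<eta> * x $ k <= w (x, t)) |
   (\<forall>x t. norm x < \<rho> --> 0 < x $ k --> - \<tau> < t --> t < 0 --> w (x, t) <= (1 - \<eta>) * x $ k))"

lemma dichotomy:
 fixes k :: "'n::finite"
 assumes L: "0 < lam" "lam <= Lam" and gam: "\<gamma> > -1" and j: "j >= 2" "(2 * real j - 1) * (1 + \<gamma>) > 1"
 shows "\<exists>\<eta> \<rho> \<tau>. 0 < \<eta> & \<eta> <= 1/2 & 0 < \<rho> & \<rho> <= 1 & 0 < \<tau> & \<tau> <= 1 &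
  slope_dichotomy k j \<gamma> lam Lam \<eta> \<rho> \<tau>"
proof -
 define W where "W = real CARD('n) * Lam"
 define b0 :: real where "b0 = 4 powr (- \<bar>\<gamma>\<bar>)"
 have W: "0 < W" and b0: "0 < b0" using L by (auto simp: W_def b0_def)
 \<comment> \<open>The order of choices matters: \<open>h\<close> comes from the upper barrier,
   \<delta> from the short time estimate at height about \<open>h\<close>, \<open>r1\<close> from
   the modulus, \<open>h2\<close> from the lower barrier on the time scale \<delta>/8, and \<eta>'
   from the bump that connects the two heights.\<close>
 obtain h where h: "0 < h" "h <= 1/192" and sc: "3/2 * h / (1/8) <= b0 * (lam / (4 * h) - 48 * h * W)"
  using layer_height[OF L(1) W b0, of "1/8"] by auto
 have hh: "0 < h / 2" "h / 2 <= 1" "0 < h / 16" "h / 16 <= 1" "0 < h / 32" "h / 32 <= 1" using h by auto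
 obtain \<delta>0 where d0: "\<delta>0 > 0" and ST: "\<forall>(F :: real^'n^'n => real) q \<theta> w x0 t1 t. canonical k j \<gamma> lam Lam F q \<theta> w --> cball x0 (h / 2) \<subseteq> {x. norm x < 1 & 0 < x $ k} -->
   - 1 < t1 --> (\<forall>x\<in>cball x0 (h / 2). w (x, t1) <= h / 16) --> t1 <= t --> t < t1 + \<delta>0 --> t < 0 --> w (x0, t) <= 2 * (h / 16)"
  using short_time[OF L j hh(1-4), where k = k] by blast
 define \<delta> where "\<delta> = min \<delta>0 (1/8)"
 have del: "0 < \<delta>" "\<delta> <= \<delta>0" "\<delta> <= 1/8" using d0 by (auto simp: \<delta>_def)
 obtain r1 where r1: "r1 > 0" and SM: "\<forall>(F :: real^'n^'n => real) q \<theta> \<Omega> w x0 t0 T y0. elliptic_op lam Lam F --> norm q = 1 --> 0 < \<theta> --> \<theta> <= 2 --> open \<Omega> -->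
   vsub j \<gamma> F q \<theta> \<Omega> w --> vsub j \<gamma> (%M. - F (- M)) (- q) \<theta> \<Omega> (%z. - w z) -->
   (\<forall>x t. norm (x - x0) <= 3 * (h / 16) --> t0 - 1/2 <= t --> t < T --> (x, t) \<in> \<Omega> & 0 <= w (x, t) & w (x, t) <= 1) --> t0 < T -->
   norm (y0 - x0) <= r1 --> w (x0, t0) - w (y0, t0) <= h / 32"
  using space_modulus[OF L gam hh(3,5,6), where j = j and 'n = 'n] by blast
 obtain h2 where h2: "0 < h2" "h2 <= 1/192" and sc2: "3/2 * h2 / (\<delta> / 8) <= b0 * (lam / (4 * h2) - 48 * h2 * W)"
  using layer_height[OF L(1) W b0, of "\<delta> / 8"] del by auto
 define \<rho>M where "\<rho>M = min r1 (min (h / 4) (h2 / 2))"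
 have rM: "0 < \<rho>M" "\<rho>M <= r1" "\<rho>M <= h / 4" "\<rho>M <= h2 / 2" "\<rho>M <= 1"
 proof -
  show "0 < \<rho>M" "\<rho>M <= r1" "\<rho>M <= h / 4" "\<rho>M <= h2 / 2" using r1 h h2 by (auto simp: \<rho>M_def min.coboundedI1 min.coboundedI2)
  then show "\<rho>M <= 1" using h by linarith
 qed
 have dM: "0 < \<delta> / 4" using del by simp
 obtain \<eta>' where e': "\<eta>' > 0" and MB: "\<forall>(F :: real^'n^'n => real) q \<theta> w x1 x2 t1 t2. canonical k j \<gamma> lam Lam F q \<theta> w -->
   cball x1 \<rho>M \<subseteq> {x. norm x < 1 & 0 < x $ k} --> cball x2 \<rho>M \<subseteq> {x. norm x < 1 & 0 < x $ k} -->
   - 1 < t1 --> t1 + \<delta> / 4 <= t2 --> t2 < 0 --> (\<forall>x\<in>cball x1 \<rho>M. h / 32 <= w (x, t1)) --> \<eta>' <= w (x2, t2)"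
  using moving_bump[OF L rM(1,5) hh(5) dM, where k = k and j = j and \<gamma> = \<gamma>] by blast
 \<comment> \<open>\<open>a <= \<eta>'\<close> is what the bump provides at height
   \<open>h2\<close>. The cap 1/5 bounds the gradient of the lower barrier by 1/4, hence \<theta>
   times it by 1/2.\<close>
 define a where "a = min (1/5) \<eta>'"
 have a: "0 < a" "a <= 1/5" "a <= \<eta>'" using e' by (auto simp: a_def)
 define \<rho> where "\<rho> = min h h2"
 have rho: "0 < \<rho>" "\<rho> <= h" "\<rho> <= h2" using h h2 by (auto simp: \<rho>_def)
 have nsub: "cball x r \<subseteq> {x. norm x < 1 & 0 < x $ k}" if "r < x $ k" "norm x + r < 1" for x :: "real^'n" and r
 proof
  fix y assume "y \<in> cball x r"
  then have y: "norm (y - x) <= r" by (simp add: dist_norm norm_minus_commute)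
  have "\<bar>(y - x) $ k\<bar> <= norm (y - x)" by (rule component_le_norm_cart)
  then have "0 < y $ k" using y that(1) by (simp add: abs_le_iff)
  moreover have "norm y < 1" using norm_triangle_ineq[of x "y - x"] y that(2) by simp
  ultimately show "y \<in> {x. norm x < 1 & 0 < x $ k}" by simp
 qed
 have main: "(\<forall>x t. norm x < \<rho> --> 0 < x $ k --> - (\<delta> / 8) < t --> t < 0 --> (3/4 * a) * x $ k <= w (x, t)) |
   (\<forall>x t. norm x < \<rho> --> 0 < x $ k --> - (\<delta> / 8) < t --> t < 0 --> w (x, t) <= (1 - 3/4 * a) * x $ k)"
  if can: "canonical k j \<gamma> lam Lam F q \<theta> w" for F :: "real^'n^'n => real" and q \<theta> w
 proof -
  note c = canonicalD[OF can]
  have ax: "norm (axis k 1 :: real^'n) = 1" by (simp add: norm_axis_1)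
  show ?thesis
  \<comment> \<open>The threshold \<open>h / 8\<close> is the value \<open>(1 - 7/8) * h\<close>
    that the upper barrier with \<open>l = 1\<close> and \<open>a = 1\<close> requires at its
    top.\<close>
  proof (cases "\<forall>x t. norm x <= 1/2 --> x $ k = h --> - (1/4) <= t --> t < 0 --> w (x, t) <= h / 8")
   case True
   have "w (x, t) <= (1 - 3/4 * a) * x $ k" if x: "norm x < \<rho>" "0 < x $ k" and t: "- (\<delta> / 8) < t" "t < 0" for x t
   proof -
    have xk: "x $ k <= norm x" using component_le_norm_cart[of x k] by simp
    have "w (x, t) <= (1 - 3/4 * 1) * x $ k"
    proof (rule layer_bound[OF c(1) L(1) c(5,7) _ h, where a = 1 and T = "1/8" and l = 1])
     show "w (x, t) <= 1 * x $ k" if "(x, t) \<in> half_cyl_flat k" for x t using c(9)[OF that] by simp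
     show "w (x, s) <= (1 - 7/8 * 1) * h" if "norm x <= 1/2" "x $ k = h" "t - 1/8 <= s" "s < 0" for x s
      using True[rule_format, of x s] that t del by simp
     fix \<sigma> :: real and \<omega> :: "real^'n" assume s: "3/4 <= \<sigma>" "\<sigma> <= 1" "norm \<omega> <= 1/16"
     define v where "v = \<theta> *\<^sub>R (1 *\<^sub>R axis k 1 - 1 *\<^sub>R (\<sigma> *\<^sub>R axis k 1 + \<omega>))"
     have eq: "1 *\<^sub>R axis k 1 - 1 *\<^sub>R (\<sigma> *\<^sub>R axis k 1 + \<omega>) = (1 - \<sigma>) *\<^sub>R axis k 1 - \<omega>" by (simp add: algebra_simps)
     have "norm (1 *\<^sub>R axis k 1 - 1 *\<^sub>R (\<sigma> *\<^sub>R axis k 1 + \<omega>)) <= 5/16"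
      unfolding eq using norm_triangle_ineq4[of "(1 - \<sigma>) *\<^sub>R axis k 1" \<omega>] s ax by simp
     then have "\<theta> * norm (1 *\<^sub>R axis k 1 - 1 *\<^sub>R (\<sigma> *\<^sub>R axis k 1 + \<omega>)) <= 2 * (5/16)" using c(3,4) by (intro mult_mono) auto
     then have "norm v <= 5/8" using c(3) by (simp add: v_def)
     from norm_add_bounds[OF c(2) this] show "1/4 <= norm (q + \<theta> *\<^sub>R (1 *\<^sub>R axis k 1 - 1 *\<^sub>R (\<sigma> *\<^sub>R axis k 1 + \<omega>))) &
      norm (q + \<theta> *\<^sub>R (1 *\<^sub>R axis k 1 - 1 *\<^sub>R (\<sigma> *\<^sub>R axis k 1 + \<omega>))) <= 4" unfolding v_def[symmetric] by linarith
    next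
     show "3/2 * h / (1/8) <= 4 powr (- \<bar>\<gamma>\<bar>) * (lam / (4 * h) - 48 * h * (real CARD('n) * Lam))" using sc by (simp only: b0_def W_def)
     show "norm x <= 1/4" "x $ k <= h" using x xk rho h by linarith+
     show "- 1 < t - 1/8" using t del by simp
    qed (use x t in auto)
    moreover have "(1 - 3/4 * 1) * x $ k <= (1 - 3/4 * a) * x $ k" using x a by (intro mult_right_mono) auto
    ultimately show ?thesis by linarith
   qed
   then show ?thesis by blast
  next
   case False
   then obtain x1 ts where x1: "norm x1 <= 1/2" "x1 $ k = h" and ts: "- (1/4) <= ts" "ts < 0" and wx1: "w (x1, ts) > h / 8" by force
   \<comment> \<open>Going back by \<delta>/2 leaves the bump its travel time: every time from
     \<open>- (\<delta> / 4)\<close> on is at least \<delta>/4 later than \<open>t1\<close>. If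
     \<open>w\<close> were small around \<open>x1\<close> at time \<open>t1\<close>,
     \<open>short_time\<close> would make it small at \<open>(x1, ts)\<close>.\<close>
   define t1 where "t1 = ts - \<delta> / 2"
   have t1: "- 1/2 < t1" "t1 <= ts" "ts < t1 + \<delta>0" using ts del by (auto simp: t1_def)
   have "\<not> (\<forall>x\<in>cball x1 (h / 2). w (x, t1) <= h / 16)"
   proof
    assume A: "\<forall>x\<in>cball x1 (h / 2). w (x, t1) <= h / 16"
    have "cball x1 (h / 2) \<subseteq> {x. norm x < 1 & 0 < x $ k}" using x1 h by (intro nsub) auto
    from ST[rule_format, OF can this _ _ t1(2,3) ts(2)] have "w (x1, ts) <= 2 * (h / 16)" using A t1 by auto
    then show False using wx1 by simp
   qed
   then obtain x3 where x3: "x3 \<in> cball x1 (h / 2)" "w (x3, t1) > h / 16" by force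
   have x31: "norm (x3 - x1) <= h / 2" using x3 by (simp add: dist_norm norm_minus_commute)
   have "\<bar>(x3 - x1) $ k\<bar> <= norm (x3 - x1)" by (rule component_le_norm_cart)
   then have x3k: "h / 2 <= x3 $ k" using x31 x1 by (simp add: abs_le_iff)
   have x3n: "norm x3 <= 3/4" using norm_triangle_ineq[of x1 "x3 - x1"] x31 x1 h by simp
   have ball: "\<forall>y\<in>cball x3 \<rho>M. h / 32 <= w (y, t1)"
   proof
    fix y assume "y \<in> cball x3 \<rho>M"
    then have y: "norm (y - x3) <= r1" using rM by (simp add: dist_norm norm_minus_commute)
    have "w (x3, t1) - w (y, t1) <= h / 32"
    proof (rule SM[rule_format, OF c(1-4) open_half_cyl c(5,6) _ _ y])
     fix x t assume a: "norm (x - x3) <= 3 * (h / 16)" "t1 - 1/2 <= t" "t < 0"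
     have "cball x3 (3 * (h / 16)) \<subseteq> {x. norm x < 1 & 0 < x $ k}" using x3k x3n h by (intro nsub) auto
     moreover have "x \<in> cball x3 (3 * (h / 16))" using a by (simp add: dist_norm norm_minus_commute)
     ultimately have "norm x < 1 & 0 < x $ k" by blast
     then have "(x, t) \<in> half_cyl k & (x, t) \<in> half_cyl_flat k" using a t1 by (auto simp: half_cyl_def half_cyl_flat_def)
     then show "(x, t) \<in> half_cyl k & 0 <= w (x, t) & w (x, t) <= 1" using c(8,10) by blast
    qed (use t1 ts in auto)
    then show "h / 32 <= w (y, t1)" using x3 by linarith
   qed
   have s3: "cball x3 \<rho>M \<subseteq> {x. norm x < 1 & 0 < x $ k}" using x3k x3n h rM by (intro nsub) auto
   have low: "\<eta>' <= w (x2, t2)" if "norm x2 <= 1/2" "x2 $ k = h2" "- (\<delta> / 4) <= t2" "t2 < 0" for x2 t2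
   proof -
    have "cball x2 \<rho>M \<subseteq> {x. norm x < 1 & 0 < x $ k}" using that rM h2 by (intro nsub) auto
    moreover have "- 1 < t1" "t1 + \<delta> / 4 <= t2" using t1 that ts del by (auto simp: t1_def)
    ultimately show ?thesis using MB[rule_format, OF can s3 _ _ _ that(4)] ball by blast
   qed
   have "3/4 * a * x $ k <= w (x, t)" if x: "norm x < \<rho>" "0 < x $ k" and t: "- (\<delta> / 8) < t" "t < 0" for x t
   proof -
    have xk: "x $ k <= norm x" using component_le_norm_cart[of x k] by simp
    have cm: "continuous_on (half_cyl_flat k) (%z. - w z)" using c(7) by (intro continuous_intros)
    have "- w (x, t) <= (0 - 3/4 * a) * x $ k"
    proof (rule layer_bound[OF elliptic_op_neg[OF c(1)] L(1) c(6) cm _ h2 a(1), where T = "\<delta> / 8" and l = 0])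
     show "- w (x, t) <= 0 * x $ k" if "(x, t) \<in> half_cyl_flat k" for x t using c(8)[OF that] by simp
     show "- w (x, s) <= (0 - 7/8 * a) * h2" if "norm x <= 1/2" "x $ k = h2" "t - \<delta> / 8 <= s" "s < 0" for x s
     proof -
      have "- (\<delta> / 4) <= s" using that t by simp
      then have "\<eta>' <= w (x, s)" using that by (intro low) auto
      moreover have "7/8 * a * h2 <= a * 1" using a h2 by (intro mult_mono) auto
      moreover have "(0 - 7/8 * a) * h2 = - (7/8 * a * h2)" by simp
      ultimately show ?thesis using a by linarith
     qed
     fix \<sigma> :: real and \<omega> :: "real^'n" assume s: "3/4 <= \<sigma>" "\<sigma> <= 1" "norm \<omega> <= 1/16"
     define v where "v = 0 *\<^sub>R axis k 1 - a *\<^sub>R (\<sigma> *\<^sub>R axis k 1 + \<omega>)"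
     have "norm (\<sigma> *\<^sub>R axis k 1 + \<omega>) <= 17/16" using norm_triangle_ineq[of "\<sigma> *\<^sub>R axis k 1" \<omega>] s ax by simp
     then have "a * norm (\<sigma> *\<^sub>R axis k 1 + \<omega>) <= 1/5 * (17/16)" using a by (intro mult_mono) auto
     then have "norm v <= 1/4" using a by (simp add: v_def)
     then have "\<theta> * norm v <= 2 * (1/4)" using c(3,4) by (intro mult_mono) auto
     then have nv: "norm (\<theta> *\<^sub>R v) <= 1/2" using c(3) by simp
     have "norm (- q) = 1" using c(2) by simp
     from norm_add_bounds[OF this nv] show "1/4 <= norm (- q + \<theta> *\<^sub>R (0 *\<^sub>R axis k 1 - a *\<^sub>R (\<sigma> *\<^sub>R axis k 1 + \<omega>))) &
      norm (- q + \<theta> *\<^sub>R (0 *\<^sub>R axis k 1 - a *\<^sub>R (\<sigma> *\<^sub>R axis k 1 + \<omega>))) <= 4" unfolding v_def[symmetric] by linarith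
    next
     show "3/2 * h2 / (\<delta> / 8) <= 4 powr (- \<bar>\<gamma>\<bar>) * (lam / (4 * h2) - 48 * h2 * (real CARD('n) * Lam))" using sc2 by (simp only: b0_def W_def)
     show "norm x <= 1/4" "x $ k <= h2" using x xk rho h by linarith+
     show "- 1 < t - \<delta> / 8" using t del by simp
    qed (use x t del in auto)
    then show ?thesis by simp
   qed
   then show ?thesis by blast
  qed
 qed
 show ?thesis
 proof (rule exI[of _ "3/4 * a"], rule exI[of _ \<rho>], rule exI[of _ "\<delta> / 8"], unfold slope_dichotomy_def, intro conjI allI impI)
  fix F :: "real^'n^'n => real" and q \<theta> w assume "canonical k j \<gamma> lam Lam F q \<theta> w"
  then show "(\<forall>x t. norm x < \<rho> --> 0 < x $ k --> - (\<delta> / 8) < t --> t < 0 --> (3/4 * a) * x $ k <= w (x, t)) |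
   (\<forall>x t. norm x < \<rho> --> 0 < x $ k --> - (\<delta> / 8) < t --> t < 0 --> w (x, t) <= (1 - 3/4 * a) * x $ k)" by (rule main)
 qed (use a rho h del in auto)
qed

section \<open>The initial bound on the slopes\<close>

text \<open>As \<open>p $ k = 0\<close>, the normal component of the full gradient is at least
  \<open>M\<close> on the barrier, which excludes criticality. The coefficient is at least
  \<open>1 / (5 * M)\<close> because \<gamma> > -1, and the Hessian contributes a negative term of
  order \<open>M / h\<close>. Their product does not decay with \<open>M\<close>, and
  \<open>h\<close>, chosen before \<open>M\<close>, makes it exceed the time derivative
  \<open>4 * K\<close>.\<close>

lemma boundary_lipschitz:
 fixes k :: "'n::finite"
 assumes L: "0 < lam" "lam <= Lam" and gam: "\<gamma> > -1" and K: "0 <= K"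
 shows "\<exists>M\<ge>1. \<forall>(F :: real^'n^'n => real) p w. elliptic_op lam Lam F --> norm p <= 1 --> p $ k = 0 --> vsub j \<gamma> F p 1 (half_cyl k) w -->
  continuous_on (half_cyl_flat k) w --> (\<forall>x t. (x, t) \<in> half_cyl_flat k --> w (x, t) <= K & (x $ k = 0 --> w (x, t) = 0)) -->
  (\<forall>x t. norm x <= 1/2 --> 0 <= x $ k --> - (1/2) <= t --> t < 0 --> w (x, t) <= M * x $ k)"
proof -
 define W where "W = real CARD('n) * Lam"
 have W: "0 < W" using L by (simp add: W_def)
 define h where "h = min (1/4) (2 * lam / (20 * K + 2 * W))"
 have h: "0 < h" "h <= 1/4" "h <= 2 * lam / (20 * K + 2 * W)" using L W K by (auto simp: h_def add_nonneg_pos)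
 have hl: "20 * K + 2 * W <= 2 * lam / h" using h W K by (simp add: field_simps add_nonneg_pos)
 define M where "M = 1 + 16 * K + K / h"
 have M: "1 <= M" "1 + 16 * K <= M" "K <= M * h"
 proof -
  have "0 <= K / h" using K h by simp
  then show "1 <= M" "1 + 16 * K <= M" using K by (auto simp: M_def)
  have "0 <= (1 + 16 * K) * h" using K h by simp
  moreover have "M * h = (1 + 16 * K) * h + K" using h by (simp add: M_def algebra_simps)
  ultimately show "K <= M * h" by linarith
 qed
 have main: "w (x, t) <= (3 * M) * x $ k"
  if F: "elliptic_op lam Lam F" and p: "norm p <= 1" "p $ k = 0" and w: "vsub j \<gamma> F p 1 (half_cyl k) w" and cw: "continuous_on (half_cyl_flat k) w"
   and wK: "\<forall>x t. (x, t) \<in> half_cyl_flat k --> w (x, t) <= K & (x $ k = 0 --> w (x, t) = 0)"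
   and x: "norm x <= 1/2" "0 <= x $ k" and t: "- (1/2) <= t" "t < 0"
  for F :: "real^'n^'n => real" and p w x t
 proof (cases "x $ k <= h")
  case False
  have "w (x, t) <= K" using wK x t by (simp add: half_cyl_flat_def)
  also have "... <= M * x $ k" using M False by (intro order_trans[OF M(3)] mult_left_mono) auto
  also have "... <= (3 * M) * x $ k" using M x by (intro mult_right_mono) auto
  finally show ?thesis .
 next
  case xh: True
  show ?thesis
  proof (rule field_le_epsilon)
   fix \<epsilon> :: real assume eps: "0 < \<epsilon>"
   define t0 where "t0 = t + min (- t / 2) (min (1/8) (\<epsilon> / (4 * K + 1)))"
   have m: "0 < min (- t / 2) (min (1/8) (\<epsilon> / (4 * K + 1)))" using t eps K by simp
   have "min (- t / 2) (min (1/8) (\<epsilon> / (4 * K + 1))) <= - t / 2" "min (- t / 2) (min (1/8) (\<epsilon> / (4 * K + 1))) <= 1/8"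
    "min (- t / 2) (min (1/8) (\<epsilon> / (4 * K + 1))) <= \<epsilon> / (4 * K + 1)"
    by (rule min.cobounded1 min.coboundedI2[OF min.cobounded1] min.coboundedI2[OF min.cobounded2])+
   then have t0: "t < t0" "t0 < 0" "t0 - 1/4 < t" "t0 - t <= \<epsilon> / (4 * K + 1)" using m t unfolding t0_def by auto
   define e :: "real^'n" where "e = axis k 1"
   have e: "norm e = 1" "e $ k = 1" "\<And>x. e \<bullet> x = x $ k" by (simp_all add: e_def norm_axis_1 inner_axis')
   define x0 where "x0 = x - x $ k *\<^sub>R e"
   have x0k: "x0 $ k = 0" using e by (simp add: x0_def)
   have "x0 \<bullet> x0 = x \<bullet> x - x $ k * x $ k" using e(2,3) by (simp add: x0_def inner_diff_left inner_diff_right inner_commute[of x e])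
   then have "x0 \<bullet> x0 <= x \<bullet> x" using zero_le_square[of "x $ k"] by linarith
   then have x0n: "norm x0 <= 1/2" using x by (simp add: norm_le[symmetric])
   \<comment> \<open>The barrier is at least \<open>K\<close> on every part of the boundary but the
     flat one: at height \<open>h\<close> since \<open>M * h >= K\<close>, at distance 1/4 from
     \<open>x0\<close> by the factor \<open>16 * K\<close>, and at time \<open>t0 - 1/4\<close> by
     the factor \<open>4 * K\<close>.\<close>
   define \<phi> where "\<phi> = (%z. ((3 * M) *\<^sub>R e) \<bullet> fst z + (- (M / h)) * (fst z $ k)^2 + (16 * K) * (norm (fst z - x0))^2 + (- (4 * K) * snd z + 4 * K * t0))"
   have ph: "\<phi> (y, s) = (3 * M * y $ k - M / h * (y $ k)^2) + 16 * K * (norm (y - x0))^2 + 4 * K * (t0 - s)" for y s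
    unfolding \<phi>_def using e(3) by (simp add: algebra_simps)
   define Kc where "Kc = (cball x0 (1/4) \<times> {t0 - 1/4..t0}) \<inter> {z. 0 <= fst z $ k} \<inter> {z. fst z $ k <= h}"
   define V where "V = (ball x0 (1/4) \<times> {t0 - 1/4<..<t0}) \<inter> {z. 0 < fst z $ k} \<inter> {z. fst z $ k < h}"
   have KcI: "(y, s) \<in> Kc \<longleftrightarrow> norm (y - x0) <= 1/4 & t0 - 1/4 <= s & s <= t0 & 0 <= y $ k & y $ k <= h" for y s
    by (auto simp: Kc_def dist_norm norm_minus_commute)
   have VI: "(y, s) \<in> V \<longleftrightarrow> norm (y - x0) < 1/4 & t0 - 1/4 < s & s < t0 & 0 < y $ k & y $ k < h" for y s
    by (auto simp: V_def dist_norm norm_minus_commute)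
   have n34: "norm y < 1" if "norm (y - x0) <= 1/4" for y using norm_triangle_ineq[of x0 "y - x0"] x0n that by simp
   have Kin: "(y, s) \<in> half_cyl_flat k" if "(y, s) \<in> Kc" for y s using that n34[of y] t t0 by (auto simp: KcI half_cyl_flat_def)
   have "w (x0 + x $ k *\<^sub>R e, t) <= \<phi> (x0 + x $ k *\<^sub>R e, t)"
   proof (rule barrier_comparison_open[OF w _ _ _ _ _ _ _ _ _ t0(1)])
    show "compact Kc" unfolding Kc_def by (intro compact_Int_closed compact_Times closed_Collect_le continuous_intros) auto
    have "Kc \<subseteq> half_cyl_flat k" using Kin by (rule subrelI)
    then show "continuous_on Kc w" by (rule continuous_on_subset[OF cw])
    show "C21_on UNIV \<phi> (%z. (3 * M) *\<^sub>R e + (2 * (- (M / h)) * fst z $ k) *\<^sub>R axis k 1 + (2 * (16 * K)) *\<^sub>R (fst z - x0))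
     (%z. (2 * (16 * K)) *\<^sub>R mat 1 - (- 2 * (- (M / h))) *\<^sub>R outer (axis k 1)) (%z. - (4 * K))"
     unfolding \<phi>_def by (rule C21_quadratic)
    show "open V" unfolding V_def by (intro open_Int open_Times open_Collect_less continuous_intros) auto
    show "V \<subseteq> Kc" by (auto simp: VI KcI)
    show "V \<subseteq> half_cyl k"
    proof (rule subrelI)
     fix y s assume "(y, s) \<in> V"
     then show "(y, s) \<in> half_cyl k" using n34[of y] t t0 by (auto simp: VI half_cyl_def)
    qed
    show "(x0 + x $ k *\<^sub>R e, t) \<in> Kc" using xh h x t0 x0k e by (simp add: KcI)
   next
    fix y s assume Ky: "(y, s) \<in> Kc" and s: "s < t0" and gt: "w (y, s) > \<phi> (y, s)"
    have y: "0 <= y $ k" "y $ k <= h" "norm (y - x0) <= 1/4" "t0 - 1/4 <= s" using Ky by (auto simp: KcI)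
    have wy: "w (y, s) <= K" "y $ k = 0 ==> w (y, s) = 0" using wK Kin[OF Ky] by auto
    have "M / h * (y $ k)^2 <= M * y $ k"
     using mult_left_mono[OF y(2), of "M * y $ k"] M y h by (simp add: power2_eq_square field_simps)
    then have q: "2 * M * y $ k <= 3 * M * y $ k - M / h * (y $ k)^2" by linarith
    have nn: "0 <= 2 * M * y $ k" "0 <= 16 * K * (norm (y - x0))^2" "0 <= 4 * K * (t0 - s)" using M y K s by auto
    have "y $ k ~= 0" using gt wy(2) nn q by (auto simp: ph)
    moreover have "y $ k ~= h"
    proof
     assume "y $ k = h"
     then have "2 * M * y $ k = 2 * (M * h)" by simp
     then show False using gt wy(1) nn q M(3) K unfolding ph by linarith
    qed
    moreover have "norm (y - x0) ~= 1/4"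
    proof
     assume n: "norm (y - x0) = 1/4"
     have "16 * K * (norm (y - x0))^2 = K" unfolding n by (simp add: power2_eq_square)
     then show False using gt wy(1) nn q unfolding ph by linarith
    qed
    moreover have "s ~= t0 - 1/4"
    proof
     assume "s = t0 - 1/4"
     then have "4 * K * (t0 - s) = K" by simp
     then show False using gt wy(1) nn q unfolding ph by linarith
    qed
    ultimately show "(y, s) \<in> V" using y s by (auto simp: VI)
   next
    fix y s assume V: "(y, s) \<in> V"
    define D where "D = (3 * M) *\<^sub>R e + (2 * (- (M / h)) * fst (y, s) $ k) *\<^sub>R axis k 1 + (2 * (16 * K)) *\<^sub>R (fst (y, s) - x0)"
    have De: "D = (3 * M - 2 * M * (y $ k / h)) *\<^sub>R e + (32 * K) *\<^sub>R (y - x0)" by (simp add: D_def e_def algebra_simps)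
    have yh: "0 <= y $ k / h" "y $ k / h <= 1" using V h by (auto simp: VI)
    have c: "M <= 3 * M - 2 * M * (y $ k / h)" "3 * M - 2 * M * (y $ k / h) <= 3 * M"
     using mult_left_mono[OF yh(2), of "2 * M"] mult_nonneg_nonneg[OF _ yh(1), of "2 * M"] M by linarith+
    have "(p + 1 *\<^sub>R D) $ k = (3 * M - 2 * M * (y $ k / h)) + 32 * K * y $ k" using p x0k e by (simp add: De)
    moreover have "0 <= 32 * K * y $ k" using K V by (simp add: VI)
    ultimately have lo: "M <= norm (p + 1 *\<^sub>R D)" using component_le_norm_cart[of "p + 1 *\<^sub>R D" k] c by linarith
    have "norm (p + 1 *\<^sub>R D) <= norm p + (norm ((3 * M - 2 * M * (y $ k / h)) *\<^sub>R e) + norm ((32 * K) *\<^sub>R (y - x0)))"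
     unfolding De scaleR_one by (intro order_trans[OF norm_triangle_ineq] add_left_mono norm_triangle_ineq)
    also have "... <= 1 + (3 * M + 8 * K)"
    proof (intro add_mono p)
     show "norm ((3 * M - 2 * M * (y $ k / h)) *\<^sub>R e) <= 3 * M" using c M e by simp
     have "32 * K * norm (y - x0) <= 32 * K * (1/4)" using K V by (intro mult_left_mono) (auto simp: VI)
     then show "norm ((32 * K) *\<^sub>R (y - x0)) <= 8 * K" using K by simp
    qed
    finally have up: "norm (p + 1 *\<^sub>R D) <= 5 * M" using M K by linarith
    define b where "b = norm (p + 1 *\<^sub>R D) powr \<gamma>"
    have "1 / (5 * M) <= 1 / norm (p + 1 *\<^sub>R D)" using up lo M by (intro divide_left_mono mult_pos_pos) linarith+
    also have "... = norm (p + 1 *\<^sub>R D) powr (- 1)" using lo M by (simp add: powr_minus_divide)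
    also have "... <= b" unfolding b_def using lo M gam by (intro powr_mono) auto
    finally have b: "1 / (5 * M) <= b" .
    define Y where "Y = 2 * M * lam / h - 32 * K * W"
    have FY: "F ((2 * (16 * K)) *\<^sub>R mat 1 - (- 2 * (- (M / h))) *\<^sub>R outer (axis k 1)) <= - Y"
     using elliptic_rank_one[OF F, of "2 * (16 * K)" "- 2 * (- (M / h))" "axis k 1"] K M h by (simp add: norm_axis_1 Y_def W_def algebra_simps)
    have Yl: "20 * K * M <= Y"
    proof -
     have "M * (20 * K + 2 * W) <= M * (2 * lam / h)" using hl M by (intro mult_left_mono) auto
     moreover have "16 * K * (2 * W) <= M * (2 * W)" using M W by (intro mult_right_mono) auto
     ultimately show ?thesis by (simp add: Y_def algebra_simps)
    qed
    have Y0: "0 <= Y" using Yl K M by (intro order_trans[OF _ Yl]) auto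
    have "b * F ((2 * (16 * K)) *\<^sub>R mat 1 - (- 2 * (- (M / h))) *\<^sub>R outer (axis k 1)) <= b * (- Y)" using FY by (intro mult_left_mono) (auto simp: b_def)
    also have "... <= 1 / (5 * M) * (- Y)" using b Y0 by (intro mult_right_mono_neg) auto
    also have "... <= - (4 * K)" using Yl M by (simp add: field_simps)
    finally show "p + 1 *\<^sub>R ((3 * M) *\<^sub>R e + (2 * (- (M / h)) * fst (y, s) $ k) *\<^sub>R axis k 1 + (2 * (16 * K)) *\<^sub>R (fst (y, s) - x0)) ~= 0 &
     norm (p + 1 *\<^sub>R ((3 * M) *\<^sub>R e + (2 * (- (M / h)) * fst (y, s) $ k) *\<^sub>R axis k 1 + (2 * (16 * K)) *\<^sub>R (fst (y, s) - x0))) powr \<gamma> *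
     F ((2 * (16 * K)) *\<^sub>R mat 1 - (- 2 * (- (M / h))) *\<^sub>R outer (axis k 1)) <= - (4 * K)"
     using lo M unfolding b_def D_def by auto
   qed
   also have "\<phi> (x0 + x $ k *\<^sub>R e, t) <= 3 * M * x $ k + 4 * K * (t0 - t)"
   proof -
    have "16 * K * h <= 16 * K * 1" using K h by (intro mult_left_mono) auto
    then have "16 * K * h <= M" using M(2) by linarith
    then have "16 * K <= M / h" using h by (simp add: pos_le_divide_eq)
    then have "16 * K * (x $ k)^2 <= M / h * (x $ k)^2" by (intro mult_right_mono) auto
    then show ?thesis unfolding ph using x0k e x by simp
   qed
   also have "4 * K * (t0 - t) <= \<epsilon>"
   proof -
    have "4 * K * (t0 - t) <= (4 * K + 1) * (\<epsilon> / (4 * K + 1))" using t0 K by (intro mult_mono) auto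
    then show ?thesis using K by simp
   qed
   finally show "w (x, t) <= (3 * M) * x $ k + \<epsilon>" by (simp add: x0_def)
  qed
 qed
 show ?thesis by (intro exI[of _ "3 * M"] conjI allI impI) (use M main in auto)
qed

section \<open>Shrinking the slope interval on intrinsic cylinders\<close>

text \<open>If \<open>p $ k = 0\<close>, this is the norm of \<open>p + s e_n\<close> for the end
  \<open>s\<close> of the interval with larger modulus, that is, the largest full gradient
  compatible with slopes between \<open>lo\<close> and \<open>hi\<close>.\<close>

definition slope_scale :: "real^'n => real => real => real" where
 "slope_scale p lo hi = sqrt ((norm p)^2 + (max \<bar>lo\<bar> \<bar>hi\<bar>)^2)"

text \<open>Subtracting \<open>lo * x $ k\<close>, dividing by the width and using the intrinsic
  time scale gives a function in the form of \<open>canonical\<close>; the alternatives of the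
  dichotomy raise \<open>lo\<close> or lower \<open>hi\<close>. The condition
  \<open>lo + hi <= 0\<close> makes \<open>lo\<close> the end of larger modulus, so that dividing by
  \<open>slope_scale\<close> normalises \<open>p + lo e_n\<close>.\<close>

lemma slope_step_aux:
 fixes u :: "(real^'n) \<times> real => real" and F :: "real^'n^'n => real" and k :: "'n::finite"
 assumes D: "slope_dichotomy k j \<gamma> lam Lam \<eta> \<rho> \<tau>"
  and c: "0 < \<eta>" "\<eta> <= 1/2" "0 < \<rho>" "\<rho> <= 1" "0 < \<tau>" "\<tau> <= 1"
  and F: "elliptic_op lam Lam F" and p: "p $ k = 0"
  and sub: "vsub j \<gamma> F p 1 (half_cyl k) u" and sup: "vsub j \<gamma> (%M. - F (- M)) (- p) 1 (half_cyl k) (%z. - u z)"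
  and cu: "continuous_on (half_cyl_flat k) u" and lh: "lo < hi" "lo + hi <= 0" and r: "0 < r" "r <= 1"
  and T: "T = r^2 * slope_scale p lo hi powr (- \<gamma>)" "T <= 1"
  and bd: "\<And>x t. norm x < r ==> 0 <= x $ k ==> - T < t ==> t < 0 ==> lo * x $ k <= u (x, t) & u (x, t) <= hi * x $ k"
 shows "\<exists>lo' hi'. lo <= lo' & hi' <= hi & hi' - lo' = (1 - \<eta>) * (hi - lo) &
  (\<forall>x t. norm x < \<rho> * r --> 0 <= x $ k --> - (\<tau> * T) < t --> t < 0 --> lo' * x $ k <= u (x, t) & u (x, t) <= hi' * x $ k)"
proof -
 define \<omega> where "\<omega> = hi - lo"
 define m where "m = slope_scale p lo hi"
 define e :: "real^'n" where "e = axis k 1"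
 have e: "norm e = 1" "e $ k = 1" "\<And>x. e \<bullet> x = x $ k" by (simp_all add: e_def norm_axis_1 inner_axis')
 have om: "\<omega> > 0" "lo <= - \<omega> / 2" "max \<bar>lo\<bar> \<bar>hi\<bar> = \<bar>lo\<bar>" using lh by (auto simp: \<omega>_def max_def abs_if)
 have m2: "m = norm (p + lo *\<^sub>R e)"
 proof -
  have "(p + lo *\<^sub>R e) \<bullet> (p + lo *\<^sub>R e) = p \<bullet> p + lo^2"
   using e(2,3) p by (simp add: inner_add_left inner_add_right inner_commute[of p e] power2_eq_square)
  then show ?thesis by (simp add: m_def slope_scale_def om(3) norm_eq_sqrt_inner[of "p + lo *\<^sub>R e"] power2_norm_eq_inner)
 qed
 have m0: "m > 0"
 proof -
  have "\<bar>(p + lo *\<^sub>R e) $ k\<bar> <= m" unfolding m2 by (rule component_le_norm_cart)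
  then show ?thesis using p e om by simp
 qed
 have T0: "T > 0" using r m0 by (simp add: T(1) m_def)
 define cc where "cc = 1 / (\<omega> * r)"
 define l where "l = (- (lo / \<omega>)) *\<^sub>R e"
 have cc: "cc > 0" "cc * r = 1 / \<omega>" using om r by (auto simp: cc_def)
 define w where "w z = cc * u (r *\<^sub>R fst z, T * snd z) + l \<bullet> fst z" for z
 have wv: "w (x, t) = (u (r *\<^sub>R x, T * t) - lo * (r *\<^sub>R x) $ k) / (\<omega> * r)" for x t
  using om r by (simp add: w_def l_def cc_def e(3) field_simps)
 define F' where "F' = (%M::real^'n^'n. (cc * r^2) * F ((1 / (cc * r^2)) *\<^sub>R M))"
 define q where "q = (1 / m) *\<^sub>R (p + lo *\<^sub>R e)"
 have ccT: "cc * T * m powr \<gamma> = cc * r^2" using m0 by (simp add: T(1) m_def[symmetric] mult.assoc powr_add[symmetric])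
 have in1: "norm (r *\<^sub>R x) < r" "0 <= (r *\<^sub>R x) $ k" "- T < T * t" "T * t < 0" "(r *\<^sub>R x, T * t) \<in> half_cyl_flat k" if "(x, t) \<in> half_cyl_flat k" for x t
 proof -
  have a: "norm x < 1" "0 <= x $ k" "- 1 < t" "t < 0" using that by (auto simp: half_cyl_flat_def)
  show 1: "norm (r *\<^sub>R x) < r" "0 <= (r *\<^sub>R x) $ k" using a r by auto
  have "T * (- 1) < T * t" "T * t < 0" using a T0 by (intro mult_strict_left_mono mult_pos_neg; simp)+
  then show 2: "- T < T * t" "T * t < 0" by auto
  show "(r *\<^sub>R x, T * t) \<in> half_cyl_flat k" using 1 2 r T(2) unfolding half_cyl_flat_def mem_Collect_eq case_prod_conv by (intro conjI; linarith)
 qed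
 have dom: "half_cyl k \<subseteq> {z. (r *\<^sub>R fst z, T * snd z) \<in> half_cyl k}"
 proof (rule subrelI)
  fix x t assume a: "(x, t) \<in> half_cyl k"
  then have "(x, t) \<in> half_cyl_flat k" by (auto simp: half_cyl_def half_cyl_flat_def)
  from in1(5)[OF this] show "(x, t) \<in> {z. (r *\<^sub>R fst z, T * snd z) \<in> half_cyl k}" using a r by (auto simp: half_cyl_def half_cyl_flat_def)
 qed
 have th: "1 / (cc * r * m) = \<omega> / m" using om by (simp add: cc(2))
 have pos1: "(0::real) < 1" by simp
 have s1: "vsub j \<gamma> F' q (\<omega> / m) (half_cyl k) w"
 proof -
  have "(1 / m) *\<^sub>R (p - (1 / (cc * r)) *\<^sub>R l) = q" using om by (simp add: cc(2) l_def q_def)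
  with vsub_transform[OF sub cc(1) r(1) T0 m0 pos1, of l] show ?thesis
   unfolding ccT th w_def[abs_def] F'_def by (intro vsub_subset[OF _ open_half_cyl dom]) simp
 qed
 have s2: "vsub j \<gamma> (%M. - F' (- M)) (- q) (\<omega> / m) (half_cyl k) (%z. - w z)"
 proof -
  have "(1 / m) *\<^sub>R (- p - (1 / (cc * r)) *\<^sub>R (- l)) = - q" using om by (simp add: cc(2) l_def q_def algebra_simps)
  with vsub_transform[OF sup cc(1) r(1) T0 m0 pos1, of "- l"] show ?thesis
   unfolding ccT th w_def[abs_def] F'_def by (intro vsub_subset[OF _ open_half_cyl dom]) simp
 qed
 have "canonical k j \<gamma> lam Lam F' q (\<omega> / m) w" unfolding canonical_def
 proof (intro conjI allI impI s1 s2)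
  show "elliptic_op lam Lam F'" unfolding F'_def using cc r by (intro elliptic_op_scale[OF F]) auto
  show "norm q = 1" using m0 m2 by (simp add: q_def)
  show "0 < \<omega> / m" using om m0 by simp
  have "lo / m <= (- \<omega> / 2) / m" using om(2) m0 by (intro divide_right_mono) auto
  then show "q $ k <= - (\<omega> / m) / 2" using p e by (simp add: q_def)
  have "continuous_on (half_cyl_flat k) (%z. u (r *\<^sub>R fst z, T * snd z))"
   by (rule continuous_on_compose2[OF cu]) (auto intro!: continuous_intros in1(5))
  then show "continuous_on (half_cyl_flat k) w" unfolding w_def by (intro continuous_intros)
  fix x t assume a: "(x, t) \<in> half_cyl_flat k"
  have orp: "0 < \<omega> * r" using om r by simp
  note b = bd[OF in1(1-4)[OF a]]
  show "0 <= w (x, t)" unfolding wv using b orp by simp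
  have "hi * (r *\<^sub>R x) $ k = lo * (r *\<^sub>R x) $ k + x $ k * (\<omega> * r)" by (simp add: \<omega>_def algebra_simps)
  then show "w (x, t) <= x $ k" unfolding wv using b orp by (simp add: pos_divide_le_eq)
 qed
 note alt = D[unfolded slope_dichotomy_def, rule_format, OF this]
 have ub: "u (y, s) = lo * y $ k + w ((1 / r) *\<^sub>R y, s / T) * (\<omega> * r)" for y s
  using om r T0 by (simp add: wv)
 have sc: "norm ((1 / r) *\<^sub>R y) < \<rho>" "- \<tau> < s / T" "s / T < 0" "norm y < r" "- T < s"
  if "norm y < \<rho> * r" "- (\<tau> * T) < s" "s < 0" for y :: "real^'n" and s
 proof -
  have "\<rho> * r <= 1 * r" "\<tau> * T <= 1 * T" using c r T0 by (intro mult_right_mono; simp)+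
  then show "norm y < r" "- T < s" using that by linarith+
  show "norm ((1 / r) *\<^sub>R y) < \<rho>" "- \<tau> < s / T" "s / T < 0" using that r T0 by (auto simp: field_simps)
 qed
 \<comment> \<open>The dichotomy speaks of positive height only; on the flat face the two bounds
   force \<open>u = 0\<close>.\<close>
 have zero: "u (y, s) = 0" if "norm y < \<rho> * r" "y $ k = 0" "- (\<tau> * T) < s" "s < 0" for y s
  using bd[OF sc(4)[OF that(1,3,4)] _ sc(5)[OF that(1,3,4)] that(4)] that(2) by simp
 from alt show ?thesis
 proof
  assume A: "\<forall>x t. norm x < \<rho> --> 0 < x $ k --> - \<tau> < t --> t < 0 --> \<eta> * x $ k <= w (x, t)"
  have res: "(lo + \<eta> * \<omega>) * y $ k <= u (y, s) & u (y, s) <= hi * y $ k" if y: "norm y < \<rho> * r" "0 <= y $ k" "- (\<tau> * T) < s" "s < 0" for y s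
  proof (cases "y $ k = 0")
   case False
   then have "\<eta> * ((1 / r) *\<^sub>R y) $ k <= w ((1 / r) *\<^sub>R y, s / T)" using y(2) r by (intro A[rule_format, OF sc(1)[OF y(1,3,4)] _ sc(2,3)[OF y(1,3,4)]]) simp
   then have "\<eta> * ((1 / r) *\<^sub>R y) $ k * (\<omega> * r) <= w ((1 / r) *\<^sub>R y, s / T) * (\<omega> * r)" using om r by (intro mult_right_mono) auto
   then have "lo * y $ k + \<eta> * \<omega> * y $ k <= u (y, s)" unfolding ub[of y s] using r by (simp add: mult_ac)
   then show ?thesis using bd[OF sc(4)[OF y(1,3,4)] y(2) sc(5)[OF y(1,3,4)] y(4)] by (simp add: algebra_simps)
  qed (use zero y in simp)
  have nn: "0 <= \<eta> * \<omega>" using c om by simp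
  show ?thesis
  proof (rule exI[of _ "lo + \<eta> * \<omega>"], rule exI[of _ hi], intro conjI)
   show "\<forall>x t. norm x < \<rho> * r --> 0 <= x $ k --> - (\<tau> * T) < t --> t < 0 --> (lo + \<eta> * \<omega>) * x $ k <= u (x, t) & u (x, t) <= hi * x $ k"
    using res by blast
  qed (use nn in \<open>auto simp: \<omega>_def algebra_simps\<close>)
 next
  assume A: "\<forall>x t. norm x < \<rho> --> 0 < x $ k --> - \<tau> < t --> t < 0 --> w (x, t) <= (1 - \<eta>) * x $ k"
  have res: "lo * y $ k <= u (y, s) & u (y, s) <= (lo + (1 - \<eta>) * \<omega>) * y $ k" if y: "norm y < \<rho> * r" "0 <= y $ k" "- (\<tau> * T) < s" "s < 0" for y s
  proof (cases "y $ k = 0")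
   case False
   then have "w ((1 / r) *\<^sub>R y, s / T) <= (1 - \<eta>) * ((1 / r) *\<^sub>R y) $ k" using y(2) r by (intro A[rule_format, OF sc(1)[OF y(1,3,4)] _ sc(2,3)[OF y(1,3,4)]]) simp
   then have "w ((1 / r) *\<^sub>R y, s / T) * (\<omega> * r) <= (1 - \<eta>) * ((1 / r) *\<^sub>R y) $ k * (\<omega> * r)" using om r by (intro mult_right_mono) auto
   then have "u (y, s) <= lo * y $ k + (1 - \<eta>) * \<omega> * y $ k" unfolding ub[of y s] using r by (simp add: mult_ac)
   then show ?thesis using bd[OF sc(4)[OF y(1,3,4)] y(2) sc(5)[OF y(1,3,4)] y(4)] by (simp add: algebra_simps)
  qed (use zero y in simp)
  have nn: "0 <= \<eta> * \<omega>" using c om by simp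
  show ?thesis
  proof (rule exI[of _ lo], rule exI[of _ "lo + (1 - \<eta>) * \<omega>"], intro conjI)
   show "\<forall>x t. norm x < \<rho> * r --> 0 <= x $ k --> - (\<tau> * T) < t --> t < 0 --> lo * x $ k <= u (x, t) & u (x, t) <= (lo + (1 - \<eta>) * \<omega>) * x $ k"
    using res by blast
  qed (use nn in \<open>auto simp: \<omega>_def algebra_simps\<close>)
 qed
qed

text \<open>If \<open>lo + hi > 0\<close>, the previous lemma applies to \<open>- u\<close>, whose
  slopes lie between \<open>- hi\<close> and \<open>- lo\<close>.\<close>

lemma slope_step:
 fixes u :: "(real^'n) \<times> real => real" and F :: "real^'n^'n => real" and k :: "'n::finite"
 assumes D: "slope_dichotomy k j \<gamma> lam Lam \<eta> \<rho> \<tau>"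
  and c: "0 < \<eta>" "\<eta> <= 1/2" "0 < \<rho>" "\<rho> <= 1" "0 < \<tau>" "\<tau> <= 1"
  and F: "elliptic_op lam Lam F" and p: "p $ k = 0"
  and sub: "vsub j \<gamma> F p 1 (half_cyl k) u" and sup: "vsub j \<gamma> (%M. - F (- M)) (- p) 1 (half_cyl k) (%z. - u z)"
  and cu: "continuous_on (half_cyl_flat k) u" and lh: "lo < hi" and r: "0 < r" "r <= 1"
  and T: "T = r^2 * slope_scale p lo hi powr (- \<gamma>)" "T <= 1"
  and bd: "\<And>x t. norm x < r ==> 0 <= x $ k ==> - T < t ==> t < 0 ==> lo * x $ k <= u (x, t) & u (x, t) <= hi * x $ k"
 shows "\<exists>lo' hi'. lo <= lo' & hi' <= hi & hi' - lo' = (1 - \<eta>) * (hi - lo) &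
  (\<forall>x t. norm x < \<rho> * r --> 0 <= x $ k --> - (\<tau> * T) < t --> t < 0 --> lo' * x $ k <= u (x, t) & u (x, t) <= hi' * x $ k)"
proof (cases "lo + hi <= 0")
 case True
 show ?thesis by (rule slope_step_aux[OF D c F p sub sup cu lh True r T bd])
next
 case False
 have "\<exists>lo' hi'. - hi <= lo' & hi' <= - lo & hi' - lo' = (1 - \<eta>) * (- lo - - hi) &
  (\<forall>x t. norm x < \<rho> * r --> 0 <= x $ k --> - (\<tau> * T) < t --> t < 0 --> lo' * x $ k <= - u (x, t) & - u (x, t) <= hi' * x $ k)"
 proof (rule slope_step_aux[OF D c elliptic_op_neg[OF F] _ sup _ _ _ _ r _ T(2)])
  show "T = r^2 * slope_scale (- p) (- hi) (- lo) powr (- \<gamma>)" unfolding T(1) by (simp add: slope_scale_def max.commute)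
  show "- hi * x $ k <= - u (x, t) & - u (x, t) <= - lo * x $ k" if "norm x < r" "0 <= x $ k" "- T < t" "t < 0" for x t using bd[OF that] by simp
  show "vsub j \<gamma> (%M. - (- F (- (- M)))) (- (- p)) 1 (half_cyl k) (%z. - (- u z))" using sub by simp
  show "continuous_on (half_cyl_flat k) (%z. - u z)" by (rule continuous_on_minus[OF cu])
  show "(- p) $ k = 0" "- hi < - lo" "- hi + - lo <= 0" using p lh False by auto
 qed
 then obtain lo' hi' where "- hi <= lo'" "hi' <= - lo" "hi' - lo' = (1 - \<eta>) * (hi - lo)" and
  b: "\<forall>x t. norm x < \<rho> * r --> 0 <= x $ k --> - (\<tau> * T) < t --> t < 0 --> lo' * x $ k <= - u (x, t) & - u (x, t) <= hi' * x $ k" by auto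
 moreover have "\<forall>x t. norm x < \<rho> * r --> 0 <= x $ k --> - (\<tau> * T) < t --> t < 0 --> (- hi') * x $ k <= u (x, t) & u (x, t) <= (- lo') * x $ k"
  using b by fastforce
 ultimately show ?thesis
  by - (rule exI[of _ "- hi'"], rule exI[of _ "- lo'"], auto)
qed

text \<open>An interval that keeps at least half of its length keeps the larger modulus of its ends
  up to a bounded factor. Hence consecutive intrinsic time scales differ by at most
  \<open>4 powr \<bar>\<gamma>\<bar>\<close>, apart from the change of radius.\<close>

lemma slope_scale_nested:
 assumes "lo <= lo'" "lo' <= hi'" "hi' <= hi" "hi - lo <= 2 * (hi' - lo')"
 shows "slope_scale p lo' hi' <= slope_scale p lo hi" "slope_scale p lo hi <= 4 * slope_scale p lo' hi'"
proof -
 define s where "s = max \<bar>lo\<bar> \<bar>hi\<bar>"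
 define s' where "s' = max \<bar>lo'\<bar> \<bar>hi'\<bar>"
 have 1: "0 <= s'" "s' <= s" "s <= 4 * s'" using assms by (auto simp: s_def s'_def max_def abs_if split: if_splits)
 show "slope_scale p lo' hi' <= slope_scale p lo hi" unfolding slope_scale_def s_def[symmetric] s'_def[symmetric]
  using 1 by (intro real_sqrt_le_mono add_left_mono power_mono) auto
 have "s^2 <= (4 * s')^2" using 1 by (intro power_mono) auto
 then have "s^2 <= 16 * s'^2" by (simp add: power_mult_distrib)
 then have "(norm p)^2 + s^2 <= 16 * (norm p)^2 + 16 * s'^2" by (intro add_mono) simp_all
 then have "(norm p)^2 + s^2 <= 16 * ((norm p)^2 + s'^2)" by (simp only: distrib_left)
 then have "sqrt ((norm p)^2 + s^2) <= sqrt (16 * ((norm p)^2 + s'^2))" by (rule real_sqrt_le_mono)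
 moreover have "sqrt 16 = (4::real)" by (rule real_sqrt_unique) auto
 ultimately show "slope_scale p lo hi <= 4 * slope_scale p lo' hi'" unfolding slope_scale_def s_def[symmetric] s'_def[symmetric] real_sqrt_mult by simp
qed

text \<open>The radii shrink by a factor \<rho>' so small that the next intrinsic cylinder fits into
  the fraction \<tau> of the previous one, however the scale changes. The lengths \<open>T i\<close>
  need not be geometric, but they never fall below \<open>d0 * \<sigma> ^ i\<close>; so the estimate
  holds in cylinders of that size in both space and time.\<close>

lemma slope_limit:
 fixes u :: "(real^'n) \<times> real => real" and F :: "real^'n^'n => real" and k :: "'n::finite"
 assumes D: "slope_dichotomy k j \<gamma> lam Lam \<eta> \<rho> \<tau>"
  and c: "0 < \<eta>" "\<eta> <= 1/2" "0 < \<rho>" "\<rho> <= 1" "0 < \<tau>" "\<tau> <= 1"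
  and F: "elliptic_op lam Lam F" and p: "norm p <= 1" "p $ k = 0"
  and sub: "vsub j \<gamma> F p 1 (half_cyl k) u" and sup: "vsub j \<gamma> (%M. - F (- M)) (- p) 1 (half_cyl k) (%z. - u z)"
  and cu: "continuous_on (half_cyl_flat k) u" and M: "1 <= M"
  and start: "\<And>x t. norm x <= 1/2 ==> 0 <= x $ k ==> - (1/2) <= t ==> t < 0 ==> \<bar>u (x, t)\<bar> <= M * x $ k"
  and sig: "\<sigma> = (min \<rho> (\<tau> * 4 powr (- \<bar>\<gamma>\<bar>)))^2 * 4 powr (- \<bar>\<gamma>\<bar>)"
  and d0: "d0 = ((2 * M) powr (- \<bar>\<gamma>\<bar>) / 2)^2 * (2 * M) powr (- \<bar>\<gamma>\<bar>)"
 shows "\<exists>a. \<bar>a\<bar> <= M & (\<forall>i x t. norm x < d0 * \<sigma> ^ i --> 0 <= x $ k --> - (d0 * \<sigma> ^ i) < t --> t < 0 -->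
  \<bar>u (x, t) - a * x $ k\<bar> <= 2 * M * (1 - \<eta>) ^ i * x $ k)"
proof -
 define b0 :: real where "b0 = 4 powr (- \<bar>\<gamma>\<bar>)"
 define B where "B = (2 * M) powr (- \<bar>\<gamma>\<bar>)"
 define \<rho>' where "\<rho>' = min \<rho> (\<tau> * b0)"
 define r0 where "r0 = B / 2"
 have b0: "0 < b0" "b0 <= 1" "b0 * 4 powr \<bar>\<gamma>\<bar> = 1" using powr_mono[of "- \<bar>\<gamma>\<bar>" 0 4] by (auto simp: b0_def powr_add[symmetric])
 have B: "0 < B" "B <= 1" "B * (2 * M) powr \<bar>\<gamma>\<bar> = 1"
  using M powr_mono[of "- \<bar>\<gamma>\<bar>" 0 "2 * M"] by (auto simp: B_def powr_add[symmetric])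
 have rp: "0 < \<rho>'" "\<rho>' <= \<rho>" "\<rho>' <= \<tau> * b0" "\<rho>' <= 1" using c b0 by (auto simp: \<rho>'_def)
 have sg: "\<sigma> = \<rho>'^2 * b0" "d0 = r0^2 * B" by (simp_all add: sig \<rho>'_def b0_def d0 r0_def B_def)
 define r where "r i = r0 * \<rho>' ^ i" for i
 have r: "0 < r i" "r i <= 1/2" for i
 proof -
  show "0 < r i" using rp B by (simp add: r_def r0_def)
  have "r0 * \<rho>' ^ i <= 1/2 * 1" using rp B by (intro mult_mono power_le_one) (auto simp: r0_def)
  then show "r i <= 1/2" by (simp add: r_def)
 qed
 define T where "T i l = (r i)^2 * slope_scale p (fst l) (snd l) powr (- \<gamma>)" for i l
 define P where "P i l \<longleftrightarrow> - M <= fst l & snd l <= M & snd l - fst l = 2 * M * (1 - \<eta>) ^ i & T i l <= 1 & d0 * \<sigma> ^ i <= T i l &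
   (\<forall>x t. norm x < r i --> 0 <= x $ k --> - T i l < t --> t < 0 --> fst l * x $ k <= u (x, t) & u (x, t) <= snd l * x $ k)" for i l
 define Q where "Q l l' \<longleftrightarrow> fst l <= fst l' & snd l' <= snd l" for l l' :: "real \<times> real"
 have "\<exists>l. P 0 l"
 proof
  \<comment> \<open>For slopes in \<open>[- M, M]\<close> and \<open>norm p <= 1\<close> the scale
    lies between 1 and \<open>2 * M\<close>, which explains the powers of \<open>2 * M\<close> in
    \<open>d0\<close>.\<close>
  define m where "m = slope_scale p (- M) M"
  have "(norm p)^2 <= 1" using p by (simp add: power_le_one)
  then have "(norm p)^2 + M^2 <= (2 * M)^2" using one_le_power[OF M, of 2] by (simp add: power_mult_distrib)
  moreover have "1 <= (norm p)^2 + M^2" using one_le_power[OF M, of 2] by (simp add: add_increasing)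
  ultimately have m: "1 <= m" "m <= 2 * M" using M by (auto simp: m_def slope_scale_def intro: real_le_lsqrt)
  have "1 / (2 * M) <= 1" using M by simp
  then have m1: "1 / (2 * M) <= m" using m by linarith
  have pw: "B <= m powr (- \<gamma>)" "m powr (- \<gamma>) <= (2 * M) powr \<bar>\<gamma>\<bar>"
   using powr_two_sided[of "2 * M" m "- \<gamma>"] m m1 M by (auto simp: B_def)
  have Te: "T 0 (- M, M) = r0^2 * m powr (- \<gamma>)" by (simp add: T_def r_def m_def)
  have "r0^2 * m powr (- \<gamma>) <= r0^2 * (2 * M) powr \<bar>\<gamma>\<bar>" using pw by (intro mult_left_mono) auto
  also have "... = B / 4 * (B * (2 * M) powr \<bar>\<gamma>\<bar>)" by (simp add: r0_def power2_eq_square)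
  also have "... <= 1/2" unfolding B(3) using B by simp
  finally have T4: "T 0 (- M, M) <= 1/2" unfolding Te .
  have "d0 <= T 0 (- M, M)" unfolding Te sg using pw by (intro mult_left_mono) auto
  moreover have "- M * x $ k <= u (x, t) & u (x, t) <= M * x $ k" if "norm x < r 0" "0 <= x $ k" "- T 0 (- M, M) < t" "t < 0" for x t
   using start[of x t] that r(2)[of 0] T4 by (auto simp: abs_le_iff)
  ultimately show "P 0 (- M, M)" using T4 M unfolding P_def by auto
 qed
 moreover have "\<exists>l'. P (Suc i) l' & Q l l'" if "P i l" for l i
 proof -
  obtain lo hi where l: "l = (lo, hi)" by (cases l)
  have Pl: "- M <= lo" "hi <= M" "hi - lo = 2 * M * (1 - \<eta>) ^ i" "T i l <= 1" "d0 * \<sigma> ^ i <= T i l"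
   and bd: "\<And>x t. norm x < r i ==> 0 <= x $ k ==> - T i l < t ==> t < 0 ==> lo * x $ k <= u (x, t) & u (x, t) <= hi * x $ k"
   using that unfolding P_def l fst_conv snd_conv by blast+
  have "0 < 2 * M * (1 - \<eta>) ^ i" using M c by simp
  then have lh: "lo < hi" using Pl(3) by linarith
  have ri1: "r i <= 1" using r(2)[of i] by linarith
  have Tl: "T i l = (r i)^2 * slope_scale p lo hi powr (- \<gamma>)" by (simp add: T_def l)
  obtain lo' hi' where n: "lo <= lo'" "hi' <= hi" "hi' - lo' = (1 - \<eta>) * (hi - lo)" and
   bd': "\<forall>x t. norm x < \<rho> * r i --> 0 <= x $ k --> - (\<tau> * T i l) < t --> t < 0 --> lo' * x $ k <= u (x, t) & u (x, t) <= hi' * x $ k"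
   using slope_step[OF D c F p(2) sub sup cu lh r(1) ri1 Tl Pl(4) bd] by blast
  have half: "hi - lo <= 2 * (hi' - lo')" and lh': "lo' < hi'"
  proof -
   have h: "1/2 * (hi - lo) <= hi' - lo'" unfolding n(3) using c lh by (intro mult_right_mono) auto
   then show "hi - lo <= 2 * (hi' - lo')" by argo
   show "lo' < hi'" using h lh by argo
  qed
  define m where "m = slope_scale p lo hi"
  define m' where "m' = slope_scale p lo' hi'"
  note nest = slope_scale_nested[OF n(1) less_imp_le[OF lh'] n(2) half, of p, folded m_def m'_def]
  have m0: "0 < m"
  proof -
   have "0 < max \<bar>lo\<bar> \<bar>hi\<bar>" using lh by auto
   then show ?thesis by (simp add: m_def slope_scale_def add_nonneg_pos del: max_less_iff_conj)
  qed
  then have m0': "0 < m'" using nest by linarith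
  define cr where "cr = (m' / m) powr (- \<gamma>)"
  have "1/4 <= m' / m" "m' / m <= 4" using nest m0 m0' by (auto simp: field_simps)
  then have cr: "b0 <= cr" "cr <= 4 powr \<bar>\<gamma>\<bar>" using powr_two_sided[of 4 "m' / m" "- \<gamma>"] by (auto simp: cr_def b0_def)
  have mm: "m' powr (- \<gamma>) = m powr (- \<gamma>) * cr" using m0 m0' by (simp add: cr_def powr_divide)
  have T': "T (Suc i) (lo', hi') = \<rho>'^2 * cr * T i l"
   unfolding Tl m_def[symmetric] by (simp add: T_def m'_def[symmetric] mm r_def power_mult_distrib)
  have Tp: "0 < T i l" using r(1)[of i] m0 by (simp add: Tl m_def[symmetric])
  have rr: "\<rho>'^2 <= \<tau> * b0"
  proof -
   have "\<rho>'^2 <= \<rho>'" using rp by (simp add: power2_eq_square mult_left_le)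
   then show ?thesis using rp by linarith
  qed
  have "\<rho>'^2 * cr <= (\<tau> * b0) * 4 powr \<bar>\<gamma>\<bar>" using rr cr b0 c by (intro mult_mono) auto
  also have "... = \<tau>" using b0(3) by (simp add: mult.assoc)
  finally have up: "T (Suc i) (lo', hi') <= \<tau> * T i l" unfolding T' using Tp by (intro mult_right_mono) auto
  have "\<tau> * T i l <= 1 * 1" using c Tp Pl(4) by (intro mult_mono) auto
  then have T1: "T (Suc i) (lo', hi') <= 1" using up by linarith
  have "\<sigma> * (d0 * \<sigma> ^ i) <= (\<rho>'^2 * cr) * T i l"
   unfolding sg(1) using cr b0 rp B Pl(5) by (intro mult_mono) (auto simp: sg)
  then have T2: "d0 * \<sigma> ^ Suc i <= T (Suc i) (lo', hi')" unfolding T' by (simp add: mult_ac)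
  have "r (Suc i) <= \<rho> * r i" using mult_right_mono[OF rp(2), of "r i"] r(1)[of i] by (simp add: r_def mult_ac)
  then have "\<forall>x t. norm x < r (Suc i) --> 0 <= x $ k --> - T (Suc i) (lo', hi') < t --> t < 0 --> lo' * x $ k <= u (x, t) & u (x, t) <= hi' * x $ k"
   using bd' up by (meson less_le_trans le_less_trans neg_le_iff_le)
  then have "P (Suc i) (lo', hi')" unfolding P_def fst_conv snd_conv using n Pl T1 T2 by simp
  moreover have "Q l (lo', hi')" using n by (simp add: Q_def l)
  ultimately show ?thesis by blast
 qed
 ultimately obtain f where f: "\<And>i. P i (f i)" "\<And>i. Q (f i) (f (Suc i))"
  using dependent_nat_choice[of P "%_. Q"] by blast
 define lo where "lo i = fst (f i)" for i
 define hi where "hi i = snd (f i)" for i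
 have mono: "incseq lo" "decseq hi" using f(2) by (auto simp: Q_def lo_def hi_def intro: incseq_SucI decseq_SucI)
 have fP: "- M <= lo i" "hi i <= M" "hi i - lo i = 2 * M * (1 - \<eta>) ^ i" "d0 * \<sigma> ^ i <= T i (f i)" and
  fb: "\<And>x t. norm x < r i ==> 0 <= x $ k ==> - T i (f i) < t ==> t < 0 ==> lo i * x $ k <= u (x, t) & u (x, t) <= hi i * x $ k" for i
  using f(1)[of i] unfolding P_def lo_def hi_def by blast+
 have lh: "lo i <= hi i" for i
 proof -
  have "0 <= 2 * M * (1 - \<eta>) ^ i" using M c by simp
  then show ?thesis using fP(3)[of i] by linarith
 qed
 have cross: "lo n <= hi i" for n i
 proof (cases "n <= i")
  case True
  then show ?thesis using incseqD[OF mono(1)] lh[of i] by (meson order_trans)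
 next
  case False
  then show ?thesis using decseqD[OF mono(2), of i n] lh[of n] by simp
 qed
 define a where "a = (SUP i. lo i)"
 have bdd: "bdd_above (range lo)" using cross by (auto intro!: bdd_aboveI[of _ "hi 0"])
 have a: "lo i <= a" "a <= hi i" for i
  unfolding a_def using cross by (auto intro!: cSUP_upper[OF _ bdd] cSUP_least)
 have "\<bar>a\<bar> <= M" using a[of 0] fP(1,2)[of 0] by (simp add: abs_le_iff)
 moreover have "\<bar>u (x, t) - a * x $ k\<bar> <= 2 * M * (1 - \<eta>) ^ i * x $ k"
  if x: "norm x < d0 * \<sigma> ^ i" "0 <= x $ k" "- (d0 * \<sigma> ^ i) < t" "t < 0" for i x t
 proof -
  have "\<rho>' * (\<rho>' * b0) <= \<rho>' * 1" using rp b0 by (intro mult_left_mono mult_le_one) auto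
  then have "\<sigma> <= \<rho>'" by (simp add: sg power2_eq_square mult.assoc)
  moreover have "0 <= \<sigma>" using b0 by (simp add: sg)
  moreover have "r0 * (r0 * B) <= r0 * 1" using B by (intro mult_left_mono mult_le_one) (auto simp: r0_def)
  then have "d0 <= r0" by (simp add: sg power2_eq_square mult.assoc)
  ultimately have "d0 * \<sigma> ^ i <= r i" unfolding r_def using B by (intro mult_mono power_mono) (auto simp: r0_def)
  then have b: "lo i * x $ k <= u (x, t) & u (x, t) <= hi i * x $ k" using x fP(4)[of i] by (intro fb) auto
  have "lo i * x $ k <= a * x $ k" "a * x $ k <= hi i * x $ k" using a x by (auto intro: mult_right_mono)
  then have "\<bar>u (x, t) - a * x $ k\<bar> <= hi i * x $ k - lo i * x $ k" using b by (simp add: abs_le_iff)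
  also have "... = 2 * M * (1 - \<eta>) ^ i * x $ k" unfolding fP(3)[symmetric] by (simp add: algebra_simps)
  finally show ?thesis .
 qed
 ultimately show ?thesis by blast
qed

section \<open>Decay rate and conclusion\<close>

text \<open>The exponent solves \<open>\<sigma> powr \<beta> = 1 - \<eta>\<close>. The index is that
  of the last scale still exceeding \<open>N\<close>; as \<open>1 - \<eta> >= 1/2\<close>, passing
  to the next scale costs at most a factor 2.\<close>

lemma geometric_power_decay:
 fixes \<sigma> \<eta> d N :: real
 assumes s: "0 < \<sigma>" "\<sigma> < 1" and e: "0 < \<eta>" "\<eta> <= 1/2" and N: "0 < N" "N < d"
 shows "\<exists>i. N < d * \<sigma> ^ i & (1 - \<eta>) ^ i <= 2 * (N / d) powr (ln (1 - \<eta>) / ln \<sigma>)"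
proof -
 define \<beta> where "\<beta> = ln (1 - \<eta>) / ln \<sigma>"
 have b: "\<beta> > 0" using s e by (simp add: \<beta>_def divide_neg_neg)
 have d: "0 < d" using N by simp
 define A where "A n \<longleftrightarrow> d * \<sigma> ^ Suc n <= N" for n
 obtain n where "\<sigma> ^ n < N / d" using real_arch_pow_inv[of "N / d" \<sigma>] N s d by auto
 then have "d * \<sigma> ^ n < N" using d by (simp add: field_simps)
 moreover have "d * \<sigma> ^ Suc n <= d * \<sigma> ^ n" using s d by (intro mult_left_mono power_decreasing) auto
 ultimately have "A n" by (simp add: A_def)
 define i where "i = (LEAST n. A n)"
 have i: "A i" unfolding i_def by (rule LeastI[of A n, OF \<open>A n\<close>])
 have 1: "N < d * \<sigma> ^ i"
 proof (cases i)
  case (Suc n)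
  then have "\<not> A n" using not_less_Least[of n A] by (simp add: i_def)
  then show ?thesis by (simp add: A_def Suc)
 qed (use N in simp)
 have "\<sigma> powr \<beta> = 1 - \<eta>" using s e by (simp add: powr_def \<beta>_def)
 then have pw: "(\<sigma> ^ n) powr \<beta> = (1 - \<eta>) ^ n" for n using s e by (simp add: powr_realpow[symmetric] powr_powr mult.commute) (simp add: powr_powr[symmetric])
 have "(1 - \<eta>) ^ Suc i <= (N / d) powr \<beta>" unfolding pw[symmetric] using i s d b by (intro powr_mono2) (auto simp: A_def field_simps)
 moreover have "(1 - \<eta>) ^ i <= 2 * (1 - \<eta>) ^ Suc i"
 proof -
  have "1/2 * (1 - \<eta>) ^ i <= (1 - \<eta>) * (1 - \<eta>) ^ i" using e by (intro mult_right_mono) auto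
  then show ?thesis by simp
 qed
 ultimately show ?thesis using 1 unfolding \<beta>_def by (intro exI[of _ i]) auto
qed

text \<open>The essential supremum gives a bound almost everywhere. By continuity, a violation at
  one point of the open half cylinder would persist on an open set, which is not null.\<close>

lemma bounded_by_Linfty_norm:
 fixes u :: "(real^'n) \<times> real => real"
 assumes cu: "continuous_on (half_cyl k) u" and K: "Linfty_norm (Qplus k 1) u = ereal K" and z: "z \<in> half_cyl k"
 shows "\<bar>u z\<bar> <= K"
proof (rule ccontr)
 assume neg: "\<not> ?thesis"
 define S where "S = {z \<in> half_cyl k. \<bar>u z\<bar> \<in> {K<..}}"
 have "continuous_on (half_cyl k) (%z. \<bar>u z\<bar>)" using cu by (intro continuous_intros)
 then have "open (half_cyl k \<inter> (%z. \<bar>u z\<bar>) -` {K<..})" by (rule continuous_open_preimage[OF _ open_half_cyl]) simp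
 moreover have "half_cyl k \<inter> (%z. \<bar>u z\<bar>) -` {K<..} = S" by (auto simp: S_def)
 ultimately have "open S" by simp
 moreover have "z \<in> S" using z neg by (simp add: S_def)
 ultimately have nn: "\<not> negligible S" using open_not_negligible by blast
 have Q: "Qplus k 1 \<in> sets lborel"
 proof -
  have "Qplus k 1 = (ball 0 1 \<times> {-1<..0}) \<inter> {z::(real^'n) \<times> real. 0 < fst z $ k}" by (auto simp: Qplus_def Qcyl_def)
  moreover have "open {z::(real^'n) \<times> real. 0 < fst z $ k}" by (intro open_Collect_less continuous_intros)
  moreover have "(ball 0 1 \<times> {-1<..0} :: ((real^'n) \<times> real) set) \<in> sets borel" by (intro borel_Times) auto
  ultimately show ?thesis by (simp add: sets.Int)
 qed
 have "AE z in restrict_space lborel (Qplus k 1). ereal \<bar>u z\<bar> <= ereal K" using esssup_AE[of "%z. ereal \<bar>u z\<bar>" "restrict_space lborel (Qplus k 1)"] K by (simp add: Linfty_norm_def)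
 then have "AE z in lborel. z \<in> Qplus k 1 --> \<bar>u z\<bar> <= K" using Q by (simp add: AE_restrict_space_iff)
 then obtain N where N: "{z. \<not> (z \<in> Qplus k 1 --> \<bar>u z\<bar> <= K)} \<subseteq> N" "emeasure lborel N = 0" "N \<in> sets lborel" by (auto elim!: AE_E)
 have "N \<in> null_sets lebesgue" using N by (intro null_sets_completionI) (auto simp: null_sets_def)
 then have "negligible N" by (simp add: negligible_iff_null_sets)
 moreover have "S \<subseteq> N"
 proof
  fix z assume "z \<in> S"
  then have "z \<in> Qplus k 1" "\<not> \<bar>u z\<bar> <= K" by (auto simp: S_def half_cyl_def Qplus_def Qcyl_def)
  then show "z \<in> N" using N(1) by blast
 qed
 ultimately show False using nn negligible_subset by blast
qed

lemma half_cyl_subsets: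
 "half_cyl k \<subseteq> Qplus k 1" "half_cyl_flat k \<subseteq> Qplus k 1 \<union> Sflat k 1" "half_cyl k \<subseteq> half_cyl_flat k"
 by (auto simp: half_cyl_def half_cyl_flat_def Qplus_def Qcyl_def Sflat_def)

theorem theorem1p1:
  fixes \<gamma> lam Lam :: real and k :: "'n::finite"
  assumes "\<gamma> > -1" and "0 < lam" and "lam \<le> Lam"
  shows "\<exists>\<alpha>::real. 0 < \<alpha> \<and> \<alpha> < 1 \<and> \<alpha> < 1 / (1 + \<gamma>) \<and>
    (\<forall>K::real. \<exists>C>0. \<forall>(F :: real^'n^'n \<Rightarrow> real) (p :: real^'n) (u :: (real^'n) \<times> real \<Rightarrow> real).
       uniformly_elliptic lam Lam F \<and> F 0 = 0 \<and>
       (concave_on sym_matrices F \<or> convex_on sym_matrices F) \<and>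
       norm p \<le> 1 \<and> p $ k = 0 \<and>
       visc_solution 1 p 0 \<gamma> F (\<lambda>_. 0) (Qplus k 1) u \<and>
       continuous_on (Qplus k 1 \<union> Sflat k 1) u \<and> (\<forall>z\<in>Sflat k 1. u z = 0) \<and>
       Linfty_norm (Qplus k 1) u = ereal K
       \<longrightarrow> (\<exists>a::real. \<bar>a\<bar> \<le> C \<and>
             (\<forall>(x, t)\<in>Qplus k (1/2).
                \<bar>u (x, t) - a * x $ k\<bar> \<le>
                C * (norm x powr (1 + \<alpha>) + \<bar>t\<bar> powr ((1 + \<alpha>) / (2 - \<alpha> * \<gamma>))))))"
proof -
 note L = assms(2,3) and gam = assms(1)
 obtain n :: nat where n: "1 / (1 + \<gamma>) < real n" using reals_Archimedean2 by blast
 \<comment> \<open>Large enough for the exponent in \<open>power_operator_bound\<close> to be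
   positive; the summand 2 ensures \<open>j >= 2\<close>.\<close>
 define j where "j = n + 2"
 have "1 < real n * (1 + \<gamma>)" using n gam by (simp add: pos_divide_less_eq)
 also have "... <= (2 * real j - 1) * (1 + \<gamma>)" using gam by (intro mult_right_mono) (auto simp: j_def)
 finally have j: "j >= 2" "(2 * real j - 1) * (1 + \<gamma>) > 1" by (auto simp: j_def)
 obtain \<eta> \<rho> \<tau> where c: "0 < \<eta>" "\<eta> <= 1/2" "0 < \<rho>" "\<rho> <= 1" "0 < \<tau>" "\<tau> <= 1" and
  D: "slope_dichotomy k j \<gamma> lam Lam \<eta> \<rho> \<tau>"
  using dichotomy[OF L gam j, where k = k] by blast
 define b0 :: real where "b0 = 4 powr (- \<bar>\<gamma>\<bar>)"
 have b0: "0 < b0" "b0 <= 1" using powr_mono[of "- \<bar>\<gamma>\<bar>" 0 4] by (auto simp: b0_def)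
 define \<sigma>' where "\<sigma>' = (min \<rho> (\<tau> * b0))^2 * b0"
 have s': "0 < \<sigma>'" "\<sigma>' <= 1"
 proof -
  have "0 < min \<rho> (\<tau> * b0)" using c b0 by simp
  then show "0 < \<sigma>'" unfolding \<sigma>'_def using b0(1) by (intro mult_pos_pos zero_less_power)
  have "(min \<rho> (\<tau> * b0))^2 <= 1" using c b0 by (intro power_le_one) auto
  then show "\<sigma>' <= 1" using b0 by (simp add: \<sigma>'_def mult_le_one)
 qed
 \<comment> \<open>The cut at 1/2 ensures \<sigma> < 1 for \<open>geometric_power_decay\<close>; a
   smaller ratio only makes the cylinders smaller.\<close>
 define \<sigma> where "\<sigma> = min \<sigma>' (1/2)"
 have s: "0 < \<sigma>" "\<sigma> < 1" "\<sigma> <= \<sigma>'" using s' by (auto simp: \<sigma>_def)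
 define \<beta> where "\<beta> = ln (1 - \<eta>) / ln \<sigma>"
 have beta: "0 < \<beta>" using s c by (simp add: \<beta>_def divide_neg_neg)
 \<comment> \<open>The last bound gives \<open>\<alpha> * (1 + \<gamma>) <= 1/2\<close>, hence
   \<alpha> < 1 / (1 + \<gamma>) and \<open>2 - \<alpha> * \<gamma> >= 1\<close>. So the exponent
   \<open>ex\<close> of time is at most \<open>1 + \<alpha>\<close>, and for times of modulus at
   most 1 the decay in ordinary cylinders implies the claim.\<close>
 define \<alpha> where "\<alpha> = min \<beta> (min (1/2) (1 / (2 * (1 + \<gamma>))))"
 have al: "0 < \<alpha>" "\<alpha> < 1" "\<alpha> <= \<beta>" "\<alpha> <= 1 / (2 * (1 + \<gamma>))" using beta gam by (auto simp: \<alpha>_def min_less_iff_disj)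
 have al2: "\<alpha> * (1 + \<gamma>) <= 1/2" using al(4) gam by (simp add: field_simps)
 have al3: "\<alpha> < 1 / (1 + \<gamma>)" using al2 gam by (simp add: pos_less_divide_eq)
 define ex where "ex = (1 + \<alpha>) / (2 - \<alpha> * \<gamma>)"
 have den: "1 <= 2 - \<alpha> * \<gamma>" using al2 al by (simp add: algebra_simps)
 have ex: "0 < ex" "ex <= 1 + \<alpha>" "ex <= 2"
 proof -
  show "0 < ex" using den al by (simp add: ex_def)
  have "(1 + \<alpha>) / (2 - \<alpha> * \<gamma>) <= (1 + \<alpha>) / 1" using den al by (intro divide_left_mono) auto
  then show "ex <= 1 + \<alpha>" by (simp add: ex_def)
  then show "ex <= 2" using al by linarith
 qed
 have "\<exists>C>0. \<forall>(F :: real^'n^'n => real) (p :: real^'n) (u :: (real^'n) \<times> real => real).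
    uniformly_elliptic lam Lam F & F 0 = 0 & (concave_on sym_matrices F | convex_on sym_matrices F) &
    norm p <= 1 & p $ k = 0 & visc_solution 1 p 0 \<gamma> F (%_. 0) (Qplus k 1) u &
    continuous_on (Qplus k 1 \<union> Sflat k 1) u & (\<forall>z\<in>Sflat k 1. u z = 0) & Linfty_norm (Qplus k 1) u = ereal K
    --> (\<exists>a::real. \<bar>a\<bar> <= C & (\<forall>(x, t)\<in>Qplus k (1/2). \<bar>u (x, t) - a * x $ k\<bar> <= C * (norm x powr (1 + \<alpha>) + \<bar>t\<bar> powr ex)))" for K
 proof -
  \<comment> \<open>\<open>K\<close> ranges over all reals; \<open>boundary_lipschitz\<close> wants
    a nonnegative bound.\<close>
  define K' where "K' = max K 0"
  have K': "0 <= K'" "K <= K'" by (auto simp: K'_def)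
  obtain M where M: "1 <= M" and BL: "\<forall>(F :: real^'n^'n => real) p w. elliptic_op lam Lam F --> norm p <= 1 --> p $ k = 0 --> vsub j \<gamma> F p 1 (half_cyl k) w -->
   continuous_on (half_cyl_flat k) w --> (\<forall>x t. (x, t) \<in> half_cyl_flat k --> w (x, t) <= K' & (x $ k = 0 --> w (x, t) = 0)) -->
   (\<forall>x t. norm x <= 1/2 --> 0 <= x $ k --> - (1/2) <= t --> t < 0 --> w (x, t) <= M * x $ k)"
   using boundary_lipschitz[OF L gam K'(1), where k = k and j = j] by blast
  define B where "B = (2 * M) powr (- \<bar>\<gamma>\<bar>)"
  have B: "0 < B" "B <= 1" using M powr_mono[of "- \<bar>\<gamma>\<bar>" 0 "2 * M"] by (auto simp: B_def)
  define d0 where "d0 = (B / 2)^2 * B"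
  have d0: "0 < d0" "d0 <= 1"
  proof -
   show "0 < d0" using B by (simp add: d0_def)
   have "(B / 2)^2 <= 1" using B by (intro power_le_one) auto
   then show "d0 <= 1" using B by (simp add: d0_def mult_le_one)
  qed
  \<comment> \<open>The summands serve, in order, the points near the origin, the points with
    \<open>N >= d0\<close>, where the right-hand side without \<open>C\<close> is at least
    \<open>d0^2\<close>, and the bound on \<open>a\<close>.\<close>
  define C where "C = 4 * M * (1 / d0) powr \<beta> + (K' + M) / d0^2 + M"
  have C: "0 < C" "4 * M * (1 / d0) powr \<beta> <= C" "(K' + M) / d0^2 <= C" "M <= C"
  proof -
   have "0 <= 4 * M * (1 / d0) powr \<beta>" "0 <= (K' + M) / d0^2" using M K' by auto
   then show "0 < C" "4 * M * (1 / d0) powr \<beta> <= C" "(K' + M) / d0^2 <= C" "M <= C" using M unfolding C_def by linarith+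
  qed
  have main: "\<exists>a::real. \<bar>a\<bar> <= C & (\<forall>(x, t)\<in>Qplus k (1/2). \<bar>u (x, t) - a * x $ k\<bar> <= C * (norm x powr (1 + \<alpha>) + \<bar>t\<bar> powr ex))"
   if UE: "uniformly_elliptic lam Lam F" "F 0 = 0" and p: "norm p <= 1" "p $ k = 0" and vs: "visc_solution 1 p 0 \<gamma> F (%_. 0) (Qplus k 1) u"
    and cu: "continuous_on (Qplus k 1 \<union> Sflat k 1) u" and u0: "\<forall>z\<in>Sflat k 1. u z = 0" and Li: "Linfty_norm (Qplus k 1) u = ereal K"
   for F :: "real^'n^'n => real" and p u
  proof -
   have F: "elliptic_op lam Lam F" by (rule elliptic_op_of_uniformly_elliptic[OF UE L(2)])
   have sub: "vsub j \<gamma> F p 1 (half_cyl k) u"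
    using vs unfolding visc_solution_def by (intro vsub_of_visc_subsolution[OF _ open_half_cyl half_cyl_subsets(1) F L j]) auto
   have sup: "vsub j \<gamma> (%M. - F (- M)) (- p) 1 (half_cyl k) (%z. - u z)"
    using vs unfolding visc_solution_def
    by (intro vsub_of_visc_subsolution[OF visc_subsolution_neg open_half_cyl half_cyl_subsets(1) elliptic_op_neg[OF F] L j]) auto
   have cf: "continuous_on (half_cyl_flat k) u" by (rule continuous_on_subset[OF cu half_cyl_subsets(2)])
   have ch: "continuous_on (half_cyl k) u" by (rule continuous_on_subset[OF cf half_cyl_subsets(3)])
   have flat0: "u (x, t) = 0" if "(x, t) \<in> half_cyl_flat k" "x $ k = 0" for x t
    using u0 that by (auto simp: half_cyl_flat_def Sflat_def Qcyl_def)
   have uK: "\<bar>u (x, t)\<bar> <= K'" if "(x, t) \<in> half_cyl_flat k" for x t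
   proof (cases "x $ k = 0")
    case True
    then show ?thesis using flat0 that K' by simp
   next
    case False
    then have "(x, t) \<in> half_cyl k" using that by (simp add: half_cyl_def half_cyl_flat_def)
    from bounded_by_Linfty_norm[OF ch Li this] show ?thesis using K' by linarith
   qed
   have start: "\<bar>u (x, t)\<bar> <= M * x $ k" if "norm x <= 1/2" "0 <= x $ k" "- (1/2) <= t" "t < 0" for x t
   proof -
    have "u (x, t) <= M * x $ k"
     using uK flat0 by (intro BL[rule_format, OF F p sub cf _ that]) (auto simp: abs_le_iff)
    moreover have "- u (x, t) <= M * x $ k"
     using uK flat0 p by (intro BL[rule_format, OF elliptic_op_neg[OF F] _ _ sup continuous_on_minus[OF cf] _ that]) (auto simp: abs_le_iff)
    ultimately show ?thesis by (simp add: abs_le_iff)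
   qed
   have s0: "\<sigma>' = (min \<rho> (\<tau> * 4 powr (- \<bar>\<gamma>\<bar>)))^2 * 4 powr (- \<bar>\<gamma>\<bar>)" by (simp add: \<sigma>'_def b0_def)
   have d00: "d0 = ((2 * M) powr (- \<bar>\<gamma>\<bar>) / 2)^2 * (2 * M) powr (- \<bar>\<gamma>\<bar>)" by (simp add: d0_def B_def)
   obtain a where a: "\<bar>a\<bar> <= M" and dec: "\<And>i x t. norm x < d0 * \<sigma>' ^ i ==> 0 <= x $ k ==> - (d0 * \<sigma>' ^ i) < t ==> t < 0 ==>
    \<bar>u (x, t) - a * x $ k\<bar> <= 2 * M * (1 - \<eta>) ^ i * x $ k"
    using slope_limit[OF D c F p sub sup cf M start s0 d00] by blast
   have neg: "\<bar>u (x, t) - a * x $ k\<bar> <= C * (norm x powr (1 + \<alpha>) + \<bar>t\<bar> powr ex)" if x: "norm x < 1/2" "0 < x $ k" and t: "- (1/4) < t" "t < 0" for x t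
   proof -
    have xk: "x $ k <= norm x" using component_le_norm_cart[of x k] by simp
    have x0: "0 < norm x" using xk x by linarith
    define N where "N = max (norm x) \<bar>t\<bar>"
    have N: "0 < N" "N <= 1" "norm x <= N" "\<bar>t\<bar> <= N" using x0 x t by (auto simp: N_def)
    show ?thesis
    proof (cases "N < d0")
     case True
     obtain i where i: "N < d0 * \<sigma> ^ i" "(1 - \<eta>) ^ i <= 2 * (N / d0) powr \<beta>"
      using geometric_power_decay[OF s(1,2) c(1,2) N(1) True] unfolding \<beta>_def by blast
     have "d0 * \<sigma> ^ i <= d0 * \<sigma>' ^ i" using s d0 by (intro mult_left_mono power_mono) auto
     then have Ni: "N < d0 * \<sigma>' ^ i" using i by linarith
     have "\<bar>u (x, t) - a * x $ k\<bar> <= 2 * M * (1 - \<eta>) ^ i * x $ k" using Ni N x t by (intro dec) auto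
     also have "... <= 2 * M * (2 * (N / d0) powr \<beta>) * norm x" using i(2) M xk x c by (intro mult_mono mult_left_mono) auto
     also have "... = 4 * M * (1 / d0) powr \<beta> * (N powr \<beta> * norm x)" using N d0 by (simp add: powr_divide)
     also have "... <= C * (norm x powr (1 + \<alpha>) + \<bar>t\<bar> powr ex)"
     proof (intro mult_mono C(2))
      have "N powr \<beta> * norm x <= N powr \<alpha> * norm x" using N al by (intro mult_right_mono powr_mono') auto
      also have "... <= norm x powr (1 + \<alpha>) + \<bar>t\<bar> powr ex"
      proof (cases "\<bar>t\<bar> <= norm x")
       case True
       then have "N powr \<alpha> * norm x = norm x powr (1 + \<alpha>)" using x0 by (simp add: N_def max_def powr_add)
       then show ?thesis by simp
      next
       case False
       then have "N powr \<alpha> * norm x <= \<bar>t\<bar> powr \<alpha> * \<bar>t\<bar>" by (auto simp: N_def max_def intro!: mult_left_mono)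
       also have "... = \<bar>t\<bar> powr (1 + \<alpha>)" using t by (simp add: powr_add)
       also have "... <= \<bar>t\<bar> powr ex" using t ex by (intro powr_mono') auto
       finally show ?thesis by (simp add: add_increasing)
      qed
      finally show "N powr \<beta> * norm x <= norm x powr (1 + \<alpha>) + \<bar>t\<bar> powr ex" .
     qed (use C in auto)
     finally show ?thesis .
    next
     case False
     have "(x, t) \<in> half_cyl_flat k" using x t by (simp add: half_cyl_flat_def)
     then have "\<bar>u (x, t)\<bar> <= K'" by (rule uK)
     moreover have "\<bar>a * x $ k\<bar> <= M * 1" unfolding abs_mult using a x xk M by (intro mult_mono) auto
     ultimately have "\<bar>u (x, t) - a * x $ k\<bar> <= K' + M" by linarith
     also have "K' + M = (K' + M) / d0^2 * d0^2" using d0 by simp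
     also have "... <= C * (norm x powr (1 + \<alpha>) + \<bar>t\<bar> powr ex)"
     proof (intro mult_mono C(3))
      have pw: "d0^2 <= y powr e" if "d0 <= y" "0 < e" "e <= 2" for y e
      proof -
       have "d0^2 = d0 powr 2" using d0 by simp
       also have "... <= d0 powr e" using d0 that by (intro powr_mono') auto
       also have "... <= y powr e" using d0 that by (intro powr_mono2) auto
       finally show ?thesis .
      qed
      from False consider "d0 <= norm x" | "d0 <= \<bar>t\<bar>" by (auto simp: N_def max_def split: if_splits)
      then show "d0^2 <= norm x powr (1 + \<alpha>) + \<bar>t\<bar> powr ex"
      proof cases
       case 1
       from pw[OF this, of "1 + \<alpha>"] show ?thesis using al by (simp add: add_increasing2)
      next
       case 2
       from pw[OF this ex(1,3)] show ?thesis by (simp add: add_increasing)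
      qed
     qed (use C in auto)
     finally show ?thesis .
    qed
   qed
   have "\<bar>u (x, t) - a * x $ k\<bar> <= C * (norm x powr (1 + \<alpha>) + \<bar>t\<bar> powr ex)" if q: "(x, t) \<in> Qplus k (1/2)" for x t
   proof -
    have x: "norm x < 1/2" "0 < x $ k" and t: "- (1/4) < t" "t <= 0" using q by (auto simp: Qplus_def Qcyl_def power2_eq_square)
    \<comment> \<open>The slice \<open>t = 0\<close> is reached from negative times, both sides
      being continuous in time.\<close>
    define g where "g s = C * (norm x powr (1 + \<alpha>) + \<bar>s\<bar> powr ex) - \<bar>u (x, s) - a * x $ k\<bar>" for s
    have cl: "closure {-(1/4)<..<0} = {-(1/4)..0::real}" by simp
    have "0 <= g t"
    proof (rule continuous_ge_on_closure[of "{-(1/4)<..<0}" g])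
     have "continuous_on {-(1/4)..0} (%s. u (x, s))"
      by (rule continuous_on_compose2[OF cu]) (use x in \<open>auto intro!: continuous_intros simp: Qplus_def Qcyl_def\<close>)
     moreover have "continuous_on {-(1/4)..0::real} (%s. \<bar>s\<bar> powr ex)" using ex by (intro continuous_on_powr' continuous_intros) auto
     ultimately show "continuous_on (closure {-(1/4)<..<0}) g" unfolding cl g_def
      by (intro continuous_on_diff continuous_on_mult continuous_on_add continuous_on_const continuous_on_rabs)
     show "t \<in> closure {-(1/4)<..<0}" unfolding cl using t by simp
     show "0 <= g s" if "s \<in> {-(1/4)<..<0}" for s using neg[OF x, of s] that by (simp add: g_def)
    qed
    then show ?thesis by (simp add: g_def)
   qed
   then show ?thesis using a C(4) by (intro exI[of _ a]) auto
  qed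
  show ?thesis by (rule exI[of _ C], intro conjI C(1) allI impI, elim conjE, rule main)
 qed
 note fin = allI[OF this[unfolded ex_def]]
 show ?thesis by (rule exI[of _ \<alpha>], intro conjI al(1,2) al3 fin)
qed

end
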